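(* Let $(V_j)_{j\in\mathbb{Z}}$ be a GMRA of $L^2(\mathbb{R}^n)$ (with respect to the dilation matrix $A$) such that $\dim_{V_0}(\xi)<\infty$ for $\xi$ in a set of positive measure, and let $\Psi$ be a NTF generator for $W_0:=V_1\ominus V_0$. Let $\Phi$ be a countable subset of $L^2(\mathbb{R}^n)$. The following are equivalent: (i) $\Phi$ is a NTF generator for $V_0$. (ii) For a.e. $\xi\in\mathbb{R}^n$, $$-\sum_{\varphi\in\Phi}\widehat{\varphi}(\xi)\overline{\widehat{\varphi}(\xi+2s\pi)}=\sum_{\psi\in\Psi}\widehat{\psi}(\xi)\overline{\widehat{\psi}(\xi+2s\pi)},\qquad (s\in\mathbb{Z}^n\setminus A^*\mathbb{Z}^n),$$ $$\sum_{\varphi\in\Phi}\widehat{\varphi}((A^* )^{-1}\xi)\overline{\widehat{\varphi}((A^* )^{-1}(\xi+2s\pi))}-\sum_{\varphi\in\Phi}\widehat{\varphi}(\xi)\overline{\widehat{\varphi}(\xi+2s\pi)}=\sum_{\psi\in\Psi}\widehat{\psi}(\xi)\overline{\widehat{\psi}(\xi+2s\pi)},\qquad (s\in A^*\mathbb{Z}^n),$$ and $$\lim_{j\rightarrow\infty}\sum_{\varphi\in\Phi}|\widehat{\varphi}|^2((A^* )^j\xi)=0\quad\text{for a.e. }\xi\in\mathbb{R}^n.$$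
   Context: $A$ is a fixed $n\times n$ matrix, all of whose eigenvalues $\lambda$ satisfy $|\lambda|>1$, with $A\mathbb{Z}^n\subset\mathbb{Z}^n$; $A^*$ is its adjoint (transpose). On $L^2(\mathbb{R}^n)$ put $T_kf(\xi)=f(\xi-k)$ for $k\in\mathbb{Z}^n$ and $D_Af(\xi)=|\det A|^{1/2}f(A\xi)$. The Fourier transform is $\widehat f(\xi)=\int_{\mathbb{R}^n}f(x)e^{-i\langle x\,|\,\xi\rangle}\,dx$ (extended to $L^2(\mathbb{R}^n)$). A family $\{e_i\}_{i\in I}$ in a Hilbert space $H$ is a normalized tight frame (NTF) for $H$ if its members lie in $H$ and $\sum_{i\in I}|\langle f\,|\,e_i\rangle|^2=\|f\|^2$ for all $f\in H$. A closed subspace $V\subset L^2(\mathbb{R}^n)$ is shift invariant (SI) if $T_kV=V$ for all $k\in\mathbb{Z}^n$. A subset $\Phi\subset V$ is a NTF generator for the SI space $V$ if $\{T_k\varphi\,|\,k\in\mathbb{Z}^n,\varphi\in\Phi\}$ is a NTF for $V$. Dimension function: for $f\in L^2(\mathbb{R}^n)$ let $\mathcal{T}_{per}f(\xi)=(\widehat f(\xi+2k\pi))_{k\in\mathbb{Z}^n}\in l^2(\mathbb{Z}^n)$ (defined for a.e. $\xi$). Every SI space $V$ has a unique (up to a.e. equality) measurable periodic range function $J_{per}$, assigning to $\xi\in\mathbb{R}^n$ a closed subspace $J_{per}(\xi)$ of $l^2(\mathbb{Z}^n)$ (also identified with the projection onto it), such that $V=\{f\in L^2(\mathbb{R}^n)\,|\,\mathcal{T}_{per}f(\xi)\in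 J_{per}(\xi)\text{ for a.e. }\xi\}$; periodicity means $J_{per}(\xi+2k\pi)=\lambda(k)^*(J_{per}(\xi))$, where $(\lambda(k)\alpha)(l)=\alpha(l-k)$. If $V$ is the closed span of $\{T_k\varphi\,|\,k\in\mathbb{Z}^n,\varphi\in\mathcal{A}\}$ with $\mathcal{A}$ countable, then $J_{per}(\xi)=\overline{\mathrm{span}}\{\mathcal{T}_{per}\varphi(\xi)\,|\,\varphi\in\mathcal{A}\}$ for a.e. $\xi$. Then $\dim_V(\xi)=\mathrm{Trace}(J_{per}(\xi))$, i.e. the dimension of the subspace $J_{per}(\xi)$, in $[0,\infty]$. A generalized multiresolution analysis (GMRA) is a sequence $(V_j)_{j\in\mathbb{Z}}$ of closed subspaces of $L^2(\mathbb{R}^n)$ such that: $V_j\subset V_{j+1}$ for all $j$; $f\in V_j$ iff $D_Af\in V_{j+1}$ for all $j$; $\overline{\bigcup_{j}V_j}=L^2(\mathbb{R}^n)$; $\bigcap_jV_j=\{0\}$; and $T_kV_0=V_0$ for all $k\in\mathbb{Z}^n$. $V_1\ominus V_0$ denotes the orthogonal complement of $V_0$ in $V_1$. *)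

theory Defs
  imports "HOL-Analysis.Analysis"
begin

section \<open>Complex \<open>L\<^sup>2\<close> spaces\<close>

text \<open>
  As usual in HOL-Analysis, elements of \<open>L\<^sup>2(M)\<close> are represented by functions, not by classes
  modulo equality almost everywhere.  Since \<open>Lsq_norm\<close> vanishes on null functions, every set of the
  form \<open>Lsq_closure M S\<close>, in particular every closed subspace, is saturated under a.e. equality.
  The case \<open>M = lborel\<close> gives \<open>L\<^sup>2(\<real>\<^sup>n)\<close>, the case \<open>M = count_space UNIV\<close> gives \<open>l\<^sup>2\<close>.
\<close>

definition Lsq :: "'a measure \<Rightarrow> ('a \<Rightarrow> complex) set" where
  "Lsq M = {f \<in> borel_measurable M. integrable M (\<lambda>x. (cmod (f x))\<^sup>2)}"

definition Lsq_inner :: "'a measure \<Rightarrow> ('a \<Rightarrow> complex) \<Rightarrow> ('a \<Rightarrow> complex) \<Rightarrow> complex" where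
  "Lsq_inner M f g = (\<integral>x. f x * cnj (g x) \<partial>M)"

definition Lsq_norm :: "'a measure \<Rightarrow> ('a \<Rightarrow> complex) \<Rightarrow> real" where
  "Lsq_norm M f = sqrt (\<integral>x. (cmod (f x))\<^sup>2 \<partial>M)"

definition Lsq_closure :: "'a measure \<Rightarrow> ('a \<Rightarrow> complex) set \<Rightarrow> ('a \<Rightarrow> complex) set" where
  "Lsq_closure M S = {f \<in> Lsq M. \<forall>e>0. \<exists>g\<in>S. Lsq_norm M (\<lambda>x. f x - g x) < e}"

definition closed_subspace :: "'a measure \<Rightarrow> ('a \<Rightarrow> complex) set \<Rightarrow> bool" where
  "closed_subspace M V \<longleftrightarrow>
     V \<subseteq> Lsq M \<and> (\<lambda>x. 0) \<in> V \<and>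
     (\<forall>f\<in>V. \<forall>g\<in>V. (\<lambda>x. f x + g x) \<in> V) \<and>
     (\<forall>c. \<forall>f\<in>V. (\<lambda>x. c * f x) \<in> V) \<and>
     Lsq_closure M V \<subseteq> V"

definition orth_diff ::
    "'a measure \<Rightarrow> ('a \<Rightarrow> complex) set \<Rightarrow> ('a \<Rightarrow> complex) set \<Rightarrow> ('a \<Rightarrow> complex) set" where
  "orth_diff M V U = {f \<in> V. \<forall>g\<in>U. Lsq_inner M f g = 0}"

text \<open>The orthogonal projection onto a closed subspace; it is determined up to a.e. equality, hence
  uniquely when \<open>M\<close> is a counting measure.\<close>

definition Lsq_proj ::
    "'a measure \<Rightarrow> ('a \<Rightarrow> complex) set \<Rightarrow> ('a \<Rightarrow> complex) \<Rightarrow> ('a \<Rightarrow> complex)" where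
  "Lsq_proj M V f = (SOME p. p \<in> V \<and> (\<forall>g\<in>V. Lsq_inner M (\<lambda>x. f x - p x) g = 0))"

definition normalized_tight_frame ::
    "'a measure \<Rightarrow> ('a \<Rightarrow> complex) set \<Rightarrow> 'i set \<Rightarrow> ('i \<Rightarrow> 'a \<Rightarrow> complex) \<Rightarrow> bool" where
  "normalized_tight_frame M H I e \<longleftrightarrow>
     (\<forall>i\<in>I. e i \<in> H) \<and>
     (\<forall>f\<in>H. ((\<lambda>i. (cmod (Lsq_inner M f (e i)))\<^sup>2) has_sum (Lsq_norm M f)\<^sup>2) I)"


section \<open>Fourier transform on \<open>L\<^sup>2(\<real>\<^sup>n)\<close>\<close>

definition fourier_integral :: "(real^'n \<Rightarrow> complex) \<Rightarrow> real^'n \<Rightarrow> complex" where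
  "fourier_integral f \<xi> = (\<integral>x. f x * exp (- (\<i> * complex_of_real (x \<bullet> \<xi>))) \<partial>lborel)"

text \<open>Extension by continuity from \<open>L\<^sup>1 \<inter> L\<^sup>2\<close>.  The membership of \<open>fourier_integral (F m)\<close> in
  \<open>L\<^sup>2\<close> is automatic (Plancherel), but is needed for \<open>Lsq_norm\<close> to be meaningful.\<close>

definition is_fourier :: "(real^'n \<Rightarrow> complex) \<Rightarrow> (real^'n \<Rightarrow> complex) \<Rightarrow> bool" where
  "is_fourier f g \<longleftrightarrow> g \<in> Lsq lborel \<and>
     (\<exists>F :: nat \<Rightarrow> real^'n \<Rightarrow> complex.
        (\<forall>m. F m \<in> Lsq lborel \<and> integrable lborel (F m) \<and> fourier_integral (F m) \<in> Lsq lborel) \<and>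
        (\<lambda>m. Lsq_norm lborel (\<lambda>x. F m x - f x)) \<longlonglongrightarrow> 0 \<and>
        (\<lambda>m. Lsq_norm lborel (\<lambda>\<xi>. fourier_integral (F m) \<xi> - g \<xi>)) \<longlonglongrightarrow> 0)"

text \<open>A representative of the class of the transform, which is the same for a.e. equal functions.\<close>

definition fourier :: "(real^'n \<Rightarrow> complex) \<Rightarrow> real^'n \<Rightarrow> complex" where
  "fourier f = (SOME g. is_fourier f g)"


section \<open>Translations and dilations\<close>

definition lattice_vec :: "int^'n \<Rightarrow> real^'n" where
  "lattice_vec k = (\<chi> i. real_of_int (k $ i))"

definition translate :: "int^'n \<Rightarrow> (real^'n \<Rightarrow> complex) \<Rightarrow> (real^'n \<Rightarrow> complex)" where
  "translate k f = (\<lambda>x. f (x - lattice_vec k))"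

definition dilate :: "real^'n^'n \<Rightarrow> (real^'n \<Rightarrow> complex) \<Rightarrow> (real^'n \<Rightarrow> complex)" where
  "dilate A f = (\<lambda>x. complex_of_real (sqrt \<bar>det A\<bar>) * f (A *v x))"

text \<open>The eigenvalues of the real matrix \<open>A\<close> are the complex ones.\<close>

definition dilation_matrix :: "real^'n^'n \<Rightarrow> bool" where
  "dilation_matrix A \<longleftrightarrow>
     (\<forall>\<mu>::complex. (\<exists>v. v \<noteq> 0 \<and> map_matrix complex_of_real A *v v = \<mu> *s v) \<longrightarrow> cmod \<mu> > 1) \<and>
     (\<lambda>x. A *v x) ` range lattice_vec \<subseteq> range lattice_vec"

text \<open>The family of translates is indexed by \<open>\<int>\<^sup>n \<times> \<Phi>\<close>, so coinciding translates are counted with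
  multiplicity.\<close>

definition ntf_generator :: "(real^'n \<Rightarrow> complex) set \<Rightarrow> (real^'n \<Rightarrow> complex) set \<Rightarrow> bool" where
  "ntf_generator \<Phi> V \<longleftrightarrow>
     \<Phi> \<subseteq> V \<and> normalized_tight_frame lborel V (UNIV \<times> \<Phi>) (\<lambda>(k, \<phi>). translate k \<phi>)"

definition gmra :: "real^'n^'n \<Rightarrow> (int \<Rightarrow> (real^'n \<Rightarrow> complex) set) \<Rightarrow> bool" where
  "gmra A V \<longleftrightarrow>
     (\<forall>j. closed_subspace lborel (V j)) \<and>
     (\<forall>j. V j \<subseteq> V (j + 1)) \<and>
     (\<forall>j. \<forall>f\<in>Lsq lborel. f \<in> V j \<longleftrightarrow> dilate A f \<in> V (j + 1)) \<and>
     Lsq_closure lborel (\<Union>j. V j) = Lsq lborel \<and>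
     (\<Inter>j. V j) = {f \<in> Lsq lborel. AE x in lborel. f x = 0} \<and>
     (\<forall>k. translate k ` V 0 = V 0)"


section \<open>Range function and dimension function\<close>

definition periodize :: "(real^'n \<Rightarrow> complex) \<Rightarrow> real^'n \<Rightarrow> (int^'n \<Rightarrow> complex)" where
  "periodize f \<xi> = (\<lambda>k. fourier f (\<xi> + (2 * pi) *\<^sub>R lattice_vec k))"

text \<open>Measurability is weak measurability of the associated projections.  The map
  \<open>\<alpha> \<mapsto> (\<lambda>l. \<alpha> (l + k))\<close> is the adjoint of the shift \<open>\<alpha> \<mapsto> (\<lambda>l. \<alpha> (l - k))\<close>.\<close>

definition periodic_range_function :: "(real^'n \<Rightarrow> (int^'n \<Rightarrow> complex) set) \<Rightarrow> bool" where
  "periodic_range_function J \<longleftrightarrow>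
     (\<forall>\<xi>. closed_subspace (count_space UNIV) (J \<xi>)) \<and>
     (\<forall>a \<in> Lsq (count_space UNIV). \<forall>b \<in> Lsq (count_space UNIV).
        (\<lambda>\<xi>. Lsq_inner (count_space UNIV) (Lsq_proj (count_space UNIV) (J \<xi>) a) b)
          \<in> borel_measurable lborel) \<and>
     (\<forall>\<xi> k. J (\<xi> + (2 * pi) *\<^sub>R lattice_vec k) = (\<lambda>\<alpha> l. \<alpha> (l + k)) ` J \<xi>)"

text \<open>The range function of a shift invariant space exists and is unique up to a.e. equality; the
  choice made here does not matter for statements holding almost everywhere.\<close>

definition J_per :: "(real^'n \<Rightarrow> complex) set \<Rightarrow> real^'n \<Rightarrow> (int^'n \<Rightarrow> complex) set" where
  "J_per V = (SOME J. periodic_range_function J \<and>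
     V = {f \<in> Lsq lborel. AE \<xi> in lborel. periodize f \<xi> \<in> J \<xi>})"

definition projection_trace :: "('a \<Rightarrow> complex) set \<Rightarrow> ennreal" where
  "projection_trace U =
     (\<Sum>\<^sub>\<infinity>l\<in>UNIV. ennreal (Re (Lsq_inner (count_space UNIV)
        (Lsq_proj (count_space UNIV) U (indicator {l})) (indicator {l}))))"

definition dim_fun :: "(real^'n \<Rightarrow> complex) set \<Rightarrow> real^'n \<Rightarrow> ennreal" where
  "dim_fun V \<xi> = projection_trace (J_per V \<xi>)"


section \<open>Correlation sums\<close>

text \<open>The sums over \<open>\<Phi>\<close> carry no order, so convergence means unconditional (equivalently, absolute)
  convergence.  As \<open>infsum\<close> is \<open>0\<close> for a divergent sum, convergence has to be asserted separately.\<close>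

definition corr_converges ::
    "(real^'n \<Rightarrow> complex) set \<Rightarrow> real^'n \<Rightarrow> real^'n \<Rightarrow> bool" where
  "corr_converges \<Phi> \<xi> \<eta> \<longleftrightarrow> (\<lambda>\<phi>. fourier \<phi> \<xi> * cnj (fourier \<phi> \<eta>)) summable_on \<Phi>"

definition corr :: "(real^'n \<Rightarrow> complex) set \<Rightarrow> real^'n \<Rightarrow> real^'n \<Rightarrow> complex" where
  "corr \<Phi> \<xi> \<eta> = (\<Sum>\<^sub>\<infinity>\<phi>\<in>\<Phi>. fourier \<phi> \<xi> * cnj (fourier \<phi> \<eta>))"

end

theory Submission
 imports Defs "HOL-Computational_Algebra.Fundamental_Theorem_Algebra"
begin

text \<open>Write \<open>K\<^sub>\<Phi>(y, s) = \<Sum>\<phi>\<in>\<Phi>. fourier \<phi> y * cnj (fourier \<phi> (y + 2 \<pi> s))\<close> for the correlation kernel of a family.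
 On the Fourier side the energy \<open>\<Sum>\<phi>,k. |\<langle>f, T\<^sub>k \<phi>\<rangle>|\<^sup>2\<close> of the integer translates is a quadratic form in
 \<open>fourier f\<close> with kernel \<open>K\<^sub>\<Phi>\<close> (\<open>shift_energy_kernel_form\<close>).  The form determines the kernel almost everywhere and
 conversely (\<open>kernel_eq_iff_shift_energy_eq\<close>).  Since \<open>\<Phi>\<close> is a NTF generator for a closed subspace \<open>V\<close> if and only if
 its energy at every \<open>f\<close> is the squared norm of the projection of \<open>f\<close> onto \<open>V\<close> (\<open>ntf_generator_iff_energy\<close>), all
 NTF generators for \<open>V\<close> have the same kernel, and having that kernel characterizes them.

 The space \<open>V\<^sub>0\<close> has at least one NTF generator \<open>\<phi>\<close>: project the functions whose transforms are indicators of
 translated period cells onto \<open>V\<^sub>0\<close>, and apply the Gram-Schmidt procedure to the fibers of their transforms, point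
 by point (\<open>orthonormal_field_exists\<close>).  Its kernel satisfies the two equations: the projection onto \<open>V\<^sub>1\<close> is the sum of the
 projections onto \<open>V\<^sub>0\<close> and onto \<open>W\<^sub>0\<close>, and it is conjugate by the unitary dilation to the projection onto \<open>V\<^sub>0\<close>.
 In terms of kernels, the pull-back of \<open>K\<^sub>\<phi>\<close> under the inverse transpose, extended by zero to displacements outside
 the sublattice, is \<open>K\<^sub>\<phi> + K\<^sub>\<Psi>\<close> (\<open>dilated_kernel_decomposition\<close>).

 The limit condition for \<open>\<phi>\<close> is where the dimension function enters.  The diagonal \<open>\<sigma> = K\<^sub>\<phi>(\<cdot>, 0)\<close> decreases along the
 orbits of the transpose, and its lattice sum is bounded by the dimension function (\<open>dim_fun_ge\<close>).  The limit of
 \<open>\<sigma>\<close> along orbits is invariant under the dilation; ergodicity of the induced endomorphism of the torus makes it integrable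
 as soon as the dimension function is finite on a set of positive measure, and an invariant integrable
 function vanishes, because the dilation expands volumes (\<open>decreasing_along_orbits_tendsto_0\<close>).

 So every NTF generator \<open>\<Phi>\<close>, having the kernel of \<open>\<phi>\<close>, satisfies all conditions.  Conversely, if \<open>\<Phi>\<close> satisfies them, the
 difference \<open>D\<close> of the two kernels solves the homogeneous equations: it vanishes off the sublattice and is invariant under
 the dilation.  A nonzero displacement leaves the sublattice after finitely many divisions by the transpose,
 so \<open>D\<close> vanishes there; on the diagonal \<open>D\<close> is constant along orbits and tends to zero
 (\<open>dilation_invariant_kernel_zero\<close>).  Hence the kernels agree, and \<open>\<Phi>\<close> is a NTF generator.\<close>

abbreviation "cplx \<equiv> complex_of_real"
abbreviation esq :: "complex => ennreal" where "esq z \<equiv> ennreal ((cmod z)\<^sup>2)"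
abbreviation "counting \<equiv> count_space UNIV"
abbreviation "borelfun \<equiv> borel_measurable borel"
abbreviation "L2 \<equiv> Lsq lborel"
abbreviation "L2norm \<equiv> Lsq_norm lborel"
abbreviation "L2inner \<equiv> Lsq_inner lborel"

section \<open>Hilbert space geometry\<close>

lemma borel_measurable_cnj [measurable]:
 assumes "f \<in> borel_measurable M"
 shows "(\<lambda>x. cnj (f x)) \<in> borel_measurable M"
 using assms by (intro borel_measurable_continuous_on[of cnj] continuous_intros) auto

lemma LsqD:
 assumes "f \<in> Lsq M"
 shows Lsq_measurable: "f \<in> borel_measurable M"
  and Lsq_integrable: "integrable M (\<lambda>x. (cmod (f x))\<^sup>2)"
 using assms by (auto simp: Lsq_def)

lemma Lsq_iff_nn_integral:
 assumes "f \<in> borel_measurable M"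
 shows "f \<in> Lsq M \<longleftrightarrow> (\<integral>\<^sup>+x. esq (f x) \<partial>M) < \<infinity>"
 using assms by (auto simp: Lsq_def integrable_iff_bounded)

lemma Lsq_norm_nonneg [simp]: "0 \<le> Lsq_norm M f"
 by (simp add: Lsq_norm_def)

lemma Lsq_norm_power2: "(Lsq_norm M f)\<^sup>2 = (\<integral>x. (cmod (f x))\<^sup>2 \<partial>M)"
 by (simp add: Lsq_norm_def)

lemma nn_integral_Lsq_norm:
 assumes "f \<in> Lsq M"
 shows "(\<integral>\<^sup>+x. esq (f x) \<partial>M) = ennreal ((Lsq_norm M f)\<^sup>2)"
 using assms by (simp add: Lsq_norm_power2 nn_integral_eq_integral LsqD)

lemma Lsq_zero [simp]: "(\<lambda>x. 0) \<in> Lsq M"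
 by (simp add: Lsq_def)

lemma Lsq_scale:
 assumes "f \<in> Lsq M"
 shows "(\<lambda>x. c * f x) \<in> Lsq M"
 using assms by (auto simp: Lsq_def norm_mult power_mult_distrib)

lemma cmod_add_power2_le: "(cmod (a + b))\<^sup>2 \<le> 2 * (cmod a)\<^sup>2 + 2 * (cmod b)\<^sup>2"
proof -
 have "(cmod (a + b))\<^sup>2 + (cmod (a - b))\<^sup>2 = 2 * (cmod a)\<^sup>2 + 2 * (cmod b)\<^sup>2"
  by (simp only: cmod_power2) (simp add: power2_eq_square algebra_simps)
 thus ?thesis
  using zero_le_power2[of "cmod (a - b)"] by linarith
qed

lemma Lsq_add:
 assumes "f \<in> Lsq M" "g \<in> Lsq M"
 shows "(\<lambda>x. f x + g x) \<in> Lsq M"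
proof -
 have "integrable M (\<lambda>x. (cmod (f x + g x))\<^sup>2)"
  by (rule Bochner_Integration.integrable_bound[of _ "\<lambda>x. 2 * (cmod (f x))\<^sup>2 + 2 * (cmod (g x))\<^sup>2"])
    (use assms in \<open>auto simp: Lsq_def cmod_add_power2_le\<close>)
 thus ?thesis using assms by (auto simp: Lsq_def)
qed

lemma Lsq_uminus: "f \<in> Lsq M ==> (\<lambda>x. - f x) \<in> Lsq M"
 using Lsq_scale[of f M "-1"] by simp

lemma Lsq_diff: "f \<in> Lsq M ==> g \<in> Lsq M ==> (\<lambda>x. f x - g x) \<in> Lsq M"
 using Lsq_add[of f M "\<lambda>x. - g x"] Lsq_uminus[of g M] by simp

lemma Lsq_cnj: "f \<in> Lsq M ==> (\<lambda>x. cnj (f x)) \<in> Lsq M"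
 by (auto simp: Lsq_def)

lemma Lsq_bounded_mult:
 assumes "f \<in> Lsq M" "p \<in> borel_measurable M" "AE x in M. cmod (p x) \<le> C"
 shows "(\<lambda>x. p x * f x) \<in> Lsq M"
proof -
 have "integrable M (\<lambda>x. (cmod (p x * f x))\<^sup>2)"
 proof (rule Bochner_Integration.integrable_bound[of _ "\<lambda>x. C\<^sup>2 * (cmod (f x))\<^sup>2"])
  show "AE x in M. norm ((cmod (p x * f x))\<^sup>2) \<le> norm (C\<^sup>2 * (cmod (f x))\<^sup>2)"
   using assms(3) by eventually_elim
    (auto simp: norm_mult power_mult_distrib intro!: mult_right_mono power_mono)
 qed (use assms in \<open>auto simp: Lsq_def\<close>)
 thus ?thesis using assms by (auto simp: Lsq_def)
qed

lemma Lsq_inner_integrable: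
 assumes "f \<in> Lsq M" "g \<in> Lsq M"
 shows "integrable M (\<lambda>x. f x * cnj (g x))"
proof (rule Bochner_Integration.integrable_bound[of _ "\<lambda>x. (cmod (f x))\<^sup>2 + (cmod (g x))\<^sup>2"])
 show "AE x in M. norm (f x * cnj (g x)) \<le> norm ((cmod (f x))\<^sup>2 + (cmod (g x))\<^sup>2)"
 proof (intro AE_I2)
  fix x
  have "2 * (cmod (f x) * cmod (g x)) \<le> (cmod (f x))\<^sup>2 + (cmod (g x))\<^sup>2"
   using sum_squares_bound[of "cmod (f x)" "cmod (g x)"] by simp
  moreover have "0 \<le> cmod (f x) * cmod (g x)" by simp
  ultimately have "cmod (f x) * cmod (g x) \<le> (cmod (f x))\<^sup>2 + (cmod (g x))\<^sup>2"
   by linarith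
  thus "norm (f x * cnj (g x)) \<le> norm ((cmod (f x))\<^sup>2 + (cmod (g x))\<^sup>2)"
   by (simp add: norm_mult)
 qed
qed (use assms in \<open>auto simp: Lsq_def\<close>)

lemma Lsq_inner_cong_AE:
 assumes "AE x in M. f x = f' x" "AE x in M. g x = g' x"
  "f \<in> borel_measurable M" "f' \<in> borel_measurable M"
  "g \<in> borel_measurable M" "g' \<in> borel_measurable M"
 shows "Lsq_inner M f g = Lsq_inner M f' g'"
 unfolding Lsq_inner_def using assms by (intro integral_cong_AE) auto

lemma Lsq_norm_cong_AE:
 assumes "AE x in M. f x = g x" "f \<in> borel_measurable M" "g \<in> borel_measurable M"
 shows "Lsq_norm M f = Lsq_norm M g"
 unfolding Lsq_norm_def using assms by (intro arg_cong[where f = sqrt] integral_cong_AE) auto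

lemma Lsq_inner_commute: "Lsq_inner M g f = cnj (Lsq_inner M f g)"
proof -
 have "(\<integral>x. g x * cnj (f x) \<partial>M) = (\<integral>x. cnj (f x * cnj (g x)) \<partial>M)"
  by (simp add: mult.commute)
 also have "... = cnj (\<integral>x. f x * cnj (g x) \<partial>M)" by (rule integral_bounded_linear'[OF bounded_linear_cnj bounded_linear_cnj]) simp
 finally show ?thesis by (simp add: Lsq_inner_def)
qed

lemma Lsq_inner_scale_left [simp]: "Lsq_inner M (\<lambda>x. c * f x) g = c * Lsq_inner M f g"
 by (simp add: Lsq_inner_def mult.assoc)

lemma Lsq_inner_scale_right [simp]: "Lsq_inner M f (\<lambda>x. c * g x) = cnj c * Lsq_inner M f g"
 by (simp add: Lsq_inner_def mult.left_commute)

lemma Lsq_inner_add_left: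
 assumes "f \<in> Lsq M" "g \<in> Lsq M" "h \<in> Lsq M"
 shows "Lsq_inner M (\<lambda>x. f x + g x) h = Lsq_inner M f h + Lsq_inner M g h"
 using assms by (simp add: Lsq_inner_def distrib_right Lsq_inner_integrable)

lemma Lsq_inner_diff_left:
 assumes "f \<in> Lsq M" "g \<in> Lsq M" "h \<in> Lsq M"
 shows "Lsq_inner M (\<lambda>x. f x - g x) h = Lsq_inner M f h - Lsq_inner M g h"
 using assms by (simp add: Lsq_inner_def left_diff_distrib Lsq_inner_integrable)

lemma Lsq_inner_add_right:
 assumes "f \<in> Lsq M" "g \<in> Lsq M" "h \<in> Lsq M"
 shows "Lsq_inner M h (\<lambda>x. f x + g x) = Lsq_inner M h f + Lsq_inner M h g"
 using assms by (simp add: Lsq_inner_def distrib_left Lsq_inner_integrable)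

lemma Lsq_inner_diff_right:
 assumes "f \<in> Lsq M" "g \<in> Lsq M" "h \<in> Lsq M"
 shows "Lsq_inner M h (\<lambda>x. f x - g x) = Lsq_inner M h f - Lsq_inner M h g"
 using assms by (simp add: Lsq_inner_def right_diff_distrib Lsq_inner_integrable)

lemma Lsq_inner_zero [simp]: "Lsq_inner M (\<lambda>x. 0) f = 0" "Lsq_inner M f (\<lambda>x. 0) = 0"
 by (simp_all add: Lsq_inner_def)

lemma Lsq_inner_self: "Lsq_inner M f f = cplx ((Lsq_norm M f)\<^sup>2)"
proof -
 have "Lsq_inner M f f = (\<integral>x. cplx ((cmod (f x))\<^sup>2) \<partial>M)"
  unfolding Lsq_inner_def by (intro Bochner_Integration.integral_cong) (simp_all only: complex_norm_square)
 thus ?thesis by (simp only: integral_complex_of_real Lsq_norm_power2)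
qed

lemma Lsq_norm_power2_Re: "(Lsq_norm M f)\<^sup>2 = Re (Lsq_inner M f f)"
 by (simp add: Lsq_inner_self)

lemma Lsq_norm_add_power2:
 assumes "f \<in> Lsq M" "g \<in> Lsq M"
 shows "(Lsq_norm M (\<lambda>x. f x + g x))\<^sup>2 =
  (Lsq_norm M f)\<^sup>2 + (Lsq_norm M g)\<^sup>2 + 2 * Re (Lsq_inner M f g)"
 using assms Lsq_inner_commute[of M g f]
 by (simp add: Lsq_norm_power2_Re Lsq_inner_add_left Lsq_inner_add_right Lsq_add)

lemma Lsq_norm_diff_power2:
 assumes "f \<in> Lsq M" "g \<in> Lsq M"
 shows "(Lsq_norm M (\<lambda>x. f x - g x))\<^sup>2 =
  (Lsq_norm M f)\<^sup>2 + (Lsq_norm M g)\<^sup>2 - 2 * Re (Lsq_inner M f g)"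
 using assms Lsq_inner_commute[of M g f]
 by (simp add: Lsq_norm_power2_Re Lsq_inner_diff_left Lsq_inner_diff_right Lsq_diff)

lemma Lsq_norm_scale [simp]: "Lsq_norm M (\<lambda>x. c * f x) = cmod c * Lsq_norm M f"
 by (simp add: Lsq_norm_def norm_mult power_mult_distrib real_sqrt_mult)

lemma Lsq_norm_minus_commute: "Lsq_norm M (\<lambda>x. f x - g x) = Lsq_norm M (\<lambda>x. g x - f x)"
 by (simp add: Lsq_norm_def norm_minus_commute)

lemma Lsq_norm_zero [simp]: "Lsq_norm M (\<lambda>x. 0) = 0"
 by (simp add: Lsq_norm_def)

lemma Lsq_norm_eq_0_iff:
 assumes "f \<in> Lsq M"
 shows "Lsq_norm M f = 0 \<longleftrightarrow> (AE x in M. f x = 0)"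
 using integral_nonneg_eq_0_iff_AE[OF Lsq_integrable[OF assms]] by (simp add: Lsq_norm_def)

lemma Lsq_Cauchy_Schwarz:
 assumes f: "f \<in> Lsq M" and g: "g \<in> Lsq M"
 shows "cmod (Lsq_inner M f g) \<le> Lsq_norm M f * Lsq_norm M g"
proof (cases "Lsq_norm M g = 0")
 case True
 hence "AE x in M. g x = 0" using g by (simp add: Lsq_norm_eq_0_iff)
 hence "Lsq_inner M f g = Lsq_inner M f (\<lambda>x. 0)"
  using f g by (intro Lsq_inner_cong_AE) (auto dest: LsqD)
 thus ?thesis by simp
next
 case False
 define z where "z = Lsq_inner M f g"
 define N where "N = (Lsq_norm M g)\<^sup>2"
 have N: "N > 0" using False by (simp add: N_def)
 define c where "c = z / cplx N"
 have "0 \<le> (Lsq_norm M (\<lambda>x. f x - c * g x))\<^sup>2" by simp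
 also have "... = (Lsq_norm M f)\<^sup>2 + (cmod c)\<^sup>2 * N - 2 * Re (cnj c * z)"
  using f g by (subst Lsq_norm_diff_power2) (auto simp: Lsq_scale power_mult_distrib z_def N_def)
 also have "cnj c * z = cplx ((cmod z)\<^sup>2 / N)"
  by (simp add: c_def mult.commute[of "cnj z"] complex_mult_cnj cmod_power2)
 also have "(cmod c)\<^sup>2 * N = (cmod z)\<^sup>2 / N"
  using N by (simp add: c_def norm_divide power_divide field_simps power2_eq_square)
 finally have "(cmod z)\<^sup>2 / N \<le> (Lsq_norm M f)\<^sup>2" by (simp del: of_real_divide of_real_power)
 hence "(cmod z)\<^sup>2 \<le> (Lsq_norm M f * Lsq_norm M g)\<^sup>2"
  using N by (simp add: field_simps power_mult_distrib N_def)
 thus ?thesis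
  unfolding z_def by (rule power2_le_imp_le) simp
qed

lemma Lsq_norm_triangle:
 assumes f: "f \<in> Lsq M" and g: "g \<in> Lsq M"
 shows "Lsq_norm M (\<lambda>x. f x + g x) \<le> Lsq_norm M f + Lsq_norm M g"
proof (rule power2_le_imp_le)
 have "Re (Lsq_inner M f g) \<le> Lsq_norm M f * Lsq_norm M g"
  using Lsq_Cauchy_Schwarz[OF f g] complex_Re_le_cmod[of "Lsq_inner M f g"] by linarith
 thus "(Lsq_norm M (\<lambda>x. f x + g x))\<^sup>2 \<le> (Lsq_norm M f + Lsq_norm M g)\<^sup>2"
  by (simp add: Lsq_norm_add_power2[OF f g] power2_sum)
qed simp

lemma Lsq_norm_triangle_diff:
 assumes f: "f \<in> Lsq M" and g: "g \<in> Lsq M" and h: "h \<in> Lsq M"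
 shows "Lsq_norm M (\<lambda>x. f x - h x) \<le> Lsq_norm M (\<lambda>x. f x - g x) + Lsq_norm M (\<lambda>x. g x - h x)"
 using Lsq_norm_triangle[OF Lsq_diff[OF f g] Lsq_diff[OF g h]] by simp

lemma Lsq_norm_diff_le:
 assumes f: "f \<in> Lsq M" and g: "g \<in> Lsq M"
 shows "\<bar>Lsq_norm M f - Lsq_norm M g\<bar> \<le> Lsq_norm M (\<lambda>x. f x - g x)"
 using Lsq_norm_triangle[OF Lsq_diff[OF f g] g] Lsq_norm_triangle[OF Lsq_diff[OF g f] f]
  Lsq_norm_minus_commute[of M f g] by simp

lemma Lsq_norm_tendsto:
 assumes "!!n. F n \<in> Lsq M" "f \<in> Lsq M" "(\<lambda>n. Lsq_norm M (\<lambda>x. F n x - f x)) \<longlonglongrightarrow> 0"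
 shows "(\<lambda>n. Lsq_norm M (F n)) \<longlonglongrightarrow> Lsq_norm M f"
proof (rule LIM_zero_cancel, rule Lim_null_comparison[OF _ assms(3)])
 show "\<forall>\<^sub>F n in sequentially. norm (Lsq_norm M (F n) - Lsq_norm M f) \<le> Lsq_norm M (\<lambda>x. F n x - f x)"
  using Lsq_norm_diff_le[OF assms(1,2)] by simp
qed

lemma Lsq_inner_tendsto:
 assumes "!!n. F n \<in> Lsq M" "f \<in> Lsq M" "g \<in> Lsq M" "(\<lambda>n. Lsq_norm M (\<lambda>x. F n x - f x)) \<longlonglongrightarrow> 0"
 shows "(\<lambda>n. Lsq_inner M (F n) g) \<longlonglongrightarrow> Lsq_inner M f g"
proof (rule LIM_zero_cancel, rule Lim_null_comparison)
 show "(\<lambda>n. Lsq_norm M (\<lambda>x. F n x - f x) * Lsq_norm M g) \<longlonglongrightarrow> 0"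
  using tendsto_mult_right[OF assms(4), of "Lsq_norm M g"] by simp
 show "\<forall>\<^sub>F n in sequentially. norm (Lsq_inner M (F n) g - Lsq_inner M f g)
   \<le> Lsq_norm M (\<lambda>x. F n x - f x) * Lsq_norm M g"
  using Lsq_Cauchy_Schwarz[OF Lsq_diff[OF assms(1,2)] assms(3)]
  by (simp add: Lsq_inner_diff_left assms)
qed

text \<open>Passing to a subsequence with \<open>\<parallel>F (r (k+1)) - F (r k)\<parallel> < 2 ^ (-k)\<close>, the bound
 \<open>\<bar>d\<bar> \<le> 2 ^ k * \<bar>d\<bar>\<^sup>2 + 2 ^ (-k)\<close> turns square summability of the increments into absolute
 convergence almost everywhere.\<close>

lemma Lsq_complete:
 assumes F: "!!n. F n \<in> Lsq M"
  and Cauchy: "!!e. e > 0 ==> \<exists>N. \<forall>m\<ge>N. \<forall>n\<ge>N. Lsq_norm M (\<lambda>x. F m x - F n x) < e"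
 shows "\<exists>f\<in>Lsq M. (\<lambda>n. Lsq_norm M (\<lambda>x. F n x - f x)) \<longlonglongrightarrow> 0"
proof -
 have [measurable]: "F n \<in> borel_measurable M" for n using F by (rule Lsq_measurable)
 have "\<exists>N. \<forall>m\<ge>N. \<forall>n\<ge>N. Lsq_norm M (\<lambda>x. F m x - F n x) < (1/2)^k" for k :: nat
  by (rule Cauchy) simp
 then obtain s where s: "!!k m n. m \<ge> s k ==> n \<ge> s k ==> Lsq_norm M (\<lambda>x. F m x - F n x) < (1/2)^k"
  by metis
 define r where "r k = Max (s ` {..k})" for k :: nat
 have r: "r k \<ge> s k" "r (Suc k) \<ge> s k" for k by (auto simp: r_def)
 have r_mono: "r m \<ge> s k" if "m \<ge> k" for m k using that by (auto simp: r_def intro!: Max_ge)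
 define d where "d k x = F (r (Suc k)) x - F (r k) x" for k x
 have d: "d k \<in> Lsq M" for k unfolding d_def[abs_def] by (intro Lsq_diff F)
 have [measurable]: "d k \<in> borel_measurable M" for k using d by (rule Lsq_measurable)
 have nd: "Lsq_norm M (d k) < (1/2)^k" for k
  unfolding d_def[abs_def] by (intro s r)
 have "(\<integral>\<^sup>+x. (\<Sum>k. ennreal (2^k * (cmod (d k x))\<^sup>2)) \<partial>M) = (\<Sum>k. \<integral>\<^sup>+x. ennreal (2^k * (cmod (d k x))\<^sup>2) \<partial>M)"
  by (intro nn_integral_suminf) auto
 also have "... \<le> (\<Sum>k. ennreal ((1/2)^k))"
 proof (intro suminf_le summableI)
  fix k
  have "(\<integral>\<^sup>+x. ennreal (2^k * (cmod (d k x))\<^sup>2) \<partial>M) = ennreal (2^k) * ennreal ((Lsq_norm M (d k))\<^sup>2)"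
   unfolding nn_integral_Lsq_norm[OF d, symmetric]
   by (subst nn_integral_cmult[symmetric]) (auto simp: ennreal_mult)
  also have "... = ennreal (2^k * (Lsq_norm M (d k))\<^sup>2)" by (simp add: ennreal_mult)
  also have "... \<le> ennreal ((1/2)^k)"
  proof (rule ennreal_leI)
   have "(Lsq_norm M (d k))\<^sup>2 \<le> ((1/2)^k)\<^sup>2" using nd[of k] by (intro power_mono) auto
   hence "2^k * (Lsq_norm M (d k))\<^sup>2 \<le> 2^k * ((1/2)^k)\<^sup>2" by simp
   also have "... = (1/2)^k" by (simp add: power2_eq_square power_divide)
   finally show "2^k * (Lsq_norm M (d k))\<^sup>2 \<le> (1/2)^k" .
  qed
  finally show "(\<integral>\<^sup>+x. ennreal (2^k * (cmod (d k x))\<^sup>2) \<partial>M) \<le> ennreal ((1/2)^k)" .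
 qed
 also have "... < \<infinity>"
  by (subst suminf_ennreal2) (auto intro: summable_geometric)
 finally have "AE x in M. (\<Sum>k. ennreal (2^k * (cmod (d k x))\<^sup>2)) ~= \<infinity>"
  by (intro nn_integral_PInf_AE) auto
 hence conv: "AE x in M. convergent (\<lambda>k. F (r k) x)"
 proof eventually_elim
  fix x assume "(\<Sum>k. ennreal (2^k * (cmod (d k x))\<^sup>2)) ~= \<infinity>"
  hence "summable (\<lambda>k. 2^k * (cmod (d k x))\<^sup>2)"
   by (intro summable_suminf_not_top) auto
  hence "summable (\<lambda>k. 2^k * (cmod (d k x))\<^sup>2 + (1/2)^k)"
   by (intro summable_add summable_geometric) auto
  hence "summable (\<lambda>k. d k x)"
  proof (rule summable_comparison_test_ev[rotated], intro always_eventually allI)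
   fix k
   have "0 \<le> (2^k * cmod (d k x) - 1)\<^sup>2 + 2^k * cmod (d k x)" by simp
   hence "2^k * cmod (d k x) \<le> (2^k * cmod (d k x))\<^sup>2 + 1" by (simp add: power2_eq_square algebra_simps)
   thus "norm (d k x) \<le> 2^k * (cmod (d k x))\<^sup>2 + (1/2)^k"
    by (simp add: field_simps power2_eq_square power_divide)
  qed
  hence "summable (\<lambda>k. F (r (Suc k)) x - F (r k) x)" by (simp add: d_def)
  hence "convergent (\<lambda>n. \<Sum>k<n. F (r (Suc k)) x - F (r k) x)"
   by (simp add: summable_iff_convergent)
  hence "convergent (\<lambda>n. F (r n) x - F (r 0) x)"
   by (simp only: sum_lessThan_telescope[of "\<lambda>n. F (r n) x"])
  thus "convergent (\<lambda>k. F (r k) x)"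
   using convergent_add[of _ "\<lambda>_. F (r 0) x"] convergent_const by fastforce
 qed
 define f where "f x = lim (\<lambda>k. F (r k) x)" for x
 have [measurable]: "f \<in> borel_measurable M" unfolding f_def[abs_def] by measurable
 have bound: "(\<integral>\<^sup>+x. esq (F n x - f x) \<partial>M) \<le> ennreal (((1/2)^k)\<^sup>2)" if n: "n \<ge> s k" for n k
 proof -
  have "(\<integral>\<^sup>+x. esq (F n x - f x) \<partial>M) =
    (\<integral>\<^sup>+x. liminf (\<lambda>j. esq (F n x - F (r j) x)) \<partial>M)"
  proof (rule nn_integral_cong_AE)
   show "AE x in M. esq (F n x - f x) = liminf (\<lambda>j. esq (F n x - F (r j) x))"
    using conv
   proof eventually_elim
    fix x assume "convergent (\<lambda>k. F (r k) x)"
    hence "(\<lambda>j. F (r j) x) \<longlonglongrightarrow> f x" unfolding f_def by (simp add: convergent_LIMSEQ_iff)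
    hence "(\<lambda>j. esq (F n x - F (r j) x)) \<longlonglongrightarrow> esq (F n x - f x)"
     by (intro tendsto_ennrealI tendsto_intros)
    thus "esq (F n x - f x) = liminf (\<lambda>j. esq (F n x - F (r j) x))"
     by (rule lim_imp_Liminf[OF trivial_limit_sequentially, symmetric])
   qed
  qed
  also have "... \<le> liminf (\<lambda>j. \<integral>\<^sup>+x. esq (F n x - F (r j) x) \<partial>M)"
   by (intro nn_integral_liminf) auto
  also have "... \<le> ennreal (((1/2)^k)\<^sup>2)"
  proof (rule Liminf_le)
   show "\<forall>\<^sub>F j in sequentially. (\<integral>\<^sup>+x. esq (F n x - F (r j) x) \<partial>M) \<le> ennreal (((1/2)^k)\<^sup>2)"
   proof (rule eventually_sequentiallyI[of k])
    fix j assume "k \<le> j"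
    thus "(\<integral>\<^sup>+x. esq (F n x - F (r j) x) \<partial>M) \<le> ennreal (((1/2)^k)\<^sup>2)"
     using s[OF n r_mono, of j] nn_integral_Lsq_norm[OF Lsq_diff[OF F F], of n "r j"]
     by (auto intro!: ennreal_leI power_mono)
   qed
  qed simp
  finally show ?thesis .
 qed
 have "(\<lambda>x. F (s 0) x - f x) \<in> Lsq M"
  using bound[of 0 "s 0"] by (subst Lsq_iff_nn_integral) (auto intro: le_less_trans)
 from Lsq_diff[OF F[of "s 0"] this] have f: "f \<in> Lsq M" by simp
 have "(\<lambda>n. Lsq_norm M (\<lambda>x. F n x - f x)) \<longlonglongrightarrow> 0"
 proof (rule LIMSEQ_I)
  fix e :: real assume "e > 0"
  then obtain k where k: "(1/2)^k < e" using real_arch_pow_inv[of e "1/2"] by auto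
  have "norm (Lsq_norm M (\<lambda>x. F n x - f x) - 0) < e" if "n \<ge> s k" for n
  proof -
   have "(Lsq_norm M (\<lambda>x. F n x - f x))\<^sup>2 \<le> ((1/2)^k)\<^sup>2"
    using bound[OF that] nn_integral_Lsq_norm[OF Lsq_diff[OF F f], of n] by (auto simp: ennreal_le_iff)
   hence "Lsq_norm M (\<lambda>x. F n x - f x) \<le> (1/2)^k" by (rule power2_le_imp_le) simp
   thus ?thesis using k by simp
  qed
  thus "\<exists>N. \<forall>n\<ge>N. norm (Lsq_norm M (\<lambda>x. F n x - f x) - 0) < e" by blast
 qed
 with f show ?thesis by blast
qed

lemma closed_subspaceD:
 assumes "closed_subspace M V"
 shows closed_subspace_Lsq: "f \<in> V ==> f \<in> Lsq M"
  and closed_subspace_zero: "(\<lambda>x. 0) \<in> V"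
  and closed_subspace_add: "f \<in> V ==> g \<in> V ==> (\<lambda>x. f x + g x) \<in> V"
  and closed_subspace_scale: "f \<in> V ==> (\<lambda>x. c * f x) \<in> V"
 using assms by (auto simp: closed_subspace_def)

lemma closed_subspace_diff:
 assumes "closed_subspace M V" "f \<in> V" "g \<in> V"
 shows "(\<lambda>x. f x - g x) \<in> V"
 using closed_subspace_add[OF assms(1,2) closed_subspace_scale[OF assms(1,3), of "-1"]] by simp

lemma closed_subspace_limit:
 assumes "closed_subspace M V" "f \<in> Lsq M" "!!n. F n \<in> V"
  "(\<lambda>n. Lsq_norm M (\<lambda>x. F n x - f x)) \<longlonglongrightarrow> 0"
 shows "f \<in> V"
proof -
 have "\<exists>g\<in>V. Lsq_norm M (\<lambda>x. f x - g x) < e" if "e > 0" for e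
 proof -
  from order_tendstoD(2)[OF assms(4) that] obtain n where "Lsq_norm M (\<lambda>x. F n x - f x) < e"
   by (auto simp: eventually_sequentially)
  thus ?thesis using assms(3) by (intro bexI[of _ "F n"]) (simp_all add: Lsq_norm_minus_commute)
 qed
 hence "f \<in> Lsq_closure M V" using assms(2) by (auto simp: Lsq_closure_def)
 thus ?thesis using assms(1) by (auto simp: closed_subspace_def)
qed

lemma closed_subspace_cong_AE:
 assumes "closed_subspace M V" "f \<in> V" "g \<in> Lsq M" "AE x in M. f x = g x"
 shows "g \<in> V"
proof (rule closed_subspace_limit[OF assms(1,3), of "\<lambda>_. f"])
 have "Lsq_norm M (\<lambda>x. f x - g x) = 0"
  using assms closed_subspace_Lsq[OF assms(1,2)] by (subst Lsq_norm_eq_0_iff) (auto intro: Lsq_diff)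
 thus "(\<lambda>n. Lsq_norm M (\<lambda>x. f x - g x)) \<longlonglongrightarrow> 0" by simp
qed (use assms in auto)

text \<open>A minimizing sequence for the distance is Cauchy by the parallelogram law, and its limit is the foot of the
 perpendicular because no multiple of an element of the subspace improves the distance.\<close>

theorem Lsq_projection_exists:
 assumes V: "closed_subspace M V" and f: "f \<in> Lsq M"
 shows "\<exists>p. p \<in> V \<and> (\<forall>g\<in>V. Lsq_inner M (\<lambda>x. f x - p x) g = 0)"
proof -
 define D where "D = (\<lambda>g. (Lsq_norm M (\<lambda>x. f x - g x))\<^sup>2) ` V"
 define d where "d = Inf D"
 have bdd: "bdd_below D" by (auto simp: D_def intro!: bdd_belowI[of _ 0])
 have ne: "D ~= {}" using closed_subspace_zero[OF V] by (auto simp: D_def)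
 have d_le: "d \<le> (Lsq_norm M (\<lambda>x. f x - g x))\<^sup>2" if "g \<in> V" for g
  unfolding d_def using that bdd by (intro cInf_lower) (auto simp: D_def)
 have "\<exists>g\<in>V. (Lsq_norm M (\<lambda>x. f x - g x))\<^sup>2 < d + 1 / Suc n" for n :: nat
  using cInf_lessD[OF ne, of "d + 1 / Suc n"] by (auto simp: d_def D_def)
 then obtain G where G: "!!n. G n \<in> V" and Gd: "!!n. (Lsq_norm M (\<lambda>x. f x - G n x))\<^sup>2 < d + 1 / Suc n"
  by metis
 have GL: "G n \<in> Lsq M" for n using G V by (blast intro: closed_subspace_Lsq)
 \<comment> \<open>The parallelogram law for the vectors from \<open>f\<close> to \<open>G m\<close> and \<open>G n\<close>, whose midpoint is again in \<open>V\<close>.\<close>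
 have par: "(Lsq_norm M (\<lambda>x. G m x - G n x))\<^sup>2 \<le> 2 / Suc m + 2 / Suc n" for m n
 proof -
  define a where "a x = f x - G m x" for x
  define b where "b x = f x - G n x" for x
  have a: "a \<in> Lsq M" and b: "b \<in> Lsq M" unfolding a_def[abs_def] b_def[abs_def] using f GL by (auto intro: Lsq_diff)
  define h where "h = (\<lambda>x. (1/2) * (G m x + G n x))"
  have "h \<in> V" unfolding h_def by (intro closed_subspace_scale[OF V] closed_subspace_add[OF V] G)
  from d_le[OF this] have "4 * d \<le> (Lsq_norm M (\<lambda>x. 2 * (f x - h x)))\<^sup>2"
   by (subst Lsq_norm_scale) (simp add: power_mult_distrib)
  also have "(\<lambda>x. 2 * (f x - h x)) = (\<lambda>x. a x + b x)"
   by (simp add: fun_eq_iff h_def a_def b_def algebra_simps)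
  finally have "4 * d \<le> (Lsq_norm M (\<lambda>x. a x + b x))\<^sup>2" .
  moreover have "(Lsq_norm M (\<lambda>x. a x + b x))\<^sup>2 + (Lsq_norm M (\<lambda>x. a x - b x))\<^sup>2
    = 2 * (Lsq_norm M a)\<^sup>2 + 2 * (Lsq_norm M b)\<^sup>2"
   using a b by (simp add: Lsq_norm_add_power2 Lsq_norm_diff_power2)
  moreover have "(\<lambda>x. a x - b x) = (\<lambda>x. G n x - G m x)" by (simp add: a_def b_def fun_eq_iff)
  moreover have "(Lsq_norm M a)\<^sup>2 < d + 1 / Suc m" "(Lsq_norm M b)\<^sup>2 < d + 1 / Suc n"
   using Gd by (simp_all add: a_def[abs_def] b_def[abs_def])
  ultimately show ?thesis by (simp add: Lsq_norm_minus_commute[of M "G m"])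
 qed
 have "\<exists>p\<in>Lsq M. (\<lambda>n. Lsq_norm M (\<lambda>x. G n x - p x)) \<longlonglongrightarrow> 0"
 proof (rule Lsq_complete[OF GL])
  fix e :: real assume e: "e > 0"
  then obtain N where N: "inverse (real (Suc N)) < e\<^sup>2 / 4" using reals_Archimedean[of "e\<^sup>2/4"] by auto
  have "Lsq_norm M (\<lambda>x. G m x - G n x) < e" if "m \<ge> N" "n \<ge> N" for m n
  proof (rule power2_less_imp_less)
   have "2 / real (Suc m) \<le> 2 * inverse (real (Suc N))" "2 / real (Suc n) \<le> 2 * inverse (real (Suc N))"
    using that by (auto simp: field_simps)
   thus "(Lsq_norm M (\<lambda>x. G m x - G n x))\<^sup>2 < e\<^sup>2" using par[of m n] N by linarith
  qed (use e in simp)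
  thus "\<exists>N. \<forall>m\<ge>N. \<forall>n\<ge>N. Lsq_norm M (\<lambda>x. G m x - G n x) < e" by blast
 qed
 then obtain p where p: "p \<in> Lsq M" and Gp: "(\<lambda>n. Lsq_norm M (\<lambda>x. G n x - p x)) \<longlonglongrightarrow> 0" by blast
 have pV: "p \<in> V" by (rule closed_subspace_limit[OF V p G Gp])
 have "(\<lambda>n. Lsq_norm M (\<lambda>x. (f x - G n x) - (f x - p x))) \<longlonglongrightarrow> 0"
  using Gp by (simp add: Lsq_norm_minus_commute[of M p])
 hence "(\<lambda>n. Lsq_norm M (\<lambda>x. f x - G n x)) \<longlonglongrightarrow> Lsq_norm M (\<lambda>x. f x - p x)"
  by (intro Lsq_norm_tendsto Lsq_diff f GL p)
 hence "(\<lambda>n. (Lsq_norm M (\<lambda>x. f x - G n x))\<^sup>2) \<longlonglongrightarrow> (Lsq_norm M (\<lambda>x. f x - p x))\<^sup>2"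
  by (intro tendsto_intros)
 moreover have "(\<lambda>n. d + 1 / real (Suc n)) \<longlonglongrightarrow> d + 0"
  by (intro tendsto_intros LIMSEQ_Suc[OF lim_1_over_n])
 ultimately have pd: "(Lsq_norm M (\<lambda>x. f x - p x))\<^sup>2 \<le> d"
  using Gd by (intro LIMSEQ_le[where Y = "\<lambda>n. d + 1 / real (Suc n)" and X = "\<lambda>n. (Lsq_norm M (\<lambda>x. f x - G n x))\<^sup>2"])
   (auto intro: less_imp_le)
 have "Lsq_inner M (\<lambda>x. f x - p x) g = 0" if g: "g \<in> V" for g
 proof -
  define r where "r x = f x - p x" for x
  have r: "r \<in> Lsq M" unfolding r_def[abs_def] using f p by (rule Lsq_diff)
  have gL: "g \<in> Lsq M" by (rule closed_subspace_Lsq[OF V g])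
  define z where "z = Lsq_inner M r g"
  define N where "N = (Lsq_norm M g)\<^sup>2 + 1"
  have N: "N > 0" by (simp add: N_def add_nonneg_pos)
  define c where "c = z / cplx N"
  have "(\<lambda>x. p x + c * g x) \<in> V" by (intro closed_subspace_add[OF V] closed_subspace_scale[OF V] pV g)
  from order_trans[OF pd d_le[OF this]]
  have "(Lsq_norm M r)\<^sup>2 \<le> (Lsq_norm M (\<lambda>x. f x - (p x + c * g x)))\<^sup>2"
   unfolding r_def[abs_def] .
  also have "(\<lambda>x. f x - (p x + c * g x)) = (\<lambda>x. r x - c * g x)" by (simp add: r_def fun_eq_iff)
  also have "(Lsq_norm M (\<lambda>x. r x - c * g x))\<^sup>2 = (Lsq_norm M r)\<^sup>2 + (cmod c)\<^sup>2 * (Lsq_norm M g)\<^sup>2 - 2 * Re (cnj c * z)"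
   using r gL by (subst Lsq_norm_diff_power2) (auto simp: Lsq_scale power_mult_distrib z_def)
  also have "cnj c * z = cplx ((cmod z)\<^sup>2 / N)"
   by (simp add: c_def mult.commute[of "cnj z"] complex_mult_cnj cmod_power2)
  also have "(cmod c)\<^sup>2 = (cmod z)\<^sup>2 / N\<^sup>2"
   using N by (simp add: c_def norm_divide power_divide)
  finally have "2 * ((cmod z)\<^sup>2 / N) \<le> (cmod z)\<^sup>2 / N\<^sup>2 * (Lsq_norm M g)\<^sup>2"
   by (simp del: of_real_divide of_real_power)
  also have "... \<le> (cmod z)\<^sup>2 / N\<^sup>2 * N" by (intro mult_left_mono) (simp_all add: N_def)
  also have "... = (cmod z)\<^sup>2 / N" using N by (simp add: power2_eq_square)
  finally have "(cmod z)\<^sup>2 / N \<le> 0" by simp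
  hence "(cmod z)\<^sup>2 \<le> 0" using N by (simp add: divide_le_0_iff)
  thus ?thesis by (simp add: z_def r_def[abs_def])
 qed
 with pV show ?thesis by blast
qed

lemma Lsq_proj:
 assumes "closed_subspace M V" "f \<in> Lsq M"
 shows Lsq_proj_in: "Lsq_proj M V f \<in> V"
  and Lsq_proj_orthogonal: "g \<in> V ==> Lsq_inner M (\<lambda>x. f x - Lsq_proj M V f x) g = 0"
 using someI_ex[OF Lsq_projection_exists[OF assms]] by (auto simp: Lsq_proj_def)

lemma Lsq_proj_Lsq:
 assumes "closed_subspace M V" "f \<in> Lsq M"
 shows "Lsq_proj M V f \<in> Lsq M"
 using Lsq_proj_in[OF assms] assms(1) by (rule closed_subspace_Lsq[rotated])

lemma Lsq_proj_inner:
 assumes "closed_subspace M V" "f \<in> Lsq M" "g \<in> V"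
 shows "Lsq_inner M (Lsq_proj M V f) g = Lsq_inner M f g"
 using Lsq_proj_orthogonal[OF assms] assms
 by (simp add: Lsq_inner_diff_left Lsq_proj_Lsq closed_subspace_Lsq)

lemma Lsq_proj_norm_power2:
 assumes "closed_subspace M V" "f \<in> Lsq M"
 shows "(Lsq_norm M f)\<^sup>2 = (Lsq_norm M (Lsq_proj M V f))\<^sup>2 + (Lsq_norm M (\<lambda>x. f x - Lsq_proj M V f x))\<^sup>2"
proof -
 let ?p = "Lsq_proj M V f"
 have "Lsq_inner M f ?p = cplx ((Lsq_norm M ?p)\<^sup>2)"
  using Lsq_proj_inner[OF assms Lsq_proj_in[OF assms]] by (simp add: Lsq_inner_self)
 thus ?thesis by (simp add: Lsq_norm_diff_power2 assms Lsq_proj_Lsq)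
qed

lemma Lsq_proj_norm_le:
 assumes "closed_subspace M V" "f \<in> Lsq M"
 shows "Lsq_norm M (Lsq_proj M V f) \<le> Lsq_norm M f"
 by (rule power2_le_imp_le) (simp_all add: Lsq_proj_norm_power2[OF assms])

text \<open>Apply the hypothesis to the difference of \<open>f\<close> and its projection, which is then orthogonal to itself.\<close>

lemma double_orthogonal_complement:
 assumes V: "closed_subspace M V" and f: "f \<in> Lsq M"
  and orth: "!!h. h \<in> Lsq M ==> (!!g. g \<in> V ==> Lsq_inner M h g = 0) ==> Lsq_inner M f h = 0"
 shows "f \<in> V"
proof -
 define r where "r = (\<lambda>x. f x - Lsq_proj M V f x)"
 have r: "r \<in> Lsq M" unfolding r_def using V f by (intro Lsq_diff Lsq_proj_Lsq)
 have "Lsq_inner M r g = 0" if "g \<in> V" for g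
  unfolding r_def by (rule Lsq_proj_orthogonal[OF V f that])
 hence "Lsq_inner M f r = 0" and "Lsq_inner M r (Lsq_proj M V f) = 0"
  using orth[OF r] Lsq_proj_in[OF V f] by auto
 moreover have "Lsq_inner M r r = Lsq_inner M f r - Lsq_inner M (Lsq_proj M V f) r"
  using Lsq_inner_diff_left[OF f Lsq_proj_Lsq[OF V f] r] by (simp only: r_def[symmetric])
 moreover have "Lsq_inner M (Lsq_proj M V f) r = cnj (Lsq_inner M r (Lsq_proj M V f))"
  by (rule Lsq_inner_commute)
 ultimately have "Lsq_inner M r r = 0" by simp
 hence "Lsq_norm M r = 0" by (simp add: Lsq_inner_self)
 hence "AE x in M. r x = 0" using Lsq_norm_eq_0_iff[OF r] by blast
 hence "AE x in M. Lsq_proj M V f x = f x" by eventually_elim (simp add: r_def)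
 thus ?thesis by (rule closed_subspace_cong_AE[OF V Lsq_proj_in[OF V f] f])
qed

lemma closed_subspace_eqI:
 assumes V: "closed_subspace M V" and W: "closed_subspace M W" and WV: "W \<subseteq> V"
  and orth: "!!f. f \<in> V ==> (!!g. g \<in> W ==> Lsq_inner M f g = 0) ==> AE x in M. f x = 0"
 shows "V \<subseteq> W"
proof
 fix f assume fV: "f \<in> V"
 have f: "f \<in> Lsq M" by (rule closed_subspace_Lsq[OF V fV])
 let ?p = "Lsq_proj M W f"
 have "(\<lambda>x. f x - ?p x) \<in> V"
  using Lsq_proj_in[OF W f] WV by (intro closed_subspace_diff[OF V] fV) auto
 from orth[OF this Lsq_proj_orthogonal[OF W f]] have "AE x in M. f x - ?p x = 0" .
 hence "AE x in M. ?p x = f x" by eventually_elim simp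
 thus "f \<in> W" by (rule closed_subspace_cong_AE[OF W Lsq_proj_in[OF W f] f])
qed

lemma orth_diff_closed_subspace:
 assumes V: "closed_subspace M V" and U: "closed_subspace M U"
 shows "closed_subspace M (orth_diff M V U)"
 unfolding closed_subspace_def
proof (intro conjI ballI allI subsetI)
 fix f assume f: "f \<in> Lsq_closure M (orth_diff M V U)"
 hence fL: "f \<in> Lsq M" and "\<forall>n. \<exists>g\<in>orth_diff M V U. Lsq_norm M (\<lambda>x. f x - g x) < 1 / Suc n"
  by (auto simp: Lsq_closure_def)
 then obtain G where G: "!!n. G n \<in> orth_diff M V U" and Gf: "!!n. Lsq_norm M (\<lambda>x. f x - G n x) < 1 / Suc n"
  by metis
 have lim: "(\<lambda>n. Lsq_norm M (\<lambda>x. G n x - f x)) \<longlonglongrightarrow> 0"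
 proof (rule Lim_null_comparison[OF _ LIMSEQ_Suc[OF lim_1_over_n]])
  show "\<forall>\<^sub>F n in sequentially. norm (Lsq_norm M (\<lambda>x. G n x - f x)) \<le> 1 / real (Suc n)"
   using Gf by (intro always_eventually allI) (simp add: Lsq_norm_minus_commute[of M f] less_imp_le)
 qed
 have GV: "G n \<in> V" and GL: "G n \<in> Lsq M" for n
  using G closed_subspace_Lsq[OF V] by (auto simp: orth_diff_def)
 have "Lsq_inner M f g = 0" if g: "g \<in> U" for g
 proof -
  have "(\<lambda>n. Lsq_inner M (G n) g) \<longlonglongrightarrow> Lsq_inner M f g"
   by (rule Lsq_inner_tendsto[OF GL fL closed_subspace_Lsq[OF U g] lim])
  moreover have "Lsq_inner M (G n) g = 0" for n using G[of n] g by (auto simp: orth_diff_def)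
  ultimately show ?thesis by (simp add: LIMSEQ_const_iff)
 qed
 thus "f \<in> orth_diff M V U"
  using closed_subspace_limit[OF V fL GV lim] by (simp add: orth_diff_def)
qed (use closed_subspace_Lsq[OF V] closed_subspace_Lsq[OF U] closed_subspaceD(2-)[OF V] in
   \<open>auto simp: orth_diff_def Lsq_inner_add_left\<close>)

text \<open>For nested subspaces the orthogonal projections split, and so do their energies.\<close>

lemma orth_diff_proj_norm_power2:
 assumes V: "closed_subspace M V" and U: "closed_subspace M U" and UV: "U \<subseteq> V" and f: "f \<in> Lsq M"
 shows "(Lsq_norm M (Lsq_proj M V f))\<^sup>2 =
  (Lsq_norm M (Lsq_proj M U f))\<^sup>2 + (Lsq_norm M (Lsq_proj M (orth_diff M V U) f))\<^sup>2"
proof -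
 note W = orth_diff_closed_subspace[OF V U]
 let ?pV = "Lsq_proj M V f" and ?pU = "Lsq_proj M U f" and ?pW = "Lsq_proj M (orth_diff M V U) f"
 note L = Lsq_proj_Lsq[OF V f] Lsq_proj_Lsq[OF U f] Lsq_proj_Lsq[OF W f]
 define r where "r x = ?pV x - ?pU x" for x
 have rV: "r \<in> V" unfolding r_def[abs_def]
  using Lsq_proj_in[OF U f] UV by (intro closed_subspace_diff[OF V] Lsq_proj_in[OF V f]) auto
 have rL: "r \<in> Lsq M" by (rule closed_subspace_Lsq[OF V rV])
 have rU: "Lsq_inner M r g = 0" if "g \<in> U" for g
 proof -
  have "Lsq_inner M r g = Lsq_inner M ?pV g - Lsq_inner M ?pU g"
   unfolding r_def[abs_def] by (intro Lsq_inner_diff_left L closed_subspace_Lsq[OF U that])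
  thus ?thesis using that UV Lsq_proj_inner[OF V f, of g] Lsq_proj_inner[OF U f that] by auto
 qed
 hence rW: "r \<in> orth_diff M V U" using rV by (simp add: orth_diff_def)
 have "Lsq_inner M ?pW g = Lsq_inner M r g" if g: "g \<in> orth_diff M V U" for g
 proof -
  have gV: "g \<in> V" and gL: "g \<in> Lsq M" and gU: "Lsq_inner M g ?pU = 0"
   using g closed_subspace_Lsq[OF V] Lsq_proj_in[OF U f] by (auto simp: orth_diff_def)
  have "Lsq_inner M r g = Lsq_inner M ?pV g - Lsq_inner M ?pU g"
   unfolding r_def[abs_def] by (intro Lsq_inner_diff_left L gL)
  thus ?thesis
   using Lsq_proj_inner[OF W f g] Lsq_proj_inner[OF V f gV] gU Lsq_inner_commute[of M ?pU g] by simp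
 qed
 from this[OF rW] this[OF Lsq_proj_in[OF W f]]
 have "Lsq_inner M ?pW r = Lsq_inner M r r" "Lsq_inner M ?pW ?pW = Lsq_inner M r ?pW" by auto
 hence "Lsq_inner M ?pW ?pW = Lsq_inner M r r"
  using Lsq_inner_commute[of M r ?pW] by (simp add: Lsq_inner_self)
 hence "(Lsq_norm M ?pW)\<^sup>2 = (Lsq_norm M r)\<^sup>2" by (simp only: Lsq_norm_power2_Re)
 moreover have "?pV = (\<lambda>x. ?pU x + r x)" by (simp add: r_def fun_eq_iff)
 moreover have "Lsq_inner M ?pU r = 0"
  using rU[OF Lsq_proj_in[OF U f]] Lsq_inner_commute[of M ?pU r] by simp
 ultimately show ?thesis
  using Lsq_norm_add_power2[OF L(2) rL] by simp
qed

section \<open>Frame energies\<close>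

text \<open>With extended nonnegative values the sum is defined for every index set, and Tonelli's theorem
 applies to it.\<close>

definition frame_energy :: "'a measure => 'i set => ('i => 'a => complex) => ('a => complex) => ennreal" where
 "frame_energy M I e f = (\<integral>\<^sup>+i. esq (Lsq_inner M f (e i)) \<partial>count_space I)"

lemma integral_count_space_eq_infsum:
 fixes g :: "'i => 'b::{banach, second_countable_topology}"
 assumes "integrable (count_space I) g"
 shows "(\<integral>i. g i \<partial>count_space I) = infsum g I"
 by (rule infsetsum_infsum[unfolded infsetsum_def Infinite_Set_Sum.abs_summable_on_def, OF assms])

lemma integrable_count_space_summable_on:
 fixes g :: "'i => 'b::{banach, second_countable_topology}"
 assumes "integrable (count_space I) g"
 shows "g summable_on I"
proof -
 have "Infinite_Set_Sum.abs_summable_on g I"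
  unfolding Infinite_Set_Sum.abs_summable_on_def by (rule assms)
 thus ?thesis by (rule abs_summable_summable[OF abs_summable_equivalent[THEN iffD2]])
qed

text \<open>This translates the unordered sums in the definition of a frame into integrals.\<close>

lemma has_sum_iff_nn_integral_count_space:
 fixes g :: "'i => real"
 assumes g: "!!i. i \<in> I ==> 0 \<le> g i" and a: "0 \<le> a"
 shows "(g has_sum a) I \<longleftrightarrow> (\<integral>\<^sup>+i. ennreal (g i) \<partial>count_space I) = ennreal a"
proof
 assume "(g has_sum a) I"
 hence s: "g summable_on I" "infsum g I = a" by (auto simp: has_sum_imp_summable infsumI)
 have "(\<lambda>i. norm (g i)) summable_on I"
  by (rule summable_on_iff_abs_summable_on_real[THEN iffD1, OF s(1)])
 hence i: "integrable (count_space I) g"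
  unfolding Infinite_Set_Sum.abs_summable_on_def[symmetric] by (rule abs_summable_equivalent[THEN iffD1])
 hence "(\<integral>\<^sup>+i. ennreal (g i) \<partial>count_space I) = ennreal (\<integral>i. g i \<partial>count_space I)"
  using g by (intro nn_integral_eq_integral) (auto simp: AE_count_space)
 also have "(\<integral>i. g i \<partial>count_space I) = a"
  using s by (simp add: integral_count_space_eq_infsum[OF i])
 finally show "(\<integral>\<^sup>+i. ennreal (g i) \<partial>count_space I) = ennreal a" .
next
 assume *: "(\<integral>\<^sup>+i. ennreal (g i) \<partial>count_space I) = ennreal a"
 have i: "integrable (count_space I) g"
  using g * by (intro integrableI_nonneg) (auto simp: AE_count_space)
 hence "(\<integral>i. g i \<partial>count_space I) = a"
  using g * a by (subst integral_eq_nn_integral) (auto simp: AE_count_space)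
 hence "infsum g I = a"
  by (simp add: integral_count_space_eq_infsum[OF i])
 moreover have "g summable_on I"
  by (rule integrable_count_space_summable_on[OF i])
 ultimately show "(g has_sum a) I" using has_sum_infsum by blast
qed

lemma normalized_tight_frame_iff_energy:
 "normalized_tight_frame M H I e \<longleftrightarrow>
   (\<forall>i\<in>I. e i \<in> H) \<and> (\<forall>f\<in>H. frame_energy M I e f = ennreal ((Lsq_norm M f)\<^sup>2))"
 by (simp add: normalized_tight_frame_def frame_energy_def has_sum_iff_nn_integral_count_space)

lemma frame_energy_scale:
 "frame_energy M I e (\<lambda>x. c * f x) = esq c * frame_energy M I e f"
 unfolding frame_energy_def
 by (subst nn_integral_cmult[symmetric]) (auto simp: norm_mult power_mult_distrib ennreal_mult)

lemma frame_energy_parallelogram: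
 assumes "f \<in> Lsq M" "g \<in> Lsq M" "!!i. i \<in> I ==> e i \<in> Lsq M"
 shows "frame_energy M I e (\<lambda>x. f x + g x) + frame_energy M I e (\<lambda>x. f x - g x)
    = 2 * frame_energy M I e f + 2 * frame_energy M I e g"
proof -
 have "(cmod (Lsq_inner M (\<lambda>x. f x + g x) (e i)))\<^sup>2 + (cmod (Lsq_inner M (\<lambda>x. f x - g x) (e i)))\<^sup>2
   = 2 * (cmod (Lsq_inner M f (e i)))\<^sup>2 + 2 * (cmod (Lsq_inner M g (e i)))\<^sup>2" if "i \<in> I" for i
  using assms that
  by (simp only: Lsq_inner_add_left Lsq_inner_diff_left cmod_power2) (simp add: power2_eq_square algebra_simps)
 hence "esq (Lsq_inner M (\<lambda>x. f x + g x) (e i)) + esq (Lsq_inner M (\<lambda>x. f x - g x) (e i))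
   = 2 * esq (Lsq_inner M f (e i)) + 2 * esq (Lsq_inner M g (e i))" if "i \<in> I" for i
  by (subst ennreal_plus[symmetric]) (simp_all add: that ennreal_mult)
 hence "(\<integral>\<^sup>+i. (esq (Lsq_inner M (\<lambda>x. f x + g x) (e i)) + esq (Lsq_inner M (\<lambda>x. f x - g x) (e i))) \<partial>count_space I)
   = (\<integral>\<^sup>+i. (2 * esq (Lsq_inner M f (e i)) + 2 * esq (Lsq_inner M g (e i))) \<partial>count_space I)"
  by (intro nn_integral_cong) simp
 thus ?thesis
  unfolding frame_energy_def by (simp add: nn_integral_add nn_integral_cmult)
qed

text \<open>If the energy never exceeds the square of the norm, the defect is a nonnegative quadratic form
 dominated by the square of the norm.  The parallelogram law makes its zero set a closed subspace.\<close>

lemma energy_equality_closed_subspace: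
 assumes e: "!!i. i \<in> I ==> e i \<in> Lsq M"
  and bessel: "!!f. f \<in> Lsq M ==> frame_energy M I e f \<le> ennreal ((Lsq_norm M f)\<^sup>2)"
 shows "closed_subspace M {f \<in> Lsq M. frame_energy M I e f = ennreal ((Lsq_norm M f)\<^sup>2)}"
proof -
 define q where "q f = enn2real (frame_energy M I e f)" for f
 have fin: "frame_energy M I e f = ennreal (q f)" if "f \<in> Lsq M" for f
  using bessel[OF that] by (auto simp: q_def ennreal_enn2real_if top_unique)
 have q0: "q f \<ge> 0" for f by (simp add: q_def)
 define d where "d f = (Lsq_norm M f)\<^sup>2 - q f" for f
 have d0: "d f \<ge> 0" if "f \<in> Lsq M" for f
  using bessel[OF that] fin[OF that] by (simp add: d_def ennreal_le_iff)
 have d_iff: "frame_energy M I e f = ennreal ((Lsq_norm M f)\<^sup>2) \<longleftrightarrow> d f = 0" if "f \<in> Lsq M" for f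
  using fin[OF that] q0 by (auto simp: d_def)
 have par: "d (\<lambda>x. f x + g x) + d (\<lambda>x. f x - g x) = 2 * d f + 2 * d g" if f: "f \<in> Lsq M" and g: "g \<in> Lsq M" for f g
 proof -
  have "ennreal (q (\<lambda>x. f x + g x) + q (\<lambda>x. f x - g x)) = ennreal (2 * q f + 2 * q g)"
   using frame_energy_parallelogram[OF f g, of I e] e q0 f g
   by (simp add: fin Lsq_add Lsq_diff ennreal_mult)
  hence "q (\<lambda>x. f x + g x) + q (\<lambda>x. f x - g x) = 2 * q f + 2 * q g"
   using q0 by (subst (asm) ennreal_inj) (auto intro!: add_nonneg_nonneg)
  thus ?thesis using f g by (simp add: d_def Lsq_norm_add_power2 Lsq_norm_diff_power2)
 qed
 show ?thesis
  unfolding closed_subspace_def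
 proof (intro conjI ballI allI subsetI)
  fix f g assume "f \<in> {f \<in> Lsq M. frame_energy M I e f = ennreal ((Lsq_norm M f)\<^sup>2)}"
   "g \<in> {f \<in> Lsq M. frame_energy M I e f = ennreal ((Lsq_norm M f)\<^sup>2)}"
  hence f: "f \<in> Lsq M" "d f = 0" and g: "g \<in> Lsq M" "d g = 0" by (auto simp: d_iff)
  have "d (\<lambda>x. f x + g x) = 0"
   using par[OF f(1) g(1)] f g d0[OF Lsq_add[OF f(1) g(1)]] d0[OF Lsq_diff[OF f(1) g(1)]] by linarith
  thus "(\<lambda>x. f x + g x) \<in> {f \<in> Lsq M. frame_energy M I e f = ennreal ((Lsq_norm M f)\<^sup>2)}"
   using f g by (simp add: d_iff Lsq_add)
 next
  fix c f assume "f \<in> {f \<in> Lsq M. frame_energy M I e f = ennreal ((Lsq_norm M f)\<^sup>2)}"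
  thus "(\<lambda>x. c * f x) \<in> {f \<in> Lsq M. frame_energy M I e f = ennreal ((Lsq_norm M f)\<^sup>2)}"
   by (auto simp: Lsq_scale frame_energy_scale power_mult_distrib ennreal_mult)
 next
  fix f assume f: "f \<in> Lsq_closure M {f \<in> Lsq M. frame_energy M I e f = ennreal ((Lsq_norm M f)\<^sup>2)}"
  hence fL: "f \<in> Lsq M" by (auto simp: Lsq_closure_def)
  have "d f \<le> 2 * t\<^sup>2" if t: "t > 0" for t
  proof -
   from f t obtain g where g: "g \<in> Lsq M" "d g = 0" and fg: "Lsq_norm M (\<lambda>x. f x - g x) < t"
    by (auto simp: Lsq_closure_def d_iff)
   define h where "h = (\<lambda>x. f x - g x)"
   have h: "h \<in> Lsq M" unfolding h_def by (intro Lsq_diff fL g)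
   have "d f + d (\<lambda>x. g x - h x) = 2 * d g + 2 * d h" using par[OF g(1) h] by (simp add: h_def)
   moreover have "d (\<lambda>x. g x - h x) \<ge> 0" by (intro d0 Lsq_diff g h)
   moreover have "d h \<le> (Lsq_norm M h)\<^sup>2" using q0 by (simp add: d_def)
   moreover have "(Lsq_norm M h)\<^sup>2 \<le> t\<^sup>2" using fg by (intro power_mono) (auto simp: h_def)
   ultimately show ?thesis using g by linarith
  qed
  from this[of "sqrt (t/2)" for t] have "d f \<le> 0 + t" if "t > 0" for t using that by auto
  hence "d f \<le> 0" by (rule field_le_epsilon)
  with d0[OF fL] show "f \<in> {f \<in> Lsq M. frame_energy M I e f = ennreal ((Lsq_norm M f)\<^sup>2)}"
   using fL by (simp add: d_iff)
 qed (auto simp: frame_energy_def)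
qed

text \<open>Vectors of a normalized orthogonal system may also vanish; this is what the Gram-Schmidt
 procedure produces from a dependent sequence.\<close>

definition orthonormal_or_zero :: "'a measure => 'i set => ('i => 'a => complex) => bool" where
 "orthonormal_or_zero M I e \<longleftrightarrow> (\<forall>i\<in>I. e i \<in> Lsq M) \<and>
   (\<forall>i\<in>I. \<forall>j\<in>I. i ~= j --> Lsq_inner M (e i) (e j) = 0) \<and>
   (\<forall>i\<in>I. Lsq_inner M (e i) (e i) = 0 \<or> Lsq_inner M (e i) (e i) = 1)"

lemma Lsq_sum:
 assumes "finite F" "!!i. i \<in> F ==> e i \<in> Lsq M"
 shows "(\<lambda>x. \<Sum>i\<in>F. e i x) \<in> Lsq M"
 using assms by (induction F rule: finite_induct) (auto intro: Lsq_add)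

lemma Lsq_inner_sum_left:
 assumes "finite F" "!!i. i \<in> F ==> e i \<in> Lsq M" "f \<in> Lsq M"
 shows "Lsq_inner M (\<lambda>x. \<Sum>i\<in>F. e i x) f = (\<Sum>i\<in>F. Lsq_inner M (e i) f)"
 using assms by (induction F rule: finite_induct) (auto simp: Lsq_inner_add_left Lsq_sum)

lemma Lsq_inner_sum_right:
 assumes "finite F" "!!i. i \<in> F ==> e i \<in> Lsq M" "f \<in> Lsq M"
 shows "Lsq_inner M f (\<lambda>x. \<Sum>i\<in>F. e i x) = (\<Sum>i\<in>F. Lsq_inner M f (e i))"
 using assms by (induction F rule: finite_induct) (auto simp: Lsq_inner_add_right Lsq_sum)

lemma orthonormal_or_zero_inner_self:
 assumes "orthonormal_or_zero M I e" "i \<in> I" "f \<in> Lsq M"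
 shows "Lsq_inner M f (e i) * Lsq_inner M (e i) (e i) = Lsq_inner M f (e i)"
proof (cases "Lsq_inner M (e i) (e i) = 1")
 case False
 hence "Lsq_inner M (e i) (e i) = 0" using assms by (auto simp: orthonormal_or_zero_def)
 hence "Lsq_norm M (e i) = 0" by (simp add: Lsq_inner_self)
 hence "cmod (Lsq_inner M f (e i)) \<le> 0"
  using Lsq_Cauchy_Schwarz[of f M "e i"] assms by (auto simp: orthonormal_or_zero_def)
 thus ?thesis by simp
qed simp

lemma orthonormal_or_zero_sum_inner:
 assumes e: "orthonormal_or_zero M I e" and F: "finite F" "F \<subseteq> I" and j: "j \<in> F" and f: "f \<in> Lsq M"
 shows "Lsq_inner M (\<lambda>x. \<Sum>i\<in>F. Lsq_inner M f (e i) * e i x) (e j) = Lsq_inner M f (e j)"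
proof -
 have L: "e i \<in> Lsq M" if "i \<in> F" for i using e F that by (auto simp: orthonormal_or_zero_def)
 have "Lsq_inner M (\<lambda>x. \<Sum>i\<in>F. Lsq_inner M f (e i) * e i x) (e j)
   = (\<Sum>i\<in>F. Lsq_inner M f (e i) * Lsq_inner M (e i) (e j))"
  using F j L by (subst Lsq_inner_sum_left) (auto intro: Lsq_scale)
 also have "... = (\<Sum>i\<in>F. if i = j then Lsq_inner M f (e i) * Lsq_inner M (e i) (e i) else 0)"
 proof (intro sum.cong refl)
  fix i assume "i \<in> F"
  thus "Lsq_inner M f (e i) * Lsq_inner M (e i) (e j)
    = (if i = j then Lsq_inner M f (e i) * Lsq_inner M (e i) (e i) else 0)"
   using e subsetD[OF F(2)] j unfolding orthonormal_or_zero_def by (cases "i = j") auto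
 qed
 also have "... = Lsq_inner M f (e j)"
  using orthonormal_or_zero_inner_self[OF e _ f, of j] F j by (auto simp: sum.delta)
 finally show ?thesis .
qed

lemma Bessel_finite:
 assumes e: "orthonormal_or_zero M I e" and F: "finite F" "F \<subseteq> I" and f: "f \<in> Lsq M"
 shows "(Lsq_norm M (\<lambda>x. f x - (\<Sum>i\<in>F. Lsq_inner M f (e i) * e i x)))\<^sup>2
  = (Lsq_norm M f)\<^sup>2 - (\<Sum>i\<in>F. (cmod (Lsq_inner M f (e i)))\<^sup>2)"
proof -
 define s where "s x = (\<Sum>i\<in>F. Lsq_inner M f (e i) * e i x)" for x
 have L: "e i \<in> Lsq M" if "i \<in> F" for i using e F that by (auto simp: orthonormal_or_zero_def)
 have s: "s \<in> Lsq M" unfolding s_def[abs_def] using F L by (intro Lsq_sum Lsq_scale) auto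
 have "Lsq_inner M h s = (\<Sum>i\<in>F. cnj (Lsq_inner M f (e i)) * Lsq_inner M h (e i))" if "h \<in> Lsq M" for h
  unfolding s_def[abs_def] using F L that by (subst Lsq_inner_sum_right) (auto intro: Lsq_scale)
 hence "Lsq_inner M s s = (\<Sum>i\<in>F. cnj (Lsq_inner M f (e i)) * Lsq_inner M f (e i))"
  "Lsq_inner M f s = (\<Sum>i\<in>F. cnj (Lsq_inner M f (e i)) * Lsq_inner M f (e i))"
  using s f orthonormal_or_zero_sum_inner[OF e F _ f] by (auto simp: s_def[abs_def])
 moreover have "cnj z * z = cplx ((cmod z)\<^sup>2)" for z
  by (simp only: complex_norm_square mult.commute)
 ultimately have "Lsq_inner M s s = cplx (\<Sum>i\<in>F. (cmod (Lsq_inner M f (e i)))\<^sup>2)"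
  "Lsq_inner M f s = cplx (\<Sum>i\<in>F. (cmod (Lsq_inner M f (e i)))\<^sup>2)" by auto
 thus ?thesis
  using Lsq_norm_diff_power2[OF f s] by (simp add: s_def[abs_def] Lsq_norm_power2_Re)
qed

text \<open>Monotone convergence along the initial segments of an enumeration.\<close>

lemma nn_integral_count_space_le:
 fixes g :: "'i => ennreal"
 assumes I: "countable I" and le: "!!F. finite F ==> F \<subseteq> I ==> (\<Sum>i\<in>F. g i) \<le> C"
 shows "(\<integral>\<^sup>+i. g i \<partial>count_space I) \<le> C"
proof -
 define J where "J = to_nat_on I ` I"
 have bij: "bij_betw (from_nat_into I) J I"
  using I unfolding J_def by (intro bij_betw_byWitness[of _ "to_nat_on I"]) auto
 define h where "h n = g (from_nat_into I n) * indicator J n" for n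
 have "(\<integral>\<^sup>+i. g i \<partial>count_space I) = (\<integral>\<^sup>+n. g (from_nat_into I n) \<partial>count_space J)"
  by (rule nn_integral_bij_count_space[OF bij, symmetric])
 also have "... = (\<Sum>n. h n)"
  by (simp add: nn_integral_count_space_indicator nn_integral_count_space_nat h_def)
 also have "... = (SUP n. \<Sum>i<n. h i)" by (rule suminf_eq_SUP)
 also have "... \<le> C"
 proof (rule SUP_least)
  fix n
  have "(\<Sum>i<n. h i) = (\<Sum>i\<in>{..<n} \<inter> J. g (from_nat_into I i))"
   by (simp add: h_def indicator_def sum.inter_restrict)
  also have "... = (\<Sum>i\<in>from_nat_into I ` ({..<n} \<inter> J). g i)"
   using bij by (subst sum.reindex) (auto simp: bij_betw_def intro: inj_on_subset)
  also have "... \<le> C" using bij by (intro le) (auto simp: bij_betw_def)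
  finally show "(\<Sum>i<n. h i) \<le> C" .
 qed
 finally show ?thesis .
qed

theorem Bessel_inequality:
 assumes e: "orthonormal_or_zero M I e" and I: "countable I" and f: "f \<in> Lsq M"
 shows "frame_energy M I e f \<le> ennreal ((Lsq_norm M f)\<^sup>2)"
 unfolding frame_energy_def
proof (rule nn_integral_count_space_le[OF I])
 fix F assume F: "finite F" "F \<subseteq> I"
 have "0 \<le> (Lsq_norm M (\<lambda>x. f x - (\<Sum>i\<in>F. Lsq_inner M f (e i) * e i x)))\<^sup>2" by (rule zero_le_power2)
 hence "(\<Sum>i\<in>F. (cmod (Lsq_inner M f (e i)))\<^sup>2) \<le> (Lsq_norm M f)\<^sup>2"
  unfolding Bessel_finite[OF e F f] by simp
 thus "(\<Sum>i\<in>F. esq (Lsq_inner M f (e i))) \<le> ennreal ((Lsq_norm M f)\<^sup>2)"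
  by (simp add: ennreal_leI)
qed

lemma frame_energy_orthonormal_member:
 assumes e: "orthonormal_or_zero M I e" and j: "j \<in> I"
 shows "frame_energy M I e (e j) = ennreal ((Lsq_norm M (e j))\<^sup>2)"
proof -
 have "frame_energy M I e (e j) = (\<integral>\<^sup>+i. esq (Lsq_inner M (e j) (e j)) * indicator {j} i \<partial>count_space I)"
  unfolding frame_energy_def
  using e j by (intro nn_integral_cong) (auto simp: orthonormal_or_zero_def indicator_def)
 also have "... = esq (Lsq_inner M (e j) (e j))"
  using j by (subst nn_integral_cmult_indicator) auto
 also have "(cmod (Lsq_inner M (e j) (e j)))\<^sup>2 = (Lsq_norm M (e j))\<^sup>2"
  using e j unfolding orthonormal_or_zero_def Lsq_norm_power2_Re by force
 finally show ?thesis .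
qed

text \<open>The vectors satisfying Parseval's identity form a closed subspace that contains the system; the
 orthogonal complement of this subspace is trivial by totality.\<close>

theorem Parseval_total:
 assumes e: "orthonormal_or_zero M I e" and I: "countable I"
  and total: "!!f. f \<in> Lsq M ==> (!!i. i \<in> I ==> Lsq_inner M f (e i) = 0) ==> AE x in M. f x = 0"
  and f: "f \<in> Lsq M"
 shows "frame_energy M I e f = ennreal ((Lsq_norm M f)\<^sup>2)"
proof -
 let ?H = "{f \<in> Lsq M. frame_energy M I e f = ennreal ((Lsq_norm M f)\<^sup>2)}"
 have eL: "e i \<in> Lsq M" if "i \<in> I" for i using e that by (auto simp: orthonormal_or_zero_def)
 have H: "closed_subspace M ?H"
  by (rule energy_equality_closed_subspace[OF eL Bessel_inequality[OF e I]])
 have "Lsq M \<subseteq> ?H"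
 proof (rule closed_subspace_eqI[OF _ H])
  show "closed_subspace M (Lsq M)"
   by (auto simp: closed_subspace_def Lsq_closure_def intro: Lsq_add Lsq_scale)
  fix g assume "g \<in> Lsq M" "!!h. h \<in> ?H ==> Lsq_inner M g h = 0"
  thus "AE x in M. g x = 0"
   using frame_energy_orthonormal_member[OF e] eL by (intro total) auto
 qed auto
 thus ?thesis using f by blast
qed

section \<open>The period cell and the unfolding of integrals\<close>

lemma lattice_vec_simps [simp]:
 "lattice_vec 0 = 0" "lattice_vec (k + l) = lattice_vec k + lattice_vec l"
 "lattice_vec (- k) = - lattice_vec k" "lattice_vec (k - l) = lattice_vec k - lattice_vec l"
 "lattice_vec k $ i = real_of_int (k $ i)"
 by (simp_all add: lattice_vec_def vec_eq_iff)

lemma lattice_vec_inj: "lattice_vec k = lattice_vec l \<longleftrightarrow> k = l"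
 by (simp add: vec_eq_iff)

definition cell :: "(real^'n) set" where
 "cell = {y. \<forall>i. - pi < y $ i \<and> y $ i \<le> pi}"

abbreviation cellM :: "(real^'n) measure" where
 "cellM \<equiv> restrict_space lborel cell"

abbreviation shift2pi :: "int^'n => real^'n => real^'n" where
 "shift2pi k y \<equiv> y + (2 * pi) *\<^sub>R lattice_vec k"

lemma cell_borel [measurable]: "(cell :: (real^'n) set) \<in> sets borel"
proof -
 have "(cell :: (real^'n) set) = (\<Inter>i::'n. {y. - pi < y $ i \<and> y $ i \<le> pi})" by (auto simp: cell_def)
 also have "... \<in> sets borel" by (intro sets.finite_INT) auto
 finally show ?thesis .
qed

text \<open>The translate is found coordinate by coordinate with the ceiling function, matching the half-open sides.\<close>

lemma cell_translate_unique: "\<exists>!k::int^'n. y - (2 * pi) *\<^sub>R lattice_vec k \<in> cell"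
proof (rule ex1I)
 let ?k = "(\<chi> i. \<lceil>(y $ i - pi) / (2 * pi)\<rceil>) :: int^'n"
 show "y - (2 * pi) *\<^sub>R lattice_vec ?k \<in> cell"
 proof (unfold cell_def, clarify, intro conjI)
  fix i
  define t where "t = (y $ i - pi) / (2 * pi)"
  have t: "y $ i = 2 * pi * t + pi" by (simp add: t_def)
  have "of_int \<lceil>t\<rceil> < t + 1" "t \<le> of_int \<lceil>t\<rceil>" by linarith+
  hence "2 * pi * of_int \<lceil>t\<rceil> < 2 * pi * (t + 1)" "2 * pi * t \<le> 2 * pi * of_int \<lceil>t\<rceil>"
   by (auto intro!: mult_strict_left_mono mult_left_mono)
  thus "- pi < (y - (2 * pi) *\<^sub>R lattice_vec ?k) $ i" "(y - (2 * pi) *\<^sub>R lattice_vec ?k) $ i \<le> pi"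
   by (simp_all add: t_def[symmetric] t algebra_simps)
 qed
 fix k :: "int^'n" assume k: "y - (2 * pi) *\<^sub>R lattice_vec k \<in> cell"
 show "k = ?k"
 proof (simp only: vec_eq_iff vec_lambda_beta, intro allI)
  fix i
  define t where "t = (y $ i - pi) / (2 * pi)"
  have t: "y $ i = 2 * pi * t + pi" by (simp add: t_def)
  have "- pi < y $ i - 2 * pi * of_int (k $ i)" "y $ i - 2 * pi * of_int (k $ i) \<le> pi"
   using k by (auto simp: cell_def)
  hence k: "2 * pi * of_int (k $ i) < 2 * pi * (t + 1)" "2 * pi * t \<le> 2 * pi * of_int (k $ i)"
   by (simp_all add: t algebra_simps)
  have pos: "0 < 2 * pi" by simp
  from k have "of_int (k $ i) < t + 1" "t \<le> of_int (k $ i)"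
   by (simp_all only: mult_less_cancel_left_pos[OF pos] mult_le_cancel_left_pos[OF pos])
  hence "\<lceil>t\<rceil> = k $ i" by (intro ceiling_unique) auto
  thus "k $ i = \<lceil>(y $ i - pi) / (2 * pi)\<rceil>" by (simp add: t_def)
 qed
qed

lemma nn_integral_count_space_indicator_cell:
 "(\<integral>\<^sup>+k. indicator cell (y - (2 * pi) *\<^sub>R lattice_vec (k::int^'n)) \<partial>counting) = (1::ennreal)"
proof -
 obtain k0 :: "int^'n" where k0: "y - (2 * pi) *\<^sub>R lattice_vec k0 \<in> cell"
  "!!k. y - (2 * pi) *\<^sub>R lattice_vec k \<in> cell ==> k = k0"
  using cell_translate_unique[of y] by (metis (no_types, lifting))
 have "y - (2 * pi) *\<^sub>R lattice_vec k \<in> cell \<longleftrightarrow> k = k0" for k using k0 by blast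
 hence "(\<integral>\<^sup>+k. indicator cell (y - (2 * pi) *\<^sub>R lattice_vec (k::int^'n)) \<partial>counting)
   = (\<integral>\<^sup>+k. indicator {k0} k \<partial>counting)"
  by (intro nn_integral_cong) (simp add: indicator_def)
 thus ?thesis by simp
qed

lemma nn_integral_lborel_translate:
 fixes f :: "'a::euclidean_space => ennreal"
 assumes [measurable]: "f \<in> borelfun"
 shows "(\<integral>\<^sup>+x. f (x + t) \<partial>lborel) = (\<integral>\<^sup>+x. f x \<partial>lborel)"
proof -
 have "(\<integral>\<^sup>+x. f x \<partial>lborel) = (\<integral>\<^sup>+x. f x \<partial>distr lborel borel ((+) t))"
  by (simp add: lborel_distr_plus)
 also have "... = (\<integral>\<^sup>+x. f (t + x) \<partial>lborel)" by (subst nn_integral_distr) auto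
 finally show ?thesis by (simp add: add.commute)
qed

lemma integral_lborel_translate:
 fixes f :: "'a::euclidean_space => 'b::{banach, second_countable_topology}"
 assumes [measurable]: "f \<in> borelfun"
 shows "(\<integral>x. f (x + t) \<partial>lborel) = (\<integral>x. f x \<partial>lborel)"
  and "integrable lborel (\<lambda>x. f (x + t)) \<longleftrightarrow> integrable lborel f"
proof -
 have eq: "distr lborel borel (\<lambda>x. x + t) = lborel"
  using lborel_distr_plus[of t] by (simp only: add.commute[of _ t])
 have "(\<integral>x. f x \<partial>distr lborel borel (\<lambda>x. x + t)) = (\<integral>x. f (x + t) \<partial>lborel)"
  by (subst integral_distr) auto
 thus "(\<integral>x. f (x + t) \<partial>lborel) = (\<integral>x. f x \<partial>lborel)" by (simp add: eq)
 have "integrable (distr lborel borel (\<lambda>x. x + t)) f \<longleftrightarrow> integrable lborel (\<lambda>x. f (x + t))"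
  by (subst integrable_distr_eq) auto
 thus "integrable lborel (\<lambda>x. f (x + t)) \<longleftrightarrow> integrable lborel f" by (simp add: eq)
qed

lemma AE_lborel_translate:
 assumes "AE x in lborel. P (x::'a::euclidean_space)"
 shows "AE x in lborel. P (x + t)"
proof -
 have eq: "distr lborel borel (\<lambda>x. x + t) = lborel"
  using lborel_distr_plus[of t] by (simp only: add.commute[of _ t])
 from assms obtain N where N: "N \<in> sets lborel" "emeasure lborel N = 0" "{x. \<not> P x} \<subseteq> N"
  unfolding eventually_ae_filter null_sets_def by auto
 have "AE x in distr lborel borel (\<lambda>x. x + t). x \<notin> N"
  unfolding eq using N by (auto intro!: AE_not_in simp: null_sets_def)
 hence "AE x in lborel. x + t \<notin> N"
  using N by (subst (asm) AE_distr_iff) auto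
 thus ?thesis by eventually_elim (use N in auto)
qed

lemma emeasure_cell: "emeasure lborel (cell :: (real^'n) set) = ennreal ((2 * pi) ^ CARD('n))"
proof -
 define a :: "real^'n" where "a = (\<chi> i. - pi)"
 define b :: "real^'n" where "b = (\<chi> i. pi)"
 have ab: "!!i. i \<in> Basis ==> a \<bullet> i \<le> b \<bullet> i"
  using pi_gt_zero by (auto simp: a_def b_def Basis_vec_def inner_axis)
 have p: "(\<Prod>i\<in>Basis. (b - a) \<bullet> i) = (2 * pi) ^ CARD('n)"
 proof -
  have "(\<Prod>i\<in>Basis. (b - a) \<bullet> i) = (\<Prod>i\<in>(Basis :: (real^'n) set). 2 * pi)"
   by (intro prod.cong) (auto simp: a_def b_def Basis_vec_def inner_axis)
  thus ?thesis by simp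
 qed
 have 1: "emeasure lborel (box a b) = ennreal ((2 * pi) ^ CARD('n))"
  using emeasure_lborel_box[OF ab] p by simp
 have 2: "emeasure lborel (cbox a b) = ennreal ((2 * pi) ^ CARD('n))"
  using emeasure_lborel_cbox[OF ab] p by simp
 have s: "box a b \<subseteq> cell" "cell \<subseteq> cbox a b"
  by (auto simp: cell_def mem_box_cart a_def b_def less_imp_le)
 show ?thesis
  by (rule antisym) (use 1 2 emeasure_mono[OF s(1), of lborel] emeasure_mono[OF s(2), of lborel] in auto)
qed

lemma finite_measure_cell: "finite_measure (cellM :: (real^'n) measure)"
 by (intro finite_measureI) (simp add: emeasure_restrict_space emeasure_cell)

lemma measurable_cell_measure:
 "f \<in> borelfun ==> f \<in> borel_measurable cellM"
 by (rule measurable_restrict_space1) simp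

lemma AE_cell_measure_iff: "(AE y in cellM. P y) \<longleftrightarrow> (AE y in lborel. y \<in> cell --> P y)"
 by (subst AE_restrict_space_iff) auto

lemma integral_cell_measure:
 fixes f :: "real^'n => 'b::{banach, second_countable_topology}"
 shows "(\<integral>y. f y \<partial>cellM) = (\<integral>y. indicator cell y *\<^sub>R f y \<partial>lborel)"
 by (subst integral_restrict_space) auto

lemma nn_integral_cell_measure:
 "(\<integral>\<^sup>+y. f y \<partial>cellM) = (\<integral>\<^sup>+y. f y * indicator cell y \<partial>lborel)"
 by (subst nn_integral_restrict_space) auto

text \<open>The translates of the cell partition the space, so an integral over the space is the integral over the cell
 of a lattice sum; this is the source of all periodization arguments below.\<close>

theorem nn_integral_unfold:
 fixes f :: "real^'n => ennreal"
 assumes [measurable]: "f \<in> borelfun"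
 shows "(\<integral>\<^sup>+x. f x \<partial>lborel) = (\<integral>\<^sup>+k. (\<integral>\<^sup>+y. f (shift2pi k y) \<partial>cellM) \<partial>counting)"
proof -
 interpret pair_sigma_finite "counting :: (int^'n) measure" "lborel :: (real^'n) measure"
  by (intro pair_sigma_finite.intro sigma_finite_measure_count_space lborel.sigma_finite_measure_axioms)
 have m [measurable]: "(\<lambda>p. f (snd p) * indicator cell (snd p - (2 * pi) *\<^sub>R lattice_vec (fst p)))
   \<in> borel_measurable (count_space (UNIV :: (int^'n) set) \<Otimes>\<^sub>M lborel)"
  by (intro measurable_pair_measure_countable1) auto
 have "(\<integral>\<^sup>+x. f x \<partial>lborel) =
   (\<integral>\<^sup>+x. (\<integral>\<^sup>+k. f x * indicator cell (x - (2 * pi) *\<^sub>R lattice_vec (k::int^'n)) \<partial>counting) \<partial>lborel)"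
  by (subst nn_integral_cmult) (auto simp: nn_integral_count_space_indicator_cell)
 also have "... = (\<integral>\<^sup>+k. (\<integral>\<^sup>+x. f x * indicator cell (x - (2 * pi) *\<^sub>R lattice_vec (k::int^'n)) \<partial>lborel) \<partial>counting)"
  using Fubini[OF m] by simp
 also have "... = (\<integral>\<^sup>+k. (\<integral>\<^sup>+y. f (shift2pi k y) \<partial>cellM) \<partial>counting)"
 proof (rule nn_integral_cong)
  fix k :: "int^'n"
  show "(\<integral>\<^sup>+x. f x * indicator cell (x - (2 * pi) *\<^sub>R lattice_vec k) \<partial>lborel) = (\<integral>\<^sup>+y. f (shift2pi k y) \<partial>cellM)"
   by (subst nn_integral_lborel_translate[symmetric, of _ "(2 * pi) *\<^sub>R lattice_vec k"])
     (auto simp: nn_integral_cell_measure)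
 qed
 finally show ?thesis .
qed

lemma pair_sigma_finite_lattice_cell:
 "pair_sigma_finite (count_space (UNIV :: (int^'n) set)) (cellM :: (real^'n) measure)"
 by (intro pair_sigma_finite.intro sigma_finite_measure_count_space
   finite_measure.axioms(1) finite_measure_cell)

lemma measurable_shift2pi [measurable]:
 "(\<lambda>(k, y). shift2pi k y) \<in> count_space (UNIV :: (int^'n) set) \<Otimes>\<^sub>M cellM \<rightarrow>\<^sub>M (borel :: (real^'n) measure)"
 by (intro measurable_pair_measure_countable1) (auto intro!: measurable_cell_measure)

theorem distr_shift2pi:
 "distr (count_space (UNIV :: (int^'n) set) \<Otimes>\<^sub>M cellM) borel (\<lambda>(k, y). shift2pi k y) = (lborel :: (real^'n) measure)"
proof (rule measure_eqI)
 interpret pair_sigma_finite "count_space (UNIV :: (int^'n) set)" "cellM :: (real^'n) measure"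
  by (rule pair_sigma_finite_lattice_cell)
 fix A :: "(real^'n) set" assume "A \<in> sets (distr (count_space (UNIV :: (int^'n) set) \<Otimes>\<^sub>M cellM) borel (\<lambda>(k, y). shift2pi k y))"
 hence A [measurable]: "A \<in> sets borel" by simp
 have "emeasure (distr (count_space (UNIV :: (int^'n) set) \<Otimes>\<^sub>M cellM) borel (\<lambda>(k, y). shift2pi k y)) A
   = (\<integral>\<^sup>+x. indicator A x \<partial>distr (count_space (UNIV :: (int^'n) set) \<Otimes>\<^sub>M cellM) borel (\<lambda>(k, y). shift2pi k y))"
  by (subst nn_integral_indicator) auto
 also have "... = (\<integral>\<^sup>+p. indicator A (case p of (k, y) => shift2pi k y) \<partial>(count_space (UNIV :: (int^'n) set) \<Otimes>\<^sub>M cellM))"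
  by (subst nn_integral_distr) auto
 also have "... = (\<integral>\<^sup>+k. (\<integral>\<^sup>+y. indicator A (shift2pi k y) \<partial>cellM) \<partial>counting)"
  by (subst M2.nn_integral_fst[symmetric]) auto
 also have "... = emeasure lborel A"
  by (subst nn_integral_unfold[symmetric]) auto
 finally show "emeasure (distr (count_space (UNIV :: (int^'n) set) \<Otimes>\<^sub>M cellM) borel (\<lambda>(k, y). shift2pi k y)) A
   = emeasure lborel A" .
qed simp

lemma nn_integral_unfold_cell:
 fixes f :: "real^'n => ennreal"
 assumes [measurable]: "f \<in> borelfun"
 shows "(\<integral>\<^sup>+x. f x \<partial>lborel) = (\<integral>\<^sup>+y. (\<integral>\<^sup>+k. f (shift2pi k y) \<partial>counting) \<partial>cellM)"
proof -
 interpret pair_sigma_finite "count_space (UNIV :: (int^'n) set)" "cellM :: (real^'n) measure"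
  by (rule pair_sigma_finite_lattice_cell)
 have "(\<lambda>p. f (case p of (k, y) => shift2pi k y)) \<in> borel_measurable (count_space (UNIV :: (int^'n) set) \<Otimes>\<^sub>M cellM)"
  by measurable
 from Fubini[OF this] show ?thesis by (simp add: nn_integral_unfold)
qed

theorem integral_unfold:
 fixes f :: "real^'n => 'b::{banach, second_countable_topology}"
 assumes f: "integrable lborel f"
 shows "AE y in cellM. integrable (counting) (\<lambda>k. f (shift2pi k y))"
  and "integrable cellM (\<lambda>y. \<integral>k. f (shift2pi k y) \<partial>counting)"
  and "(\<integral>x. f x \<partial>lborel) = (\<integral>y. (\<integral>k. f (shift2pi k y) \<partial>counting) \<partial>cellM)"
proof -
 interpret pair_sigma_finite "count_space (UNIV :: (int^'n) set)" "cellM :: (real^'n) measure"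
  by (rule pair_sigma_finite_lattice_cell)
 let ?D = "distr (count_space (UNIV :: (int^'n) set) \<Otimes>\<^sub>M cellM) borel (\<lambda>(k, y). shift2pi k y)"
 have [measurable]: "f \<in> borelfun" using f by auto
 have "integrable ?D f" by (simp add: distr_shift2pi f)
 hence i: "integrable (count_space (UNIV :: (int^'n) set) \<Otimes>\<^sub>M cellM) (\<lambda>(k, y). f (shift2pi k y))"
  by (subst (asm) integrable_distr_eq) (auto simp: case_prod_unfold)
 from AE_integrable_snd[OF i] show "AE y in cellM. integrable (counting) (\<lambda>k. f (shift2pi k y))" .
 from integrable_snd[OF i] show "integrable cellM (\<lambda>y. \<integral>k. f (shift2pi k y) \<partial>counting)" .
 have "(\<integral>x. f x \<partial>lborel) = (\<integral>x. f x \<partial>?D)" by (simp add: distr_shift2pi)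
 also have "... = (\<integral>p. f (case p of (k, y) => shift2pi k y) \<partial>(count_space (UNIV :: (int^'n) set) \<Otimes>\<^sub>M cellM))"
  by (subst integral_distr) auto
 also have "... = (\<integral>p. (case p of (k, y) => f (shift2pi k y)) \<partial>(count_space (UNIV :: (int^'n) set) \<Otimes>\<^sub>M cellM))"
  by (simp add: case_prod_unfold)
 also have "... = (\<integral>y. (\<integral>k. f (shift2pi k y) \<partial>counting) \<partial>cellM)"
  by (rule integral_snd[OF i, symmetric])
 finally show "(\<integral>x. f x \<partial>lborel) = (\<integral>y. (\<integral>k. f (shift2pi k y) \<partial>counting) \<partial>cellM)" .
qed

definition periodic2pi :: "(real^'n => 'b) => bool" where
 "periodic2pi p \<longleftrightarrow> (\<forall>y k. p (shift2pi k y) = p y)"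

lemma periodic2piD: "periodic2pi p ==> p (shift2pi k y) = p y"
 by (simp add: periodic2pi_def)

text \<open>Unfolding \<open>y \<mapsto> 1\<^sub>c\<^sub>e\<^sub>l\<^sub>l (y - t) p y\<close> shows that any translate of the cell gives the same integral.\<close>

lemma nn_integral_cell_translate:
 fixes p :: "real^'n => ennreal"
 assumes [measurable]: "p \<in> borelfun" and per: "periodic2pi p"
 shows "(\<integral>\<^sup>+y. p (y + t) \<partial>cellM) = (\<integral>\<^sup>+y. p y \<partial>cellM)"
proof -
 have "(\<integral>\<^sup>+y. p (y + t) \<partial>cellM) = (\<integral>\<^sup>+y. p y * indicator cell (y - t) \<partial>lborel)"
  by (subst nn_integral_lborel_translate[symmetric, of _ t]) (auto simp: nn_integral_cell_measure)
 also have "... = (\<integral>\<^sup>+y. (\<integral>\<^sup>+k. p (shift2pi k y) * indicator cell (shift2pi k y - t) \<partial>counting) \<partial>cellM)"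
  by (rule nn_integral_unfold_cell) auto
 also have "... = (\<integral>\<^sup>+y. p y * (\<integral>\<^sup>+k. indicator cell (shift2pi k y - t) \<partial>counting) \<partial>cellM)"
  by (simp add: periodic2piD[OF per] nn_integral_cmult)
 also have "(\<lambda>y. \<integral>\<^sup>+k. indicator cell (shift2pi k y - t) \<partial>counting) = (\<lambda>y::real^'n. 1::ennreal)"
 proof
  fix y :: "real^'n"
  have "bij_betw uminus (UNIV :: (int^'n) set) UNIV" by (intro bij_uminus)
  from nn_integral_bij_count_space[OF this, of "\<lambda>k. indicator cell (y - t - (2 * pi) *\<^sub>R lattice_vec k)"]
   nn_integral_count_space_indicator_cell[of "y - t"]
  show "(\<integral>\<^sup>+k. indicator cell (shift2pi k y - t) \<partial>counting) = (1::ennreal)"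
   by (simp add: algebra_simps)
 qed
 finally show ?thesis by simp
qed

lemma integral_cell_translate:
 fixes p :: "real^'n => 'b::{banach, second_countable_topology}"
 assumes p: "integrable cellM p" "p \<in> borelfun" and per: "periodic2pi p"
 shows "(\<integral>y. p (y + t) \<partial>cellM) = (\<integral>y. p y \<partial>cellM)"
proof -
 have [measurable]: "p \<in> borelfun" by (rule p)
 have i: "integrable lborel (\<lambda>y. indicator cell (y - t) *\<^sub>R p y)"
 proof (rule integrableI_bounded)
  have "(\<integral>\<^sup>+y. ennreal (norm (indicator cell (y - t) *\<^sub>R p y)) \<partial>lborel) = (\<integral>\<^sup>+y. ennreal (norm (p (y + t))) \<partial>cellM)"
   by (subst nn_integral_lborel_translate[symmetric, of _ t])
     (auto simp: nn_integral_cell_measure indicator_def intro!: nn_integral_cong)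
  also have "... = (\<integral>\<^sup>+y. ennreal (norm (p y)) \<partial>cellM)"
   using per by (intro nn_integral_cell_translate) (auto simp: periodic2pi_def)
  also have "... < \<infinity>" using p(1) by (simp add: integrable_iff_bounded)
  finally show "(\<integral>\<^sup>+y. ennreal (norm (indicator cell (y - t) *\<^sub>R p y)) \<partial>lborel) < \<infinity>" .
 qed auto
 have "(\<integral>y. p (y + t) \<partial>cellM) = (\<integral>y. indicator cell (y - t) *\<^sub>R p y \<partial>lborel)"
  by (subst integral_lborel_translate(1)[symmetric, of _ t]) (auto simp: integral_cell_measure)
 also have "... = (\<integral>y. (\<integral>k. indicator cell (shift2pi k y - t) *\<^sub>R p (shift2pi k y) \<partial>counting) \<partial>cellM)"
  by (rule integral_unfold(3)[OF i])
 also have "... = (\<integral>y. p y \<partial>cellM)"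
 proof (rule Bochner_Integration.integral_cong[OF refl])
  fix y :: "real^'n"
  obtain k0 :: "int^'n" where k0: "y - t - (2 * pi) *\<^sub>R lattice_vec k0 \<in> cell"
   "!!k. y - t - (2 * pi) *\<^sub>R lattice_vec k \<in> cell ==> k = k0"
   using cell_translate_unique[of "y - t"] by (metis (no_types, lifting))
  have "shift2pi k y - t \<in> cell \<longleftrightarrow> k = - k0" for k
   using k0(1) k0(2)[of "- k"] by (auto simp: algebra_simps)
  hence "(\<integral>k. indicator cell (shift2pi k y - t) *\<^sub>R p (shift2pi k y) \<partial>counting)
    = (\<integral>k. indicator {- k0} k *\<^sub>R p y \<partial>counting)"
   by (intro Bochner_Integration.integral_cong) (auto simp: periodic2piD[OF per] indicator_def)
  also have "... = p y" by (subst integral_scaleR_left) (auto simp: integrable_count_space)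
  finally show "(\<integral>k. indicator cell (shift2pi k y - t) *\<^sub>R p (shift2pi k y) \<partial>counting) = p y" .
 qed
 finally show ?thesis .
qed

section \<open>Fourier series on the torus\<close>

definition torus_char :: "int^'n => real^'n => complex" where
 "torus_char k y = cis (lattice_vec k \<bullet> y)"

lemma torus_char_norm [simp]: "cmod (torus_char k y) = 1"
 by (simp add: torus_char_def)

lemma torus_char_0 [simp]: "torus_char 0 y = 1"
 by (simp add: torus_char_def)

lemma torus_char_mult: "torus_char k y * torus_char l y = torus_char (k + l) y"
 by (simp add: torus_char_def cis_mult inner_add_left)

lemma torus_char_cnj: "cnj (torus_char k y) = torus_char (- k) y"
 by (simp add: torus_char_def cis_cnj)

lemma torus_char_add_arg: "torus_char k (y + \<eta>) = torus_char k y * torus_char k \<eta>"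
 by (simp add: torus_char_def cis_mult inner_add_right)

lemma torus_char_measurable [measurable]: "torus_char k \<in> borelfun"
 unfolding torus_char_def[abs_def]
 by (intro borel_measurable_continuous_onI continuous_intros)

lemma lattice_vec_inner_Ints: "lattice_vec k \<bullet> lattice_vec l \<in> \<int>"
 by (auto simp: inner_vec_def intro!: Ints_sum Ints_mult)

lemma torus_char_lattice: "torus_char k ((2 * pi) *\<^sub>R lattice_vec l) = 1"
proof -
 obtain m where "lattice_vec k \<bullet> lattice_vec l = of_int m"
  using lattice_vec_inner_Ints[of k l] by (auto elim: Ints_cases)
 thus ?thesis using cis_multiple_2pi[of "of_int m"] by (simp add: torus_char_def mult.commute)
qed

lemma torus_char_periodic: "periodic2pi (torus_char k)"
 by (simp add: periodic2pi_def torus_char_add_arg torus_char_lattice)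

lemma integrable_cell_bounded:
 assumes "f \<in> borelfun" "!!y. cmod (f y) \<le> C"
 shows "integrable cellM f"
 by (rule finite_measure.integrable_const_bound[OF finite_measure_cell, of _ C])
   (auto intro: measurable_cell_measure assms)

lemma integral_torus_char:
 fixes k :: "int^'n"
 shows "(\<integral>y. torus_char k y \<partial>cellM) = (if k = 0 then cplx ((2 * pi) ^ CARD('n)) else 0)"
proof (cases "k = 0")
 case True
 have "measure cellM (cell :: (real^'n) set) = (2 * pi) ^ CARD('n)"
  by (simp add: measure_def emeasure_restrict_space emeasure_cell)
 thus ?thesis using True by (simp add: space_restrict_space scaleR_conv_of_real)
next
 case False
 then obtain i where i: "k $ i ~= 0" by (auto simp: vec_eq_iff)
 \<comment> \<open>Translation by a point at which the character is \<open>-1\<close>.\<close>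
 define t :: "real^'n" where "t = axis i (pi / of_int (k $ i))"
 have "lattice_vec k \<bullet> t = pi" using i by (simp add: t_def inner_axis)
 hence t: "torus_char k t = -1" by (simp add: torus_char_def)
 have "(\<integral>y. torus_char k (y + t) \<partial>cellM) = (\<integral>y. torus_char k y \<partial>cellM)"
  by (intro integral_cell_translate integrable_cell_bounded[of _ 1] torus_char_periodic) auto
 hence "- (\<integral>y. torus_char k y \<partial>cellM) = (\<integral>y. torus_char k y \<partial>cellM)"
  by (simp add: torus_char_add_arg t)
 thus ?thesis using False by (simp add: neg_equal_iff_equal eq_neg_iff_add_eq_0 flip: mult_2)
qed

inductive trig_poly :: "(real^'n => complex) => bool" where
 trig_char: "trig_poly (torus_char k)"
| trig_add: "trig_poly f ==> trig_poly g ==> trig_poly (\<lambda>y. f y + g y)"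
| trig_scale: "trig_poly f ==> trig_poly (\<lambda>y. c * f y)"

lemma trig_poly_const: "trig_poly (\<lambda>y. c)"
 using trig_scale[OF trig_char[of 0], of c] by simp

lemma trig_poly_mult:
 assumes "trig_poly f" "trig_poly g"
 shows "trig_poly (\<lambda>y. f y * g y)"
proof -
 have *: "trig_poly (\<lambda>y. torus_char k y * g y)" for k using assms(2)
 proof (induction rule: trig_poly.induct)
  case (trig_char l)
  thus ?case using trig_poly.trig_char[of "k + l"] by (simp add: torus_char_mult[abs_def])
 next
  case (trig_add f g)
  thus ?case using trig_poly.trig_add by (force simp: distrib_left)
 next
  case (trig_scale f c)
  thus ?case using trig_poly.trig_scale[of "\<lambda>y. torus_char k y * f y" c] by (simp add: mult.left_commute)
 qed
 show ?thesis using assms(1)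
 proof (induction rule: trig_poly.induct)
  case (trig_char k)
  thus ?case by (rule *)
 next
  case (trig_add f h)
  thus ?case using trig_poly.trig_add[OF trig_add.IH] by (simp add: distrib_right)
 next
  case (trig_scale f c)
  thus ?case using trig_poly.trig_scale[of "\<lambda>y. f y * g y" c] by (simp add: mult.assoc)
 qed
qed

text \<open>The exponential coordinates embed the cell into a compact set on which the Stone-Weierstrass theorem applies.\<close>

definition torus_point :: "real^'n => complex^'n" where
 "torus_point y = (\<chi> i. cis (y $ i))"

definition torus :: "(complex^'n) set" where
 "torus = {z. \<forall>i. cmod (z $ i) = 1}"

lemma torus_point_in [simp]: "torus_point y \<in> torus"
 by (simp add: torus_point_def torus_def)

lemma compact_torus: "compact (torus :: (complex^'n) set)"
proof (rule compact_eq_bounded_closed[THEN iffD2], intro conjI)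
 have "norm z \<le> real CARD('n)" if "z \<in> torus" for z :: "complex^'n"
 proof -
  have "norm z \<le> (\<Sum>i\<in>UNIV. cmod (z $ i))" unfolding norm_vec_def by (rule L2_set_le_sum) simp
  thus ?thesis using that by (simp add: torus_def)
 qed
 thus "bounded (torus :: (complex^'n) set)" by (auto simp: bounded_iff)
 have t: "torus = (\<Inter>i. {z::complex^'n. cmod (z $ i) = 1})" by (auto simp: torus_def)
 show "closed (torus :: (complex^'n) set)"
  unfolding t by (intro closed_INT ballI closed_Collect_eq continuous_intros)
qed

lemma torus_point_measurable [measurable]: "torus_point \<in> borelfun"
 unfolding torus_point_def[abs_def]
 by (intro borel_measurable_continuous_onI continuous_intros)

lemma trig_poly_coordinate:
 fixes i :: "'n::finite"
 shows "trig_poly (\<lambda>y. cplx (Re (torus_point y $ i)))"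
  and "trig_poly (\<lambda>y. cplx (Im (torus_point y $ i)))"
proof -
 have k: "torus_char (axis i 1) y = cis (y $ i)" for y :: "real^'n"
 proof -
  have "lattice_vec (axis i 1) = (axis i 1 :: real^'n)" by (simp add: vec_eq_iff axis_def)
  thus ?thesis by (simp add: torus_char_def inner_axis inner_commute[of "axis i 1"])
 qed
 have k': "torus_char (- axis i 1) y = cnj (cis (y $ i))" for y :: "real^'n"
  by (simp only: torus_char_cnj[symmetric] k)
 have "trig_poly (\<lambda>y. (1/2) * torus_char (axis i 1) y + (1/2) * torus_char (- axis i 1) y)"
  by (intro trig_poly.intros)
 moreover have "(1/2) * torus_char (axis i 1) y + (1/2) * torus_char (- axis i 1) y
   = cplx (Re (torus_point y $ i))" for y
  by (simp only: k k' torus_point_def vec_lambda_beta) (simp add: complex_eq_iff)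
 ultimately show "trig_poly (\<lambda>y. cplx (Re (torus_point y $ i)))" by simp
 have "trig_poly (\<lambda>y. (- \<i>/2) * torus_char (axis i 1) y + (\<i>/2) * torus_char (- axis i 1) y)"
  by (intro trig_poly.intros)
 moreover have "(- \<i>/2) * torus_char (axis i 1) y + (\<i>/2) * torus_char (- axis i 1) y
   = cplx (Im (torus_point y $ i))" for y
  by (simp only: k k' torus_point_def vec_lambda_beta) (simp add: complex_eq_iff)
 ultimately show "trig_poly (\<lambda>y. cplx (Im (torus_point y $ i)))" by simp
qed

text \<open>The real and imaginary parts of the coordinates are trigonometric polynomials and separate points of the torus.\<close>

lemma trig_poly_dense:
 fixes h :: "complex^'n => real"
 assumes "continuous_on torus h" "e > 0"
 shows "\<exists>g. continuous_on torus g \<and> trig_poly (\<lambda>y::real^'n. cplx (g (torus_point y)))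
  \<and> (\<forall>z\<in>torus. \<bar>h z - g z\<bar> < e)"
proof -
 define P where "P g \<longleftrightarrow> continuous_on torus g \<and>
  trig_poly (\<lambda>y::real^'n. cplx (g (torus_point y)))" for g :: "complex^'n => real"
 have "\<exists>g. P g \<and> (\<forall>z\<in>torus. \<bar>h z - g z\<bar> < e)"
 proof (rule Stone_Weierstrass_HOL[OF compact_torus _ _ _ _ _ assms])
  show "P (\<lambda>x. c)" for c by (simp add: P_def trig_poly_const)
  show "continuous_on torus f" if "P f" for f using that by (simp add: P_def)
  show "P (\<lambda>x. f x + g x)" if "P f \<and> P g" for f g
   using that by (auto simp: P_def intro!: continuous_intros dest: trig_add)
  show "P (\<lambda>x. f x * g x)" if "P f \<and> P g" for f g
   using that by (auto simp: P_def intro!: continuous_intros dest: trig_poly_mult)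
  show "\<exists>f. P f \<and> f x ~= f u" if "x \<in> torus \<and> u \<in> torus \<and> x ~= u" for x u :: "complex^'n"
  proof -
   from that obtain i where "x $ i ~= u $ i" by (auto simp: vec_eq_iff)
   hence "Re (x $ i) ~= Re (u $ i) \<or> Im (x $ i) ~= Im (u $ i)" by (auto simp: complex_eq_iff)
   moreover have "P (\<lambda>z. Re (z $ i))" "P (\<lambda>z. Im (z $ i))"
    by (auto simp: P_def trig_poly_coordinate intro!: continuous_intros)
   ultimately show ?thesis by blast
  qed
 qed
 thus ?thesis by (auto simp: P_def)
qed

text \<open>A measurable left inverse of \<open>torus_point\<close> on the cell, from
 \<open>tan (x / 2) = sin x / (1 + cos x)\<close>.\<close>

definition torus_angle :: "complex => real" where
 "torus_angle z = (if Re z = -1 then pi else 2 * arctan (Im z / (1 + Re z)))"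

lemma torus_angle_cis:
 assumes "- pi < x" "x \<le> pi"
 shows "torus_angle (cis x) = x"
proof (cases "x = pi")
 case False
 define y where "y = x / 2"
 have y: "- (pi / 2) < y" "y < pi / 2" and x: "x = 2 * y" using assms False by (auto simp: y_def)
 have c: "cos y > 0" using y by (intro cos_gt_zero_pi) auto
 have "1 + cos x = 2 * (cos y)\<^sup>2" "sin x = 2 * sin y * cos y"
  by (simp_all add: x cos_double_cos sin_double)
 hence "sin x / (1 + cos x) = tan y" "cos x ~= -1"
  using c by (auto simp: tan_def power2_eq_square)
 thus ?thesis using y by (simp add: torus_angle_def arctan_tan x)
qed (simp add: torus_angle_def)

lemma torus_angle_measurable [measurable]: "torus_angle \<in> borelfun"
 unfolding torus_angle_def[abs_def] by measurable

definition torus_inverse :: "complex^'n => real^'n" where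
 "torus_inverse z = (\<chi> i. torus_angle (z $ i))"

lemma torus_inverse_point: "y \<in> cell ==> torus_inverse (torus_point y) = y"
 by (simp add: torus_inverse_def torus_point_def cell_def torus_angle_cis vec_eq_iff)

lemma torus_inverse_measurable [measurable]: "torus_inverse \<in> borelfun"
proof -
 have [measurable]: "(\<lambda>z::complex^'n. z $ i) \<in> borelfun" for i
  by (intro borel_measurable_continuous_onI continuous_intros)
 show ?thesis
 proof (rule borel_measurable_euclidean_space[THEN iffD2], rule ballI)
  fix b :: "real^'n" assume "b \<in> Basis"
  then obtain i where b: "b = axis i 1" by (auto simp: Basis_vec_def)
  have "(\<lambda>z. torus_inverse z \<bullet> b) = (\<lambda>z::complex^'n. torus_angle (z $ i))"
   by (simp add: b torus_inverse_def inner_axis fun_eq_iff)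
  thus "(\<lambda>z. torus_inverse z \<bullet> b) \<in> borelfun" by simp
 qed
qed

text \<open>The Fourier coefficients determine an integrable function.  By the Stone-Weierstrass theorem
 vanishing coefficients give zero integrals against continuous functions on the torus, hence over
 open sets by approximation from below, hence over all Borel sets by a Dynkin argument.\<close>

theorem torus_uniqueness:
 fixes u :: "real^'n => complex"
 assumes u: "integrable cellM u"
  and coeff: "!!k. (\<integral>y. u y * torus_char k y \<partial>cellM) = 0"
 shows "AE y in cellM. u y = 0"
proof -
 have um [measurable]: "u \<in> borel_measurable cellM" using u by auto
 have chm [measurable]: "torus_char k \<in> borel_measurable cellM" for k :: "int^'n"
  by (intro measurable_cell_measure) simp
 have tpm [measurable]: "torus_point \<in> cellM \<rightarrow>\<^sub>M borel"
  by (rule measurable_restrict_space1) (simp add: torus_point_measurable)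
 have int_bdd: "integrable cellM (\<lambda>y. u y * g y)"
  if "g \<in> borel_measurable cellM" "!!y. cmod (g y) \<le> C" for g C
 proof (rule Bochner_Integration.integrable_bound[of _ "\<lambda>y. C * cmod (u y)"])
  show "AE y in cellM. norm (u y * g y) \<le> norm (C * cmod (u y))"
  proof (intro AE_I2)
   fix y :: "real^'n"
   have "cmod (g y) \<le> \<bar>C\<bar>" using that(2)[of y] by linarith
   thus "norm (u y * g y) \<le> norm (C * cmod (u y))"
    by (simp add: norm_mult mult.commute[of "cmod (u y)"] abs_mult mult_right_mono)
  qed
 qed (use u that in auto)
 have trig: "integrable cellM (\<lambda>y. u y * g y) \<and> (\<integral>y. u y * g y \<partial>cellM) = 0" if "trig_poly g" for g
  using that
 proof (induction rule: trig_poly.induct)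
  case (trig_char k)
  thus ?case using coeff int_bdd[of "torus_char k" 1] by simp
 next
  case (trig_add f g)
  thus ?case by (simp add: distrib_left)
 next
  case (trig_scale f c)
  thus ?case by (simp add: mult.left_commute[of _ c])
 qed
 have cont: "(\<integral>y. u y * cplx (h (torus_point y)) \<partial>cellM) = 0"
  if h: "continuous_on UNIV h" for h :: "complex^'n => real"
 proof -
  have hm [measurable]: "h \<in> borelfun" using h by (rule borel_measurable_continuous_onI)
  have ht: "continuous_on torus h" using h by (rule continuous_on_subset) simp
  hence "bounded (h ` torus)" by (intro compact_imp_bounded compact_continuous_image compact_torus)
  then obtain C where C: "!!z. z \<in> torus ==> \<bar>h z\<bar> \<le> C" by (auto simp: bounded_iff)
  have hi: "integrable cellM (\<lambda>y. u y * cplx (h (torus_point y)))"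
   using C by (intro int_bdd[of _ C]) auto
  have "cmod (\<integral>y. u y * cplx (h (torus_point y)) \<partial>cellM) \<le> 0 + e * (\<integral>y. cmod (u y) \<partial>cellM)"
   if "e > 0" for e
  proof -
   obtain g where g: "trig_poly (\<lambda>y::real^'n. cplx (g (torus_point y)))"
    and hg: "!!z. z \<in> torus ==> \<bar>h z - g z\<bar> < e"
    using trig_poly_dense[OF ht \<open>e > 0\<close>] by blast
   note gi = trig[OF g]
   have "(\<integral>y. u y * cplx (h (torus_point y)) \<partial>cellM)
     = (\<integral>y. u y * cplx (h (torus_point y)) - u y * cplx (g (torus_point y)) \<partial>cellM)"
    using gi hi by (subst Bochner_Integration.integral_diff) auto
   also have "cmod ... \<le> (\<integral>y. e * cmod (u y) \<partial>cellM)"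
   proof (rule Bochner_Integration.integral_norm_bound_integral)
    show "integrable cellM (\<lambda>y. u y * cplx (h (torus_point y)) - u y * cplx (g (torus_point y)))"
     using gi hi by auto
    show "norm (u y * cplx (h (torus_point y)) - u y * cplx (g (torus_point y))) \<le> e * cmod (u y)" for y
    proof -
     have "u y * cplx (h (torus_point y)) - u y * cplx (g (torus_point y))
      = cplx (h (torus_point y) - g (torus_point y)) * u y" by (simp add: algebra_simps)
     hence "norm (u y * cplx (h (torus_point y)) - u y * cplx (g (torus_point y)))
       = \<bar>h (torus_point y) - g (torus_point y)\<bar> * cmod (u y)"
      by (simp only: norm_mult norm_of_real)
     thus ?thesis using hg[of "torus_point y"] by (simp add: mult_right_mono)
    qed
   qed (use u in auto)
   finally show ?thesis by simp
  qed
  hence "cmod (\<integral>y. u y * cplx (h (torus_point y)) \<partial>cellM) \<le> 0 + e" if "e > 0" for e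
  proof -
   define L where "L = (\<integral>y. cmod (u y) \<partial>cellM)"
   have L: "L \<ge> 0" by (simp add: L_def)
   have "e / (L + 1) > 0" using that L by simp
   from \<open>!!e. e > 0 ==> _\<close>[OF this]
   have "cmod (\<integral>y. u y * cplx (h (torus_point y)) \<partial>cellM) \<le> e / (L + 1) * L" by (simp add: L_def)
   also have "... \<le> e" using that L by (simp add: field_simps)
   finally show ?thesis by simp
  qed
  hence "cmod (\<integral>y. u y * cplx (h (torus_point y)) \<partial>cellM) \<le> 0"
   by (rule field_le_epsilon)
  thus ?thesis by simp
 qed
 define G where "G A = (\<lambda>y. u y * cplx (indicator A (torus_point y)))" for A :: "(complex^'n) set"
 have Gi: "integrable cellM (G A)" if "A \<in> sets borel" for A
 proof -
  have [measurable]: "A \<in> sets borel" by (rule that)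
  show ?thesis unfolding G_def by (intro int_bdd[of _ 1]) (auto simp: indicator_def)
 qed
 have open_case: "(\<integral>y. G A y \<partial>cellM) = 0" if A: "open A" for A
 proof (cases "A = UNIV")
  case True
  thus ?thesis using cont[of "\<lambda>_. 1"] by (simp add: G_def)
 next
  case False
  have [measurable]: "A \<in> sets borel" using A by simp
  define h where "h m z = min 1 (real m * infdist z (- A))" for m :: nat and z
  have ch: "continuous_on UNIV (h m)" for m
   unfolding h_def[abs_def] by (intro continuous_intros continuous_on_infdist)
  have [measurable]: "h m \<in> borelfun" for m by (rule borel_measurable_continuous_onI[OF ch])
  have h01: "0 \<le> h m z" "h m z \<le> 1" for m z by (auto simp: h_def infdist_nonneg)
  have lim: "(\<lambda>m. h m z) \<longlonglongrightarrow> indicator A z" for z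
  proof (cases "z \<in> A")
   case True
   have ne: "- A ~= {}" using \<open>A ~= UNIV\<close> by auto
   have "closed (- A)" using A by auto
   hence pos: "infdist z (- A) > 0"
    using True ne in_closed_iff_infdist_zero[of "- A" z] infdist_nonneg[of z "- A"] by force
   obtain N :: nat where N: "1 / infdist z (- A) < N" using reals_Archimedean2 by blast
   have "h m z = 1" if "m \<ge> N" for m
   proof -
    have "1 / infdist z (- A) \<le> m" using N that by linarith
    thus ?thesis using pos by (simp add: h_def field_simps min_def)
   qed
   thus ?thesis using True by (intro tendsto_eventually eventually_sequentiallyI[of N]) simp
  qed (simp add: h_def)
  have "(\<lambda>m. \<integral>y. u y * cplx (h m (torus_point y)) \<partial>cellM) \<longlonglongrightarrow> (\<integral>y. G A y \<partial>cellM)"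
  proof (rule integral_dominated_convergence[where w = "\<lambda>y. cmod (u y)"])
   show "AE y in cellM. (\<lambda>m. u y * cplx (h m (torus_point y))) \<longlonglongrightarrow> G A y"
    unfolding G_def using lim by (intro AE_I2 tendsto_intros) auto
   show "AE y in cellM. norm (u y * cplx (h m (torus_point y))) \<le> cmod (u y)" for m
    using h01[of m] by (intro AE_I2) (auto simp: norm_mult intro!: mult_left_le)
  qed (use u Gi in auto)
  thus ?thesis by (simp add: cont[OF ch] LIMSEQ_const_iff)
 qed
 have borel_case: "(\<integral>y. G A y \<partial>cellM) = 0" if "A \<in> sets borel" for A
 proof -
  have "Int_stable {S::(complex^'n) set. open S}" by (auto simp: Int_stable_def)
  moreover have "{S::(complex^'n) set. open S} \<subseteq> Pow UNIV" by simp
  moreover have "A \<in> sigma_sets UNIV {S. open S}" using that by (simp add: sets_borel)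
  ultimately show ?thesis
  proof (induction rule: sigma_sets_induct_disjoint)
   case (basic A)
   thus ?case by (auto intro: open_case)
  next
   case empty
   thus ?case by (simp add: G_def)
  next
   case (compl A)
   have A: "A \<in> sets borel" using compl(1) by (simp add: sets_borel)
   have "G (UNIV - A) y = G UNIV y - G A y" for y by (simp add: G_def indicator_def)
   thus ?case using compl Gi[OF A] Gi[of UNIV] open_case[of UNIV] by (simp add: Bochner_Integration.integral_diff)
  next
   case (union A)
   have A: "A i \<in> sets borel" for i using union(2) by (auto simp: sets_borel)
   have A' [measurable]: "A i \<in> sets borel" for i by (rule A)
   have "(\<lambda>m. \<integral>y. (\<Sum>i<m. G (A i) y) \<partial>cellM) \<longlonglongrightarrow> (\<integral>y. G (\<Union>i. A i) y \<partial>cellM)"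
   proof (rule integral_dominated_convergence[where w = "\<lambda>y. cmod (u y)"])
    have s: "(\<Sum>i<m. G (A i) y) = G (\<Union>i<m. A i) y" for m y
    proof -
     have "indicator (\<Union>i<m. A i) z = (\<Sum>i<m. indicator (A i) z :: real)" for z
      using union(1) by (intro indicator_UN_disjoint) (auto intro: disjoint_family_on_mono)
     thus ?thesis by (simp add: G_def sum_distrib_left)
    qed
    show "AE y in cellM. (\<lambda>m. \<Sum>i<m. G (A i) y) \<longlonglongrightarrow> G (\<Union>i. A i) y"
     unfolding s
     unfolding G_def by (intro AE_I2 tendsto_intros LIMSEQ_indicator_UN)
    show "AE y in cellM. norm (\<Sum>i<m. G (A i) y) \<le> cmod (u y)" for m
     unfolding s unfolding G_def by (intro AE_I2) (auto simp: norm_mult indicator_def)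
   qed (use u Gi A in auto)
   moreover have "(\<integral>y. (\<Sum>i<m. G (A i) y) \<partial>cellM) = 0" for m
    using union(3) Gi[OF A] by (subst Bochner_Integration.integral_sum) auto
   ultimately show ?case by (simp add: LIMSEQ_const_iff)
  qed
 qed
 show ?thesis
 proof (rule sigma_finite_measure.density_zero[OF finite_measure.axioms(1)[OF finite_measure_cell] u])
  fix C :: "(real^'n) set" assume C: "C \<in> sets cellM"
  hence Cb [measurable]: "C \<in> sets borel" and Cc: "C \<subseteq> cell" by (auto simp: sets_restrict_space)
  define A where "A = torus_inverse -` C"
  have A: "A \<in> sets borel" unfolding A_def using measurable_sets[OF torus_inverse_measurable Cb] by simp
  have "set_lebesgue_integral cellM C u = (\<integral>y. G A y \<partial>cellM)"
   unfolding set_lebesgue_integral_def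
  proof (rule Bochner_Integration.integral_cong[OF refl])
   fix y :: "real^'n" assume "y \<in> space cellM"
   hence "y \<in> cell" by (simp add: space_restrict_space)
   hence "indicator A (torus_point y) = (indicator C y :: real)"
    by (simp add: A_def indicator_def torus_inverse_point)
   thus "indicator C y *\<^sub>R u y = G A y" by (simp add: G_def indicator_def)
  qed
  thus "set_lebesgue_integral cellM C u = 0" using borel_case[OF A] by simp
 qed
qed

lemma Lsq_cell_integrable:
 assumes "u \<in> Lsq cellM"
 shows "integrable cellM u"
proof -
 have "(\<lambda>y. 1) \<in> Lsq (cellM :: (real^'a) measure)"
  by (auto simp: Lsq_def intro!: finite_measure.integrable_const[OF finite_measure_cell])
 from Lsq_inner_integrable[OF assms this] show ?thesis by simp
qed

lemma torus_char_Lsq: "torus_char k \<in> Lsq cellM"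
 by (auto simp: Lsq_def intro!: measurable_cell_measure finite_measure.integrable_const[OF finite_measure_cell])

text \<open>Uniqueness of Fourier coefficients is totality of the normalized characters.\<close>

theorem Parseval_torus:
 fixes u :: "real^'n => complex"
 assumes u: "u \<in> Lsq cellM"
 shows "(\<integral>\<^sup>+k. esq (\<integral>y. u y * torus_char k y \<partial>cellM) \<partial>counting)
  = ennreal ((2 * pi) ^ CARD('n)) * (\<integral>\<^sup>+y. esq (u y) \<partial>cellM)"
proof -
 define c where "c = (2 * pi) ^ CARD('n)"
 have c: "c > 0" by (simp add: c_def)
 define e where "e k y = cplx (1 / sqrt c) * torus_char (- k) y" for k :: "int^'n" and y
 have in_e: "Lsq_inner cellM f (e k) = cplx (1 / sqrt c) * (\<integral>y. f y * torus_char k y \<partial>cellM)" for f k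
  unfolding e_def[abs_def] Lsq_inner_scale_right by (simp add: Lsq_inner_def torus_char_cnj)
 have eL: "e k \<in> Lsq cellM" for k
  unfolding e_def[abs_def] by (intro Lsq_scale torus_char_Lsq)
 have "Lsq_inner cellM (e k) (e l) = (if k = l then 1 else 0)" for k l
 proof -
  have "Lsq_inner cellM (e k) (e l)
    = cplx (1 / sqrt c) * cplx (1 / sqrt c) * (\<integral>y. torus_char (l - k) y \<partial>cellM)"
   unfolding in_e by (simp add: e_def mult.assoc torus_char_mult)
  also have "... = (if k = l then 1 else 0)"
  proof -
   have "(\<integral>y. torus_char (l - k) y \<partial>cellM) = (if k = l then cplx c else 0)"
    by (simp add: integral_torus_char c_def)
   thus ?thesis using c by (simp flip: of_real_mult of_real_divide)
  qed
  finally show ?thesis .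
 qed
 hence on: "orthonormal_or_zero cellM UNIV e"
  using eL by (auto simp: orthonormal_or_zero_def)
 have "frame_energy cellM UNIV e u = ennreal ((Lsq_norm cellM u)\<^sup>2)"
 proof (rule Parseval_total[OF on])
  fix f assume f: "f \<in> Lsq cellM" and "!!k. k \<in> UNIV ==> Lsq_inner cellM f (e k) = 0"
  hence "(\<integral>y. f y * torus_char k y \<partial>cellM) = 0" for k using c by (auto simp: in_e)
  thus "AE y in cellM. f y = 0" by (intro torus_uniqueness Lsq_cell_integrable f)
 qed (use u in auto)
 hence "ennreal c * frame_energy cellM UNIV e u = ennreal c * (\<integral>\<^sup>+y. esq (u y) \<partial>cellM)"
  by (simp add: nn_integral_Lsq_norm[OF u])
 moreover have "ennreal c * frame_energy cellM UNIV e u =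
   (\<integral>\<^sup>+k. esq (\<integral>y. u y * torus_char k y \<partial>cellM) \<partial>counting)"
  unfolding frame_energy_def in_e
  by (subst nn_integral_cmult[symmetric])
    (use c in \<open>auto simp: norm_mult norm_divide power_mult_distrib power_divide ennreal_mult[symmetric] intro!: nn_integral_cong\<close>)
 ultimately show ?thesis by (simp add: c_def)
qed

section \<open>The Plancherel theorem\<close>

lemma nn_integral_lborel_scale:
 fixes f :: "'a::euclidean_space => ennreal"
 assumes [measurable]: "f \<in> borelfun" and c: "c > 0"
 shows "(\<integral>\<^sup>+x. f x \<partial>lborel) = ennreal (c ^ DIM('a)) * (\<integral>\<^sup>+x. f (c *\<^sub>R x) \<partial>lborel)"
proof -
 have "(\<integral>\<^sup>+x. f x \<partial>lborel) = (\<integral>\<^sup>+x. f x \<partial>density (distr lborel borel (\<lambda>x. 0 + c *\<^sub>R x)) (\<lambda>_. ennreal (\<bar>c\<bar> ^ DIM('a))))"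
  using lborel_affine[of c "0::'a"] c by simp
 also have "... = ennreal (c ^ DIM('a)) * (\<integral>\<^sup>+x. f (c *\<^sub>R x) \<partial>lborel)"
  using c by (simp add: nn_integral_density nn_integral_distr nn_integral_cmult)
 finally show ?thesis .
qed

lemma integral_lborel_scale:
 fixes f :: "'a::euclidean_space => complex"
 assumes [measurable]: "f \<in> borelfun" and c: "c > 0"
 shows "(\<integral>x. f x \<partial>lborel) = cplx (c ^ DIM('a)) * (\<integral>x. f (c *\<^sub>R x) \<partial>lborel)"
proof -
 have "(\<integral>x. f x \<partial>lborel) = (\<integral>x. f x \<partial>density (distr lborel borel (\<lambda>x. 0 + c *\<^sub>R x)) (\<lambda>_. ennreal (\<bar>c\<bar> ^ DIM('a))))"
  using lborel_affine[of c "0::'a"] c by simp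
 also have "... = (\<integral>x. (\<bar>c\<bar> ^ DIM('a)) *\<^sub>R f x \<partial>distr lborel borel (\<lambda>x. 0 + c *\<^sub>R x))"
  by (subst integral_density) auto
 also have "... = (\<integral>x. (\<bar>c\<bar> ^ DIM('a)) *\<^sub>R f (0 + c *\<^sub>R x) \<partial>lborel)"
  by (subst integral_distr) auto
 also have "... = cplx (c ^ DIM('a)) * (\<integral>x. f (c *\<^sub>R x) \<partial>lborel)"
  using c by (simp add: scaleR_conv_of_real)
 finally show ?thesis .
qed

text \<open>The cubes \<open>scaled_cell R\<close> exhaust the space as \<open>R\<close> grows.\<close>

definition scaled_cell :: "real => (real^'n) set" where
 "scaled_cell R = {x. (1 / R) *\<^sub>R x \<in> cell}"

lemma scaled_cell_borel [measurable]: "scaled_cell R \<in> sets borel"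
 using measurable_sets[of "\<lambda>x. (1 / R) *\<^sub>R x" borel borel cell] by (simp add: scaled_cell_def vimage_def)

lemma scaled_cell_iff: "R > 0 ==> x \<in> scaled_cell R \<longleftrightarrow> (\<forall>i. - (pi * R) < x $ i \<and> x $ i \<le> pi * R)"
 by (auto simp: scaled_cell_def cell_def field_simps)

lemma scaled_cell_mono: "0 < R ==> R \<le> R' ==> scaled_cell R \<subseteq> scaled_cell R'"
proof
 fix x :: "real^'n" assume R: "0 < R" "R \<le> R'" and x: "x \<in> scaled_cell R"
 have le: "pi * R \<le> pi * R'" using R by simp
 have "- (pi * R') < x $ i \<and> x $ i \<le> pi * R'" for i
 proof -
  have "- (pi * R) < x $ i" "x $ i \<le> pi * R" using x R(1) by (auto simp: scaled_cell_iff)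
  thus ?thesis using le by linarith
 qed
 thus "x \<in> scaled_cell R'" using R by (simp add: scaled_cell_iff)
qed

lemma eventually_scaled_cell: "\<forall>\<^sub>F m in sequentially. x \<in> scaled_cell (real (Suc m))"
proof -
 obtain N :: nat where N: "norm x < N" using reals_Archimedean2 by blast
 have "x \<in> scaled_cell (real (Suc m))" if "m \<ge> N" for m
 proof (subst scaled_cell_iff)
  have "- (pi * real (Suc m)) < x $ i \<and> x $ i \<le> pi * real (Suc m)" for i
  proof -
   have "\<bar>x $ i\<bar> < real (Suc m)" using component_le_norm_cart[of x i] N that by linarith
   also have "... \<le> pi * real (Suc m)"
    using mult_right_mono[of 1 pi "real (Suc m)"] pi_ge_two by simp
   finally show ?thesis by linarith
  qed
  thus "\<forall>i. - (pi * real (Suc m)) < x $ i \<and> x $ i \<le> pi * real (Suc m)" by blast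
 qed simp
 thus ?thesis by (rule eventually_sequentiallyI)
qed

lemma emeasure_scaled_cell_finite:
 assumes "R > 0"
 shows "emeasure lborel (scaled_cell R :: (real^'n) set) < \<infinity>"
proof -
 define a b :: "real^'n" where "a = (\<chi> i. - (pi * R))" and "b = (\<chi> i. pi * R)"
 have "scaled_cell R \<subseteq> cbox a b"
  using assms by (auto simp: a_def b_def scaled_cell_iff mem_box_cart less_imp_le)
 hence "emeasure lborel (scaled_cell R :: (real^'n) set) \<le> emeasure lborel (cbox a b)"
  by (intro emeasure_mono) auto
 also have "... < \<infinity>" using emeasure_lborel_cbox_finite by (auto simp: less_top[symmetric])
 finally show ?thesis .
qed

definition restrict_cell :: "real => (real^'n => complex) => real^'n => complex" where
 "restrict_cell R f x = (if x \<in> scaled_cell R then f x else 0)"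

lemma restrict_cell_measurable [measurable]:
 "f \<in> borelfun ==> restrict_cell R f \<in> borelfun"
 unfolding restrict_cell_def[abs_def] by (intro measurable_If_set) auto

lemma restrict_cell_Lsq:
 assumes "f \<in> L2"
 shows "restrict_cell R f \<in> L2"
proof -
 have "(\<lambda>x. indicator (scaled_cell R) x * f x) \<in> L2"
  by (rule Lsq_bounded_mult[OF assms, of _ 1]) (auto simp: indicator_def)
 moreover have "restrict_cell R f = (\<lambda>x. indicator (scaled_cell R) x * f x)"
  by (auto simp: restrict_cell_def indicator_def)
 ultimately show ?thesis by simp
qed

text \<open>Dominated convergence, with the square of \<open>f\<close> as the dominating function.\<close>

lemma Lsq_truncation_tendsto:
 assumes f: "f \<in> Lsq M" and A: "!!m. A m \<in> sets M" and ev: "!!x. x \<in> space M ==> \<forall>\<^sub>F m in sequentially. x \<in> A m"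
 shows "(\<lambda>m. Lsq_norm M (\<lambda>x. (if x \<in> A m then f x else 0) - f x)) \<longlonglongrightarrow> 0"
proof -
 have [measurable]: "f \<in> borel_measurable M" "A m \<in> sets M" for m using f A by (auto dest: LsqD)
 have "(\<lambda>m. \<integral>x. (cmod ((if x \<in> A m then f x else 0) - f x))\<^sup>2 \<partial>M) \<longlonglongrightarrow> (\<integral>x. 0 \<partial>M)"
 proof (rule integral_dominated_convergence[where w = "\<lambda>x. (cmod (f x))\<^sup>2"])
  show "AE x in M. (\<lambda>m. (cmod ((if x \<in> A m then f x else 0) - f x))\<^sup>2) \<longlonglongrightarrow> 0"
  proof (rule AE_I2)
   fix x assume "x \<in> space M"
   from ev[OF this] have "\<forall>\<^sub>F m in sequentially. (cmod ((if x \<in> A m then f x else 0) - f x))\<^sup>2 = 0"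
    by eventually_elim simp
   thus "(\<lambda>m. (cmod ((if x \<in> A m then f x else 0) - f x))\<^sup>2) \<longlonglongrightarrow> 0"
    by (rule tendsto_eventually)
  qed
 qed (use f in \<open>auto simp: Lsq_def\<close>)
 hence "(\<lambda>m. sqrt (\<integral>x. (cmod ((if x \<in> A m then f x else 0) - f x))\<^sup>2 \<partial>M)) \<longlonglongrightarrow> sqrt 0"
  by (intro tendsto_real_sqrt) simp
 thus ?thesis by (simp add: Lsq_norm_def)
qed

lemma restrict_cell_tendsto:
 assumes "f \<in> L2"
 shows "(\<lambda>m. L2norm (\<lambda>x. restrict_cell (real (Suc m)) f x - f x)) \<longlonglongrightarrow> 0"
 unfolding restrict_cell_def using assms eventually_scaled_cell
 by (intro Lsq_truncation_tendsto) auto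

definition cell_supported :: "(real^'n => complex) => bool" where
 "cell_supported f \<longleftrightarrow> (\<exists>R>0. \<forall>x. x \<notin> scaled_cell R --> f x = 0)"

lemma cell_supported_restrict: "R > 0 ==> cell_supported (restrict_cell R f)"
 by (auto simp: cell_supported_def restrict_cell_def)

lemma cell_supported_diff:
 assumes "cell_supported f" "cell_supported g"
 shows "cell_supported (\<lambda>x. f x - g x)"
proof -
 obtain R S where "R > 0" "\<forall>x. x \<notin> scaled_cell R --> f x = 0" "S > 0" "\<forall>x. x \<notin> scaled_cell S --> g x = 0"
  using assms unfolding cell_supported_def by blast
 note RS = this
 have "scaled_cell R \<subseteq> scaled_cell (max R S)" "scaled_cell S \<subseteq> scaled_cell (max R S)"
  using RS by (simp_all add: scaled_cell_mono)
 hence "f x - g x = 0" if "x \<notin> scaled_cell (max R S)" for x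
  using RS that by (metis subsetD diff_self)
 moreover have "max R S > 0" using RS by simp
 ultimately show ?thesis unfolding cell_supported_def by blast
qed

lemma cell_supported_integrable:
 fixes f :: "real^'a => complex"
 assumes f: "f \<in> L2" "cell_supported f"
 shows "integrable lborel f"
proof -
 obtain R where R: "R > 0" "!!x. x \<notin> scaled_cell R ==> f x = 0" using f by (auto simp: cell_supported_def)
 have i: "(\<lambda>x. indicator (scaled_cell R) x) \<in> Lsq (lborel :: (real^'a) measure)"
 proof -
  have "(cmod (indicator (scaled_cell R) x))\<^sup>2 = indicator (scaled_cell R) x" for x :: "real^'a"
   by (auto simp: indicator_def)
  thus ?thesis
   using emeasure_scaled_cell_finite[OF R(1)]
   by (auto simp: Lsq_def intro!: integrable_real_indicator)
 qed
 have "f x * cnj (indicator (scaled_cell R) x) = f x" for x using R by (auto simp: indicator_def)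
 with Lsq_inner_integrable[OF f(1) i] show ?thesis by simp
qed

lemma fourier_integral_kernel_measurable [measurable]:
 "(\<lambda>(y, x). exp (- (\<i> * cplx (x \<bullet> y)))) \<in> borel_measurable (borel \<Otimes>\<^sub>M (borel :: (real^'n) measure))"
proof -
 have "(\<lambda>p. exp (- (\<i> * cplx (snd p \<bullet> fst p)))) \<in> borel_measurable (borel :: ((real^'n) \<times> (real^'n)) measure)"
  by (intro borel_measurable_continuous_onI continuous_intros)
 thus ?thesis by (simp add: borel_prod case_prod_unfold)
qed

lemma fourier_integral_measurable [measurable]:
 assumes [measurable]: "f \<in> borelfun"
 shows "fourier_integral f \<in> borel_measurable (borel :: (real^'n) measure)"
proof -
 have "(\<lambda>p. f (snd p) * (case p of (y, x) => exp (- (\<i> * cplx (x \<bullet> y))))) \<in> borel_measurable (borel \<Otimes>\<^sub>M (lborel :: (real^'n) measure))"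
  by measurable
 hence "(\<lambda>(y, x). f x * exp (- (\<i> * cplx (x \<bullet> y)))) \<in> borel_measurable (borel \<Otimes>\<^sub>M (lborel :: (real^'n) measure))"
  by (simp add: case_prod_unfold)
 from lborel.borel_measurable_lebesgue_integral[OF this] show ?thesis
  by (simp add: fourier_integral_def[abs_def])
qed

lemma fourier_integrand_integrable:
 assumes "integrable lborel f"
 shows "integrable lborel (\<lambda>x. f x * exp (- (\<i> * cplx (x \<bullet> y))))"
proof (rule Bochner_Integration.integrable_bound[OF assms])
 have [measurable]: "(\<lambda>x. exp (- (\<i> * cplx (x \<bullet> y)))) \<in> borelfun"
  by (intro borel_measurable_continuous_onI continuous_intros)
 show "(\<lambda>x. f x * exp (- (\<i> * cplx (x \<bullet> y)))) \<in> borel_measurable lborel" using assms by auto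
qed (simp add: norm_mult)

lemma fourier_integral_linear:
 assumes "integrable lborel f" "integrable lborel g"
 shows "fourier_integral (\<lambda>x. f x + g x) y = fourier_integral f y + fourier_integral g y"
  and "fourier_integral (\<lambda>x. f x - g x) y = fourier_integral f y - fourier_integral g y"
 using fourier_integrand_integrable[OF assms(1), of y] fourier_integrand_integrable[OF assms(2), of y]
 by (simp_all add: fourier_integral_def distrib_right left_diff_distrib)

lemma fourier_integral_scale: "fourier_integral (\<lambda>x. c * f x) y = c * fourier_integral f y"
 by (simp add: fourier_integral_def mult.assoc)

text \<open>For a function supported in a cube the values of the Fourier integral on each translate of a
 suitable lattice are the Fourier coefficients of a modulated function on the torus.  Parseval's
 formula on the torus, integrated over all translates of the lattice, is Plancherel's formula.\<close>

theorem Plancherel_cell_supported: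
 fixes f :: "real^'n => complex"
 assumes f: "f \<in> L2" "cell_supported f"
 shows "(\<integral>\<^sup>+y. esq (fourier_integral f y) \<partial>lborel)
  = ennreal ((2 * pi) ^ CARD('n)) * (\<integral>\<^sup>+x. esq (f x) \<partial>lborel)"
proof -
 obtain R where R: "R > 0" and supp: "!!x. x \<notin> scaled_cell R ==> f x = 0" using f by (auto simp: cell_supported_def)
 define c where "c = (2 * pi) ^ CARD('n)"
 define r where "r = R ^ CARD('n)"
 have c: "c > 0" and r: "r > 0" using R by (simp_all add: c_def r_def)
 have [measurable]: "f \<in> borelfun" using f by (auto dest: LsqD)
 have supp': "f (R *\<^sub>R z) = indicator cell z *\<^sub>R f (R *\<^sub>R z)" for z
  using R supp[of "R *\<^sub>R z"] by (auto simp: scaled_cell_def indicator_def)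
 have fR: "(\<integral>\<^sup>+z. esq (f (R *\<^sub>R z)) \<partial>cellM) * ennreal r = (\<integral>\<^sup>+x. esq (f x) \<partial>lborel)"
 proof -
  have "(\<integral>\<^sup>+z. esq (f (R *\<^sub>R z)) \<partial>cellM) = (\<integral>\<^sup>+z. esq (f (R *\<^sub>R z)) \<partial>lborel)"
   unfolding nn_integral_cell_measure
  proof (rule nn_integral_cong)
   fix z show "esq (f (R *\<^sub>R z)) * indicator cell z = esq (f (R *\<^sub>R z))"
    using supp'[of z] by (cases "z \<in> cell") auto
  qed
  thus ?thesis
   using R by (subst nn_integral_lborel_scale[of "\<lambda>x. esq (f x)", OF _ R]) (auto simp: r_def mult.commute)
 qed
 define u where "u y z = f (R *\<^sub>R z) * exp (- (\<i> * cplx (z \<bullet> y / (2 * pi))))" for y z :: "real^'n"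
 have um [measurable]: "u y \<in> borelfun" for y
 proof -
  have [measurable]: "(\<lambda>z. exp (- (\<i> * cplx (z \<bullet> y / (2 * pi))))) \<in> borelfun"
   by (intro borel_measurable_continuous_onI continuous_intros) auto
  show ?thesis unfolding u_def[abs_def] by measurable
 qed
 have nu: "cmod (u y z) = cmod (f (R *\<^sub>R z))" for y z
  by (simp add: u_def norm_mult del: of_real_divide)
 have uL: "u y \<in> Lsq cellM" for y
 proof (subst Lsq_iff_nn_integral)
  show "u y \<in> borel_measurable cellM" by (intro measurable_cell_measure um)
  have "(\<integral>\<^sup>+z. esq (f (R *\<^sub>R z)) \<partial>cellM) * ennreal r < \<infinity>"
   unfolding fR nn_integral_Lsq_norm[OF f(1)] by simp
  thus "(\<integral>\<^sup>+z. esq (u y z) \<partial>cellM) < \<infinity>"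
   using r unfolding nu by (auto simp: ennreal_mult_less_top)
 qed
 have val: "fourier_integral f ((1 / (2 * pi * R)) *\<^sub>R shift2pi k y)
   = cplx r * (\<integral>z. u y z * torus_char (- k) z \<partial>cellM)" for k y
 proof -
  define \<zeta> where "\<zeta> = (1 / (2 * pi * R)) *\<^sub>R shift2pi k y"
  have [measurable]: "(\<lambda>x. exp (- (\<i> * cplx (x \<bullet> \<zeta>)))) \<in> borelfun"
   by (intro borel_measurable_continuous_onI continuous_intros)
  have "fourier_integral f \<zeta> = cplx r * (\<integral>z. f (R *\<^sub>R z) * exp (- (\<i> * cplx ((R *\<^sub>R z) \<bullet> \<zeta>))) \<partial>lborel)"
   unfolding fourier_integral_def by (subst integral_lborel_scale[OF _ R]) (auto simp: r_def)
  also have "(\<integral>z. f (R *\<^sub>R z) * exp (- (\<i> * cplx ((R *\<^sub>R z) \<bullet> \<zeta>))) \<partial>lborel)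
    = (\<integral>z. u y z * torus_char (- k) z \<partial>cellM)"
   unfolding integral_cell_measure
  proof (rule Bochner_Integration.integral_cong[OF refl])
   fix z
   have e: "(R *\<^sub>R z) \<bullet> \<zeta> = z \<bullet> y / (2 * pi) + lattice_vec k \<bullet> z"
    using R by (simp add: \<zeta>_def inner_add_right inner_commute[of z "lattice_vec k"] field_simps)
   have t: "torus_char (- k) z = exp (- (\<i> * cplx (lattice_vec k \<bullet> z)))"
    by (simp add: torus_char_def cis_conv_exp)
   have "exp (- (\<i> * cplx ((R *\<^sub>R z) \<bullet> \<zeta>)))
     = exp (- (\<i> * cplx (z \<bullet> y / (2 * pi)))) * torus_char (- k) z"
    unfolding e t by (simp add: exp_add[symmetric] algebra_simps)
   hence "f (R *\<^sub>R z) * exp (- (\<i> * cplx ((R *\<^sub>R z) \<bullet> \<zeta>))) = u y z * torus_char (- k) z"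
    by (simp add: u_def mult.assoc)
   moreover have "f (R *\<^sub>R z) = 0" if "z \<notin> cell" using supp'[of z] that by simp
   ultimately show "f (R *\<^sub>R z) * exp (- (\<i> * cplx ((R *\<^sub>R z) \<bullet> \<zeta>)))
     = indicator cell z *\<^sub>R (u y z * torus_char (- k) z)"
    by (cases "z \<in> cell") auto
  qed
  finally show ?thesis by (simp add: \<zeta>_def)
 qed
 have lattice_sum: "(\<integral>\<^sup>+k. esq (fourier_integral f ((1 / (2 * pi * R)) *\<^sub>R shift2pi k y)) \<partial>counting)
   = ennreal (r * c) * (\<integral>\<^sup>+x. esq (f x) \<partial>lborel)" for y
 proof -
  have "(\<integral>\<^sup>+k. esq (fourier_integral f ((1 / (2 * pi * R)) *\<^sub>R shift2pi k y)) \<partial>counting)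
    = ennreal (r\<^sup>2) * (\<integral>\<^sup>+k. esq (\<integral>z. u y z * torus_char (- k) z \<partial>cellM) \<partial>counting)"
   unfolding val using r
   by (subst nn_integral_cmult[symmetric]) (auto simp: norm_mult power_mult_distrib ennreal_mult)
  also have "(\<integral>\<^sup>+k. esq (\<integral>z. u y z * torus_char (- k) z \<partial>cellM) \<partial>counting)
    = (\<integral>\<^sup>+k. esq (\<integral>z. u y z * torus_char k z \<partial>cellM) \<partial>counting)"
   by (rule nn_integral_bij_count_space[OF bij_uminus])
  also have "... = ennreal c * (\<integral>\<^sup>+z. esq (f (R *\<^sub>R z)) \<partial>cellM)"
   using Parseval_torus[OF uL[of y]] by (simp add: nu c_def)
  also have "ennreal (r\<^sup>2) * (ennreal c * (\<integral>\<^sup>+z. esq (f (R *\<^sub>R z)) \<partial>cellM))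
    = ennreal (r * c) * ((\<integral>\<^sup>+z. esq (f (R *\<^sub>R z)) \<partial>cellM) * ennreal r)"
   using r c by (simp add: power2_eq_square ennreal_mult mult_ac)
  finally show ?thesis unfolding fR .
 qed
 define g where "g \<zeta> = esq (fourier_integral f \<zeta>)" for \<zeta>
 have [measurable]: "g \<in> borelfun" unfolding g_def[abs_def] by measurable
 have "(\<integral>\<^sup>+\<zeta>. g ((1 / (2 * pi * R)) *\<^sub>R \<zeta>) \<partial>lborel)
   = (\<integral>\<^sup>+y. (\<integral>\<^sup>+k. g ((1 / (2 * pi * R)) *\<^sub>R shift2pi k y) \<partial>counting) \<partial>cellM)"
  by (rule nn_integral_unfold_cell) measurable
 also have "... = (\<integral>\<^sup>+y. ennreal (r * c) * (\<integral>\<^sup>+x. esq (f x) \<partial>lborel) \<partial>(cellM :: (real^'n) measure))"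
  unfolding g_def lattice_sum ..
 also have "... = ennreal (r * c) * (\<integral>\<^sup>+x. esq (f x) \<partial>lborel) * ennreal c"
  by (simp add: emeasure_restrict_space space_restrict_space emeasure_cell c_def)
 finally have *: "(\<integral>\<^sup>+\<zeta>. g ((1 / (2 * pi * R)) *\<^sub>R \<zeta>) \<partial>lborel)
   = ennreal (r * c) * (\<integral>\<^sup>+x. esq (f x) \<partial>lborel) * ennreal c" .
 have "(\<integral>\<^sup>+\<zeta>. g \<zeta> \<partial>lborel) = ennreal ((1 / (2 * pi * R)) ^ CARD('n)) * (\<integral>\<^sup>+\<zeta>. g ((1 / (2 * pi * R)) *\<^sub>R \<zeta>) \<partial>lborel)"
  using R by (subst nn_integral_lborel_scale[of g "1 / (2 * pi * R)"]) auto
 also have "(1 / (2 * pi * R)) ^ CARD('n) = 1 / (r * c)"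
  by (simp add: r_def c_def power_divide power_mult_distrib mult.commute)
 also have "ennreal (1 / (r * c)) * (\<integral>\<^sup>+\<zeta>. g ((1 / (2 * pi * R)) *\<^sub>R \<zeta>) \<partial>lborel)
   = (ennreal (1 / (r * c)) * ennreal (r * c)) * (ennreal c * (\<integral>\<^sup>+x. esq (f x) \<partial>lborel))"
  unfolding * by (simp add: mult_ac)
 also have "ennreal (1 / (r * c)) * ennreal (r * c) = 1"
  using r c by (simp add: ennreal_mult[symmetric])
 finally show ?thesis by (simp add: g_def c_def)
qed

lemma fourier_integral_Lsq:
 assumes "f \<in> L2" "cell_supported f"
 shows "fourier_integral f \<in> Lsq (lborel :: (real^'n) measure)"
proof (subst Lsq_iff_nn_integral)
 show "fourier_integral f \<in> borel_measurable lborel"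
  using fourier_integral_measurable[of f] assms by (auto dest: LsqD)
 show "(\<integral>\<^sup>+x. esq (fourier_integral f x) \<partial>lborel) < \<infinity>"
  unfolding Plancherel_cell_supported[OF assms] nn_integral_Lsq_norm[OF assms(1)]
  by (simp add: ennreal_mult_less_top)
qed

text \<open>The squared norm of \<open>fourier f\<close> is this constant times the squared norm of \<open>f\<close>.\<close>

definition plancherel_const :: "'n itself => real" where
 "plancherel_const _ = (2 * pi) ^ CARD('n)"

lemma plancherel_const_pos [simp]: "plancherel_const TYPE('n) > 0"
 by (simp add: plancherel_const_def)

lemma plancherel_const_neq_0 [simp]: "plancherel_const TYPE('n) ~= 0"
 by (simp add: plancherel_const_def)

lemma plancherel_const_nonneg [simp]: "plancherel_const TYPE('n) \<ge> 0"
 by (simp add: plancherel_const_def)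

lemma fourier_integral_norm:
 fixes f :: "real^'n => complex"
 assumes "f \<in> L2" "cell_supported f"
 shows "L2norm (fourier_integral f) = sqrt (plancherel_const TYPE('n)) * L2norm f"
proof -
 have "ennreal ((L2norm (fourier_integral f))\<^sup>2) = ennreal (plancherel_const TYPE('n) * (L2norm f)\<^sup>2)"
  using Plancherel_cell_supported[OF assms]
  unfolding nn_integral_Lsq_norm[OF assms(1)] nn_integral_Lsq_norm[OF fourier_integral_Lsq[OF assms]]
  by (simp add: plancherel_const_def ennreal_mult)
 hence "(L2norm (fourier_integral f))\<^sup>2 = (sqrt (plancherel_const TYPE('n)) * L2norm f)\<^sup>2"
  by (subst (asm) ennreal_inj) (auto simp: power_mult_distrib less_imp_le)
 thus ?thesis by (rule power2_eq_imp_eq) (auto intro!: mult_nonneg_nonneg simp: less_imp_le)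
qed

lemma restrict_cell_Cauchy:
 assumes f: "f \<in> L2" and e: "e > 0"
 shows "\<exists>N. \<forall>m\<ge>N. \<forall>n\<ge>N. L2norm (\<lambda>x. restrict_cell (real (Suc m)) f x - restrict_cell (real (Suc n)) f x) < e"
proof -
 from order_tendstoD(2)[OF restrict_cell_tendsto[OF f], of "e/2"] e
 obtain N where N: "!!m. m \<ge> N ==> L2norm (\<lambda>x. restrict_cell (real (Suc m)) f x - f x) < e / 2"
  by (auto simp: eventually_sequentially)
 have "L2norm (\<lambda>x. restrict_cell (real (Suc m)) f x - restrict_cell (real (Suc n)) f x) < e"
  if "m \<ge> N" "n \<ge> N" for m n
 proof -
  have "L2norm (\<lambda>x. restrict_cell (real (Suc m)) f x - restrict_cell (real (Suc n)) f x)
   \<le> L2norm (\<lambda>x. restrict_cell (real (Suc m)) f x - f x) + L2norm (\<lambda>x. f x - restrict_cell (real (Suc n)) f x)"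
   by (intro Lsq_norm_triangle_diff restrict_cell_Lsq f)
  also have "L2norm (\<lambda>x. f x - restrict_cell (real (Suc n)) f x) = L2norm (\<lambda>x. restrict_cell (real (Suc n)) f x - f x)"
   by (rule Lsq_norm_minus_commute)
  finally show ?thesis using N[OF that(1)] N[OF that(2)] by linarith
 qed
 thus ?thesis by blast
qed

lemma fourier_integral_restrict_cell_limit:
 fixes f :: "real^'n => complex"
 assumes f: "f \<in> L2"
 shows "\<exists>g\<in>L2. (\<lambda>m. L2norm (\<lambda>y. fourier_integral (restrict_cell (real (Suc m)) f) y - g y)) \<longlonglongrightarrow> 0"
proof (rule Lsq_complete)
 define F where "F m = restrict_cell (real (Suc m)) f" for m
 have F: "F m \<in> L2" "cell_supported (F m)" for m
  by (simp_all add: F_def f restrict_cell_Lsq cell_supported_restrict)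
 show "fourier_integral (restrict_cell (real (Suc m)) f) \<in> L2" for m
  using fourier_integral_Lsq[OF F, of m] by (simp add: F_def)
 fix e :: real assume e: "e > 0"
 define c where "c = sqrt (plancherel_const TYPE('n))"
 have c: "c > 0" by (simp add: c_def)
 have eq: "L2norm (\<lambda>y. fourier_integral (F m) y - fourier_integral (F n) y) = c * L2norm (\<lambda>x. F m x - F n x)" for m n
 proof -
  have "fourier_integral (\<lambda>x. F m x - F n x) = (\<lambda>y. fourier_integral (F m) y - fourier_integral (F n) y)"
   using F by (intro ext fourier_integral_linear(2) cell_supported_integrable)
  thus ?thesis
   using fourier_integral_norm[OF Lsq_diff[OF F(1) F(1)] cell_supported_diff[OF F(2) F(2)], of m n]
   by (simp add: c_def)
 qed
 obtain N where "\<forall>m\<ge>N. \<forall>n\<ge>N. L2norm (\<lambda>x. F m x - F n x) < e / c"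
  using restrict_cell_Cauchy[OF f, of "e / c"] e c unfolding F_def by auto
 hence "\<forall>m\<ge>N. \<forall>n\<ge>N. L2norm (\<lambda>y. fourier_integral (F m) y - fourier_integral (F n) y) < e"
  unfolding eq using c by (simp add: field_simps)
 thus "\<exists>N. \<forall>m\<ge>N. \<forall>n\<ge>N. L2norm (\<lambda>y. fourier_integral (restrict_cell (real (Suc m)) f) y - fourier_integral (restrict_cell (real (Suc n)) f) y) < e"
  by (auto simp: F_def)
qed

lemma is_fourier_restrict_cell:
 assumes f: "f \<in> L2" and g: "g \<in> L2"
  and lim: "(\<lambda>m. L2norm (\<lambda>y. fourier_integral (restrict_cell (real (Suc m)) f) y - g y)) \<longlonglongrightarrow> 0"
 shows "is_fourier f g"
 unfolding is_fourier_def
proof (intro conjI exI[of _ "\<lambda>m. restrict_cell (real (Suc m)) f"] allI)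
 fix m
 have F: "restrict_cell (real (Suc m)) f \<in> L2" "cell_supported (restrict_cell (real (Suc m)) f)"
  by (simp_all add: f restrict_cell_Lsq cell_supported_restrict)
 show "restrict_cell (real (Suc m)) f \<in> L2" by (rule F)
 show "integrable lborel (restrict_cell (real (Suc m)) f)" by (rule cell_supported_integrable[OF F])
 show "fourier_integral (restrict_cell (real (Suc m)) f) \<in> L2" by (rule fourier_integral_Lsq[OF F])
qed (use g lim restrict_cell_tendsto[OF f] in auto)

lemma is_fourier_fourier:
 assumes "f \<in> L2"
 shows "is_fourier f (fourier f)"
proof -
 obtain g where "g \<in> L2"
  "(\<lambda>m. L2norm (\<lambda>y. fourier_integral (restrict_cell (real (Suc m)) f) y - g y)) \<longlonglongrightarrow> 0"
  using fourier_integral_restrict_cell_limit[OF assms] by blast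
 hence "is_fourier f g" by (rule is_fourier_restrict_cell[OF assms])
 thus ?thesis unfolding fourier_def by (rule someI[of "is_fourier f"])
qed

lemma fourier_Lsq: "f \<in> L2 ==> fourier f \<in> L2"
 using is_fourier_fourier by (auto simp: is_fourier_def)

text \<open>By Fubini's theorem the Fourier integral is symmetric.  Since it is defined by two different
 limits, this symmetry is what makes the transform on \<open>L\<^sup>2\<close> independent of the approximation.\<close>

lemma fourier_integral_symmetric:
 fixes f h :: "real^'n => complex"
 assumes f: "integrable lborel f" and h: "integrable lborel h"
 shows "(\<integral>y. fourier_integral f y * h y \<partial>lborel) = (\<integral>x. f x * fourier_integral h x \<partial>lborel)"
proof -
 have [measurable]: "f \<in> borelfun" "h \<in> borelfun" using f h by auto
 let ?k = "\<lambda>y x. exp (- (\<i> * cplx (x \<bullet> y)))"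
 have km [measurable]: "(\<lambda>p. case p of (y, x) => ?k y x) \<in> borel_measurable ((lborel :: (real^'n) measure) \<Otimes>\<^sub>M (lborel :: (real^'n) measure))"
  using fourier_integral_kernel_measurable[where 'n = 'n]
  by (simp add: measurable_cong_sets[OF sets_pair_measure_cong[OF sets_lborel sets_lborel] refl])
 have "integrable (lborel \<Otimes>\<^sub>M lborel) (\<lambda>p. (f (fst p) * h (snd p)) * (case p of (y, x) => ?k y x))"
 proof (rule Bochner_Integration.integrable_bound)
  show "integrable (lborel \<Otimes>\<^sub>M lborel) (\<lambda>p. f (fst p) * h (snd p))"
  proof (rule lborel_pair.Fubini_integrable)
   show "integrable lborel (\<lambda>x. \<integral>z. norm (f (fst (x, z)) * h (snd (x, z))) \<partial>lborel)"
    using f by (simp add: norm_mult)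
   show "AE x in lborel. integrable lborel (\<lambda>z. f (fst (x, z)) * h (snd (x, z)))" using h by simp
  qed measurable
 qed (auto simp: norm_mult)
 hence i: "integrable (lborel \<Otimes>\<^sub>M lborel) (\<lambda>(x, y). f x * ?k y x * h y)"
  by (simp add: case_prod_unfold mult_ac inner_commute)
 have "(\<integral>y. fourier_integral f y * h y \<partial>lborel) = (\<integral>y. (\<integral>x. f x * ?k y x * h y \<partial>lborel) \<partial>lborel)"
  by (simp add: fourier_integral_def)
 also have "... = (\<integral>x. (\<integral>y. f x * ?k y x * h y \<partial>lborel) \<partial>lborel)"
  by (rule lborel_pair.Fubini_integral[OF i])
 also have "... = (\<integral>x. f x * fourier_integral h x \<partial>lborel)"
  by (simp add: fourier_integral_def mult.assoc mult.commute[of "exp _"] inner_commute)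
 finally show ?thesis .
qed

lemma is_fourier_symmetric:
 fixes f g h :: "real^'n => complex"
 assumes fg: "is_fourier f g" and f: "f \<in> L2" and h: "h \<in> L2" "cell_supported h"
 shows "(\<integral>y. g y * h y \<partial>lborel) = (\<integral>x. f x * fourier_integral h x \<partial>lborel)"
proof -
 obtain F where F: "!!m. F m \<in> L2" "!!m. integrable lborel (F m)" "!!m. fourier_integral (F m) \<in> L2"
  and Ff: "(\<lambda>m. L2norm (\<lambda>x. F m x - f x)) \<longlonglongrightarrow> 0"
  and Fg: "(\<lambda>m. L2norm (\<lambda>y. fourier_integral (F m) y - g y)) \<longlonglongrightarrow> 0"
  and g: "g \<in> L2"
  using fg unfolding is_fourier_def by blast
 have hi: "integrable lborel h" by (rule cell_supported_integrable[OF h])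
 have "(\<lambda>m. L2inner (fourier_integral (F m)) (\<lambda>y. cnj (h y))) \<longlonglongrightarrow> L2inner g (\<lambda>y. cnj (h y))"
  by (rule Lsq_inner_tendsto[OF F(3) g Lsq_cnj[OF h(1)] Fg])
 moreover have "(\<lambda>m. L2inner (F m) (\<lambda>y. cnj (fourier_integral h y))) \<longlonglongrightarrow> L2inner f (\<lambda>y. cnj (fourier_integral h y))"
  by (rule Lsq_inner_tendsto[OF F(1) f Lsq_cnj[OF fourier_integral_Lsq[OF h]] Ff])
 moreover have "L2inner (fourier_integral (F m)) (\<lambda>y. cnj (h y)) = L2inner (F m) (\<lambda>y. cnj (fourier_integral h y))" for m
  using fourier_integral_symmetric[OF F(2) hi] by (simp add: Lsq_inner_def)
 ultimately have "L2inner g (\<lambda>y. cnj (h y)) = L2inner f (\<lambda>y. cnj (fourier_integral h y))"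
  using LIMSEQ_unique by fastforce
 thus ?thesis by (simp add: Lsq_inner_def)
qed

lemma AE_eq_0_if_cell_orthogonal:
 assumes d: "d \<in> Lsq (lborel :: (real^'n) measure)"
  and orth: "!!h. h \<in> L2 ==> cell_supported h ==> (\<integral>y. d y * h y \<partial>lborel) = 0"
 shows "AE y in lborel. d y = 0"
proof -
 have "L2norm (restrict_cell (real (Suc m)) d) = 0" for m
 proof -
  let ?r = "restrict_cell (real (Suc m)) d"
  let ?h = "\<lambda>y. cnj (?r y)"
  have "?h \<in> L2" by (intro Lsq_cnj restrict_cell_Lsq d)
  moreover have "cell_supported ?h"
   using cell_supported_restrict[of "real (Suc m)" d] by (auto simp: cell_supported_def)
  ultimately have "(\<integral>y. d y * ?h y \<partial>lborel) = 0" by (rule orth)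
  also have "(\<lambda>y. d y * ?h y) = (\<lambda>y. ?r y * cnj (?r y))"
   by (auto simp: restrict_cell_def)
  finally have "L2inner ?r ?r = 0" by (simp add: Lsq_inner_def)
  thus ?thesis by (simp add: Lsq_inner_self)
 qed
 moreover have "(\<lambda>m. L2norm (restrict_cell (real (Suc m)) d)) \<longlonglongrightarrow> L2norm d"
  by (rule Lsq_norm_tendsto[OF restrict_cell_Lsq[OF d] d restrict_cell_tendsto[OF d]])
 ultimately have "L2norm d = 0" by (simp add: LIMSEQ_const_iff)
 thus ?thesis using Lsq_norm_eq_0_iff[OF d] by blast
qed

text \<open>By symmetry of the Fourier integral, both candidates have the same integrals against functions supported in cubes.\<close>

theorem is_fourier_unique:
 fixes f g g' :: "real^'n => complex"
 assumes "is_fourier f g" "is_fourier f g'" and f: "f \<in> L2"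
 shows "AE y in lborel. g y = g' y"
proof -
 have g: "g \<in> L2" "g' \<in> L2" using assms by (auto simp: is_fourier_def)
 have "AE y in lborel. g y - g' y = 0"
 proof (rule AE_eq_0_if_cell_orthogonal[OF Lsq_diff[OF g]])
  fix h :: "real^'n => complex" assume h: "h \<in> L2" "cell_supported h"
  have "integrable lborel (\<lambda>y. g y * h y)" "integrable lborel (\<lambda>y. g' y * h y)"
   using Lsq_inner_integrable[OF g(1) Lsq_cnj[OF h(1)]] Lsq_inner_integrable[OF g(2) Lsq_cnj[OF h(1)]] by auto
  thus "(\<integral>y. (g y - g' y) * h y \<partial>lborel) = 0"
   using is_fourier_symmetric[OF assms(1) f h] is_fourier_symmetric[OF assms(2) f h]
   by (simp add: left_diff_distrib)
 qed
 thus ?thesis by simp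
qed

lemma fourier_AE_eq:
 assumes "is_fourier f g" "f \<in> L2"
 shows "AE y in lborel. fourier f y = g y"
 using is_fourier_unique[OF is_fourier_fourier assms(1)] assms(2) by blast

lemma fourier_cong_AE:
 assumes "f \<in> L2" "g \<in> L2" "AE x in lborel. f x = g x"
 shows "fourier f = fourier g"
proof -
 have "L2norm (\<lambda>x. F x - f x) = L2norm (\<lambda>x. F x - g x)" if "F \<in> L2" for F
 proof (rule Lsq_norm_cong_AE)
  show "AE x in lborel. F x - f x = F x - g x" using assms(3) by eventually_elim simp
 qed (use Lsq_measurable[OF Lsq_diff[OF that assms(1)]] Lsq_measurable[OF Lsq_diff[OF that assms(2)]] in simp_all)
 hence "is_fourier f = is_fourier g"
  unfolding is_fourier_def by (intro ext) (simp cong: conj_cong)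
 thus ?thesis by (simp add: fourier_def)
qed

lemma fourier_norm:
 fixes f :: "real^'n => complex"
 assumes f: "f \<in> L2"
 shows "L2norm (fourier f) = sqrt (plancherel_const TYPE('n)) * L2norm f"
proof -
 obtain g where g: "g \<in> L2"
  "(\<lambda>m. L2norm (\<lambda>y. fourier_integral (restrict_cell (real (Suc m)) f) y - g y)) \<longlonglongrightarrow> 0"
  using fourier_integral_restrict_cell_limit[OF f] by blast
 have F: "restrict_cell (real (Suc m)) f \<in> L2" "cell_supported (restrict_cell (real (Suc m)) f)" for m
  by (simp_all add: f restrict_cell_Lsq cell_supported_restrict)
 have "(\<lambda>m. L2norm (fourier_integral (restrict_cell (real (Suc m)) f))) \<longlonglongrightarrow> L2norm g"
  by (rule Lsq_norm_tendsto[OF fourier_integral_Lsq[OF F] g])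
 moreover have "(\<lambda>m. sqrt (plancherel_const TYPE('n)) * L2norm (restrict_cell (real (Suc m)) f)) \<longlonglongrightarrow> sqrt (plancherel_const TYPE('n)) * L2norm f"
  by (intro tendsto_intros Lsq_norm_tendsto[OF F(1) f restrict_cell_tendsto[OF f]])
 ultimately have "L2norm g = sqrt (plancherel_const TYPE('n)) * L2norm f"
  unfolding fourier_integral_norm[OF F] by (rule LIMSEQ_unique)
 moreover have "L2norm (fourier f) = L2norm g"
  using fourier_AE_eq[OF is_fourier_restrict_cell[OF f g] f] fourier_Lsq[OF f] g
  by (intro Lsq_norm_cong_AE) (auto dest: LsqD)
 ultimately show ?thesis by simp
qed

lemma tendsto_Lsq_norm_add:
 assumes "!!m. F m \<in> Lsq M" "!!m. G m \<in> Lsq M" "f \<in> Lsq M" "g \<in> Lsq M"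
  "(\<lambda>m. Lsq_norm M (\<lambda>x. F m x - f x)) \<longlonglongrightarrow> 0" "(\<lambda>m. Lsq_norm M (\<lambda>x. G m x - g x)) \<longlonglongrightarrow> 0"
 shows "(\<lambda>m. Lsq_norm M (\<lambda>x. (F m x + G m x) - (f x + g x))) \<longlonglongrightarrow> 0"
proof (rule Lim_null_comparison)
 show "(\<lambda>m. Lsq_norm M (\<lambda>x. F m x - f x) + Lsq_norm M (\<lambda>x. G m x - g x)) \<longlonglongrightarrow> 0"
  using tendsto_add[OF assms(5,6)] by simp
 show "\<forall>\<^sub>F m in sequentially. norm (Lsq_norm M (\<lambda>x. (F m x + G m x) - (f x + g x)))
   \<le> Lsq_norm M (\<lambda>x. F m x - f x) + Lsq_norm M (\<lambda>x. G m x - g x)"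
 proof (intro always_eventually allI)
  fix m
  have "(\<lambda>x. (F m x + G m x) - (f x + g x)) = (\<lambda>x. (F m x - f x) + (G m x - g x))" by (simp add: fun_eq_iff)
  thus "norm (Lsq_norm M (\<lambda>x. (F m x + G m x) - (f x + g x)))
   \<le> Lsq_norm M (\<lambda>x. F m x - f x) + Lsq_norm M (\<lambda>x. G m x - g x)"
   using Lsq_norm_triangle[OF Lsq_diff[OF assms(1,3)] Lsq_diff[OF assms(2,4)]] by simp
 qed
qed

lemma is_fourier_add:
 fixes f g :: "real^'n => complex"
 assumes "is_fourier f f'" "is_fourier g g'" "f \<in> L2" "g \<in> L2"
 shows "is_fourier (\<lambda>x. f x + g x) (\<lambda>y. f' y + g' y)"
proof -
 obtain F where F: "!!m. F m \<in> L2" "!!m. integrable lborel (F m)" "!!m. fourier_integral (F m) \<in> L2"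
  "(\<lambda>m. L2norm (\<lambda>x. F m x - f x)) \<longlonglongrightarrow> 0"
  "(\<lambda>m. L2norm (\<lambda>y. fourier_integral (F m) y - f' y)) \<longlonglongrightarrow> 0" "f' \<in> L2"
  using assms(1) unfolding is_fourier_def by blast
 obtain G where G: "!!m. G m \<in> L2" "!!m. integrable lborel (G m)" "!!m. fourier_integral (G m) \<in> L2"
  "(\<lambda>m. L2norm (\<lambda>x. G m x - g x)) \<longlonglongrightarrow> 0"
  "(\<lambda>m. L2norm (\<lambda>y. fourier_integral (G m) y - g' y)) \<longlonglongrightarrow> 0" "g' \<in> L2"
  using assms(2) unfolding is_fourier_def by blast
 have eq: "fourier_integral (\<lambda>x. F m x + G m x) = (\<lambda>y. fourier_integral (F m) y + fourier_integral (G m) y)" for m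
  using fourier_integral_linear(1)[OF F(2) G(2)] by blast
 show ?thesis unfolding is_fourier_def
 proof (intro conjI exI[of _ "\<lambda>m x. F m x + G m x"] allI)
  show "(\<lambda>y. f' y + g' y) \<in> L2" by (intro Lsq_add F G)
  show "(\<lambda>x. F m x + G m x) \<in> L2" for m by (intro Lsq_add F G)
  show "integrable lborel (\<lambda>x. F m x + G m x)" for m using F G by auto
  show "fourier_integral (\<lambda>x. F m x + G m x) \<in> L2" for m unfolding eq by (intro Lsq_add F G)
  show "(\<lambda>m. L2norm (\<lambda>x. F m x + G m x - (f x + g x))) \<longlonglongrightarrow> 0"
   by (rule tendsto_Lsq_norm_add[OF F(1) G(1) assms(3,4) F(4) G(4)])
  show "(\<lambda>m. L2norm (\<lambda>y. fourier_integral (\<lambda>x. F m x + G m x) y - (f' y + g' y))) \<longlonglongrightarrow> 0"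
   unfolding eq by (rule tendsto_Lsq_norm_add[OF F(3) G(3) F(6) G(6) F(5) G(5)])
 qed
qed

lemma is_fourier_scale:
 fixes f :: "real^'n => complex"
 assumes "is_fourier f g"
 shows "is_fourier (\<lambda>x. c * f x) (\<lambda>y. c * g y)"
proof -
 obtain F where F: "!!m. F m \<in> L2" "!!m. integrable lborel (F m)" "!!m. fourier_integral (F m) \<in> L2"
  "(\<lambda>m. L2norm (\<lambda>x. F m x - f x)) \<longlonglongrightarrow> 0"
  "(\<lambda>m. L2norm (\<lambda>y. fourier_integral (F m) y - g y)) \<longlonglongrightarrow> 0" "g \<in> L2"
  using assms(1) unfolding is_fourier_def by blast
 have eq: "fourier_integral (\<lambda>x. c * F m x) = (\<lambda>y. c * fourier_integral (F m) y)" for m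
  by (intro ext fourier_integral_scale)
 show ?thesis unfolding is_fourier_def
 proof (intro conjI exI[of _ "\<lambda>m x. c * F m x"] allI)
  show "(\<lambda>y. c * g y) \<in> L2" by (intro Lsq_scale F)
  show "(\<lambda>x. c * F m x) \<in> L2" for m by (intro Lsq_scale F)
  show "integrable lborel (\<lambda>x. c * F m x)" for m using F by auto
  show "fourier_integral (\<lambda>x. c * F m x) \<in> L2" for m unfolding eq by (intro Lsq_scale F)
  show "(\<lambda>m. L2norm (\<lambda>x. c * F m x - c * f x)) \<longlonglongrightarrow> 0"
   using tendsto_mult_right[OF F(4), of "cmod c"] by (simp add: right_diff_distrib[symmetric] mult.commute)
  show "(\<lambda>m. L2norm (\<lambda>y. fourier_integral (\<lambda>x. c * F m x) y - c * g y)) \<longlonglongrightarrow> 0"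
   unfolding eq using tendsto_mult_right[OF F(5), of "cmod c"] by (simp add: right_diff_distrib[symmetric] mult.commute)
 qed
qed

lemma fourier_add:
 assumes "f \<in> L2" "g \<in> L2"
 shows "AE y in lborel. fourier (\<lambda>x. f x + g x) y = fourier f y + fourier g y"
 by (intro fourier_AE_eq is_fourier_add is_fourier_fourier assms Lsq_add)

lemma fourier_scale:
 assumes "f \<in> L2"
 shows "AE y in lborel. fourier (\<lambda>x. c * f x) y = c * fourier f y"
 by (intro fourier_AE_eq is_fourier_scale is_fourier_fourier assms Lsq_scale)

lemma fourier_diff:
 assumes "f \<in> L2" "g \<in> L2"
 shows "AE y in lborel. fourier (\<lambda>x. f x - g x) y = fourier f y - fourier g y"
proof -
 have "AE y in lborel. fourier (\<lambda>x. f x + (-1) * g x) y = fourier f y + fourier (\<lambda>x. (-1) * g x) y"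
  by (intro fourier_add assms Lsq_scale)
 moreover have "AE y in lborel. fourier (\<lambda>x. (-1) * g x) y = (-1) * fourier g y"
  by (intro fourier_scale assms)
 ultimately show ?thesis by eventually_elim simp
qed

text \<open>Polarization of the norm identity.\<close>

theorem fourier_inner:
 fixes f g :: "real^'n => complex"
 assumes f: "f \<in> L2" and g: "g \<in> L2"
 shows "L2inner (fourier f) (fourier g) = cplx (plancherel_const TYPE('n)) * L2inner f g"
proof -
 let ?c = "plancherel_const TYPE('n)"
 have c: "?c > 0" by simp
 have n2: "(L2norm (fourier h))\<^sup>2 = ?c * (L2norm h)\<^sup>2" if "h \<in> L2" for h :: "real^'n => complex"
  using fourier_norm[OF that] c by (simp add: power_mult_distrib)
 have re: "Re (L2inner (fourier f) (fourier h)) = ?c * Re (L2inner f h)" if h: "h \<in> L2" for h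
 proof -
  have "(L2norm (\<lambda>y. fourier f y + fourier h y))\<^sup>2 = (L2norm (fourier (\<lambda>x. f x + h x)))\<^sup>2"
   using fourier_add[OF f h] Lsq_measurable[OF Lsq_add[OF fourier_Lsq[OF f] fourier_Lsq[OF h]]]
    fourier_Lsq[OF Lsq_add[OF f h]]
   by (intro arg_cong[where f = "\<lambda>t. t\<^sup>2"] Lsq_norm_cong_AE) (auto dest: LsqD)
  hence "(L2norm (fourier f))\<^sup>2 + (L2norm (fourier h))\<^sup>2 + 2 * Re (L2inner (fourier f) (fourier h))
    = ?c * ((L2norm f)\<^sup>2 + (L2norm h)\<^sup>2 + 2 * Re (L2inner f h))"
   using n2[OF Lsq_add[OF f h]] by (simp add: Lsq_norm_add_power2 f h fourier_Lsq)
  thus ?thesis using n2[OF f] n2[OF h] by (simp add: algebra_simps)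
 qed
 have "L2inner (fourier f) (fourier (\<lambda>x. \<i> * g x)) = L2inner (fourier f) (\<lambda>y. \<i> * fourier g y)"
  using fourier_scale[OF g, of \<i>] fourier_Lsq[OF f] fourier_Lsq[OF g] fourier_Lsq[OF Lsq_scale[OF g, of \<i>]]
  by (intro Lsq_inner_cong_AE) (auto dest: LsqD)
 hence "Im (L2inner (fourier f) (fourier g)) = ?c * Im (L2inner f g)"
  using re[OF Lsq_scale[OF g, of \<i>]] by simp
 with re[OF g] show ?thesis by (simp add: complex_eq_iff)
qed

lemma fourier_symmetric:
 fixes f h :: "real^'n => complex"
 assumes f: "f \<in> L2" and h: "h \<in> L2"
 shows "(\<integral>y. fourier f y * h y \<partial>lborel) = (\<integral>x. f x * fourier h x \<partial>lborel)"
proof -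
 obtain g where g: "g \<in> L2"
  and lim: "(\<lambda>m. L2norm (\<lambda>y. fourier_integral (restrict_cell (real (Suc m)) h) y - g y)) \<longlonglongrightarrow> 0"
  using fourier_integral_restrict_cell_limit[OF h] by blast
 define H where "H m = restrict_cell (real (Suc m)) h" for m
 have H: "H m \<in> L2" "cell_supported (H m)" for m
  by (simp_all add: H_def h restrict_cell_Lsq cell_supported_restrict)
 have "(\<lambda>m. L2inner (H m) (\<lambda>x. cnj (fourier f x))) \<longlonglongrightarrow> L2inner h (\<lambda>x. cnj (fourier f x))"
  using restrict_cell_tendsto[OF h] by (intro Lsq_inner_tendsto H h Lsq_cnj fourier_Lsq f) (simp add: H_def)
 moreover have "(\<lambda>m. L2inner (fourier_integral (H m)) (\<lambda>x. cnj (f x))) \<longlonglongrightarrow> L2inner g (\<lambda>x. cnj (f x))"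
  using lim by (intro Lsq_inner_tendsto fourier_integral_Lsq H g Lsq_cnj f) (simp add: H_def)
 moreover have "L2inner (H m) (\<lambda>x. cnj (fourier f x)) = L2inner (fourier_integral (H m)) (\<lambda>x. cnj (f x))" for m
  using is_fourier_symmetric[OF is_fourier_fourier[OF f] f H, of m] by (simp add: Lsq_inner_def mult.commute)
 ultimately have "L2inner h (\<lambda>x. cnj (fourier f x)) = L2inner g (\<lambda>x. cnj (f x))"
  using LIMSEQ_unique by fastforce
 also have "... = L2inner (fourier h) (\<lambda>x. cnj (f x))"
  using fourier_AE_eq[OF is_fourier_restrict_cell[OF h g lim] h] g f fourier_Lsq[OF h]
  by (intro Lsq_inner_cong_AE) (auto dest: LsqD elim: eventually_mono)
 finally show ?thesis by (simp add: Lsq_inner_def mult.commute)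
qed

text \<open>The range of the transform is closed because the transform is isometric up to a constant, and
 a function orthogonal to it has, by symmetry, a vanishing transform.\<close>

theorem fourier_surj:
 fixes g :: "real^'n => complex"
 assumes "g \<in> L2"
 shows "\<exists>f\<in>L2. AE y in lborel. fourier f y = g y"
proof -
 define R where "R = {g \<in> L2. \<exists>f\<in>L2. AE y in lborel. fourier f y = (g :: real^'n => complex) y}"
 let ?c = "sqrt (plancherel_const TYPE('n))"
 have c: "?c > 0" by simp
 have R: "closed_subspace lborel R"
  unfolding closed_subspace_def
 proof (intro conjI ballI allI subsetI)
  fix g h assume "g \<in> R" "h \<in> R"
  then obtain a b where a: "a \<in> L2" "AE y in lborel. fourier a y = g y"
   and b: "b \<in> L2" "AE y in lborel. fourier b y = h y" and gh: "g \<in> L2" "h \<in> L2"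
   by (auto simp: R_def)
  have "AE y in lborel. fourier (\<lambda>x. a x + b x) y = g y + h y"
   using fourier_add[OF a(1) b(1)] a(2) b(2) by eventually_elim simp
  thus "(\<lambda>x. g x + h x) \<in> R" using Lsq_add[OF a(1) b(1)] gh by (auto simp: R_def intro: Lsq_add)
 next
  fix z g assume "g \<in> R"
  then obtain a where a: "a \<in> L2" "AE y in lborel. fourier a y = g y" and g: "g \<in> L2"
   by (auto simp: R_def)
  have "AE y in lborel. fourier (\<lambda>x. z * a x) y = z * g y"
   using fourier_scale[OF a(1), of z] a(2) by eventually_elim simp
  thus "(\<lambda>x. z * g x) \<in> R" using Lsq_scale[OF a(1), of z] g by (auto simp: R_def intro: Lsq_scale)
 next
  have "AE y in lborel. fourier (\<lambda>x. 0) y = (0::complex)" for f :: "real^'n => complex"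
   using fourier_scale[OF Lsq_zero, of 0] by simp
  thus "(\<lambda>x. 0) \<in> R" by (auto simp: R_def intro: bexI[of _ "\<lambda>x. 0"])
 next
  fix g assume g: "g \<in> Lsq_closure lborel R"
  hence gL: "g \<in> L2" by (simp add: Lsq_closure_def)
  have "\<forall>n. \<exists>f\<in>L2. L2norm (\<lambda>x. g x - fourier f x) < 1 / Suc n"
  proof
   fix n
   have "1 / real (Suc n) > 0" by simp
   then obtain h where h: "h \<in> R" "L2norm (\<lambda>x. g x - h x) < 1 / Suc n"
    using g unfolding Lsq_closure_def by blast
   then obtain f where f: "f \<in> L2" "AE y in lborel. fourier f y = h y" and hL: "h \<in> L2"
    by (auto simp: R_def)
   have "L2norm (\<lambda>x. g x - fourier f x) = L2norm (\<lambda>x. g x - h x)"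
    using f(2) Lsq_measurable[OF Lsq_diff[OF gL fourier_Lsq[OF f(1)]]] Lsq_measurable[OF Lsq_diff[OF gL hL]]
    by (intro Lsq_norm_cong_AE) (auto elim: eventually_mono)
   thus "\<exists>f\<in>L2. L2norm (\<lambda>x. g x - fourier f x) < 1 / Suc n"
    using f(1) h(2) by (intro bexI[of _ f]) simp_all
  qed
  then obtain F where F: "!!n. F n \<in> L2" and Fg: "!!n. L2norm (\<lambda>x. g x - fourier (F n) x) < 1 / Suc n"
   by metis
  have FL: "fourier (F n) \<in> L2" for n by (rule fourier_Lsq[OF F])
  have dist: "L2norm (\<lambda>x. fourier a x - fourier b x) = ?c * L2norm (\<lambda>x. a x - b x)"
   if "a \<in> L2" "b \<in> L2" for a b :: "real^'n => complex"
  proof -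
   have "L2norm (\<lambda>x. fourier a x - fourier b x) = L2norm (fourier (\<lambda>x. a x - b x))"
    using fourier_diff[OF that] Lsq_measurable[OF Lsq_diff[OF fourier_Lsq[OF that(1)] fourier_Lsq[OF that(2)]]]
     fourier_Lsq[OF Lsq_diff[OF that]]
    by (intro Lsq_norm_cong_AE) (auto dest: LsqD)
   thus ?thesis using fourier_norm[OF Lsq_diff[OF that]] by simp
  qed
  have lim: "(\<lambda>n. L2norm (\<lambda>x. fourier (F n) x - g x)) \<longlonglongrightarrow> 0"
  proof (rule Lim_null_comparison[OF _ LIMSEQ_Suc[OF lim_1_over_n]])
   show "\<forall>\<^sub>F n in sequentially. norm (L2norm (\<lambda>x. fourier (F n) x - g x)) \<le> 1 / real (Suc n)"
    using Fg by (intro always_eventually allI) (simp add: Lsq_norm_minus_commute[of lborel g] less_imp_le)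
  qed
  have "\<exists>f\<in>L2. (\<lambda>n. L2norm (\<lambda>x. F n x - f x)) \<longlonglongrightarrow> 0"
  proof (rule Lsq_complete[OF F])
   fix e :: real assume e: "e > 0"
   obtain N where N: "!!n. n \<ge> N ==> L2norm (\<lambda>x. fourier (F n) x - g x) < ?c * e / 2"
    using order_tendstoD(2)[OF lim, of "?c * e / 2"] e c by (auto simp: eventually_sequentially)
   have "L2norm (\<lambda>x. F m x - F n x) < e" if "m \<ge> N" "n \<ge> N" for m n
   proof -
    have "?c * L2norm (\<lambda>x. F m x - F n x) \<le>
      L2norm (\<lambda>x. fourier (F m) x - g x) + L2norm (\<lambda>x. g x - fourier (F n) x)"
     unfolding dist[OF F F, symmetric] by (intro Lsq_norm_triangle_diff FL gL)
    also have "... < ?c * e"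
     using N[OF that(1)] N[OF that(2)] by (simp add: Lsq_norm_minus_commute[of lborel g])
    finally show ?thesis using c by (simp add: mult_less_cancel_left_pos)
   qed
   thus "\<exists>N. \<forall>m\<ge>N. \<forall>n\<ge>N. L2norm (\<lambda>x. F m x - F n x) < e" by blast
  qed
  then obtain f where f: "f \<in> L2" and Ff: "(\<lambda>n. L2norm (\<lambda>x. F n x - f x)) \<longlonglongrightarrow> 0" by blast
  have "(\<lambda>n. L2norm (\<lambda>x. fourier (F n) x - g x) + ?c * L2norm (\<lambda>x. F n x - f x)) \<longlonglongrightarrow> 0 + ?c * 0"
   by (intro tendsto_intros lim Ff)
  moreover have "L2norm (\<lambda>x. fourier f x - g x) \<le>
    L2norm (\<lambda>x. fourier (F n) x - g x) + ?c * L2norm (\<lambda>x. F n x - f x)" for n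
   using Lsq_norm_triangle_diff[OF fourier_Lsq[OF f] FL gL, of n] dist[OF F f, of n]
    Lsq_norm_minus_commute[of lborel "fourier f" "fourier (F n)"] by simp
  ultimately have "L2norm (\<lambda>x. fourier f x - g x) \<le> 0 + ?c * 0"
   by (intro LIMSEQ_le_const) auto
  hence "L2norm (\<lambda>x. fourier f x - g x) \<le> 0" by simp
  hence "AE x in lborel. fourier f x - g x = 0"
   using Lsq_norm_eq_0_iff[OF Lsq_diff[OF fourier_Lsq[OF f] gL]] Lsq_norm_nonneg[of lborel "\<lambda>x. fourier f x - g x"] by simp
  hence "AE x in lborel. fourier f x = g x" by simp
  thus "g \<in> R" using f gL by (auto simp: R_def)
 qed (auto simp: R_def)
 have "L2 \<subseteq> R"
 proof (rule closed_subspace_eqI[OF _ R])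
  show "closed_subspace lborel (Lsq (lborel :: (real^'n) measure))"
   by (auto simp: closed_subspace_def Lsq_closure_def intro: Lsq_add Lsq_scale)
  show "R \<subseteq> L2" by (auto simp: R_def)
  fix h assume h: "h \<in> L2" and orth: "!!g. g \<in> R ==> L2inner h g = 0"
  define k where "k = (\<lambda>x. cnj (h x))"
  have k: "k \<in> L2" unfolding k_def by (rule Lsq_cnj[OF h])
  define f where "f = (\<lambda>x. cnj (fourier k x))"
  have f: "f \<in> L2" unfolding f_def by (intro Lsq_cnj fourier_Lsq k)
  have "fourier f \<in> R" using f fourier_Lsq[OF f] by (auto simp: R_def)
  hence "L2inner (fourier f) h = 0" using orth[of "fourier f"] Lsq_inner_commute[of lborel "fourier f" h] by simp
  hence "(\<integral>y. fourier f y * k y \<partial>lborel) = 0" by (simp add: Lsq_inner_def k_def)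
  hence "(\<integral>x. fourier k x * cnj (fourier k x) \<partial>lborel) = 0"
   using fourier_symmetric[OF f k] by (simp add: f_def mult.commute)
  hence "L2inner (fourier k) (fourier k) = 0" by (simp add: Lsq_inner_def)
  hence "L2norm (fourier k) = 0" by (simp add: Lsq_inner_self)
  hence "L2norm k = 0" using fourier_norm[OF k] plancherel_const_pos[where 'n='n] by simp
  hence "AE x in lborel. k x = 0" using Lsq_norm_eq_0_iff[OF k] by blast
  thus "AE x in lborel. h x = 0" by (simp add: k_def)
 qed
 thus ?thesis using assms by (auto simp: R_def)
qed

section \<open>Linear changes of variables\<close>

lemma matrix_vector_measurable [measurable]: "(\<lambda>x::real^'n. M *v x) \<in> borel \<rightarrow>\<^sub>M (borel :: (real^'m) measure)"
 by (intro borel_measurable_continuous_onI linear_continuous_on matrix_vector_mul_bounded_linear)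

text \<open>The factor is determined by the matrix, so identities between matrices turn into equations between factors.\<close>

definition scales_volume :: "real^'n^'n => real => bool" where
 "scales_volume M k \<longleftrightarrow> 0 < k \<and> (\<forall>A\<in>sets borel. emeasure lborel {x. M *v x \<in> A} = ennreal k * emeasure lborel A)"

lemma ennreal_cancel_right:
 assumes "0 < b" "x * ennreal b = y * ennreal b"
 shows "x = y"
proof -
 have b: "ennreal b * ennreal (1 / b) = 1" using assms(1) by (simp add: ennreal_mult[symmetric])
 have "x = x * ennreal b * ennreal (1 / b)" by (simp only: mult.assoc b) simp
 also have "... = y" unfolding assms(2) by (simp only: mult.assoc b) simp
 finally show ?thesis .
qed

lemma preimage_matrix_borel [measurable]: "A \<in> sets borel ==> {x::real^'n. M *v x \<in> A} \<in> sets borel"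
 using measurable_sets[OF matrix_vector_measurable, of A M] by (simp add: vimage_def)

text \<open>The uniqueness argument for Haar measure, applied to the image of Lebesgue measure, shows that
 an invertible matrix scales all volumes by one factor.\<close>

lemma scales_volume_exists:
 fixes M :: "real^'n^'n"
 assumes "invertible M"
 shows "\<exists>k. scales_volume M k"
proof -
 obtain N where MN: "M ** N = mat 1" "N ** M = mat 1" using assms by (auto simp: invertible_def)
 have MN': "M *v (N *v y) = y" "N *v (M *v y) = y" for y
  by (simp_all add: matrix_vector_mul_assoc MN)
 define B :: "(real^'n) set" where "B = ball 0 1"
 have B [measurable]: "B \<in> sets borel" by (simp add: B_def)
 have symB: "- y \<in> B \<longleftrightarrow> y \<in> B" for y by (simp add: B_def)
 define \<mu> where "\<mu> A = (\<integral>\<^sup>+x. indicator A (M *v x) \<partial>lborel)" for A :: "(real^'n) set"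
 have \<mu>: "\<mu> A = emeasure lborel {x. M *v x \<in> A}" if [measurable]: "A \<in> sets borel" for A
 proof -
  have "\<mu> A = (\<integral>\<^sup>+x. indicator {x. M *v x \<in> A} x \<partial>lborel)"
   unfolding \<mu>_def by (intro nn_integral_cong) (simp add: indicator_def)
  thus ?thesis using preimage_matrix_borel[OF that, of M] by simp
 qed
 have shift: "(\<integral>\<^sup>+x. f (M *v x + y) \<partial>lborel) = (\<integral>\<^sup>+x. f (M *v x) \<partial>lborel)"
  if [measurable]: "f \<in> borelfun" for f :: "real^'n => ennreal" and y
  using nn_integral_lborel_translate[of "\<lambda>x. f (M *v x)" "N *v y"]
  by (simp add: matrix_vector_right_distrib MN')
 have *: "\<mu> A * emeasure lborel B = emeasure lborel A * \<mu> B" if [measurable]: "A \<in> sets borel" for A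
 proof -
  have "\<mu> A * emeasure lborel B = (\<integral>\<^sup>+y. \<mu> A * indicator B y \<partial>lborel)"
   by (simp add: nn_integral_cmult_indicator)
  also have "... = (\<integral>\<^sup>+y. (\<integral>\<^sup>+x. indicator A (M *v x + y) * indicator B y \<partial>lborel) \<partial>lborel)"
   by (subst nn_integral_multc) (auto simp: \<mu>_def shift[of "indicator A"])
  also have "... = (\<integral>\<^sup>+x. (\<integral>\<^sup>+y. indicator A (M *v x + y) * indicator B y \<partial>lborel) \<partial>lborel)"
   by (rule lborel_pair.Fubini') measurable
  also have "... = (\<integral>\<^sup>+x. (\<integral>\<^sup>+y. indicator A y * indicator B (y - M *v x) \<partial>lborel) \<partial>lborel)"
  proof (rule nn_integral_cong)
   fix x show "(\<integral>\<^sup>+y. indicator A (M *v x + y) * indicator B y \<partial>lborel) = (\<integral>\<^sup>+y. indicator A y * indicator B (y - M *v x) \<partial>lborel)"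
    using nn_integral_lborel_translate[of "\<lambda>y. indicator A y * indicator B (y - M *v x)" "M *v x"]
    by (simp add: add.commute)
  qed
  also have "... = (\<integral>\<^sup>+y. (\<integral>\<^sup>+x. indicator A y * indicator B (y - M *v x) \<partial>lborel) \<partial>lborel)"
   by (rule lborel_pair.Fubini') measurable
  also have "... = (\<integral>\<^sup>+y. indicator A y * \<mu> B \<partial>lborel)"
  proof (rule nn_integral_cong)
   fix y
   have "(\<integral>\<^sup>+x. indicator B (y - M *v x) \<partial>lborel) = (\<integral>\<^sup>+x. indicator B (M *v x + (- y)) \<partial>lborel)"
    using symB[of "y - M *v x" for x] by (intro nn_integral_cong) (simp add: indicator_def)
   also have "... = \<mu> B" using shift[of "indicator B" "- y"] by (simp add: \<mu>_def)
   finally show "(\<integral>\<^sup>+x. indicator A y * indicator B (y - M *v x) \<partial>lborel) = indicator A y * \<mu> B"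
    by (subst nn_integral_cmult) auto
  qed
  also have "... = emeasure lborel A * \<mu> B" by (subst nn_integral_multc) auto
  finally show ?thesis .
 qed
 have bdd: "bounded {x. M *v x \<in> B}"
 proof -
  have "{x. M *v x \<in> B} \<subseteq> (\<lambda>y. N *v y) ` B" using MN'(2)[symmetric] by blast
  moreover have "bounded ((\<lambda>y. N *v y) ` B)"
   by (intro bounded_linear_image matrix_vector_mul_bounded_linear) (simp add: B_def)
  ultimately show ?thesis by (rule bounded_subset[rotated])
 qed
 have \<mu>B: "\<mu> B < \<infinity>" using emeasure_bounded_finite[OF bdd] by (simp add: \<mu>[OF B])
 have B0: "emeasure lborel B ~= 0"
  using negligible_iff_emeasure0[of B] open_not_negligible[of B] by (auto simp: B_def)
 have Bf: "emeasure lborel B < \<infinity>" using emeasure_bounded_finite[of B] by (simp add: B_def)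
 have \<mu>B0: "\<mu> B ~= 0"
 proof
  assume "\<mu> B = 0"
  with *[of UNIV] B0 have "\<mu> UNIV = 0" by simp
  thus False by (simp add: \<mu>)
 qed
 define k where "k = enn2real (\<mu> B) / enn2real (emeasure lborel B)"
 have e: "\<mu> B = ennreal (enn2real (\<mu> B))" "emeasure lborel B = ennreal (enn2real (emeasure lborel B))"
  using \<mu>B Bf by (simp_all add: ennreal_enn2real_if)
 have pos: "enn2real (\<mu> B) > 0" "enn2real (emeasure lborel B) > 0"
  using \<mu>B Bf \<mu>B0 B0 by (auto simp: enn2real_positive_iff zero_less_iff_neq_zero)
 have "scales_volume M k" unfolding scales_volume_def
 proof (intro conjI ballI)
  show "k > 0" using pos by (simp add: k_def)
  fix A :: "(real^'n) set" assume A [measurable]: "A \<in> sets borel"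
  define b where "b = enn2real (emeasure lborel B)"
  have b: "b > 0" and eb: "emeasure lborel B = ennreal b" using pos e by (simp_all add: b_def)
  have kb: "\<mu> B = ennreal k * ennreal b"
  proof -
   have "k * b = enn2real (\<mu> B)" using b by (simp add: k_def b_def)
   moreover have "ennreal k * ennreal b = ennreal (k * b)" 
    by (rule ennreal_mult[symmetric]) (use b pos in \<open>simp_all add: k_def\<close>)
   ultimately show ?thesis using e(1) by (simp only:)
  qed
  have "\<mu> A * ennreal b = (ennreal k * emeasure lborel A) * ennreal b"
   using *[OF A] by (simp add: eb kb mult_ac)
  hence "\<mu> A = ennreal k * emeasure lborel A"
   by (rule ennreal_cancel_right[OF b])
  thus "emeasure lborel {x. M *v x \<in> A} = ennreal k * emeasure lborel A" by (simp add: \<mu>)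
 qed
 thus ?thesis ..
qed

lemma scales_volume_unique:
 assumes "scales_volume M k" "scales_volume M k'"
 shows "k = k'"
proof -
 have "ennreal k * ennreal ((2 * pi) ^ CARD('a)) = ennreal k' * ennreal ((2 * pi) ^ CARD('a))"
  using assms cell_borel unfolding scales_volume_def emeasure_cell[where 'n = 'a, symmetric] by metis
 hence "ennreal k = ennreal k'" by (rule ennreal_cancel_right[rotated]) simp
 thus ?thesis using assms by (simp add: scales_volume_def)
qed

lemma scales_volume_mult:
 fixes M N :: "real^'n^'n"
 assumes "scales_volume M k" "scales_volume N l"
 shows "scales_volume (M ** N) (k * l)"
 unfolding scales_volume_def
proof (intro conjI ballI)
 fix A :: "(real^'n) set" assume A: "A \<in> sets borel"
 have "emeasure lborel {x. (M ** N) *v x \<in> A} = emeasure lborel {x. N *v x \<in> {y. M *v y \<in> A}}"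
  by (simp add: matrix_vector_mul_assoc)
 also have "... = ennreal l * (ennreal k * emeasure lborel A)"
 proof -
  have "emeasure lborel {x. N *v x \<in> {y. M *v y \<in> A}} = ennreal l * emeasure lborel {y. M *v y \<in> A}"
   using assms(2) preimage_matrix_borel[OF A, of M] unfolding scales_volume_def by blast
  moreover have "emeasure lborel {y. M *v y \<in> A} = ennreal k * emeasure lborel A"
   using assms(1) A unfolding scales_volume_def by blast
  ultimately show ?thesis by simp
 qed
 also have "... = ennreal (k * l) * emeasure lborel A"
  using assms by (simp add: scales_volume_def ennreal_mult mult_ac)
 finally show "emeasure lborel {x. (M ** N) *v x \<in> A} = ennreal (k * l) * emeasure lborel A" .
qed (use assms in \<open>auto simp: scales_volume_def\<close>)

lemma scales_volume_mat_1: "scales_volume (mat 1) 1"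
 by (simp add: scales_volume_def)

lemma scales_volume_diagonal:
 fixes M :: "real^'n^'n"
 assumes diag: "!!i j. i ~= j ==> M $ i $ j = 0" and det: "det M ~= 0"
 shows "scales_volume M (1 / \<bar>det M\<bar>)"
proof -
 define c where "c j = (M *v j) \<bullet> j" for j
 have d: "det M = (\<Prod>i\<in>UNIV. M $ i $ i)" by (rule det_diagonal) (rule diag)
 have cM: "c (axis i 1) = M $ i $ i" for i
  by (simp add: c_def inner_axis matrix_vector_mul_component inner_commute[of _ "axis i 1"])
 have Mx: "M *v x = 0 + (\<Sum>j\<in>Basis. (c j * (x \<bullet> j)) *\<^sub>R j)" for x
 proof -
  have "(M *v x) $ i = M $ i $ i * x $ i" for i
  proof -
   have "(M *v x) $ i = (\<Sum>j\<in>UNIV. if j = i then M $ i $ i * x $ i else 0)"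
    unfolding matrix_vector_mult_def vec_lambda_beta by (intro sum.cong) (auto simp: diag)
   thus ?thesis by simp
  qed
  hence "(M *v x) \<bullet> b = c b * (x \<bullet> b)" if "b \<in> Basis" for b
   using that by (auto simp: Basis_vec_def cM inner_axis)
  hence "M *v x = (\<Sum>j\<in>Basis. (c j * (x \<bullet> j)) *\<^sub>R j)"
   using euclidean_representation[of "M *v x"] by (simp cong: sum.cong)
  thus ?thesis by simp
 qed
 have Basis_range: "(Basis :: (real^'n) set) = range (\<lambda>i. axis i 1)" by (auto simp: Basis_vec_def)
 have prod: "(\<Prod>j\<in>Basis. \<bar>c j\<bar>) = \<bar>det M\<bar>"
  unfolding Basis_range d by (subst prod.reindex) (auto simp: cM abs_prod inj_on_def axis_eq_axis)
 have ne: "c j ~= 0" if "j \<in> Basis" for j using that det d cM by (auto simp: Basis_range)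
 have L: "lborel = density (distr lborel borel (\<lambda>x. M *v x)) (\<lambda>_. ennreal \<bar>det M\<bar>)"
  using lborel_affine_euclidean[where c = c and t = 0, OF ne] by (simp add: Mx prod)
 show ?thesis unfolding scales_volume_def
 proof (intro conjI ballI)
  fix A :: "(real^'n) set" assume A [measurable]: "A \<in> sets borel"
  have "emeasure lborel A = emeasure (density (distr lborel borel (\<lambda>x. M *v x)) (\<lambda>_. ennreal \<bar>det M\<bar>)) A"
   by (subst L) simp
  also have "... = ennreal \<bar>det M\<bar> * emeasure lborel {x. M *v x \<in> A}"
   by (simp add: emeasure_density nn_integral_cmult_indicator emeasure_distr vimage_def)
  finally have "ennreal (1 / \<bar>det M\<bar>) * emeasure lborel A
    = (ennreal (1 / \<bar>det M\<bar>) * ennreal \<bar>det M\<bar>) * emeasure lborel {x. M *v x \<in> A}"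
   by (simp add: mult.assoc)
  also have "ennreal (1 / \<bar>det M\<bar>) * ennreal \<bar>det M\<bar> = 1"
   using det by (simp add: ennreal_mult[symmetric])
  finally show "emeasure lborel {x. M *v x \<in> A} = ennreal (1 / \<bar>det M\<bar>) * emeasure lborel A" by simp
 qed (use det in auto)
qed

text \<open>On elementary matrices the factor follows from its multiplicativity: a transposition is its own inverse, and
 a shear is conjugate by a diagonal matrix to its own square.\<close>

theorem scales_volume_det:
 fixes M :: "real^'n^'n"
 assumes "det M ~= 0"
 shows "scales_volume M (1 / \<bar>det M\<bar>)"
proof -
 have "det M ~= 0 --> scales_volume M (1 / \<bar>det M\<bar>)"
 proof (rule induct_matrix_elementary)
  fix A B :: "real^'n^'n"
  assume "det A ~= 0 --> scales_volume A (1 / \<bar>det A\<bar>)" "det B ~= 0 --> scales_volume B (1 / \<bar>det B\<bar>)"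
  thus "det (A ** B) ~= 0 --> scales_volume (A ** B) (1 / \<bar>det (A ** B)\<bar>)"
   using scales_volume_mult[of A "1 / \<bar>det A\<bar>" B "1 / \<bar>det B\<bar>"] by (auto simp: det_mul abs_mult)
 next
  fix A :: "real^'n^'n" and i assume "row i A = 0"
  thus "det A ~= 0 --> scales_volume A (1 / \<bar>det A\<bar>)" by (simp add: det_zero_row)
 next
  fix A :: "real^'n^'n" assume "!!i j. i ~= j ==> A $ i $ j = 0"
  thus "det A ~= 0 --> scales_volume A (1 / \<bar>det A\<bar>)" by (intro impI scales_volume_diagonal) auto
 next
  fix m n :: 'n assume mn: "m ~= n"
  define W :: "real^'n^'n" where "W = (\<chi> i j. mat 1 $ i $ Transposition.transpose m n j)"
  have Wx: "W *v x = (\<chi> i. x $ Transposition.transpose m n i)" for x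
  proof -
   have "(W *v x) $ i = (\<Sum>j\<in>UNIV. if j = Transposition.transpose m n i then x $ j else 0)" for i
    unfolding matrix_vector_mult_def vec_lambda_beta W_def mat_def
    by (intro sum.cong) (auto simp: transpose_eq_iff)
   thus ?thesis by (simp add: vec_eq_iff)
  qed
  have WW: "W ** W = mat 1"
   by (simp add: matrix_eq matrix_vector_mul_assoc[symmetric] Wx vec_eq_iff)
  hence "det W * det W = 1" by (metis det_I det_mul)
  hence dW: "\<bar>det W\<bar> = 1" by (auto simp: square_eq_1_iff)
  obtain k where k: "scales_volume W k" using scales_volume_exists WW by (metis invertible_def)
  have "k * k = 1" using scales_volume_unique[OF scales_volume_mult[OF k k]] scales_volume_mat_1 WW by metis
  hence "k = 1" using k by (auto simp: square_eq_1_iff scales_volume_def)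
  with k dW show "det (\<chi> i j. mat 1 $ i $ Transposition.transpose m n j :: real^'n^'n) ~= 0 -->
    scales_volume (\<chi> i j. mat 1 $ i $ Transposition.transpose m n j) (1 / \<bar>det (\<chi> i j. mat 1 $ i $ Transposition.transpose m n j :: real^'n^'n)\<bar>)"
   by (simp add: W_def)
 next
  fix m n :: 'n and c :: real assume mn: "m ~= n"
  define S :: "real => real^'n^'n" where "S t = (\<chi> i j. if i = m \<and> j = n then t else of_bool (i = j))" for t
  have Sx: "(S t *v x) $ i = x $ i + (if i = m then t * x $ n else 0)" for t x i
  proof -
   have "(S t *v x) $ i = (\<Sum>j\<in>UNIV. (if j = i then x $ j else 0) + (if i = m \<and> j = n then t * x $ j else 0))"
    unfolding matrix_vector_mult_def vec_lambda_beta S_def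
    using mn by (intro sum.cong) auto
   also have "... = x $ i + (if i = m then t * x $ n else 0)"
    by (simp add: sum.distrib)
   finally show ?thesis .
  qed
  have SS: "S a ** S b = S (a + b)" for a b
   using mn by (auto simp: matrix_eq matrix_vector_mul_assoc[symmetric] vec_eq_iff Sx algebra_simps)
  have S0: "S 0 = mat 1" using mn by (auto simp: S_def mat_def vec_eq_iff)
  have inv: "invertible (S t)" for t using SS[of t "- t"] SS[of "- t" t] S0 by (auto simp: invertible_def)
  define D :: "real => real^'n^'n" where "D t = (\<chi> i j. if i = j then (if i = m then t else 1) else 0)" for t
  have Dx: "(D t *v x) $ i = (if i = m then t * x $ i else x $ i)" for t x i
  proof -
   have "(D t *v x) $ i = (\<Sum>j\<in>UNIV. if j = i then (if i = m then t * x $ i else x $ i) else 0)"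
    unfolding matrix_vector_mult_def vec_lambda_beta D_def by (intro sum.cong) auto
   thus ?thesis by simp
  qed
  have DS: "D 2 ** S t = S (2 * t) ** D 2" for t
   using mn by (auto simp: matrix_eq matrix_vector_mul_assoc[symmetric] vec_eq_iff Sx Dx algebra_simps)
  have "D 2 ** D (1/2) = mat 1" "D (1/2) ** D 2 = mat 1"
   by (auto simp: matrix_eq matrix_vector_mul_assoc[symmetric] vec_eq_iff Dx)
  hence "invertible (D 2)" by (auto simp: invertible_def)
  then obtain d where d: "scales_volume (D 2) d" using scales_volume_exists by blast
  obtain k where k: "scales_volume (S c) k" using scales_volume_exists[OF inv] by blast
  have k2: "scales_volume (S (2 * c)) (k * k)" using scales_volume_mult[OF k k] by (simp add: SS)
  have "d * k = (k * k) * d"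
   using scales_volume_unique[OF scales_volume_mult[OF d k]] scales_volume_mult[OF k2 d] by (simp add: DS)
  hence "k = 1" using k d by (auto simp: scales_volume_def)
  moreover have "det (S c) = 1"
  proof -
   have "S c = (\<chi> i. if i = m then row m (mat 1) + c *s row n (mat 1) else row i (mat 1))"
    using mn by (auto simp: S_def vec_eq_iff row_def mat_def)
   thus ?thesis using det_row_operation[OF mn, of "mat 1 :: real^'n^'n" c] by (simp add: det_I)
  qed
  ultimately have "det (S c) ~= 0 --> scales_volume (S c) (1 / \<bar>det (S c)\<bar>)" using k by simp
  thus "det (\<chi> i j. if i = m \<and> j = n then c else of_bool (i = j)) ~= 0 -->
    scales_volume (\<chi> i j. if i = m \<and> j = n then c else of_bool (i = j)) (1 / \<bar>det (\<chi> i j. if i = m \<and> j = n then c else of_bool (i = j))\<bar>)"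
   by (simp add: S_def)
 qed
 thus ?thesis using assms by simp
qed

lemma distr_matrix_vector:
 fixes M :: "real^'n^'n"
 assumes "det M ~= 0"
 shows "distr lborel borel (\<lambda>x. M *v x) = density lborel (\<lambda>_. ennreal (1 / \<bar>det M\<bar>))"
proof (rule measure_eqI)
 fix A assume "A \<in> sets (distr lborel borel (\<lambda>x. M *v x))"
 hence A [measurable]: "A \<in> sets borel" by simp
 have "emeasure lborel {x. M *v x \<in> A} = ennreal (1 / \<bar>det M\<bar>) * emeasure lborel A"
  using scales_volume_det[OF assms] A unfolding scales_volume_def by blast
 thus "emeasure (distr lborel borel (\<lambda>x. M *v x)) A = emeasure (density lborel (\<lambda>_. ennreal (1 / \<bar>det M\<bar>))) A"
  by (simp add: emeasure_distr vimage_def emeasure_density nn_integral_cmult_indicator)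
qed simp

lemma nn_integral_matrix_vector:
 fixes M :: "real^'n^'n" and f :: "real^'n => ennreal"
 assumes "det M ~= 0" and [measurable]: "f \<in> borelfun"
 shows "(\<integral>\<^sup>+x. f (M *v x) \<partial>lborel) = ennreal (1 / \<bar>det M\<bar>) * (\<integral>\<^sup>+x. f x \<partial>lborel)"
proof -
 have "(\<integral>\<^sup>+x. f (M *v x) \<partial>lborel) = (\<integral>\<^sup>+x. f x \<partial>distr lborel borel (\<lambda>x. M *v x))"
  by (subst nn_integral_distr) auto
 also have "... = ennreal (1 / \<bar>det M\<bar>) * (\<integral>\<^sup>+x. f x \<partial>lborel)"
  unfolding distr_matrix_vector[OF assms(1)] by (subst nn_integral_density) (auto simp: nn_integral_cmult)
 finally show ?thesis .
qed

lemma integral_matrix_vector: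
 fixes M :: "real^'n^'n" and f :: "real^'n => complex"
 assumes "det M ~= 0" and [measurable]: "f \<in> borelfun"
 shows "(\<integral>x. f (M *v x) \<partial>lborel) = cplx (1 / \<bar>det M\<bar>) * (\<integral>x. f x \<partial>lborel)"
  and "integrable lborel (\<lambda>x. f (M *v x)) \<longleftrightarrow> integrable lborel f"
proof -
 have "(\<integral>x. f (M *v x) \<partial>lborel) = (\<integral>x. f x \<partial>distr lborel borel (\<lambda>x. M *v x))"
  by (subst integral_distr) auto
 also have "... = cplx (1 / \<bar>det M\<bar>) * (\<integral>x. f x \<partial>lborel)"
  unfolding distr_matrix_vector[OF assms(1)]
  by (subst integral_density) (auto simp: scaleR_conv_of_real)
 finally show "(\<integral>x. f (M *v x) \<partial>lborel) = cplx (1 / \<bar>det M\<bar>) * (\<integral>x. f x \<partial>lborel)" .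
 have "(\<integral>\<^sup>+x. ennreal (norm (f (M *v x))) \<partial>lborel) = ennreal (1 / \<bar>det M\<bar>) * (\<integral>\<^sup>+x. ennreal (norm (f x)) \<partial>lborel)"
  by (rule nn_integral_matrix_vector[OF assms(1)]) auto
 thus "integrable lborel (\<lambda>x. f (M *v x)) \<longleftrightarrow> integrable lborel f"
  using assms(1) by (auto simp: integrable_iff_bounded ennreal_mult_less_top)
qed

lemma AE_matrix_vector:
 fixes M :: "real^'n^'n"
 assumes det: "det M ~= 0" and "AE x in lborel. P x"
 shows "AE x in lborel. P (M *v x)"
proof -
 from assms(2) obtain N where N: "N \<in> sets borel" "emeasure lborel N = 0" "{x. \<not> P x} \<subseteq> N"
  unfolding eventually_ae_filter null_sets_def by auto
 have "emeasure lborel {x. M *v x \<in> N} = 0"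
  using scales_volume_det[OF det] N by (simp add: scales_volume_def)
 hence "AE x in lborel. x \<notin> {x. M *v x \<in> N}"
  using preimage_matrix_borel[OF N(1)] by (intro AE_not_in) (auto simp: null_sets_def)
 thus ?thesis by eventually_elim (use N in auto)
qed

lemma matrix_inv_right:
 fixes M :: "real^'n^'n"
 assumes "invertible M"
 shows "M ** matrix_inv M = mat 1"
 using someI_ex[OF assms[unfolded invertible_def]] by (simp add: matrix_inv_def)

lemma matrix_inv_left:
 fixes M :: "real^'n^'n"
 assumes "invertible M"
 shows "matrix_inv M ** M = mat 1"
 using someI_ex[OF assms[unfolded invertible_def]] by (simp add: matrix_inv_def)

section \<open>Translations and dilations under the Fourier transform\<close>

lemma translate_Lsq:
 assumes "f \<in> L2"
 shows "translate k f \<in> L2"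
proof -
 have [measurable]: "f \<in> borelfun" using assms by (auto dest: LsqD)
 show ?thesis
  using assms integral_lborel_translate(2)[of "\<lambda>x. (cmod (f x))\<^sup>2" "- lattice_vec k"]
  by (auto simp: Lsq_def translate_def[abs_def])
qed

lemma translate_norm:
 assumes "f \<in> L2"
 shows "L2norm (translate k f) = L2norm f"
proof -
 have [measurable]: "f \<in> borelfun" using assms by (auto dest: LsqD)
 show ?thesis
  using integral_lborel_translate(1)[of "\<lambda>x. (cmod (f x))\<^sup>2" "- lattice_vec k"]
  by (simp add: Lsq_norm_def translate_def)
qed

lemma fourier_integral_translate:
 assumes [measurable]: "f \<in> borelfun"
 shows "fourier_integral (translate k f) y = torus_char (- k) y * fourier_integral f y"
proof -
 have [measurable]: "(\<lambda>x. exp (- (\<i> * cplx (x \<bullet> y)))) \<in> borelfun"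
  by (intro borel_measurable_continuous_onI continuous_intros)
 have "fourier_integral (translate k f) y = (\<integral>x. f x * exp (- (\<i> * cplx ((x + lattice_vec k) \<bullet> y))) \<partial>lborel)"
  unfolding fourier_integral_def translate_def
  by (subst integral_lborel_translate(1)[symmetric, of _ "lattice_vec k"]) simp_all
 also have "(\<lambda>x. f x * exp (- (\<i> * cplx ((x + lattice_vec k) \<bullet> y))))
   = (\<lambda>x. torus_char (- k) y * (f x * exp (- (\<i> * cplx (x \<bullet> y)))))"
  by (simp add: fun_eq_iff torus_char_def cis_conv_exp inner_add_left exp_diff exp_minus field_simps)
 finally show ?thesis by (simp add: fourier_integral_def)
qed

lemma fourier_translate:
 fixes f :: "real^'n => complex"
 assumes f: "f \<in> L2"
 shows "AE y in lborel. fourier (translate k f) y = torus_char (- k) y * fourier f y"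
proof (rule fourier_AE_eq[OF _ translate_Lsq[OF f]])
 obtain F where F: "!!m. F m \<in> L2" "!!m. integrable lborel (F m)" "!!m. fourier_integral (F m) \<in> L2"
  "(\<lambda>m. L2norm (\<lambda>x. F m x - f x)) \<longlonglongrightarrow> 0"
  "(\<lambda>m. L2norm (\<lambda>y. fourier_integral (F m) y - fourier f y)) \<longlonglongrightarrow> 0" "fourier f \<in> L2"
  using is_fourier_fourier[OF f] unfolding is_fourier_def by blast
 have Fm: "F m \<in> borelfun" for m using F(1)[of m] by (auto dest: LsqD)
 have char: "(\<lambda>y. torus_char (- k) y * g y) \<in> L2" if "g \<in> L2" for g
  by (rule Lsq_bounded_mult[OF that, of _ 1]) auto
 have eq: "fourier_integral (translate k (F m)) = (\<lambda>y. torus_char (- k) y * fourier_integral (F m) y)" for m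
  by (intro ext fourier_integral_translate Fm)
 show "is_fourier (translate k f) (\<lambda>y. torus_char (- k) y * fourier f y)"
  unfolding is_fourier_def
 proof (intro conjI exI[of _ "\<lambda>m. translate k (F m)"] allI)
  show "integrable lborel (translate k (F m))" for m
   using F(2)[of m] integral_lborel_translate(2)[OF Fm, of m "- lattice_vec k"] by (simp add: translate_def[abs_def])
  show "(\<lambda>m. L2norm (\<lambda>x. translate k (F m) x - translate k f x)) \<longlonglongrightarrow> 0"
   using F(4) translate_norm[OF Lsq_diff[OF F(1) f], of k] by (simp add: translate_def)
  show "(\<lambda>m. L2norm (\<lambda>y. fourier_integral (translate k (F m)) y - torus_char (- k) y * fourier f y)) \<longlonglongrightarrow> 0"
   using F(5) unfolding eq by (simp add: Lsq_norm_def norm_mult right_diff_distrib[symmetric])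
  show "translate k (F m) \<in> L2" for m by (rule translate_Lsq[OF F(1)])
  show "fourier_integral (translate k (F m)) \<in> L2" for m unfolding eq by (rule char[OF F(3)])
 qed (rule char[OF F(6)])
qed

lemma dilate_Lsq_norm:
 fixes A :: "real^'n^'n"
 assumes det: "det A ~= 0" and f: "f \<in> L2"
 shows "dilate A f \<in> L2" "L2norm (dilate A f) = L2norm f"
proof -
 have [measurable]: "f \<in> borelfun" using f by (auto dest: LsqD)
 have m: "dilate A f \<in> borel_measurable lborel" unfolding dilate_def by measurable
 have "(\<integral>\<^sup>+x. esq (dilate A f x) \<partial>lborel) = ennreal \<bar>det A\<bar> * (\<integral>\<^sup>+x. esq (f (A *v x)) \<partial>lborel)"
  by (subst nn_integral_cmult[symmetric])
    (auto simp: dilate_def norm_mult power_mult_distrib ennreal_mult intro!: nn_integral_cong)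
 also have "... = (ennreal \<bar>det A\<bar> * ennreal (1 / \<bar>det A\<bar>)) * (\<integral>\<^sup>+x. esq (f x) \<partial>lborel)"
  by (subst nn_integral_matrix_vector[OF det, of "\<lambda>x. esq (f x)"]) (auto simp: mult.assoc)
 also have "ennreal \<bar>det A\<bar> * ennreal (1 / \<bar>det A\<bar>) = 1" using det by (simp add: ennreal_mult[symmetric])
 finally have *: "(\<integral>\<^sup>+x. esq (dilate A f x) \<partial>lborel) = ennreal ((L2norm f)\<^sup>2)"
  by (simp add: nn_integral_Lsq_norm[OF f])
 thus L: "dilate A f \<in> L2" using m by (subst Lsq_iff_nn_integral) auto
 have "(L2norm (dilate A f))\<^sup>2 = (L2norm f)\<^sup>2"
  using * unfolding nn_integral_Lsq_norm[OF L] by (subst (asm) ennreal_inj) auto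
 thus "L2norm (dilate A f) = L2norm f" by (rule power2_eq_imp_eq) auto
qed

lemma transpose_matrix_inv_inner:
 fixes A :: "real^'n^'n"
 assumes det: "det A ~= 0"
 shows "(A *v x) \<bullet> (matrix_inv (transpose A) *v y) = x \<bullet> y"
proof -
 have "invertible (transpose A)" using det by (simp add: invertible_det_nz det_transpose)
 hence "transpose A ** matrix_inv (transpose A) = mat 1" by (rule matrix_inv_right)
 hence "transpose A *v (matrix_inv (transpose A) *v y) = y" by (simp add: matrix_vector_mul_assoc)
 thus ?thesis by (metis dot_lmul_matrix transpose_matrix_vector inner_commute)
qed

lemma fourier_integral_dilate:
 fixes A :: "real^'n^'n"
 assumes det: "det A ~= 0" and [measurable]: "f \<in> borelfun"
 shows "fourier_integral (dilate A f) y
  = cplx (1 / sqrt \<bar>det A\<bar>) * fourier_integral f (matrix_inv (transpose A) *v y)"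
proof -
 let ?B = "matrix_inv (transpose A)"
 have [measurable]: "(\<lambda>x. exp (- (\<i> * cplx (x \<bullet> (?B *v y))))) \<in> borelfun"
  by (intro borel_measurable_continuous_onI continuous_intros)
 have "fourier_integral (dilate A f) y = (\<integral>x. cplx (sqrt \<bar>det A\<bar>) *
   (f (A *v x) * exp (- (\<i> * cplx ((A *v x) \<bullet> (?B *v y))))) \<partial>lborel)"
  by (simp add: fourier_integral_def dilate_def transpose_matrix_inv_inner[OF det] mult.assoc)
 also have "... = cplx (sqrt \<bar>det A\<bar>) * (cplx (1 / \<bar>det A\<bar>) * fourier_integral f (?B *v y))"
  unfolding fourier_integral_def
  by (subst integral_matrix_vector(1)[OF det, symmetric]) simp_all
 also have "... = cplx (sqrt \<bar>det A\<bar> * (1 / \<bar>det A\<bar>)) * fourier_integral f (?B *v y)" by simp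
 also have "sqrt \<bar>det A\<bar> * (1 / \<bar>det A\<bar>) = 1 / sqrt \<bar>det A\<bar>"
  using det real_sqrt_mult_self[of "\<bar>det A\<bar>"] by (simp add: field_simps)
 finally show ?thesis .
qed

text \<open>Pass to the limit from integrable approximants, whose Fourier integrals are dilated exactly.\<close>

theorem fourier_dilate:
 fixes A :: "real^'n^'n"
 assumes det: "det A ~= 0" and f: "f \<in> L2"
 shows "AE y in lborel. fourier (dilate A f) y
  = cplx (1 / sqrt \<bar>det A\<bar>) * fourier f (matrix_inv (transpose A) *v y)"
proof (rule fourier_AE_eq[OF _ dilate_Lsq_norm(1)[OF det f]])
 let ?B = "matrix_inv (transpose A)"
 have "invertible (transpose A)" using det by (simp add: invertible_det_nz det_transpose)
 hence "det (transpose A) * det ?B = 1" by (metis det_I det_mul matrix_inv_right)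
 hence dB: "det ?B * det A = 1" by (simp add: det_transpose mult.commute)
 hence detB: "det ?B ~= 0" by auto
 have absB: "\<bar>det ?B\<bar> = 1 / \<bar>det A\<bar>" using dB det by (simp add: field_simps abs_mult[symmetric])
 \<comment> \<open>Up to the constant, the right-hand side is the unitary dilation by the inverse transpose.\<close>
 have eq: "cplx (1 / sqrt \<bar>det A\<bar>) * g (?B *v y) = dilate ?B g y" for g y
  by (simp add: dilate_def absB real_sqrt_divide)
 obtain F where F: "!!m. F m \<in> L2" "!!m. integrable lborel (F m)" "!!m. fourier_integral (F m) \<in> L2"
  "(\<lambda>m. L2norm (\<lambda>x. F m x - f x)) \<longlonglongrightarrow> 0"
  "(\<lambda>m. L2norm (\<lambda>y. fourier_integral (F m) y - fourier f y)) \<longlonglongrightarrow> 0" "fourier f \<in> L2"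
  using is_fourier_fourier[OF f] unfolding is_fourier_def by blast
 have Fm: "F m \<in> borelfun" for m using F(1)[of m] by (auto dest: LsqD)
 have Feq: "fourier_integral (dilate A (F m)) = dilate ?B (fourier_integral (F m))" for m
  unfolding fourier_integral_dilate[OF det Fm, abs_def] eq ..
 have diff: "(\<lambda>x. dilate M g x - dilate M h x) = dilate M (\<lambda>x. g x - h x)" for M :: "real^'n^'n" and g h
  by (simp add: dilate_def right_diff_distrib)
 have "is_fourier (dilate A f) (dilate ?B (fourier f))"
  unfolding is_fourier_def
 proof (intro conjI exI[of _ "\<lambda>m. dilate A (F m)"] allI)
  show "integrable lborel (dilate A (F m))" for m
   using F(2)[of m] integral_matrix_vector(2)[OF det Fm, of m] by (simp add: dilate_def[abs_def])
  show "(\<lambda>m. L2norm (\<lambda>x. dilate A (F m) x - dilate A f x)) \<longlonglongrightarrow> 0"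
   unfolding diff dilate_Lsq_norm(2)[OF det Lsq_diff[OF F(1) f]] by (rule F)
  show "(\<lambda>m. L2norm (\<lambda>y. fourier_integral (dilate A (F m)) y - dilate ?B (fourier f) y)) \<longlonglongrightarrow> 0"
   unfolding Feq diff dilate_Lsq_norm(2)[OF detB Lsq_diff[OF F(3) F(6)]] by (rule F)
  show "dilate A (F m) \<in> L2" for m by (rule dilate_Lsq_norm(1)[OF det F(1)])
  show "fourier_integral (dilate A (F m)) \<in> L2" for m unfolding Feq by (rule dilate_Lsq_norm(1)[OF detB F(3)])
 qed (rule dilate_Lsq_norm(1)[OF detB F(6)])
 thus "is_fourier (dilate A f) (\<lambda>y. cplx (1 / sqrt \<bar>det A\<bar>) * fourier f (?B *v y))"
  by (simp only: eq)
qed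

section \<open>Fibers and brackets\<close>

abbreviation l2 :: "(int^'n => complex) set" where
 "l2 \<equiv> Lsq (counting)"

definition fiber :: "(real^'n => complex) => real^'n => int^'n => complex" where
 "fiber g y = (\<lambda>k. g (shift2pi k y))"

text \<open>The bracket product: the inner product of the fibers over a point of the torus.  Its Fourier coefficients are the inner products
 with integer translates.\<close>

definition bracket :: "(real^'n => complex) => (real^'n => complex) => real^'n => complex" where
 "bracket g h y = Lsq_inner (counting) (fiber g y) (fiber h y)"

lemma periodize_fiber: "periodize f = fiber (fourier f)"
 by (simp add: periodize_def fiber_def fun_eq_iff)

lemma shift2pi_shift2pi: "shift2pi k (shift2pi l y) = shift2pi (l + k) y"
 by (simp add: algebra_simps)

lemma fiber_shift: "fiber g (shift2pi k y) = (\<lambda>l. fiber g y (l + k))"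
 unfolding fiber_def shift2pi_shift2pi by (simp add: add.commute)

lemma bij_add_lattice: "bij_betw (\<lambda>l. l + k) (UNIV :: (int^'n) set) UNIV"
 by (rule bij_betw_byWitness[of _ "\<lambda>l. l - k"]) auto

lemma l2_shift: "(\<lambda>l. a (l + k)) \<in> l2 \<longleftrightarrow> a \<in> l2"
 using integrable_bij_count_space[OF bij_add_lattice, of "\<lambda>l. (cmod (a l))\<^sup>2" k]
 by (simp add: Lsq_def)

lemma l2_inner_shift:
 "Lsq_inner (counting) (\<lambda>l. a (l + k)) (\<lambda>l. b (l + k :: int^'n)) = Lsq_inner (counting) a b"
 unfolding Lsq_inner_def by (rule integral_bij_count_space[OF bij_add_lattice])

lemma bracket_periodic: "periodic2pi (bracket g h)"
 by (simp add: periodic2pi_def bracket_def fiber_shift l2_inner_shift)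

lemma measurable_lattice_fiber:
 fixes F :: "int^'n => real^'n => 'b::topological_space"
 assumes "!!k. F k \<in> borelfun"
 shows "(\<lambda>(y, k). F k y) \<in> borel_measurable (borel \<Otimes>\<^sub>M count_space (UNIV :: (int^'n) set))"
proof -
 have "(\<lambda>p. F (fst p) (snd p)) \<in> borel_measurable (count_space (UNIV :: (int^'n) set) \<Otimes>\<^sub>M borel)"
  using assms by (intro measurable_pair_measure_countable1) auto
 from measurable_compose[OF measurable_pair_swap' this] show ?thesis
  by (simp add: case_prod_unfold)
qed

lemma measurable_lattice_sum:
 fixes F :: "int^'n => real^'n => complex"
 assumes "!!k. F k \<in> borelfun"
 shows "(\<lambda>y. \<integral>k. F k y \<partial>counting) \<in> borelfun"
 by (rule sigma_finite_measure.borel_measurable_lebesgue_integral[OF sigma_finite_measure_count_space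
    measurable_lattice_fiber[OF assms]])

lemma measurable_lattice_nn_sum:
 fixes F :: "int^'n => real^'n => ennreal"
 assumes "!!k. F k \<in> borelfun"
 shows "(\<lambda>y. \<integral>\<^sup>+k. F k y \<partial>counting) \<in> borelfun"
 by (rule sigma_finite_measure.borel_measurable_nn_integral[OF sigma_finite_measure_count_space
    measurable_lattice_fiber[OF assms]])

lemma bracket_measurable [measurable]:
 assumes [measurable]: "g \<in> borelfun" "h \<in> borelfun"
 shows "bracket g h \<in> borelfun"
 unfolding bracket_def[abs_def] Lsq_inner_def fiber_def by (rule measurable_lattice_sum) measurable

lemma AE_lborel_all_shifts:
 assumes "AE y in lborel. P (y :: real^'n)"
 shows "AE y in lborel. \<forall>k. P (shift2pi k y)"
 using AE_lborel_translate[OF assms] by (subst AE_all_countable) blast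

lemma AE_cell_periodic:
 assumes "AE y in cellM. P (y :: real^'n)" and per: "!!k y. P y ==> P (shift2pi k y)"
 shows "AE y in lborel. P y"
proof -
 have "AE y in lborel. y \<in> cell --> P y" using assms(1) by (simp add: AE_cell_measure_iff)
 from AE_lborel_all_shifts[OF this] show ?thesis
 proof eventually_elim
  fix y :: "real^'n" assume *: "\<forall>k. shift2pi k y \<in> cell --> P (shift2pi k y)"
  obtain k where "y - (2 * pi) *\<^sub>R lattice_vec k \<in> cell" using cell_translate_unique by blast
  hence "P (shift2pi (- k) y)" using *[rule_format, of "- k"] by simp
  from per[OF this, of k] show "P y" by simp
 qed
qed

lemma AE_lborel_imp_cell: "AE y in lborel. P y ==> AE y in cellM. P y"
 by (auto simp: AE_cell_measure_iff elim: eventually_mono)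

lemma nn_integral_fiber:
 assumes [measurable]: "g \<in> borelfun"
 shows "(\<integral>\<^sup>+y. (\<integral>\<^sup>+k. esq (fiber g y k) \<partial>counting) \<partial>cellM)
  = (\<integral>\<^sup>+y. esq (g y) \<partial>lborel)"
 unfolding fiber_def by (rule nn_integral_unfold_cell[symmetric]) measurable

lemma fiber_l2_iff: "fiber g y \<in> l2 \<longleftrightarrow> (\<integral>\<^sup>+k. esq (fiber g y k) \<partial>counting) < \<infinity>"
 by (rule Lsq_iff_nn_integral) simp

lemma fiber_l2:
 assumes "g \<in> Lsq (lborel :: (real^'n) measure)"
 shows "AE y in lborel. fiber g y \<in> l2"
proof (rule AE_cell_periodic)
 have m [measurable]: "g \<in> borelfun" using assms by (auto dest: LsqD)
 have "(\<lambda>y. \<integral>\<^sup>+k. esq (fiber g y k) \<partial>counting) \<in> borelfun"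
  unfolding fiber_def by (rule measurable_lattice_nn_sum) measurable
 hence "AE y in cellM. (\<integral>\<^sup>+k. esq (fiber g y k) \<partial>counting) ~= \<infinity>"
  using nn_integral_Lsq_norm[OF assms] nn_integral_fiber[OF m]
  by (intro nn_integral_PInf_AE measurable_cell_measure) auto
 thus "AE y in cellM. fiber g y \<in> l2"
  by eventually_elim (simp add: fiber_l2_iff less_top)
 show "fiber g (shift2pi k y) \<in> l2" if "fiber g y \<in> l2" for k y using that by (simp add: fiber_shift l2_shift)
qed

lemma bracket_integrable:
 assumes g: "g \<in> L2" and h: "h \<in> L2"
 shows "integrable cellM (bracket g h)"
  and "L2inner g h = (\<integral>y. bracket g h y \<partial>cellM)"
 using integral_unfold(2,3)[OF Lsq_inner_integrable[OF g h]]
 by (simp_all add: bracket_def[abs_def] Lsq_inner_def fiber_def)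

lemma bracket_mult_periodic:
 assumes "periodic2pi p"
 shows "bracket (\<lambda>y. p y * g y) h y = p y * bracket g h y"
  and "bracket g (\<lambda>y. p y * h y) y = cnj (p y) * bracket g h y"
 unfolding bracket_def fiber_def periodic2piD[OF assms] by simp_all

lemma bracket_Cauchy_Schwarz:
 assumes "fiber g y \<in> l2" "fiber h y \<in> l2"
 shows "(cmod (bracket g h y))\<^sup>2 \<le> (Lsq_norm (counting) (fiber g y))\<^sup>2 * (Lsq_norm (counting) (fiber h y))\<^sup>2"
 using power_mono[OF Lsq_Cauchy_Schwarz[OF assms], of 2] by (simp add: bracket_def power_mult_distrib)

section \<open>The energy of a family of integer translates\<close>

text \<open>Families are indexed, so that equal members are counted with multiplicity; a set of functions is
 the family of its members indexed by itself.\<close>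

definition shift_energy :: "'i set => ('i => real^'n => complex) => (real^'n => complex) => ennreal" where
 "shift_energy I \<phi> f = frame_energy lborel (UNIV \<times> I) (\<lambda>(k, i). translate k (\<phi> i)) f"

lemma nn_integral_count_space_prod:
 fixes F :: "'a \<times> 'b => ennreal"
 assumes "countable A" "countable B"
 shows "(\<integral>\<^sup>+p. F p \<partial>count_space (A \<times> B)) = (\<integral>\<^sup>+b. (\<integral>\<^sup>+a. F (a, b) \<partial>count_space A) \<partial>count_space B)"
proof -
 interpret pair_sigma_finite "count_space A" "count_space B"
  by (intro pair_sigma_finite.intro sigma_finite_measure_count_space_countable assms)
 have m: "F \<in> borel_measurable (count_space A \<Otimes>\<^sub>M count_space B)"
  unfolding pair_measure_countable[OF assms] by simp
 show ?thesis
  unfolding pair_measure_countable[OF assms, symmetric] by (rule nn_integral_snd[OF m, symmetric])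
qed

lemma shift_energy_eq:
 assumes "countable I"
 shows "shift_energy I \<phi> f = (\<integral>\<^sup>+i. (\<integral>\<^sup>+k. esq (L2inner f (translate k (\<phi> i))) \<partial>counting) \<partial>count_space I)"
 unfolding shift_energy_def frame_energy_def
 by (subst nn_integral_count_space_prod) (use assms in auto)

lemma inner_translate:
 fixes f \<phi> :: "real^'n => complex"
 assumes f: "f \<in> L2" and \<phi>: "\<phi> \<in> L2"
 shows "cplx (plancherel_const TYPE('n)) * L2inner f (translate k \<phi>)
  = (\<integral>y. bracket (fourier f) (fourier \<phi>) y * torus_char k y \<partial>cellM)"
proof -
 have L: "(\<lambda>y. torus_char (- k) y * fourier \<phi> y) \<in> L2"
  by (rule Lsq_bounded_mult[OF fourier_Lsq[OF \<phi>], of _ 1]) auto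
 have "cplx (plancherel_const TYPE('n)) * L2inner f (translate k \<phi>)
   = L2inner (fourier f) (fourier (translate k \<phi>))"
  by (simp add: fourier_inner f \<phi> translate_Lsq)
 also have "... = L2inner (fourier f) (\<lambda>y. torus_char (- k) y * fourier \<phi> y)"
  using fourier_translate[OF \<phi>, of k] fourier_Lsq[OF f] fourier_Lsq[OF translate_Lsq[OF \<phi>], of k] L
  by (intro Lsq_inner_cong_AE) (auto dest: LsqD)
 also have "... = (\<integral>y. bracket (fourier f) (fourier \<phi>) y * torus_char k y \<partial>cellM)"
 proof -
  have "bracket (fourier f) (\<lambda>y. torus_char (- k) y * fourier \<phi> y) = (\<lambda>y. bracket (fourier f) (fourier \<phi>) y * torus_char k y)"
   by (rule ext) (simp add: bracket_mult_periodic(2)[OF torus_char_periodic] torus_char_cnj)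
  thus ?thesis unfolding bracket_integrable(2)[OF fourier_Lsq[OF f] L] by simp
 qed
 finally show ?thesis .
qed

lemma bracket_cong_AE:
 assumes "AE y in lborel. g y = g' y" "AE y in lborel. h y = h' y"
 shows "AE y in lborel. bracket g h y = bracket g' h' y"
 using AE_lborel_all_shifts[OF assms(1)] AE_lborel_all_shifts[OF assms(2)]
 by eventually_elim (simp add: bracket_def fiber_def)

text \<open>Parseval's formula on the torus, applied to the bracket product.\<close>

lemma translates_energy:
 fixes f \<phi> g h :: "real^'n => complex"
 assumes f: "f \<in> L2" and \<phi>: "\<phi> \<in> L2"
  and g: "AE y in lborel. fourier f y = g y" and h: "AE y in lborel. fourier \<phi> y = h y"
  and L: "bracket g h \<in> Lsq cellM"
 shows "(\<integral>\<^sup>+k. esq (L2inner f (translate k \<phi>)) \<partial>counting)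
  = ennreal (1 / plancherel_const TYPE('n)) * (\<integral>\<^sup>+y. esq (bracket g h y) \<partial>cellM)"
proof -
 let ?c = "plancherel_const TYPE('n)"
 have AE: "AE y in cellM. bracket (fourier f) (fourier \<phi>) y = bracket g h y"
  by (rule AE_lborel_imp_cell[OF bracket_cong_AE[OF g h]])
 have m: "bracket (fourier f) (fourier \<phi>) \<in> borel_measurable cellM"
  using fourier_Lsq[OF f] fourier_Lsq[OF \<phi>] by (intro measurable_cell_measure bracket_measurable) (auto dest: LsqD)
 have tm [measurable]: "torus_char k \<in> borel_measurable cellM" for k :: "int^'n"
  by (rule measurable_cell_measure) simp
 have "L2inner f (translate k \<phi>) = cplx (1 / ?c) * (\<integral>y. bracket g h y * torus_char k y \<partial>cellM)" for k
 proof -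
  have "(\<integral>y. bracket (fourier f) (fourier \<phi>) y * torus_char k y \<partial>cellM)
    = (\<integral>y. bracket g h y * torus_char k y \<partial>cellM)"
   using AE m Lsq_measurable[OF L] by (intro integral_cong_AE) auto
  hence *: "cplx ?c * L2inner f (translate k \<phi>) = (\<integral>y. bracket g h y * torus_char k y \<partial>cellM)"
   using inner_translate[OF f \<phi>, of k] by simp
  have "L2inner f (translate k \<phi>) = cplx (1 / ?c) * (cplx ?c * L2inner f (translate k \<phi>))"
   using plancherel_const_pos[where 'n = 'n] by simp
  thus ?thesis unfolding * .
 qed
 hence "(\<integral>\<^sup>+k. esq (L2inner f (translate k \<phi>)) \<partial>counting)
   = (\<integral>\<^sup>+k. ennreal ((1 / ?c)\<^sup>2) * esq (\<integral>y. bracket g h y * torus_char k y \<partial>cellM) \<partial>counting)"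
  by (intro nn_integral_cong) (simp only: norm_mult norm_of_real power_mult_distrib power2_abs ennreal_mult[symmetric] zero_le_power2)
 also have "... = ennreal ((1 / ?c)\<^sup>2) * (ennreal ?c * (\<integral>\<^sup>+y. esq (bracket g h y) \<partial>cellM))"
  using Parseval_torus[OF L] by (subst nn_integral_cmult) (simp_all add: plancherel_const_def)
 also have "... = ennreal ((1 / ?c)\<^sup>2 * ?c) * (\<integral>\<^sup>+y. esq (bracket g h y) \<partial>cellM)"
  by (simp add: ennreal_mult mult.assoc)
 also have "(1 / ?c)\<^sup>2 * ?c = 1 / ?c" using plancherel_const_pos[where 'n = 'n] by (simp add: power2_eq_square)
 finally show ?thesis .
qed

text \<open>Bounded functions of bounded support on the Fourier side; their fibers are finitely supported, so that all lattice sums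
 formed with them are finite.\<close>

definition test_function :: "(real^'n => complex) => bool" where
 "test_function h \<longleftrightarrow> h \<in> borelfun \<and> (\<exists>C. \<forall>y. cmod (h y) \<le> C) \<and> cell_supported h"

text \<open>Only displacements in the cover contribute to the square of a bracket with \<open>h\<close>, which is how the sum over
 all displacements in the quadratic form of a kernel becomes finite.\<close>

definition lattice_cover :: "(int^'n) set => (real^'n => complex) => bool" where
 "lattice_cover S h \<longleftrightarrow> finite S \<and> (\<forall>y s. h y ~= 0 --> h (shift2pi s y) ~= 0 --> s \<in> S)"

lemma finite_int_vec_box: "finite {k::int^'n. \<forall>i. \<bar>k $ i\<bar> \<le> M}"
proof (rule finite_subset)
 show "{k::int^'n. \<forall>i. \<bar>k $ i\<bar> \<le> M} \<subseteq> vec_lambda ` (PiE UNIV (\<lambda>_. {- M..M}))"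
 proof
  fix k :: "int^'n" assume "k \<in> {k. \<forall>i. \<bar>k $ i\<bar> \<le> M}"
  hence "vec_nth k \<in> PiE UNIV (\<lambda>_. {- M..M})" by (auto simp: PiE_def abs_le_iff minus_le_iff)
  thus "k \<in> vec_lambda ` (PiE UNIV (\<lambda>_. {- M..M}))" by (metis imageI vec_nth_inverse)
 qed
 show "finite (vec_lambda ` (PiE UNIV (\<lambda>_. {- M..M})) :: (int^'n) set)" by (intro finite_imageI finite_PiE) auto
qed

lemma lattice_cover_exists:
 fixes h :: "real^'n => complex"
 assumes "test_function h"
 shows "\<exists>S. lattice_cover S h"
proof -
 obtain R where R: "R > 0" "!!y. y \<notin> scaled_cell R ==> h y = 0"
  using assms by (auto simp: test_function_def cell_supported_def)
 have "\<bar>s $ i\<bar> \<le> \<lceil>R\<rceil>" if "h y ~= 0" "h (shift2pi s y) ~= 0" for y s i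
 proof -
  have "y \<in> scaled_cell R" "shift2pi s y \<in> scaled_cell R" using R that by auto
  hence c: "- (pi * R) < y $ i" "y $ i \<le> pi * R"
   "- (pi * R) < y $ i + 2 * pi * real_of_int (s $ i)" "y $ i + 2 * pi * real_of_int (s $ i) \<le> pi * R"
   using R(1) by (auto simp: scaled_cell_iff)
  have "\<bar>y $ i\<bar> \<le> pi * R" using c by linarith
  moreover have "\<bar>y $ i + 2 * pi * real_of_int (s $ i)\<bar> \<le> pi * R" using c by linarith
  moreover have "2 * pi * \<bar>real_of_int (s $ i)\<bar> \<le> \<bar>y $ i + 2 * pi * real_of_int (s $ i)\<bar> + \<bar>y $ i\<bar>"
   using abs_triangle_ineq4[of "y $ i + 2 * pi * real_of_int (s $ i)" "y $ i"] by (simp add: abs_mult)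
  ultimately have "2 * pi * \<bar>real_of_int (s $ i)\<bar> \<le> 2 * (pi * R)" by linarith
  hence "(2 * pi) * \<bar>real_of_int (s $ i)\<bar> \<le> (2 * pi) * R" by (simp only: mult.assoc)
  hence "\<bar>real_of_int (s $ i)\<bar> \<le> R" by (rule mult_left_le_imp_le) simp
  thus ?thesis by linarith
 qed
 hence "lattice_cover {s. \<forall>i. \<bar>s $ i\<bar> \<le> \<lceil>R\<rceil>} h"
  by (auto simp: lattice_cover_def finite_int_vec_box)
 thus ?thesis ..
qed

lemma test_function_fiber:
 fixes C :: real
 assumes S: "lattice_cover S h" and C: "!!y. cmod (h y) \<le> C"
 shows "finite {k. fiber h y k ~= 0}" "(\<integral>\<^sup>+k. esq (fiber h y k) \<partial>counting) \<le> ennreal (card S * C\<^sup>2)"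
proof -
 have sub: "\<exists>k0. {k. fiber h y k ~= 0} \<subseteq> (\<lambda>s. s + k0) ` S"
 proof (cases "{k. fiber h y k ~= 0} = {}")
  case False
  then obtain k0 where k0: "fiber h y k0 ~= 0" by blast
  have "{k. fiber h y k ~= 0} \<subseteq> (\<lambda>s. s + k0) ` S"
  proof
   fix k assume "k \<in> {k. fiber h y k ~= 0}"
   hence "h (shift2pi k y) ~= 0" by (simp add: fiber_def)
   moreover have eq: "shift2pi (k - k0) (shift2pi k0 y) = shift2pi k y" unfolding shift2pi_shift2pi by simp
   ultimately have "h (shift2pi (k - k0) (shift2pi k0 y)) ~= 0" unfolding eq by blast
   hence "k - k0 \<in> S" using S k0 by (auto simp: lattice_cover_def fiber_def)
   thus "k \<in> (\<lambda>s. s + k0) ` S" by (intro image_eqI[of _ _ "k - k0"]) auto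
  qed
  thus ?thesis by blast
 qed auto
 then obtain k0 where sub: "{k. fiber h y k ~= 0} \<subseteq> (\<lambda>s. s + k0) ` S" by blast
 have fS: "finite S" using S by (simp add: lattice_cover_def)
 thus "finite {k. fiber h y k ~= 0}" using finite_subset[OF sub] by simp
 have "(\<integral>\<^sup>+k. esq (fiber h y k) \<partial>counting) = (\<Sum>k\<in>(\<lambda>s. s + k0) ` S. esq (fiber h y k))"
  using sub fS by (intro nn_integral_count_space') auto
 also have "... \<le> (\<Sum>k\<in>(\<lambda>s. s + k0) ` S. ennreal (C\<^sup>2))"
  using C by (intro sum_mono ennreal_leI power_mono) (auto simp: fiber_def)
 also have "... = ennreal (card S * C\<^sup>2)"
  by (simp add: card_image ennreal_mult ennreal_of_nat_eq_real_of_nat)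
 finally show "(\<integral>\<^sup>+k. esq (fiber h y k) \<partial>counting) \<le> ennreal (card S * C\<^sup>2)" .
qed

lemma test_function_Lsq:
 assumes "test_function h"
 shows "h \<in> Lsq (lborel :: (real^'n) measure)"
proof -
 obtain C where C: "!!y. cmod (h y) \<le> C" and m: "h \<in> borelfun" using assms by (auto simp: test_function_def)
 obtain S where S: "lattice_cover S h" using lattice_cover_exists[OF assms] by blast
 have "(\<integral>\<^sup>+y. esq (h y) \<partial>lborel) \<le> (\<integral>\<^sup>+y. ennreal (card S * C\<^sup>2) \<partial>(cellM :: (real^'n) measure))"
  unfolding nn_integral_fiber[OF m, symmetric] by (intro nn_integral_mono test_function_fiber(2)[OF S C])
 also have "... < \<infinity>"
  by (simp add: emeasure_restrict_space space_restrict_space emeasure_cell ennreal_mult_less_top)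
 finally show ?thesis using m by (subst Lsq_iff_nn_integral) auto
qed

lemma test_function_bracket_Lsq:
 assumes h: "test_function h" and g: "g \<in> Lsq (lborel :: (real^'n) measure)"
 shows "bracket h g \<in> Lsq cellM"
proof -
 obtain C where C: "!!y. cmod (h y) \<le> C" and hm: "h \<in> borelfun" using h by (auto simp: test_function_def)
 obtain S where S: "lattice_cover S h" using lattice_cover_exists[OF h] by blast
 have gm [measurable]: "g \<in> borelfun" using g by (auto dest: LsqD)
 have m: "(\<lambda>y. \<integral>\<^sup>+k. esq (fiber g y k) \<partial>counting) \<in> borel_measurable cellM"
  unfolding fiber_def using gm by (intro measurable_cell_measure measurable_lattice_nn_sum) measurable
 have "(\<integral>\<^sup>+y. esq (bracket h g y) \<partial>cellM)
   \<le> (\<integral>\<^sup>+y. ennreal (card S * C\<^sup>2) * (\<integral>\<^sup>+k. esq (fiber g y k) \<partial>counting) \<partial>cellM)"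
 proof (rule nn_integral_mono_AE)
  show "AE y in cellM. esq (bracket h g y)
   \<le> ennreal (card S * C\<^sup>2) * (\<integral>\<^sup>+k. esq (fiber g y k) \<partial>counting)"
   using AE_lborel_imp_cell[OF fiber_l2[OF g]]
  proof eventually_elim
   fix y :: "real^'n" assume gl: "fiber g y \<in> l2"
   have hl: "fiber h y \<in> l2" unfolding fiber_l2_iff using test_function_fiber(2)[OF S C, of y] by (auto intro: le_less_trans)
   have "(Lsq_norm (counting) (fiber h y))\<^sup>2 \<le> card S * C\<^sup>2"
    using test_function_fiber(2)[OF S C, of y] unfolding nn_integral_Lsq_norm[OF hl] by (simp add: ennreal_le_iff)
   hence "(cmod (bracket h g y))\<^sup>2 \<le> (card S * C\<^sup>2) * (Lsq_norm (counting) (fiber g y))\<^sup>2"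
    using bracket_Cauchy_Schwarz[OF hl gl] by (elim order_trans) (intro mult_right_mono, auto)
   thus "esq (bracket h g y) \<le> ennreal (card S * C\<^sup>2) * (\<integral>\<^sup>+k. esq (fiber g y k) \<partial>counting)"
    unfolding nn_integral_Lsq_norm[OF gl] by (simp add: ennreal_mult[symmetric] ennreal_leI)
  qed
 qed
 also have "... = ennreal (card S * C\<^sup>2) * ennreal ((L2norm g)\<^sup>2)"
  using m by (simp add: nn_integral_cmult nn_integral_fiber[OF gm] nn_integral_Lsq_norm[OF g])
 also have "... < \<infinity>" by (simp add: ennreal_mult_less_top)
 finally show ?thesis using hm gm
  by (subst Lsq_iff_nn_integral) (auto intro!: measurable_cell_measure)
qed

text \<open>Folding a product of four factors: expanding the square of the bracket and unfolding one of the
 two lattice sums leaves a finite sum over the displacements.\<close>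

definition bracket_integrand :: "(int^'n) set => (real^'n => complex) => (real^'n => complex) => real^'n => complex" where
 "bracket_integrand S h g y = (\<Sum>s\<in>S. h y * cnj (h (shift2pi s y)) * cnj (g y * cnj (g (shift2pi s y))))"

lemma bracket_integrand_integrable:
 assumes h: "test_function h" and g: "g \<in> Lsq (lborel :: (real^'n) measure)" and S: "finite S"
 shows "integrable lborel (bracket_integrand S h g)"
 unfolding bracket_integrand_def[abs_def]
proof (rule Bochner_Integration.integrable_sum)
 fix s assume "s \<in> S"
 obtain C where C: "!!y. cmod (h y) \<le> C" and hm [measurable]: "h \<in> borelfun" using h by (auto simp: test_function_def)
 have gm [measurable]: "g \<in> borelfun" using g by (auto dest: LsqD)
 have gs: "(\<lambda>y. g (shift2pi s y)) \<in> L2"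
  using translate_Lsq[OF g, of "0"] integral_lborel_translate(2)[of "\<lambda>x. (cmod (g x))\<^sup>2" "(2 * pi) *\<^sub>R lattice_vec s"] g
  by (auto simp: Lsq_def)
 have 1: "(\<lambda>y. cnj (h y * cnj (h (shift2pi s y))) * g y) \<in> L2"
 proof (rule Lsq_bounded_mult[OF g, of _ "C * C"])
  show "AE y in lborel. cmod (cnj (h y * cnj (h (shift2pi s y)))) \<le> C * C"
   using C order_trans[OF norm_ge_zero C] by (intro AE_I2) (auto simp: norm_mult intro!: mult_mono)
 qed measurable
 from Lsq_inner_integrable[OF Lsq_cnj[OF 1] Lsq_cnj[OF gs]]
 show "integrable lborel (\<lambda>y. h y * cnj (h (shift2pi s y)) * cnj (g y * cnj (g (shift2pi s y))))"
  by (simp add: mult.assoc)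
qed

lemma bracket_norm_unfold:
 assumes h: "test_function h" and g: "g \<in> Lsq (lborel :: (real^'n) measure)" and S: "lattice_cover S h"
 shows "(\<integral>y. bracket_integrand S h g y \<partial>lborel) = cplx ((Lsq_norm cellM (bracket h g))\<^sup>2)"
proof -
 have fS: "finite S" using S by (simp add: lattice_cover_def)
 have "bracket_integrand S h g (shift2pi k y) = fiber h y k * cnj (fiber g y k) * cnj (bracket h g y)" for k y
 proof (cases "fiber h y k = 0")
  case False
  have "bracket h g y = bracket h g (shift2pi k y)" by (simp add: periodic2piD[OF bracket_periodic])
  also have "... = (\<integral>s. fiber h (shift2pi k y) s * cnj (fiber g (shift2pi k y) s) \<partial>counting)"
   by (simp add: bracket_def Lsq_inner_def)
  also have "... = (\<Sum>s\<in>S. fiber h (shift2pi k y) s * cnj (fiber g (shift2pi k y) s))"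
  proof -
   have z: "{a. fiber h (shift2pi k y) a * cnj (fiber g (shift2pi k y) a) ~= 0} \<subseteq> S"
    using S False by (auto simp: lattice_cover_def fiber_def)
   thus ?thesis
    using fS by (subst lebesgue_integral_count_space_finite_support)
     (auto intro: finite_subset intro!: sum.mono_neutral_left)
  qed
  finally show ?thesis
   by (simp add: bracket_integrand_def fiber_def sum_distrib_left mult_ac)
 qed (simp add: bracket_integrand_def fiber_def)
 hence "(\<integral>k. bracket_integrand S h g (shift2pi k y) \<partial>counting) = bracket h g y * cnj (bracket h g y)" for y
  by (simp add: bracket_def Lsq_inner_def)
 hence "(\<integral>y. bracket_integrand S h g y \<partial>lborel) = (\<integral>y. bracket h g y * cnj (bracket h g y) \<partial>cellM)"
  using integral_unfold(3)[OF bracket_integrand_integrable[OF h g fS]] by simp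
 also have "... = Lsq_inner cellM (bracket h g) (bracket h g)" by (simp add: Lsq_inner_def)
 finally show ?thesis by (simp only: Lsq_inner_self)
qed

section \<open>Correlation kernels\<close>

definition kernel :: "'i set => ('i => real^'n => complex) => real^'n => int^'n => complex" where
 "kernel I \<phi> y s = (\<Sum>\<^sub>\<infinity>i\<in>I. fourier (\<phi> i) y * cnj (fourier (\<phi> i) (shift2pi s y)))"

text \<open>The diagonal of the kernel, with values in the extended reals; for an orthonormal basis of the
 range function it is the spectral function of the space.\<close>

definition spectral :: "'i set => ('i => real^'n => complex) => real^'n => ennreal" where
 "spectral I \<phi> y = (\<integral>\<^sup>+i. esq (fourier (\<phi> i) y) \<partial>count_space I)"

lemma spectral_finite_iff: "spectral I \<phi> y < \<infinity> \<longleftrightarrow> (\<lambda>i. fourier (\<phi> i) y) \<in> Lsq (count_space I)"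
 unfolding spectral_def by (rule Lsq_iff_nn_integral[symmetric]) simp

lemma spectral_eq_norm:
 assumes "spectral I \<phi> y < \<infinity>"
 shows "spectral I \<phi> y = ennreal ((Lsq_norm (count_space I) (\<lambda>i. fourier (\<phi> i) y))\<^sup>2)"
 using assms nn_integral_Lsq_norm[of "\<lambda>i. fourier (\<phi> i) y" "count_space I"] by (simp add: spectral_finite_iff[symmetric] spectral_def)

lemma integral_count_space_complex_infsum:
 fixes g :: "'i => complex"
 shows "(\<integral>i. g i \<partial>count_space I) = infsum g I"
proof (cases "integrable (count_space I) g")
 case False
 have "\<not> g summable_on I"
 proof
  assume "g summable_on I"
  hence "Infinite_Set_Sum.abs_summable_on g I"
   using summable_on_iff_abs_summable_on_complex[of g I] abs_summable_equivalent[of g I] by blast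
  thus False using False by (simp add: Infinite_Set_Sum.abs_summable_on_def)
 qed
 thus ?thesis using False by (simp add: not_integrable_integral_eq infsum_not_exists)
qed (rule integral_count_space_eq_infsum)

lemma kernel_eq_inner:
 "kernel I \<phi> y s = Lsq_inner (count_space I) (\<lambda>i. fourier (\<phi> i) y) (\<lambda>i. fourier (\<phi> i) (shift2pi s y))"
 by (simp add: kernel_def Lsq_inner_def integral_count_space_complex_infsum)

lemma kernel_summable:
 assumes "spectral I \<phi> y < \<infinity>" "spectral I \<phi> \<eta> < \<infinity>"
 shows "(\<lambda>i. fourier (\<phi> i) y * cnj (fourier (\<phi> i) \<eta>)) summable_on I"
  and "integrable (count_space I) (\<lambda>i. fourier (\<phi> i) y * cnj (fourier (\<phi> i) \<eta>))"
proof -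
 show "integrable (count_space I) (\<lambda>i. fourier (\<phi> i) y * cnj (fourier (\<phi> i) \<eta>))"
  by (intro Lsq_inner_integrable spectral_finite_iff[THEN iffD1] assms)
 thus "(\<lambda>i. fourier (\<phi> i) y * cnj (fourier (\<phi> i) \<eta>)) summable_on I"
  by (rule integrable_count_space_summable_on)
qed

lemma kernel_bound:
 assumes "spectral I \<phi> y \<le> 1" "spectral I \<phi> (shift2pi s y) \<le> 1"
 shows "cmod (kernel I \<phi> y s) \<le> 1"
proof -
 have fin: "spectral I \<phi> y < \<infinity>" "spectral I \<phi> (shift2pi s y) < \<infinity>" using assms by (auto intro: le_less_trans)
 have n: "Lsq_norm (count_space I) (\<lambda>i. fourier (\<phi> i) \<eta>) \<le> 1" if "spectral I \<phi> \<eta> \<le> 1" for \<eta>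
 proof -
  have "spectral I \<phi> \<eta> < \<infinity>" using that by (auto intro: le_less_trans)
  hence "(Lsq_norm (count_space I) (\<lambda>i. fourier (\<phi> i) \<eta>))\<^sup>2 \<le> 1\<^sup>2" using that by (simp add: spectral_eq_norm)
  thus ?thesis by (rule power2_le_imp_le) simp
 qed
 have "cmod (kernel I \<phi> y s) \<le> Lsq_norm (count_space I) (\<lambda>i. fourier (\<phi> i) y) * Lsq_norm (count_space I) (\<lambda>i. fourier (\<phi> i) (shift2pi s y))"
  unfolding kernel_eq_inner by (intro Lsq_Cauchy_Schwarz spectral_finite_iff[THEN iffD1] fin)
 also have "... \<le> 1 * 1" using n assms by (intro mult_mono) auto
 finally show ?thesis by simp
qed

lemma spectral_kernel_0:
 assumes "spectral I \<phi> y < \<infinity>"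
 shows "kernel I \<phi> y 0 = cplx (enn2real (spectral I \<phi> y))"
 using spectral_eq_norm[OF assms] by (simp add: kernel_eq_inner Lsq_inner_self)

lemma fourier_measurable:
 "f \<in> L2 ==> fourier f \<in> borelfun"
 using Lsq_measurable[OF fourier_Lsq[of f]] by simp

lemma measurable_countable_family:
 assumes "countable I" "!!i. i \<in> I ==> F i \<in> borelfun"
 shows "(\<lambda>(y, i). F i y) \<in> borel_measurable (borel \<Otimes>\<^sub>M count_space I)"
proof -
 have "(\<lambda>p. F (fst p) (snd p)) \<in> borel_measurable (count_space I \<Otimes>\<^sub>M borel)"
  using assms by (intro measurable_pair_measure_countable1) auto
 from measurable_compose[OF measurable_pair_swap' this] show ?thesis
  by (simp add: case_prod_unfold)
qed

lemma spectral_measurable: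
 assumes I: "countable I" and \<phi>: "!!i. i \<in> I ==> \<phi> i \<in> L2"
 shows "spectral I \<phi> \<in> borelfun"
proof -
 have "(\<lambda>(y, i). esq (fourier (\<phi> i) y)) \<in> borel_measurable (borel \<Otimes>\<^sub>M count_space I)"
  using fourier_measurable[OF \<phi>] by (intro measurable_countable_family I) measurable
 thus ?thesis unfolding spectral_def[abs_def]
  by (rule sigma_finite_measure.borel_measurable_nn_integral[OF sigma_finite_measure_count_space_countable[OF I]])
qed

lemma kernel_measurable:
 assumes I: "countable I" and \<phi>: "!!i. i \<in> I ==> \<phi> i \<in> Lsq (lborel :: (real^'n) measure)"
 shows "(\<lambda>y. kernel I \<phi> y s) \<in> borelfun"
proof -
 have sh: "(\<lambda>y. shift2pi s y) \<in> borel_measurable (borel :: (real^'n) measure)" by measurable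
 have "(\<lambda>(y, i). fourier (\<phi> i) y * cnj (fourier (\<phi> i) (shift2pi s y))) \<in> borel_measurable (borel \<Otimes>\<^sub>M count_space I)"
  using fourier_measurable[OF \<phi>] measurable_compose[OF sh fourier_measurable[OF \<phi>]]
  by (intro measurable_countable_family I borel_measurable_times borel_measurable_cnj) auto
 thus ?thesis unfolding kernel_eq_inner Lsq_inner_def
  by (rule sigma_finite_measure.borel_measurable_lebesgue_integral[OF sigma_finite_measure_count_space_countable[OF I]])
qed

text \<open>Conjugation of the kernel makes this the squared norm of the coefficients when \<open>h\<close> is the transform of \<open>f\<close>.\<close>

definition kernel_form :: "(real^'n => int^'n => complex) => (int^'n) set => (real^'n => complex) => complex" where
 "kernel_form K S h = (\<integral>y. (\<Sum>s\<in>S. h y * cnj (h (shift2pi s y)) * cnj (K y s)) \<partial>lborel)"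

lemma fourier_preimage:
 assumes "test_function h"
 obtains f where "f \<in> L2" "AE y in lborel. fourier f y = h y"
 using fourier_surj[OF test_function_Lsq[OF assms]] by blast

lemma shift_energy_bracket:
 fixes \<phi> :: "'i => real^'n => complex"
 assumes I: "countable I" and \<phi>: "!!i. i \<in> I ==> \<phi> i \<in> L2"
  and f: "f \<in> L2" "AE y in lborel. fourier f y = h y" and h: "test_function h"
 shows "shift_energy I \<phi> f = (\<integral>\<^sup>+i. ennreal ((1 / plancherel_const TYPE('n)) * (Lsq_norm cellM (bracket h (fourier (\<phi> i))))\<^sup>2) \<partial>count_space I)"
 unfolding shift_energy_eq[OF I]
proof (rule nn_integral_cong)
 fix i assume "i \<in> space (count_space I)"
 hence i: "\<phi> i \<in> L2" using \<phi> by simp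
 note L = test_function_bracket_Lsq[OF h fourier_Lsq[OF i]]
 show "(\<integral>\<^sup>+k. esq (L2inner f (translate k (\<phi> i))) \<partial>counting)
   = ennreal ((1 / plancherel_const TYPE('n)) * (Lsq_norm cellM (bracket h (fourier (\<phi> i))))\<^sup>2)"
  using translates_energy[OF f(1) i f(2) _ L] by (simp add: nn_integral_Lsq_norm[OF L] ennreal_mult[symmetric])
qed

text \<open>Sum the unfolded square of the bracket over the family.  The bound on the spectral function gives
 a summable majorant, so Fubini's theorem moves the sum inside the integral, where it produces the kernel.\<close>

theorem shift_energy_kernel_form:
 fixes \<phi> :: "'i => real^'n => complex"
 assumes I: "countable I" and \<phi>: "!!i. i \<in> I ==> \<phi> i \<in> L2"
  and bdd: "AE y in lborel. spectral I \<phi> y \<le> 1"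
  and f: "f \<in> L2" "AE y in lborel. fourier f y = h y" and h: "test_function h" and S: "lattice_cover S h"
 shows "shift_energy I \<phi> f < \<infinity>"
  and "kernel_form (kernel I \<phi>) S h = cplx (plancherel_const TYPE('n) * enn2real (shift_energy I \<phi> f))"
proof -
 let ?c = "plancherel_const TYPE('n)"
 define g where "g i = fourier (\<phi> i)" for i
 have g: "g i \<in> L2" if "i \<in> I" for i using fourier_Lsq[OF \<phi>[OF that]] by (simp add: g_def)
 have fS: "finite S" using S by (simp add: lattice_cover_def)
 obtain C where C: "!!y. cmod (h y) \<le> C" and hm [measurable]: "h \<in> borelfun" using h by (auto simp: test_function_def)
 have C0: "C \<ge> 0" using C[of 0] norm_ge_zero[of "h 0"] by linarith
 define N where "N i = (Lsq_norm cellM (bracket h (g i)))\<^sup>2" for i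
 have N0: "N i \<ge> 0" for i by (simp add: N_def)
 define F where "F i = bracket_integrand S h (g i)" for i
 have Fi: "integrable lborel (F i)" if "i \<in> I" for i
  unfolding F_def by (rule bracket_integrand_integrable[OF h g[OF that] fS])
 have FN: "(\<integral>y. F i y \<partial>lborel) = cplx (N i)" if "i \<in> I" for i
  unfolding F_def N_def by (rule bracket_norm_unfold[OF h g[OF that] S])
 have Fm: "F i \<in> borelfun" if "i \<in> I" for i using Fi[OF that] by auto
 interpret pair_sigma_finite "count_space I" "lborel :: (real^'n) measure"
  by (intro pair_sigma_finite.intro sigma_finite_measure_count_space_countable I lborel.sigma_finite_measure_axioms)
 have pm [measurable]: "(\<lambda>(i, y). F i y) \<in> borel_measurable (count_space I \<Otimes>\<^sub>M (lborel :: (real^'n) measure))"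
  using Fm by (intro measurable_pair_measure_countable1 I) auto
 have specs: "AE y in lborel. \<forall>k. spectral I \<phi> (shift2pi k y) \<le> 1"
  by (rule AE_lborel_all_shifts[OF bdd])
 have Fbound: "cmod (F i y) \<le> (\<Sum>s\<in>S. C * cmod (h y) * ((cmod (g i y))\<^sup>2 + (cmod (g i (shift2pi s y)))\<^sup>2))" for i y
  unfolding F_def bracket_integrand_def
 proof (rule order_trans[OF norm_sum sum_mono])
  fix s
  have g1: "cmod (g i y) * cmod (g i (shift2pi s y)) \<le> (cmod (g i y))\<^sup>2 + (cmod (g i (shift2pi s y)))\<^sup>2"
  proof -
   have "2 * (cmod (g i y) * cmod (g i (shift2pi s y))) \<le> (cmod (g i y))\<^sup>2 + (cmod (g i (shift2pi s y)))\<^sup>2"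
    using sum_squares_bound[of "cmod (g i y)" "cmod (g i (shift2pi s y))"] by simp
   moreover have "0 \<le> cmod (g i y) * cmod (g i (shift2pi s y))" by simp
   ultimately show ?thesis by linarith
  qed
  have h1: "cmod (h y) * cmod (h (shift2pi s y)) \<le> C * cmod (h y)"
   using mult_left_mono[OF C[of "shift2pi s y"] norm_ge_zero[of "h y"]] by (simp add: mult.commute)
  show "cmod (h y * cnj (h (shift2pi s y)) * cnj (g i y * cnj (g i (shift2pi s y))))
    \<le> C * cmod (h y) * ((cmod (g i y))\<^sup>2 + (cmod (g i (shift2pi s y)))\<^sup>2)"
   unfolding norm_mult complex_mod_cnj by (rule mult_mono[OF h1 g1]) (use C0 in auto)
 qed
 have hint: "integrable lborel h"
  using h by (intro cell_supported_integrable test_function_Lsq) (auto simp: test_function_def)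
 have total: "(\<integral>\<^sup>+i. (\<integral>\<^sup>+y. ennreal (cmod (F i y)) \<partial>lborel) \<partial>count_space I) < \<infinity>"
 proof -
  have "(\<integral>\<^sup>+i. (\<integral>\<^sup>+y. ennreal (cmod (F i y)) \<partial>lborel) \<partial>count_space I)
    = (\<integral>\<^sup>+y. (\<integral>\<^sup>+i. ennreal (cmod (F i y)) \<partial>count_space I) \<partial>lborel)"
   by (rule Fubini'[symmetric]) measurable
  also have "... \<le> (\<integral>\<^sup>+y. ennreal (card S * (2 * C)) * ennreal (cmod (h y)) \<partial>lborel)"
  proof (rule nn_integral_mono_AE)
   show "AE y in lborel. (\<integral>\<^sup>+i. ennreal (cmod (F i y)) \<partial>count_space I) \<le> ennreal (card S * (2 * C)) * ennreal (cmod (h y))"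
    using specs
   proof eventually_elim
    fix y assume sp: "\<forall>k. spectral I \<phi> (shift2pi k y) \<le> 1"
    have sp0: "spectral I \<phi> y \<le> 1" using sp[rule_format, of 0] by simp
    have "(\<integral>\<^sup>+i. ennreal (cmod (F i y)) \<partial>count_space I)
      \<le> (\<integral>\<^sup>+i. (\<Sum>s\<in>S. ennreal (C * cmod (h y)) * (esq (g i y) + esq (g i (shift2pi s y)))) \<partial>count_space I)"
    proof (rule nn_integral_mono)
     fix i
     have "ennreal (cmod (F i y)) \<le> ennreal (\<Sum>s\<in>S. C * cmod (h y) * ((cmod (g i y))\<^sup>2 + (cmod (g i (shift2pi s y)))\<^sup>2))"
      by (rule ennreal_leI[OF Fbound])
     also have "... = (\<Sum>s\<in>S. ennreal (C * cmod (h y) * ((cmod (g i y))\<^sup>2 + (cmod (g i (shift2pi s y)))\<^sup>2)))"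
      using C0 by (intro sum_ennreal[symmetric]) auto
     also have "... = (\<Sum>s\<in>S. ennreal (C * cmod (h y)) * (esq (g i y) + esq (g i (shift2pi s y))))"
     proof (rule sum.cong[OF refl])
      fix s
      have "ennreal (C * cmod (h y) * ((cmod (g i y))\<^sup>2 + (cmod (g i (shift2pi s y)))\<^sup>2))
       = ennreal (C * cmod (h y)) * ennreal ((cmod (g i y))\<^sup>2 + (cmod (g i (shift2pi s y)))\<^sup>2)"
       using C0 by (intro ennreal_mult) auto
      thus "ennreal (C * cmod (h y) * ((cmod (g i y))\<^sup>2 + (cmod (g i (shift2pi s y)))\<^sup>2))
       = ennreal (C * cmod (h y)) * (esq (g i y) + esq (g i (shift2pi s y)))"
       by (simp add: ennreal_plus)
     qed
     finally show "ennreal (cmod (F i y)) \<le> (\<Sum>s\<in>S. ennreal (C * cmod (h y)) * (esq (g i y) + esq (g i (shift2pi s y))))" .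
    qed
    also have "... = (\<Sum>s\<in>S. ennreal (C * cmod (h y)) * (spectral I \<phi> y + spectral I \<phi> (shift2pi s y)))"
     by (simp add: nn_integral_sum nn_integral_cmult nn_integral_add spectral_def g_def)
    also have "... \<le> (\<Sum>s\<in>S. ennreal (C * cmod (h y)) * 2)"
    proof (intro sum_mono mult_left_mono)
     fix s show "spectral I \<phi> y + spectral I \<phi> (shift2pi s y) \<le> 2"
      using add_mono[OF sp0 sp[rule_format, of s]] by simp
    qed auto
    also have "... = ennreal (card S * (2 * C)) * ennreal (cmod (h y))"
     using C0 by (simp add: ennreal_mult ennreal_of_nat_eq_real_of_nat[symmetric] mult_ac)
    finally show "(\<integral>\<^sup>+i. ennreal (cmod (F i y)) \<partial>count_space I) \<le> ennreal (card S * (2 * C)) * ennreal (cmod (h y))" .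
   qed
  qed
  also have "... = ennreal (card S * (2 * C)) * (\<integral>\<^sup>+y. ennreal (cmod (h y)) \<partial>lborel)"
   by (rule nn_integral_cmult) measurable
  also have "... < \<infinity>" using hint by (auto simp: integrable_iff_bounded ennreal_mult_less_top)
  finally show ?thesis .
 qed
 have prod: "integrable (count_space I \<Otimes>\<^sub>M lborel) (\<lambda>(i, y). F i y)"
 proof (rule integrableI_bounded[OF pm])
  have "(\<integral>\<^sup>+p. ennreal (norm (case p of (i, y) => F i y)) \<partial>(count_space I \<Otimes>\<^sub>M lborel))
   = (\<integral>\<^sup>+i. (\<integral>\<^sup>+y. ennreal (cmod (F i y)) \<partial>lborel) \<partial>count_space I)"
   by (subst lborel.nn_integral_fst[symmetric]) auto
  thus "(\<integral>\<^sup>+p. ennreal (norm (case p of (i, y) => F i y)) \<partial>(count_space I \<Otimes>\<^sub>M lborel)) < \<infinity>" using total by simp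
 qed
 have Ni: "integrable (count_space I) (\<lambda>i. cplx (N i))"
  using integrable_fst[OF prod] Bochner_Integration.integrable_cong[OF refl, of "count_space I"
   "\<lambda>i. \<integral>y. F i y \<partial>lborel" "\<lambda>i. cplx (N i)"] FN by simp
 hence NiR: "integrable (count_space I) N" using integrable_Re by fastforce
 have int_eq: "(\<integral>i. cplx (N i) \<partial>count_space I) = kernel_form (kernel I \<phi>) S h"
 proof -
  have "(\<integral>i. cplx (N i) \<partial>count_space I) = (\<integral>i. (\<integral>y. F i y \<partial>lborel) \<partial>count_space I)"
   by (intro Bochner_Integration.integral_cong) (auto simp: FN)
  also have "... = (\<integral>y. (\<integral>i. F i y \<partial>count_space I) \<partial>lborel)"
   by (rule Fubini_integral[OF prod, symmetric])
  also have "... = kernel_form (kernel I \<phi>) S h"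
   unfolding kernel_form_def
  proof (rule integral_cong_AE)
   show "(\<lambda>y. \<integral>i. F i y \<partial>count_space I) \<in> borel_measurable lborel"
    using integrable_snd[OF prod] by auto
   have [measurable]: "(\<lambda>y. kernel I \<phi> y s) \<in> borelfun" for s
    by (rule kernel_measurable[OF I \<phi>])
   show "(\<lambda>y. \<Sum>s\<in>S. h y * cnj (h (shift2pi s y)) * cnj (kernel I \<phi> y s)) \<in> borel_measurable lborel"
    by measurable
   show "AE y in lborel. (\<integral>i. F i y \<partial>count_space I) = (\<Sum>s\<in>S. h y * cnj (h (shift2pi s y)) * cnj (kernel I \<phi> y s))"
    using specs
   proof eventually_elim
    fix y assume sp: "\<forall>k. spectral I \<phi> (shift2pi k y) \<le> 1"
    have sp': "spectral I \<phi> (shift2pi s y) < \<infinity>" for s using sp[rule_format, of s] by (auto intro: le_less_trans)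
    have int: "integrable (count_space I) (\<lambda>i. cnj (g i y * cnj (g i (shift2pi s y))))" for s
     using kernel_summable(2)[OF sp'[of 0] sp'[of s]] by (simp add: g_def del: complex_cnj_mult)
    have k: "(\<integral>i. cnj (g i y * cnj (g i (shift2pi s y))) \<partial>count_space I) = cnj (kernel I \<phi> y s)" for s
     by (simp add: kernel_eq_inner Lsq_inner_def g_def del: complex_cnj_mult)
    have "(\<integral>i. F i y \<partial>count_space I) = (\<Sum>s\<in>S. h y * cnj (h (shift2pi s y)) * (\<integral>i. cnj (g i y * cnj (g i (shift2pi s y))) \<partial>count_space I))"
     unfolding F_def bracket_integrand_def using int by (subst Bochner_Integration.integral_sum) (auto simp del: complex_cnj_mult)
    thus "(\<integral>i. F i y \<partial>count_space I) = (\<Sum>s\<in>S. h y * cnj (h (shift2pi s y)) * cnj (kernel I \<phi> y s))"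
     unfolding k .
   qed
  qed
  finally show ?thesis .
 qed
 have "shift_energy I \<phi> f = (\<integral>\<^sup>+i. ennreal ((1 / ?c) * N i) \<partial>count_space I)"
  using shift_energy_bracket[of I \<phi>, OF I \<phi> f h] by (simp add: N_def g_def)
 also have "... = ennreal (\<integral>i. (1 / ?c) * N i \<partial>count_space I)"
  using NiR N0 by (intro nn_integral_eq_integral) auto
 also have "(\<integral>i. (1 / ?c) * N i \<partial>count_space I) = (1 / ?c) * (\<integral>i. N i \<partial>count_space I)"
  by (rule integral_mult_right_zero)
 finally have E: "shift_energy I \<phi> f = ennreal ((1 / ?c) * (\<integral>i. N i \<partial>count_space I))" .
 thus "shift_energy I \<phi> f < \<infinity>" by simp
 have "(\<integral>i. N i \<partial>count_space I) \<ge> 0" using N0 by simp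
 hence "?c * enn2real (shift_energy I \<phi> f) = (\<integral>i. N i \<partial>count_space I)" by (simp add: E)
 thus "kernel_form (kernel I \<phi>) S h = cplx (?c * enn2real (shift_energy I \<phi> f))"
  using int_eq by simp
qed

lemma cell_translates_disjoint:
 fixes s k :: "int^'n"
 assumes "shift2pi k y \<in> cell" "shift2pi k (shift2pi s y) \<in> cell"
 shows "s = 0"
proof -
 let ?z = "shift2pi k y"
 have "?z - (2 * pi) *\<^sub>R lattice_vec 0 \<in> cell" "?z - (2 * pi) *\<^sub>R lattice_vec (- s) \<in> cell"
  using assms by (simp_all add: algebra_simps)
 hence "0 = - s" using cell_translate_unique[of ?z] by blast
 thus ?thesis by simp
qed

lemma bounded_subset_scaled_cell:
 fixes E :: "(real^'n) set"
 assumes "bounded E"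
 shows "\<exists>R>0. E \<subseteq> scaled_cell R"
proof -
 obtain b where b: "b > 0" "!!x. x \<in> E ==> norm x \<le> b" using assms by (auto simp: bounded_pos)
 have "x \<in> scaled_cell b" if "x \<in> E" for x
 proof -
  have "- (pi * b) < x $ i \<and> x $ i \<le> pi * b" for i
  proof -
   have "\<bar>x $ i\<bar> \<le> b" using component_le_norm_cart[of x i] b(2)[OF that] by linarith
   moreover have "b < pi * b" using b(1) pi_ge_two by simp
   ultimately show ?thesis by linarith
  qed
  thus ?thesis using b(1) by (simp add: scaled_cell_iff)
 qed
 thus ?thesis using b(1) by blast
qed

lemma bounded_cell_translate: "bounded {y::real^'n. shift2pi k y \<in> cell}"
proof -
 have "cell \<subseteq> (cbox (\<chi> i. - pi) (\<chi> i. pi) :: (real^'n) set)" by (auto simp: cell_def mem_box_cart less_imp_le)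
 hence "bounded (cell :: (real^'n) set)" by (rule bounded_subset[OF bounded_cbox])
 hence "bounded ((\<lambda>x. - (2 * pi) *\<^sub>R lattice_vec k + x) ` (cell :: (real^'n) set))" by (rule bounded_translation)
 moreover have "{y::real^'n. shift2pi k y \<in> cell} \<subseteq> (\<lambda>x. - (2 * pi) *\<^sub>R lattice_vec k + x) ` cell"
 proof
  fix y :: "real^'n" assume "y \<in> {y. shift2pi k y \<in> cell}"
  thus "y \<in> (\<lambda>x. - (2 * pi) *\<^sub>R lattice_vec k + x) ` cell" by (intro image_eqI[of _ _ "shift2pi k y"]) auto
 qed
 ultimately show ?thesis by (rule bounded_subset)
qed

text \<open>The lattice translates of such a set are disjoint.\<close>

definition small_set :: "int^'n => (real^'n) set => bool" where
 "small_set k E \<longleftrightarrow> E \<in> sets borel \<and> E \<subseteq> {y. shift2pi k y \<in> cell}"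

lemma small_set_bounded: "small_set k E ==> bounded E"
 using bounded_cell_translate bounded_subset unfolding small_set_def by blast

lemma small_set_displacement: "small_set k E ==> y \<in> E ==> shift2pi s y \<in> E ==> s = 0"
 using cell_translates_disjoint unfolding small_set_def by blast

lemma bounded_test_function:
 assumes "h \<in> borelfun" "!!y. cmod (h y) \<le> C" "bounded E" "!!y. y \<notin> E ==> h y = 0"
 shows "test_function h"
 using assms bounded_subset_scaled_cell[OF assms(3)] unfolding test_function_def cell_supported_def by blast

lemma AE_cell_translates:
 assumes "!!k. AE y in lborel. shift2pi k y \<in> cell --> P (y :: real^'n)"
 shows "AE y in lborel. P y"
proof -
 have "AE y in lborel. \<forall>k. shift2pi k y \<in> cell --> P y" using assms by (subst AE_all_countable) blast
 thus ?thesis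
 proof eventually_elim
  fix y :: "real^'n" assume *: "\<forall>k. shift2pi k y \<in> cell --> P y"
  obtain k where "y - (2 * pi) *\<^sub>R lattice_vec k \<in> cell" using cell_translate_unique by blast
  thus "P y" using *[rule_format, of "- k"] by simp
 qed
qed

lemma cell_translate_borel [measurable]: "{y::real^'n. shift2pi k y \<in> cell} \<in> sets borel"
 using measurable_sets[of "\<lambda>y. shift2pi k y" borel borel cell] by (simp add: vimage_def)

text \<open>Test the hypothesis on the sets where \<open>f\<close> exceeds \<open>1\<close> by a definite amount.\<close>

lemma AE_le_1_if_small_integrals:
 fixes f :: "real^'n => ennreal"
 assumes [measurable]: "f \<in> borelfun"
  and le: "!!k E. small_set k E ==> (\<integral>\<^sup>+y. f y * indicator E y \<partial>lborel) \<le> emeasure lborel E"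
 shows "AE y in lborel. f y \<le> 1"
proof (rule AE_cell_translates)
 fix k :: "int^'n"
 define E where "E n = {y. shift2pi k y \<in> cell} \<inter> {y. ennreal (1 + 1 / Suc n) \<le> f y}" for n
 have Eb [measurable]: "E n \<in> sets borel" for n unfolding E_def by measurable
 have small: "small_set k (E n)" for n using Eb by (auto simp: small_set_def E_def)
 have zero: "emeasure lborel (E n) = 0" for n
 proof -
  define m where "m = measure lborel (E n)"
  have fin: "emeasure lborel (E n) < \<infinity>"
   using emeasure_bounded_finite[OF small_set_bounded[OF small]] by simp
  hence m: "emeasure lborel (E n) = ennreal m" by (simp add: m_def emeasure_eq_ennreal_measure less_top)
  have m0: "m \<ge> 0" by (simp add: m_def)
  have "ennreal (1 + 1 / Suc n) * emeasure lborel (E n) = (\<integral>\<^sup>+y. ennreal (1 + 1 / Suc n) * indicator (E n) y \<partial>lborel)"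
   by (simp add: nn_integral_cmult_indicator)
  also have "... \<le> (\<integral>\<^sup>+y. f y * indicator (E n) y \<partial>lborel)"
   by (intro nn_integral_mono) (auto simp: E_def indicator_def)
  also have "... \<le> emeasure lborel (E n)" by (rule le[OF small])
  finally have "ennreal ((1 + 1 / Suc n) * m) \<le> ennreal m" using m0 by (simp add: m ennreal_mult)
  hence "(1 + 1 / Suc n) * m \<le> m" using m0 by (simp add: ennreal_le_iff)
  hence "m / Suc n \<le> 0" by (simp add: algebra_simps)
  hence "m = 0" using m0 by (simp add: divide_le_0_iff)
  thus ?thesis by (simp add: m)
 qed
 have "AE y in lborel. \<forall>n. y \<notin> E n"
  using zero Eb by (subst AE_all_countable) (auto intro!: AE_not_in simp: null_sets_def)
 thus "AE y in lborel. shift2pi k y \<in> cell --> f y \<le> 1"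
 proof eventually_elim
  fix y assume *: "\<forall>n. y \<notin> E n"
  show "shift2pi k y \<in> cell --> f y \<le> 1"
  proof
   assume "shift2pi k y \<in> cell"
   hence "f y \<le> ennreal (1 + 1 / Suc n)" for n using *[rule_format, of n] by (auto simp: E_def not_le less_imp_le)
   moreover have "(\<lambda>n. ennreal (1 + 1 / Suc n)) \<longlonglongrightarrow> ennreal (1 + 0)"
    by (intro tendsto_ennrealI tendsto_intros LIMSEQ_Suc[OF lim_1_over_n])
   ultimately show "f y \<le> 1" by (intro LIMSEQ_le_const[of "\<lambda>n. ennreal (1 + 1 / Suc n)"]) auto
  qed
 qed
qed

lemma AE_zero_if_small_integrals:
 fixes u :: "real^'n => complex"
 assumes um [measurable]: "u \<in> borelfun" and bdd: "AE y in lborel. cmod (u y) \<le> C"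
  and zero: "!!k E. small_set k E ==> (\<integral>y. indicator E y * u y \<partial>lborel) = 0"
 shows "AE y in lborel. u y = 0"
proof (rule AE_cell_translates)
 fix k :: "int^'n"
 define Q where "Q = {y::real^'n. shift2pi k y \<in> cell}"
 have [measurable]: "Q \<in> sets borel" by (simp add: Q_def)
 have Qf: "emeasure lborel Q < \<infinity>" using emeasure_bounded_finite[OF bounded_cell_translate[of k]] by (simp add: Q_def)
 have int: "integrable lborel (\<lambda>y. indicator Q y * u y)"
 proof (rule Bochner_Integration.integrable_bound[of _ "\<lambda>y. C * indicator Q y :: real"])
  show "integrable lborel (\<lambda>y. C * indicator Q y :: real)" using Qf by (intro integrable_mult_right integrable_real_indicator) auto
  show "AE y in lborel. norm (indicator Q y * u y) \<le> norm (C * indicator Q y :: real)"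
   using bdd by eventually_elim (auto simp: indicator_def)
 qed measurable
 have "AE y in lborel. indicator Q y * u y = 0"
 proof (rule sigma_finite_measure.density_zero[OF lborel.sigma_finite_measure_axioms int])
  fix A :: "(real^'n) set" assume "A \<in> sets lborel"
  hence [measurable]: "A \<in> sets borel" by simp
  have "small_set k (A \<inter> Q)" by (auto simp: small_set_def Q_def)
  from zero[OF this] show "set_lebesgue_integral lborel A (\<lambda>y. indicator Q y * u y) = 0"
   by (simp add: set_lebesgue_integral_def indicator_inter_arith scaleR_conv_of_real of_real_indicator mult.assoc)
 qed
 thus "AE y in lborel. shift2pi k y \<in> cell --> u y = 0"
  by eventually_elim (auto simp: Q_def indicator_def split: if_splits)
qed

text \<open>Testing the Bessel inequality against the indicators of small sets on the Fourier side.\<close>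

theorem spectral_le_1:
 fixes \<phi> :: "'i => real^'n => complex"
 assumes I: "countable I" and \<phi>: "!!i. i \<in> I ==> \<phi> i \<in> L2"
  and bessel: "!!f. f \<in> L2 ==> shift_energy I \<phi> f \<le> ennreal ((L2norm f)\<^sup>2)"
 shows "AE y in lborel. spectral I \<phi> y \<le> 1"
proof (rule AE_le_1_if_small_integrals[OF spectral_measurable[OF I \<phi>]])
 let ?c = "plancherel_const TYPE('n)"
 fix k and E :: "(real^'n) set" assume E: "small_set k E"
 hence [measurable]: "E \<in> sets borel" by (simp add: small_set_def)
 define h :: "real^'n => complex" where "h = indicator E"
 have h: "test_function h" unfolding h_def
  by (rule bounded_test_function[of _ 1, OF _ _ small_set_bounded[OF E]]) (auto simp: indicator_def)
 have S: "lattice_cover {0} h"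
  using small_set_displacement[OF E] by (auto simp: lattice_cover_def h_def indicator_def split: if_splits)
 obtain f where f: "f \<in> L2" "AE y in lborel. fourier f y = h y" by (rule fourier_preimage[OF h])
 define m where "m = measure lborel E"
 have m: "emeasure lborel E = ennreal m"
  using emeasure_bounded_finite[OF small_set_bounded[OF E]] by (simp add: m_def emeasure_eq_ennreal_measure less_top)
 have "(L2norm h)\<^sup>2 = m"
 proof -
  have "(\<lambda>y. (cmod (h y))\<^sup>2) = indicator E" by (auto simp: h_def indicator_def)
  thus ?thesis by (simp add: Lsq_norm_power2 m_def)
 qed
 moreover have "L2norm (fourier f) = L2norm h"
  using f(2) fourier_Lsq[OF f(1)] test_function_Lsq[OF h] by (intro Lsq_norm_cong_AE) (auto dest: LsqD)
 ultimately have "(sqrt ?c * L2norm f)\<^sup>2 = m" using fourier_norm[OF f(1)] by (simp only:)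
 hence fm: "?c * (L2norm f)\<^sup>2 = m" by (simp add: power_mult_distrib)
 have Ni: "(\<integral>\<^sup>+y. esq (fourier (\<phi> i) y) * indicator E y \<partial>lborel)
   = ennreal ((Lsq_norm cellM (bracket h (fourier (\<phi> i))))\<^sup>2)" if "i \<in> I" for i
 proof -
  let ?g = "fourier (\<phi> i)"
  have g: "?g \<in> L2" by (rule fourier_Lsq[OF \<phi>[OF that]])
  have bi: "bracket_integrand {0} h ?g = (\<lambda>y. cplx ((cmod (?g y))\<^sup>2 * indicator E y))"
  proof
   fix y
   have "cnj (?g y) * ?g y = cplx ((cmod (?g y))\<^sup>2)" by (simp only: complex_norm_square mult.commute)
   thus "bracket_integrand {0} h ?g y = cplx ((cmod (?g y))\<^sup>2 * indicator E y)"
    by (cases "y \<in> E") (simp_all add: bracket_integrand_def h_def)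
  qed
  have int: "integrable lborel (\<lambda>y. (cmod (?g y))\<^sup>2 * indicator E y)"
   using integrable_Re[OF bracket_integrand_integrable[OF h g, of "{0}"]] unfolding bi by (simp del: of_real_mult)
  have "cplx (\<integral>y. (cmod (?g y))\<^sup>2 * indicator E y \<partial>lborel) = cplx ((Lsq_norm cellM (bracket h ?g))\<^sup>2)"
   unfolding bracket_norm_unfold[OF h g S, symmetric] bi by (rule integral_complex_of_real[symmetric])
  hence "(\<integral>y. (cmod (?g y))\<^sup>2 * indicator E y \<partial>lborel) = (Lsq_norm cellM (bracket h ?g))\<^sup>2" by (simp only: of_real_eq_iff)
  moreover have "(\<integral>\<^sup>+y. esq (?g y) * indicator E y \<partial>lborel) = (\<integral>\<^sup>+y. ennreal ((cmod (?g y))\<^sup>2 * indicator E y) \<partial>lborel)"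
   by (intro nn_integral_cong) (simp add: indicator_def)
  ultimately show ?thesis using nn_integral_eq_integral[OF int] by simp
 qed
 interpret pair_sigma_finite "count_space I" "lborel :: (real^'n) measure"
  by (intro pair_sigma_finite.intro sigma_finite_measure_count_space_countable I lborel.sigma_finite_measure_axioms)
 have pm: "(\<lambda>(i, y). esq (fourier (\<phi> i) y) * indicator E y) \<in> borel_measurable (count_space I \<Otimes>\<^sub>M (lborel :: (real^'n) measure))"
 proof (intro measurable_pair_measure_countable1 I)
  fix i assume "i \<in> I"
  hence [measurable]: "fourier (\<phi> i) \<in> borelfun" by (intro fourier_measurable \<phi>)
  show "(\<lambda>z. case (i, z) of (i, y) => esq (fourier (\<phi> i) y) * indicator E y) \<in> borel_measurable lborel" by simp
 qed
 have "(\<integral>\<^sup>+y. spectral I \<phi> y * indicator E y \<partial>lborel)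
   = (\<integral>\<^sup>+y. (\<integral>\<^sup>+i. esq (fourier (\<phi> i) y) * indicator E y \<partial>count_space I) \<partial>lborel)"
  unfolding spectral_def by (simp add: nn_integral_multc)
 also have "... = (\<integral>\<^sup>+i. (\<integral>\<^sup>+y. esq (fourier (\<phi> i) y) * indicator E y \<partial>lborel) \<partial>count_space I)"
  using Fubini'[OF pm] by simp
 also have "... = (\<integral>\<^sup>+i. ennreal ?c * ennreal ((1 / ?c) * (Lsq_norm cellM (bracket h (fourier (\<phi> i))))\<^sup>2) \<partial>count_space I)"
  using Ni by (intro nn_integral_cong) (simp add: ennreal_mult[symmetric])
 also have "... = ennreal ?c * (\<integral>\<^sup>+i. ennreal ((1 / ?c) * (Lsq_norm cellM (bracket h (fourier (\<phi> i))))\<^sup>2) \<partial>count_space I)"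
  by (rule nn_integral_cmult) simp
 also have "(\<integral>\<^sup>+i. ennreal ((1 / ?c) * (Lsq_norm cellM (bracket h (fourier (\<phi> i))))\<^sup>2) \<partial>count_space I) = shift_energy I \<phi> f"
  by (rule shift_energy_bracket[of I \<phi>, OF I \<phi> f h, symmetric])
 also have "ennreal ?c * ... \<le> ennreal ?c * ennreal ((L2norm f)\<^sup>2)" by (intro mult_left_mono bessel f) simp
 also have "... = emeasure lborel E" unfolding m fm[symmetric] by (simp add: ennreal_mult)
 finally show "(\<integral>\<^sup>+y. spectral I \<phi> y * indicator E y \<partial>lborel) \<le> emeasure lborel E" .
qed

lemma test_function_bounded_integrable:
 assumes h: "test_function h" and um [measurable]: "u \<in> borelfun"
  and bdd: "AE y in lborel. cmod (u y) \<le> C"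
 shows "integrable lborel (\<lambda>y. h y * cnj (h (shift2pi s y)) * cnj (u y))"
proof -
 obtain D where D: "!!y. cmod (h y) \<le> D" and hm [measurable]: "h \<in> borelfun" using h by (auto simp: test_function_def)
 have D0: "0 \<le> D" using D[of 0] norm_ge_zero[of "h 0"] by linarith
 have hint: "integrable lborel h"
  using h by (intro cell_supported_integrable test_function_Lsq) (auto simp: test_function_def)
 show ?thesis
 proof (rule Bochner_Integration.integrable_bound[of _ "\<lambda>y. (D * C) * cmod (h y)"])
  show "integrable lborel (\<lambda>y. (D * C) * cmod (h y))" using hint by auto
  show "AE y in lborel. norm (h y * cnj (h (shift2pi s y)) * cnj (u y)) \<le> norm ((D * C) * cmod (h y))"
   using bdd
  proof eventually_elim
   fix y assume u: "cmod (u y) \<le> C"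
   have "cmod (h (shift2pi s y)) * cmod (u y) \<le> D * C"
    by (rule mult_mono[OF D u D0]) simp
   from mult_left_mono[OF this norm_ge_zero[of "h y"]]
   have "cmod (h y) * (cmod (h (shift2pi s y)) * cmod (u y)) \<le> (D * C) * cmod (h y)" by (simp only: mult.commute)
   also have "... \<le> norm ((D * C) * cmod (h y))" by simp
   finally show "norm (h y * cnj (h (shift2pi s y)) * cnj (u y)) \<le> norm ((D * C) * cmod (h y))"
    by (simp only: norm_mult complex_mod_cnj mult.assoc)
  qed
 qed measurable
qed

text \<open>A bounded kernel is determined by its form: the indicator of a small set isolates the diagonal, and a
 combination of the indicators of two congruent small sets isolates the corresponding displacement.\<close>

theorem kernel_form_determines:
 fixes K :: "real^'n => int^'n => complex"
 assumes Km: "!!s. (\<lambda>y. K y s) \<in> borelfun" and bdd: "!!s. AE y in lborel. cmod (K y s) \<le> C"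
  and zero: "!!h S. test_function h ==> lattice_cover S h ==> kernel_form K S h = 0"
 shows "AE y in lborel. \<forall>s. K y s = 0"
proof -
 have [measurable]: "(\<lambda>y. K y s) \<in> borelfun" for s by (rule Km)
 have diag: "AE y in lborel. K y 0 = 0"
 proof -
  have "AE y in lborel. cnj (K y 0) = 0"
  proof (rule AE_zero_if_small_integrals[where C = C])
   fix k and E :: "(real^'n) set" assume E: "small_set k E"
   hence [measurable]: "E \<in> sets borel" by (simp add: small_set_def)
   define h :: "real^'n => complex" where "h = indicator E"
   have h: "test_function h" unfolding h_def
    by (rule bounded_test_function[of _ 1, OF _ _ small_set_bounded[OF E]]) (auto simp: indicator_def)
   have S: "lattice_cover {0} h"
    using small_set_displacement[OF E] by (auto simp: lattice_cover_def h_def indicator_def split: if_splits)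
   have "kernel_form K {0} h = (\<integral>y. indicator E y * cnj (K y 0) \<partial>lborel)"
    unfolding kernel_form_def by (intro Bochner_Integration.integral_cong) (auto simp: h_def indicator_def)
   with zero[OF h S] show "(\<integral>y. indicator E y * cnj (K y 0) \<partial>lborel) = 0" by simp
  qed (use bdd[of 0] in auto)
  thus ?thesis by simp
 qed
 have "AE y in lborel. K y s = 0" for s
 proof (cases "s = 0")
  case False
  have "AE y in lborel. cnj (K y s) = 0"
  proof (rule AE_zero_if_small_integrals[where C = C])
   fix k and E :: "(real^'n) set" assume E: "small_set k E"
   hence Eb [measurable]: "E \<in> sets borel" by (simp add: small_set_def)
   define e :: "real^'n => complex" where "e = indicator E"
   have em [measurable]: "e \<in> borelfun" by (simp add: e_def)
   have ee: "e y * e (shift2pi t y) = 0" if "t ~= 0" for y t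
    using small_set_displacement[OF E, of y t] that by (auto simp: e_def indicator_def)
   have e_sq: "e y * e y = e y" "cnj (e y) = e y" for y by (auto simp: e_def indicator_def)
   have s2: "s + s ~= 0" using False by (auto simp: vec_eq_iff)
   have ss: "s ~= - s" using s2 by (metis add.right_inverse)
   define X where "X = (\<integral>y. e y * cnj (K y s) \<partial>lborel)"
   define Y where "Y = (\<integral>y. e (shift2pi (- s) y) * cnj (K y (- s)) \<partial>lborel)"
   have XY: "cnj a * X + a * Y = 0" for a :: complex
   proof -
    define h where "h y = e y + a * e (shift2pi (- s) y)" for y
    have hm [measurable]: "h \<in> borelfun" unfolding h_def[abs_def] by measurable
    have Es: "bounded (E \<union> (\<lambda>x. (2 * pi) *\<^sub>R lattice_vec s + x) ` E)"
     using small_set_bounded[OF E] bounded_translation[OF small_set_bounded[OF E]] by simp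
    have h: "test_function h"
    proof (rule bounded_test_function[OF hm _ Es])
     show "cmod (h y) \<le> 1 + cmod a" for y
      unfolding h_def by (rule order_trans[OF norm_triangle_ineq]) (auto simp: e_def indicator_def norm_mult intro!: add_mono)
     fix y assume x: "y \<notin> E \<union> (\<lambda>x. (2 * pi) *\<^sub>R lattice_vec s + x) ` E"
     have "shift2pi (- s) y \<notin> E"
     proof
      assume "shift2pi (- s) y \<in> E"
      hence "(2 * pi) *\<^sub>R lattice_vec s + shift2pi (- s) y \<in> (\<lambda>x. (2 * pi) *\<^sub>R lattice_vec s + x) ` E" by blast
      thus False using x by simp
     qed
     thus "h y = 0" using x by (simp add: h_def e_def)
    qed
    have S: "lattice_cover {0, s, - s} h"
     unfolding lattice_cover_def
    proof (intro conjI allI impI)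
     fix y t assume "h y ~= 0" "h (shift2pi t y) ~= 0"
     then obtain p q where pq: "p = 0 \<or> p = - s" "q = 0 \<or> q = - s"
      and *: "shift2pi p y \<in> E" "shift2pi q (shift2pi t y) \<in> E"
      unfolding h_def e_def
      by (metis (no_types, lifting) add_cancel_left_left add.right_neutral indicator_simps(2) lattice_vec_simps(1) mult_zero_right scaleR_zero_right)
     have "shift2pi (t + q - p) (shift2pi p y) \<in> E" using *(2) unfolding shift2pi_shift2pi by simp
     from small_set_displacement[OF E *(1) this] have "t = p - q" by (simp add: algebra_simps eq_diff_eq)
     thus "t \<in> {0, s, - s}" using pq by auto
    qed simp
    have int: "integrable lborel (\<lambda>y. h y * cnj (h (shift2pi t y)) * cnj (K y t))" for t
     by (rule test_function_bounded_integrable[OF h Km bdd])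
    have "kernel_form K {0, s, - s} h = (\<Sum>t\<in>{0, s, - s}. \<integral>y. h y * cnj (h (shift2pi t y)) * cnj (K y t) \<partial>lborel)"
     unfolding kernel_form_def using int by (rule Bochner_Integration.integral_sum)
    also have "... = (\<integral>y. h y * cnj (h (shift2pi 0 y)) * cnj (K y 0) \<partial>lborel)
      + (\<integral>y. h y * cnj (h (shift2pi s y)) * cnj (K y s) \<partial>lborel)
      + (\<integral>y. h y * cnj (h (shift2pi (- s) y)) * cnj (K y (- s)) \<partial>lborel)"
     using False ss by simp
    also have "(\<integral>y. h y * cnj (h (shift2pi 0 y)) * cnj (K y 0) \<partial>lborel) = (\<integral>y. 0 \<partial>(lborel :: (real^'n) measure))"
    proof (rule integral_cong_AE)
     show "AE y in lborel. h y * cnj (h (shift2pi 0 y)) * cnj (K y 0) = 0" using diag by eventually_elim simp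
    qed measurable
    also have "(\<lambda>y. h y * cnj (h (shift2pi s y)) * cnj (K y s)) = (\<lambda>y. cnj a * (e y * cnj (K y s)))"
    proof
     fix y
     have p1: "e y * e (shift2pi s y) = 0" by (rule ee[OF False])
     have p2: "e (shift2pi (- s) y) * e (shift2pi s y) = 0"
      using ee[OF s2, of "shift2pi (- s) y"] unfolding shift2pi_shift2pi by simp
     have p3: "e (shift2pi (- s) y) * e y = 0"
      using ee[OF False, of "shift2pi (- s) y"] unfolding shift2pi_shift2pi by simp
     have "shift2pi (- s) (shift2pi s y) = y" unfolding shift2pi_shift2pi by simp
     hence "h y * cnj (h (shift2pi s y)) = (e y + a * e (shift2pi (- s) y)) * (e (shift2pi s y) + cnj a * e y)"
      by (simp only: h_def complex_cnj_add complex_cnj_mult e_sq)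
     also have "... = e y * e (shift2pi s y) + cnj a * (e y * e y) + a * (e (shift2pi (- s) y) * e (shift2pi s y))
       + a * cnj a * (e (shift2pi (- s) y) * e y)" by (simp add: algebra_simps)
     also have "... = cnj a * e y" unfolding p1 p2 p3 e_sq by simp
     finally show "h y * cnj (h (shift2pi s y)) * cnj (K y s) = cnj a * (e y * cnj (K y s))" by simp
    qed
    also have "(\<lambda>y. h y * cnj (h (shift2pi (- s) y)) * cnj (K y (- s))) = (\<lambda>y. a * (e (shift2pi (- s) y) * cnj (K y (- s))))"
    proof
     fix y
     define z where "z = shift2pi (- s) y"
     define u where "u = shift2pi (- s) z"
     have zs: "shift2pi s z = y" and ys: "shift2pi s u = z" and yss: "shift2pi (s + s) u = y"
      unfolding z_def u_def shift2pi_shift2pi by simp_all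
     have p1: "e y * e z = 0" using ee[OF False, of z] unfolding zs by (simp add: mult.commute)
     have p2: "e y * e u = 0" using ee[OF s2, of u] unfolding yss by (simp add: mult.commute)
     have p3: "e z * e u = 0" using ee[OF False, of u] unfolding ys by (simp add: mult.commute)
     have "h y * cnj (h z) = (e y + a * e z) * (e z + cnj a * e u)"
      by (simp only: h_def complex_cnj_add complex_cnj_mult e_sq z_def u_def)
     also have "... = e y * e z + cnj a * (e y * e u) + a * (e z * e z) + a * cnj a * (e z * e u)"
      by (simp add: algebra_simps)
     also have "... = a * e z" unfolding p1 p2 p3 e_sq by simp
     finally show "h y * cnj (h (shift2pi (- s) y)) * cnj (K y (- s)) = a * (e (shift2pi (- s) y) * cnj (K y (- s)))"
      unfolding z_def by simp
    qed
    finally show ?thesis using zero[OF h S] by (simp add: X_def Y_def)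
   qed
   have "X + Y = 0" "- \<i> * X + \<i> * Y = 0" using XY[of 1] XY[of \<i>] by simp_all
   hence "X = 0" by (simp add: complex_eq_iff)
   thus "(\<integral>y. indicator E y * cnj (K y s) \<partial>lborel) = 0" by (simp add: X_def e_def)
  qed (use bdd[of s] in auto)
  thus ?thesis by simp
 qed (use diag in simp)
 thus ?thesis by (subst AE_all_countable) blast
qed

section \<open>Gram-Schmidt orthonormalization\<close>

definition Lsq_normalize :: "'a measure => ('a => complex) => 'a => complex" where
 "Lsq_normalize M r = (\<lambda>x. cplx (if Lsq_inner M r r = 0 then 0 else 1 / sqrt (Re (Lsq_inner M r r))) * r x)"

fun gram_schmidt :: "'a measure => (nat => 'a => complex) => nat => 'a => complex" where
 "gram_schmidt M v m = Lsq_normalize M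
   (\<lambda>x. v m x - (\<Sum>i<m. Lsq_inner M (v m) (gram_schmidt M v i) * gram_schmidt M v i x))"

declare gram_schmidt.simps [simp del]

text \<open>The part of the next vector that is orthogonal to the vectors already produced; normalizing zero gives zero.\<close>

definition gs_residual :: "'a measure => (nat => 'a => complex) => nat => 'a => complex" where
 "gs_residual M v m = (\<lambda>x. v m x - (\<Sum>i<m. Lsq_inner M (v m) (gram_schmidt M v i) * gram_schmidt M v i x))"

lemma gram_schmidt_residual: "gram_schmidt M v m = Lsq_normalize M (gs_residual M v m)"
 by (subst gram_schmidt.simps) (simp add: gs_residual_def)

lemma Lsq_normalize_inner:
 assumes "r \<in> Lsq M"
 shows "Lsq_inner M (Lsq_normalize M r) (Lsq_normalize M r) \<in> {0, 1}"
proof -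
 define t where "t = (Lsq_norm M r)\<^sup>2"
 have t: "Lsq_inner M r r = cplx t" "t \<ge> 0" by (simp_all add: t_def Lsq_inner_self)
 show ?thesis
 proof (cases "t = 0")
  case False
  hence "t > 0" using t by simp
  hence "cplx (1 / sqrt t) * (cplx (1 / sqrt t) * cplx t) = 1"
   by (simp flip: of_real_mult)
  moreover have "Lsq_normalize M r = (\<lambda>x. cplx (1 / sqrt t) * r x)"
   using False by (simp add: Lsq_normalize_def t)
  ultimately show ?thesis
   by (simp only: Lsq_inner_scale_left Lsq_inner_scale_right complex_cnj_complex_of_real t insert_iff simp_thms)
 qed (simp add: Lsq_normalize_def t)
qed

lemma gram_schmidt_Lsq:
 assumes "!!m. v m \<in> Lsq M"
 shows "gram_schmidt M v m \<in> Lsq M"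
proof (induction m rule: less_induct)
 case (less m)
 hence "gs_residual M v m \<in> Lsq M"
  unfolding gs_residual_def by (intro Lsq_scale Lsq_diff Lsq_sum assms) auto
 thus ?case by (subst gram_schmidt_residual) (simp only: Lsq_normalize_def Lsq_scale)
qed

lemma gs_residual_Lsq:
 assumes "!!m. v m \<in> Lsq M"
 shows "gs_residual M v m \<in> Lsq M"
 unfolding gs_residual_def by (intro Lsq_diff Lsq_sum Lsq_scale assms gram_schmidt_Lsq) auto

theorem gram_schmidt_orthonormal:
 assumes v: "!!m. v m \<in> Lsq M"
 shows "orthonormal_or_zero M UNIV (gram_schmidt M v)"
proof -
 let ?e = "gram_schmidt M v"
 have e: "?e m \<in> Lsq M" for m by (rule gram_schmidt_Lsq[OF v])
 have self: "Lsq_inner M (?e m) (?e m) = 0 \<or> Lsq_inner M (?e m) (?e m) = 1" for m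
  using Lsq_normalize_inner[OF gs_residual_Lsq[of v M m, OF v]] by (simp add: gram_schmidt_residual)
 have *: "\<forall>i<m. Lsq_inner M (?e m) (?e i) = 0" for m
 proof (induction m rule: less_induct)
  case (less m)
  have on: "orthonormal_or_zero M {..<m} ?e"
   unfolding orthonormal_or_zero_def
  proof (intro conjI ballI impI e self)
   fix i j assume "i \<in> {..<m}" "j \<in> {..<m}" "i ~= j"
   thus "Lsq_inner M (?e i) (?e j) = 0"
    using less[of i] less[of j] Lsq_inner_commute[of M "?e i" "?e j"] by (cases "i < j") auto
  qed
  show ?case
  proof (intro allI impI)
   fix i assume i: "i < m"
   have "Lsq_inner M (gs_residual M v m) (?e i) = Lsq_inner M (v m) (?e i)
     - Lsq_inner M (\<lambda>x. \<Sum>i<m. Lsq_inner M (v m) (?e i) * ?e i x) (?e i)"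
    unfolding gs_residual_def by (intro Lsq_inner_diff_left v e Lsq_sum Lsq_scale) auto
   also have "... = 0"
    using orthonormal_or_zero_sum_inner[OF on finite_lessThan subset_refl, where j = i and f = "v m"] v i by simp
   finally have "Lsq_inner M (gs_residual M v m) (?e i) = 0" .
   thus "Lsq_inner M (?e m) (?e i) = 0"
    by (subst gram_schmidt_residual) (simp add: Lsq_normalize_def)
  qed
 qed
 show ?thesis unfolding orthonormal_or_zero_def
 proof (intro conjI ballI impI e self)
  fix i j :: nat assume "i ~= j"
  thus "Lsq_inner M (?e i) (?e j) = 0"
   using *[of i] *[of j] Lsq_inner_commute[of M "?e i" "?e j"] by (cases "i < j") auto
 qed
qed

lemma gram_schmidt_energy:
 assumes v: "!!m. v m \<in> Lsq M"
 shows "frame_energy M UNIV (gram_schmidt M v) (v m) = ennreal ((Lsq_norm M (v m))\<^sup>2)"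
proof -
 let ?e = "gram_schmidt M v"
 let ?H = "{f \<in> Lsq M. frame_energy M UNIV ?e f = ennreal ((Lsq_norm M f)\<^sup>2)}"
 note on = gram_schmidt_orthonormal[OF v]
 have e: "?e m \<in> Lsq M" for m by (rule gram_schmidt_Lsq[OF v])
 have H: "closed_subspace M ?H"
  by (rule energy_equality_closed_subspace[OF e Bessel_inequality[OF on]]) auto
 have eH: "?e i \<in> ?H" for i using frame_energy_orthonormal_member[OF on, of i] e by simp
 have sumH: "(\<lambda>x. \<Sum>i\<in>F. c i * ?e i x) \<in> ?H" if "finite F" for F :: "nat set" and c
  using that
 proof (induction F rule: finite_induct)
  case (insert i F)
  thus ?case using closed_subspace_add[OF H closed_subspace_scale[OF H eH] insert.IH] by simp
 qed (use closed_subspace_zero[OF H] in simp)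
 let ?r = "gs_residual M v m"
 define t where "t = (Lsq_norm M ?r)\<^sup>2"
 have t: "Lsq_inner M ?r ?r = cplx t" "t \<ge> 0" by (simp_all add: t_def Lsq_inner_self)
 have "AE x in M. cplx (sqrt t) * ?e m x = ?r x"
 proof (cases "t = 0")
  case True
  hence "AE x in M. ?r x = 0" using Lsq_norm_eq_0_iff[OF gs_residual_Lsq[OF v]] by (simp add: t_def)
  thus ?thesis by eventually_elim (simp add: True)
 next
  case False
  hence "cplx (sqrt t) * ?e m x = ?r x" for x
   using t by (subst gram_schmidt_residual) (simp add: Lsq_normalize_def)
  thus ?thesis by simp
 qed
 hence "?r \<in> ?H"
  by (rule closed_subspace_cong_AE[OF H closed_subspace_scale[OF H eH] gs_residual_Lsq[OF v]])
 from closed_subspace_add[OF H this sumH[of "{..<m}" "\<lambda>i. Lsq_inner M (v m) (?e i)"]]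
 have "v m \<in> ?H" by (simp add: gs_residual_def)
 thus ?thesis by simp
qed

lemma gram_schmidt_orthogonal:
 assumes v: "!!m. v m \<in> Lsq M" and h: "h \<in> Lsq M" and orth: "!!m. Lsq_inner M (v m) h = 0"
 shows "Lsq_inner M (gram_schmidt M v m) h = 0"
proof (induction m rule: less_induct)
 case (less m)
 let ?e = "gram_schmidt M v"
 have e: "?e m \<in> Lsq M" for m by (rule gram_schmidt_Lsq[OF v])
 have "Lsq_inner M (gs_residual M v m) h = Lsq_inner M (v m) h - Lsq_inner M (\<lambda>x. \<Sum>i<m. Lsq_inner M (v m) (?e i) * ?e i x) h"
  unfolding gs_residual_def by (intro Lsq_inner_diff_left v h Lsq_sum Lsq_scale e) auto
 also have "Lsq_inner M (\<lambda>x. \<Sum>i<m. Lsq_inner M (v m) (?e i) * ?e i x) h = 0"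
  using less h e by (subst Lsq_inner_sum_left) (auto intro: Lsq_scale)
 finally show ?case by (subst gram_schmidt_residual) (simp add: Lsq_normalize_def orth)
qed

text \<open>Shifting sequences preserves inner products; this makes the orthonormalized fibers fibers of a function.\<close>

lemma gram_schmidt_shift:
 fixes v :: "nat => int^'n => complex"
 shows "gram_schmidt (counting) (\<lambda>m l. v m (l + k)) m = (\<lambda>l. gram_schmidt (counting) v m (l + k))"
proof (induction m rule: less_induct)
 case (less m)
 have "gs_residual (counting) (\<lambda>m l. v m (l + k)) m = (\<lambda>l. gs_residual (counting) v m (l + k))"
  unfolding gs_residual_def using less by (intro ext arg_cong2[where f = minus] refl sum.cong) (simp_all add: l2_inner_shift)
 thus ?case
  by (subst (1 2) gram_schmidt_residual) (simp add: Lsq_normalize_def l2_inner_shift)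
qed

lemma l2_inner_measurable:
 fixes a b :: "real^'n => int^'n => complex"
 assumes [measurable]: "!!k. (\<lambda>y. a y k) \<in> borelfun" "!!k. (\<lambda>y. b y k) \<in> borelfun"
 shows "(\<lambda>y. Lsq_inner (counting) (a y) (b y)) \<in> borelfun"
 unfolding Lsq_inner_def by (rule measurable_lattice_sum) measurable

lemma gram_schmidt_measurable:
 fixes v :: "real^'n => nat => int^'n => complex"
 assumes v: "!!m k. (\<lambda>y. v y m k) \<in> borelfun"
 shows "(\<lambda>y. gram_schmidt (counting) (v y) m k) \<in> borelfun"
proof (induction m arbitrary: k rule: less_induct)
 case (less m)
 have r: "(\<lambda>y. gs_residual (counting) (v y) m k) \<in> borelfun" for k
  unfolding gs_residual_def using less v
  by (intro borel_measurable_diff borel_measurable_sum borel_measurable_times l2_inner_measurable) auto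
 have [measurable]: "(\<lambda>y. Lsq_inner (counting) (gs_residual (counting) (v y) m) (gs_residual (counting) (v y) m)) \<in> borelfun"
  by (intro l2_inner_measurable r)
 have [measurable]: "(\<lambda>y. gs_residual (counting) (v y) m k) \<in> borelfun" for k by (rule r)
 show ?case unfolding gram_schmidt_residual Lsq_normalize_def by measurable
qed

section \<open>Shift invariant spaces\<close>

definition shift_invariant :: "(real^'n => complex) set => bool" where
 "shift_invariant V \<longleftrightarrow> closed_subspace lborel V \<and> (\<forall>k. \<forall>f\<in>V. translate k f \<in> V)"

lemma fourier_zero_imp_zero:
 assumes "f \<in> Lsq (lborel :: (real^'n) measure)" "AE y in lborel. fourier f y = 0"
 shows "AE x in lborel. f x = 0"
proof -
 have "L2norm (fourier f) = 0" using assms Lsq_norm_eq_0_iff[OF fourier_Lsq[OF assms(1)]] by blast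
 hence "L2norm f = 0" using fourier_norm[OF assms(1)] by simp
 thus ?thesis using Lsq_norm_eq_0_iff[OF assms(1)] by blast
qed

lemma bracket_commute: "bracket h g y = cnj (bracket g h y)"
 unfolding bracket_def by (rule Lsq_inner_commute)

text \<open>The inner products with the translates are the Fourier coefficients of the bracket.\<close>

lemma bracket_zero_iff_orthogonal_translates:
 fixes f h :: "real^'n => complex"
 assumes f: "f \<in> L2" and h: "h \<in> L2"
 shows "(AE y in lborel. bracket (fourier h) (fourier f) y = 0) \<longleftrightarrow> (\<forall>k. L2inner h (translate k f) = 0)"
proof
 assume "AE y in lborel. bracket (fourier h) (fourier f) y = 0"
 hence 0: "AE y in cellM. bracket (fourier h) (fourier f) y * torus_char k y = 0" for k
  by (rule AE_lborel_imp_cell[OF eventually_mono]) simp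
 have "(\<integral>y. bracket (fourier h) (fourier f) y * torus_char k y \<partial>cellM) = 0" for k
  by (rule integral_eq_zero_AE[OF 0])
 thus "\<forall>k. L2inner h (translate k f) = 0"
  using inner_translate[OF h f] by simp
next
 assume *: "\<forall>k. L2inner h (translate k f) = 0"
 have "AE y in cellM. bracket (fourier h) (fourier f) y = 0"
  using inner_translate[OF h f] *
  by (intro torus_uniqueness bracket_integrable(1) fourier_Lsq h f) simp
 thus "AE y in lborel. bracket (fourier h) (fourier f) y = 0"
  by (rule AE_cell_periodic) (simp add: periodic2piD[OF bracket_periodic])
qed

lemma shift_invariant_bracket:
 assumes V: "shift_invariant V" and f: "f \<in> V" and h: "h \<in> L2" and orth: "!!g. g \<in> V ==> L2inner h g = 0"
 shows "AE y in lborel. bracket (fourier h) (fourier f) y = 0"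
 using V f orth closed_subspace_Lsq[of lborel V f]
 by (subst bracket_zero_iff_orthogonal_translates) (auto simp: shift_invariant_def h)

text \<open>An orthonormal range basis of a shift invariant space consists of measurable functions whose fibers are, at
 every point, an orthonormal basis (up to zero vectors) of the range function at that point.\<close>

definition range_energy :: "(nat => real^'n => complex) => real^'n => (int^'n => complex) => ennreal" where
 "range_energy w y a = frame_energy (counting) UNIV (\<lambda>m. fiber (w m) y) a"

text \<open>The closed span of the fibers, described by Parseval's identity.\<close>

definition range_space :: "(nat => real^'n => complex) => real^'n => (int^'n => complex) set" where
 "range_space w y = {a \<in> l2. range_energy w y a = ennreal ((Lsq_norm (counting) a)\<^sup>2)}"

definition orthonormal_field :: "(nat => real^'n => complex) => bool" where
 "orthonormal_field w \<longleftrightarrow> (\<forall>m. w m \<in> borelfun) \<and>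
   (\<forall>y. orthonormal_or_zero (counting) UNIV (\<lambda>m. fiber (w m) y))"

lemma orthonormal_fieldD:
 assumes "orthonormal_field w"
 shows "w m \<in> borelfun" "orthonormal_or_zero (counting) UNIV (\<lambda>m. fiber (w m) y)"
  "fiber (w m) y \<in> l2" "Lsq_norm (counting) (fiber (w m) y) \<le> 1"
proof -
 show 1: "w m \<in> borelfun" "orthonormal_or_zero (counting) UNIV (\<lambda>m. fiber (w m) y)"
  using assms by (auto simp: orthonormal_field_def)
 thus "fiber (w m) y \<in> l2" by (auto simp: orthonormal_or_zero_def)
 have "Lsq_inner (counting) (fiber (w m) y) (fiber (w m) y) = 0 \<or> Lsq_inner (counting) (fiber (w m) y) (fiber (w m) y) = 1"
  using 1 by (auto simp: orthonormal_or_zero_def)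
 hence "(Lsq_norm (counting) (fiber (w m) y))\<^sup>2 \<le> 1\<^sup>2" by (auto simp: Lsq_norm_power2_Re)
 thus "Lsq_norm (counting) (fiber (w m) y) \<le> 1" by (rule power2_le_imp_le) simp
qed

lemma range_energy_Bessel:
 assumes "orthonormal_field w" "a \<in> l2"
 shows "range_energy w y a \<le> ennreal ((Lsq_norm (counting) a)\<^sup>2)"
 unfolding range_energy_def by (rule Bessel_inequality[OF orthonormal_fieldD(2)[OF assms(1)] _ assms(2)]) simp

lemma range_space_closed_subspace:
 assumes "orthonormal_field w"
 shows "closed_subspace (counting) (range_space w y)"
 unfolding range_space_def range_energy_def
 by (rule energy_equality_closed_subspace[OF orthonormal_fieldD(3)[OF assms] range_energy_Bessel[OF assms, unfolded range_energy_def]])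

lemma range_energy_shift: "range_energy w (shift2pi k y) (\<lambda>l. a (l + k)) = range_energy w y a"
 by (simp add: range_energy_def frame_energy_def fiber_shift l2_inner_shift)

lemma l2_norm_shift: "Lsq_norm (counting) (\<lambda>l. a (l + k :: int^'n)) = Lsq_norm (counting) a"
 by (rule power2_eq_imp_eq) (simp_all only: Lsq_norm_power2_Re l2_inner_shift Lsq_norm_nonneg)

lemma range_space_shift_iff: "(\<lambda>l. a (l + k)) \<in> range_space w (shift2pi k y) \<longleftrightarrow> a \<in> range_space w y"
 by (simp add: range_space_def l2_shift range_energy_shift l2_norm_shift)

lemma range_energy_measurable:
 fixes a :: "real^'n => int^'n => complex"
 assumes w: "orthonormal_field w" and a: "!!k. (\<lambda>y. a y k) \<in> borelfun"
 shows "(\<lambda>y. range_energy w y (a y)) \<in> borelfun"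
proof -
 have [measurable]: "w m \<in> borelfun" for m by (rule orthonormal_fieldD(1)[OF w])
 have [measurable]: "(\<lambda>y. Lsq_inner (counting) (a y) (fiber (w m) y)) \<in> borelfun" for m
  by (intro l2_inner_measurable a) (simp add: fiber_def)
 show ?thesis unfolding range_energy_def frame_energy_def nn_integral_count_space_nat by measurable
qed

theorem range_space_periodic_range_function:
 fixes w :: "nat => real^'n => complex"
 assumes w: "orthonormal_field w"
 shows "periodic_range_function (range_space w)"
 unfolding periodic_range_function_def
proof (intro conjI allI ballI)
 note J = range_space_closed_subspace[OF w]
 let ?P = "\<lambda>y. Lsq_proj (counting) (range_space w y)"
 let ?in = "Lsq_inner (counting)"
 show "closed_subspace (counting) (range_space w y)" for y by (rule J)
 fix a b :: "int^'n => complex" assume a: "a \<in> l2" and b: "b \<in> l2"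
 have member: "fiber (w m) y \<in> range_space w y" for m y
  using frame_energy_orthonormal_member[OF orthonormal_fieldD(2)[OF w], of m y] orthonormal_fieldD(3)[OF w]
  by (simp add: range_space_def range_energy_def)
 \<comment> \<open>The norm of the projection is a countable sum of measurable functions; polarization does the rest.\<close>
 have norm: "ennreal ((Lsq_norm (counting) (?P y c))\<^sup>2) = range_energy w y c" if c: "c \<in> l2" for y c
 proof -
  have "range_energy w y (?P y c) = ennreal ((Lsq_norm (counting) (?P y c))\<^sup>2)"
   using Lsq_proj_in[OF J c, of y] by (simp add: range_space_def)
  moreover have "range_energy w y (?P y c) = range_energy w y c"
   unfolding range_energy_def frame_energy_def by (simp add: Lsq_proj_inner[OF J c member])
  ultimately show ?thesis by simp
 qed
 have norm_m: "(\<lambda>y. (Lsq_norm (counting) (?P y c))\<^sup>2) \<in> borelfun" if c: "c \<in> l2" for c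
 proof -
  have "(\<lambda>y. enn2real (range_energy w y c)) \<in> borelfun"
   using range_energy_measurable[OF w, of "\<lambda>_. c"] by measurable
  thus ?thesis unfolding norm[OF c, symmetric] by simp
 qed
 have re: "Re (?in (?P y a) c) = ((Lsq_norm (counting) (?P y (\<lambda>l. a l + c l)))\<^sup>2
   - (Lsq_norm (counting) (?P y a))\<^sup>2 - (Lsq_norm (counting) (?P y c))\<^sup>2) / 2" if c: "c \<in> l2" for y c
 proof -
  note in_in = Lsq_proj_in[OF J]
  note LL = Lsq_proj_Lsq[OF J]
  have ac: "(\<lambda>l. a l + c l) \<in> l2" by (rule Lsq_add[OF a c])
  have add: "?in (?P y (\<lambda>l. a l + c l)) g = ?in (\<lambda>l. ?P y a l + ?P y c l) g" if g: "g \<in> range_space w y" for g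
   using Lsq_proj_inner[OF J ac g] Lsq_proj_inner[OF J a g] Lsq_proj_inner[OF J c g]
   by (simp add: Lsq_inner_add_left a c LL closed_subspace_Lsq[OF J g])
  let ?s = "\<lambda>l. ?P y a l + ?P y c l"
  have s: "?s \<in> range_space w y" by (intro closed_subspace_add[OF J] in_in a c)
  have "?in (?P y (\<lambda>l. a l + c l)) (?P y (\<lambda>l. a l + c l)) = ?in ?s (?P y (\<lambda>l. a l + c l))"
   by (rule add[OF in_in[OF ac]])
  also have "... = cnj (?in ?s ?s)" using add[OF s] Lsq_inner_commute[of "counting" ?s "?P y (\<lambda>l. a l + c l)"] by simp
  finally have "(Lsq_norm (counting) (?P y (\<lambda>l. a l + c l)))\<^sup>2 = (Lsq_norm (counting) ?s)\<^sup>2"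
   by (simp add: Lsq_norm_power2_Re)
  also have "... = (Lsq_norm (counting) (?P y a))\<^sup>2 + (Lsq_norm (counting) (?P y c))\<^sup>2 + 2 * Re (?in (?P y a) (?P y c))"
   by (rule Lsq_norm_add_power2[OF LL[OF a] LL[OF c]])
  also have "?in (?P y a) (?P y c) = ?in (?P y a) c"
   using Lsq_proj_inner[OF J c in_in[OF a], of y] Lsq_inner_commute[of "counting" "?P y a" "?P y c"]
    Lsq_inner_commute[of "counting" "?P y a" c] by simp
  finally show ?thesis by simp
 qed
 have im: "Im (?in (?P y a) b) = Re (?in (?P y a) (\<lambda>l. \<i> * b l))" for y by simp
 have "(\<lambda>y. Complex (Re (?in (?P y a) b)) (Im (?in (?P y a) b))) \<in> borelfun"
  unfolding im re[OF b] re[OF Lsq_scale[OF b, of \<i>]] Complex_eq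
  using norm_m[OF a] norm_m[OF b] norm_m[OF Lsq_scale[OF b, of \<i>]] norm_m[OF Lsq_add[OF a b]]
   norm_m[OF Lsq_add[OF a Lsq_scale[OF b, of \<i>]]] by measurable
 thus "(\<lambda>y. ?in (?P y a) b) \<in> borel_measurable lborel" by (simp add: complex_surj)
next
 fix y :: "real^'n" and k
 show "range_space w (shift2pi k y) = (\<lambda>\<alpha> l. \<alpha> (l + k)) ` range_space w y"
 proof (intro set_eqI iffI)
  fix a assume "a \<in> range_space w (shift2pi k y)"
  hence "(\<lambda>l. a (l - k)) \<in> range_space w y"
   using range_space_shift_iff[of "\<lambda>l. a (l - k)" k w y] by simp
  thus "a \<in> (\<lambda>\<alpha> l. \<alpha> (l + k)) ` range_space w y" by (intro image_eqI[of _ _ "\<lambda>l. a (l - k)"]) auto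
 qed (auto simp: range_space_shift_iff)
qed

text \<open>The squared norm of \<open>w m\<close> is the integral over the cell of the squared norms of its fibers, which are at most \<open>1\<close>.\<close>

lemma orthonormal_field_Lsq:
 assumes w: "orthonormal_field w"
 shows "w m \<in> Lsq (lborel :: (real^'n) measure)"
proof (subst Lsq_iff_nn_integral)
 show wm: "w m \<in> borel_measurable lborel" using orthonormal_fieldD(1)[OF w] by simp
 have "(\<integral>\<^sup>+y. esq (w m y) \<partial>lborel)
   = (\<integral>\<^sup>+y. (\<integral>\<^sup>+k. esq (fiber (w m) y k) \<partial>counting) \<partial>cellM)"
  by (rule nn_integral_fiber[OF orthonormal_fieldD(1)[OF w], symmetric])
 also have "... \<le> (\<integral>\<^sup>+y. 1 \<partial>(cellM :: (real^'n) measure))"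
 proof (rule nn_integral_mono)
  fix y
  have "(Lsq_norm (counting) (fiber (w m) y))\<^sup>2 \<le> 1"
   using orthonormal_fieldD(4)[OF w, of m y] by (simp add: power_le_one)
  thus "(\<integral>\<^sup>+k. esq (fiber (w m) y k) \<partial>counting) \<le> 1"
   unfolding nn_integral_Lsq_norm[OF orthonormal_fieldD(3)[OF w]] by (simp add: ennreal_le_1)
 qed
 also have "... < \<infinity>" by (simp add: emeasure_restrict_space space_restrict_space emeasure_cell)
 finally show "(\<integral>\<^sup>+y. esq (w m y) \<partial>lborel) < \<infinity>" .
qed

lemma fiber_energy_integral:
 fixes f :: "real^'n => complex"
 assumes f: "f \<in> L2"
 shows "ennreal ((L2norm f)\<^sup>2) = ennreal (1 / plancherel_const TYPE('n)) *
  (\<integral>\<^sup>+y. (\<integral>\<^sup>+k. esq (fiber (fourier f) y k) \<partial>counting) \<partial>cellM)"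
proof -
 let ?c = "plancherel_const TYPE('n)"
 have "ennreal (1 / ?c) * (\<integral>\<^sup>+y. (\<integral>\<^sup>+k. esq (fiber (fourier f) y k) \<partial>counting) \<partial>cellM)
  = ennreal (1 / ?c) * ennreal ((L2norm (fourier f))\<^sup>2)"
  by (simp add: nn_integral_fiber[OF fourier_measurable[OF f]] nn_integral_Lsq_norm[OF fourier_Lsq[OF f]])
 also have "... = ennreal (1 / ?c * (?c * (L2norm f)\<^sup>2))"
  by (simp add: fourier_norm[OF f] power_mult_distrib ennreal_mult[symmetric])
 finally show ?thesis by simp
qed

lemma shift_energy_field:
 fixes f :: "real^'n => complex"
 assumes w: "orthonormal_field w" and \<phi>: "!!m. \<phi> m \<in> L2" "!!m. AE y in lborel. fourier (\<phi> m) y = w m y"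
  and f: "f \<in> L2"
 shows "shift_energy UNIV \<phi> f = ennreal (1 / plancherel_const TYPE('n)) * (\<integral>\<^sup>+y. range_energy w y (fiber (fourier f) y) \<partial>cellM)"
proof -
 let ?c = "plancherel_const TYPE('n)"
 have [measurable]: "w m \<in> borelfun" for m by (rule orthonormal_fieldD(1)[OF w])
 have [measurable]: "fourier f \<in> borelfun" by (rule fourier_measurable[OF f])
 have bm [measurable]: "bracket (fourier f) (w m) \<in> borel_measurable cellM" for m
  by (intro measurable_cell_measure) measurable
 have L: "bracket (fourier f) (w m) \<in> Lsq cellM" for m
 proof (subst Lsq_iff_nn_integral[OF bm])
  have "(\<integral>\<^sup>+y. esq (bracket (fourier f) (w m) y) \<partial>cellM)
   \<le> (\<integral>\<^sup>+y. (\<integral>\<^sup>+k. esq (fiber (fourier f) y k) \<partial>counting) \<partial>cellM)"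
  proof (rule nn_integral_mono_AE)
   show "AE y in cellM. esq (bracket (fourier f) (w m) y)
    \<le> (\<integral>\<^sup>+k. esq (fiber (fourier f) y k) \<partial>counting)"
    using AE_lborel_imp_cell[OF fiber_l2[OF fourier_Lsq[OF f]]]
   proof eventually_elim
    fix y :: "real^'n" assume fl: "fiber (fourier f) y \<in> l2"
    have "(cmod (bracket (fourier f) (w m) y))\<^sup>2 \<le> (Lsq_norm (counting) (fiber (fourier f) y))\<^sup>2 * (Lsq_norm (counting) (fiber (w m) y))\<^sup>2"
     by (rule bracket_Cauchy_Schwarz[OF fl orthonormal_fieldD(3)[OF w]])
    also have "... \<le> (Lsq_norm (counting) (fiber (fourier f) y))\<^sup>2 * 1"
     using orthonormal_fieldD(4)[OF w, of m y] by (intro mult_left_mono power_le_one) auto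
    finally show "esq (bracket (fourier f) (w m) y)
     \<le> (\<integral>\<^sup>+k. esq (fiber (fourier f) y k) \<partial>counting)"
     unfolding nn_integral_Lsq_norm[OF fl] by (simp add: ennreal_leI)
   qed
  qed
  also have "... < \<infinity>"
   by (simp add: nn_integral_fiber nn_integral_Lsq_norm[OF fourier_Lsq[OF f]])
  finally show "(\<integral>\<^sup>+y. esq (bracket (fourier f) (w m) y) \<partial>cellM) < \<infinity>" .
 qed
 have "shift_energy UNIV \<phi> f = (\<Sum>m. ennreal (1 / ?c) * (\<integral>\<^sup>+y. esq (bracket (fourier f) (w m) y) \<partial>cellM))"
  unfolding shift_energy_eq[OF countableI_type] nn_integral_count_space_nat
  using translates_energy[OF f \<phi>(1) _ \<phi>(2) L] by simp
 also have "... = ennreal (1 / ?c) * (\<integral>\<^sup>+y. (\<Sum>m. esq (bracket (fourier f) (w m) y)) \<partial>cellM)"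
  by (subst nn_integral_suminf) (simp_all add: ennreal_suminf_cmult)
 finally show ?thesis
  by (simp add: range_energy_def frame_energy_def nn_integral_count_space_nat bracket_def)
qed

lemma shift_energy_field_Bessel:
 fixes f :: "real^'n => complex"
 assumes w: "orthonormal_field w" and \<phi>: "!!m. \<phi> m \<in> L2" "!!m. AE y in lborel. fourier (\<phi> m) y = w m y"
  and f: "f \<in> L2"
 shows "shift_energy UNIV \<phi> f \<le> ennreal ((L2norm f)\<^sup>2)"
proof -
 have "(\<integral>\<^sup>+y. range_energy w y (fiber (fourier f) y) \<partial>cellM)
  \<le> (\<integral>\<^sup>+y. (\<integral>\<^sup>+k. esq (fiber (fourier f) y k) \<partial>counting) \<partial>cellM)"
 proof (rule nn_integral_mono_AE)
  show "AE y in cellM. range_energy w y (fiber (fourier f) y) \<le> (\<integral>\<^sup>+k. esq (fiber (fourier f) y k) \<partial>counting)"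
   using AE_lborel_imp_cell[OF fiber_l2[OF fourier_Lsq[OF f]]]
   by eventually_elim (simp add: nn_integral_Lsq_norm range_energy_Bessel[OF w])
 qed
 thus ?thesis
  unfolding shift_energy_field[OF w \<phi> f] fiber_energy_integral[OF f] by (rule mult_left_mono) simp
qed

text \<open>Equality of the integrated energies forces equality in almost every fiber, because the fiberwise
 inequality always holds.\<close>

lemma shift_energy_field_eq_iff:
 fixes f :: "real^'n => complex"
 assumes w: "orthonormal_field w" and \<phi>: "!!m. \<phi> m \<in> L2" "!!m. AE y in lborel. fourier (\<phi> m) y = w m y"
  and f: "f \<in> L2"
 shows "shift_energy UNIV \<phi> f = ennreal ((L2norm f)\<^sup>2) \<longleftrightarrow> (AE y in lborel. fiber (fourier f) y \<in> range_space w y)"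
proof
 let ?c = "plancherel_const TYPE('n)"
 let ?n = "\<lambda>y. \<integral>\<^sup>+k. esq (fiber (fourier f) y k) \<partial>counting"
 let ?r = "\<lambda>y. range_energy w y (fiber (fourier f) y)"
 have fm [measurable]: "fourier f \<in> borelfun" by (rule fourier_measurable[OF f])
 have nm: "?n \<in> borel_measurable cellM"
  unfolding fiber_def by (intro measurable_cell_measure measurable_lattice_nn_sum) measurable
 have rm: "?r \<in> borel_measurable cellM"
  by (intro measurable_cell_measure range_energy_measurable[OF w]) (simp add: fiber_def)
 have l2: "AE y in cellM. fiber (fourier f) y \<in> l2" by (rule AE_lborel_imp_cell[OF fiber_l2[OF fourier_Lsq[OF f]]])
 {
  assume "shift_energy UNIV \<phi> f = ennreal ((L2norm f)\<^sup>2)"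
  hence eq: "(\<integral>\<^sup>+y. ?r y \<partial>cellM) * ennreal (1 / ?c) = (\<integral>\<^sup>+y. ?n y \<partial>cellM) * ennreal (1 / ?c)"
   unfolding shift_energy_field[OF w \<phi> f] fiber_energy_integral[OF f] by (simp only: mult.commute)
  have cp: "0 < 1 / ?c" by simp
  from ennreal_cancel_right[OF cp eq] have eq: "(\<integral>\<^sup>+y. ?r y \<partial>cellM) = (\<integral>\<^sup>+y. ?n y \<partial>cellM)" .
  have fin: "(\<integral>\<^sup>+y. ?n y \<partial>cellM) ~= \<infinity>" by (simp add: nn_integral_fiber[OF fm] nn_integral_Lsq_norm[OF fourier_Lsq[OF f]])
  have le: "AE y in cellM. ?r y \<le> ?n y"
   using l2 by eventually_elim (simp add: nn_integral_Lsq_norm range_energy_Bessel[OF w])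
  have "(\<integral>\<^sup>+y. ?n y - ?r y \<partial>cellM) = (\<integral>\<^sup>+y. ?n y \<partial>cellM) - (\<integral>\<^sup>+y. ?r y \<partial>cellM)"
   by (rule nn_integral_diff[OF nm rm _ le]) (use fin eq in simp)
  also have "... = 0" using eq fin by (simp add: less_top)
  finally have "AE y in cellM. ?n y - ?r y = 0"
   using nm rm by (subst (asm) nn_integral_0_iff_AE) auto
  hence "AE y in cellM. fiber (fourier f) y \<in> range_space w y"
   using le l2
  proof eventually_elim
   fix y assume d: "?n y - ?r y = 0" and le: "?r y \<le> ?n y" and fl: "fiber (fourier f) y \<in> l2"
   have "?n y \<le> ?r y" using d by (simp add: diff_eq_0_iff_ennreal)
   thus "fiber (fourier f) y \<in> range_space w y"
    using le fl by (simp add: range_space_def nn_integral_Lsq_norm[OF fl])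
  qed
  thus "AE y in lborel. fiber (fourier f) y \<in> range_space w y"
   by (rule AE_cell_periodic) (simp add: fiber_shift range_space_shift_iff)
 next
  assume *: "AE y in lborel. fiber (fourier f) y \<in> range_space w y"
  have "AE y in cellM. ?r y = ?n y"
   using AE_lborel_imp_cell[OF *] by eventually_elim (simp add: range_space_def nn_integral_Lsq_norm)
  hence "(\<integral>\<^sup>+y. ?r y \<partial>cellM) = (\<integral>\<^sup>+y. ?n y \<partial>cellM)"
   by (rule nn_integral_cong_AE)
  thus "shift_energy UNIV \<phi> f = ennreal ((L2norm f)\<^sup>2)"
   unfolding shift_energy_field[OF w \<phi> f] fiber_energy_integral[OF f] by simp
 }
qed

lemma closed_subspace_Int:
 assumes "closed_subspace M V" "closed_subspace M W"
 shows "closed_subspace M (V \<inter> W)"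
proof -
 have "Lsq_closure M (V \<inter> W) \<subseteq> Lsq_closure M V \<inter> Lsq_closure M W" by (fastforce simp: Lsq_closure_def)
 thus ?thesis using assms unfolding closed_subspace_def by blast
qed

lemma translate_0 [simp]: "translate 0 f = f"
 by (simp add: translate_def)

text \<open>The generators fed into the Gram-Schmidt procedure are the projections of the functions whose
 Fourier transforms are the indicators of the translated cells.  They generate the space under integer
 translations, since a function orthogonal to all of these has a transform that vanishes on every cell.\<close>

theorem orthonormal_field_exists:
 fixes V :: "(real^'n => complex) set"
 assumes V: "shift_invariant V"
 shows "\<exists>w \<phi>. orthonormal_field w \<and> (\<forall>m. \<phi> m \<in> V) \<and> (\<forall>m. AE y in lborel. fourier (\<phi> m) y = w m y)
  \<and> (\<forall>f\<in>V. shift_energy UNIV \<phi> f = ennreal ((L2norm f)\<^sup>2))"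
proof -
 have Vc: "closed_subspace lborel V" and VT: "!!k f. f \<in> V ==> translate k f \<in> V" using V by (auto simp: shift_invariant_def)
 note VL = closed_subspace_Lsq[OF Vc]
 define one :: "int^'n => real^'n => complex" where "one l = indicator {\<zeta>. shift2pi (- l) \<zeta> \<in> cell}" for l
 have one_test: "test_function (one l)" for l
  unfolding one_def by (rule bounded_test_function[of _ 1, OF _ _ bounded_cell_translate[of "- l"]]) (auto simp: indicator_def)
 have "\<exists>e\<in>L2. AE y in lborel. fourier e y = one l y" for l
  by (rule fourier_surj[OF test_function_Lsq[OF one_test]])
 then obtain e where e: "!!l. e l \<in> L2" "!!l. AE y in lborel. fourier (e l) y = one l y" by metis
 define G where "G l = Lsq_proj lborel V (e l)" for l
 have G: "G l \<in> V" for l unfolding G_def by (rule Lsq_proj_in[OF Vc e(1)])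
 define \<gamma> where "\<gamma> l = fourier (G l)" for l
 have \<gamma>L: "\<gamma> l \<in> L2" for l unfolding \<gamma>_def by (rule fourier_Lsq[OF VL[OF G]])
 have \<gamma>m [measurable]: "\<gamma> l \<in> borelfun" for l using \<gamma>L[of l] by (auto dest: LsqD)
 define good where "good y \<longleftrightarrow> (\<forall>l. fiber (\<gamma> l) y \<in> l2)" for y
 have good_AE: "AE y in lborel. good y"
  unfolding good_def using fiber_l2[OF \<gamma>L] by (subst AE_all_countable) blast
 have good_shift: "good (shift2pi k y) \<longleftrightarrow> good y" for k y by (simp add: good_def fiber_shift l2_shift)
 have good_m [measurable]: "Measurable.pred borel good"
 proof -
  have [measurable]: "(\<lambda>y. \<integral>\<^sup>+k. esq (fiber (\<gamma> l) y k) \<partial>counting) \<in> borelfun" for l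
   unfolding fiber_def by (rule measurable_lattice_nn_sum) measurable
  show ?thesis unfolding good_def fiber_l2_iff by measurable
 qed
 define v where "v y m = (if good y then fiber (\<gamma> (from_nat m)) y else (\<lambda>_. 0))" for y m
 have v: "v y m \<in> l2" for y m by (simp add: v_def good_def)
 have v_shift: "v (shift2pi k y) = (\<lambda>m l. v y m (l + k))" for k y
  by (auto simp: v_def good_shift fiber_shift fun_eq_iff)
 have vm: "(\<lambda>y. v y m k) \<in> borelfun" for m k
 proof -
  have "(\<lambda>y. v y m k) = (\<lambda>y. if good y then \<gamma> (from_nat m) (shift2pi k y) else 0)"
   by (simp add: v_def fiber_def fun_eq_iff)
  thus ?thesis by simp
 qed
 define w where "w m y = gram_schmidt (counting) (v y) m 0" for m y
 have fw: "fiber (w m) y = gram_schmidt (counting) (v y) m" for m y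
  by (simp add: fiber_def w_def v_shift gram_schmidt_shift)
 have w: "orthonormal_field w"
  unfolding orthonormal_field_def fw
  using gram_schmidt_measurable[OF vm] gram_schmidt_orthonormal[OF v] by (simp add: w_def[abs_def])
 have wL: "w m \<in> L2" for m by (rule orthonormal_field_Lsq[OF w])
 have "\<exists>p\<in>L2. AE y in lborel. fourier p y = w m y" for m by (rule fourier_surj[OF wL])
 then obtain \<phi> where \<phi>: "!!m. \<phi> m \<in> L2" "!!m. AE y in lborel. fourier (\<phi> m) y = w m y" by metis
 have \<phi>V: "\<phi> m \<in> V" for m
 proof (rule double_orthogonal_complement[OF Vc \<phi>(1)])
  fix h assume h: "h \<in> L2" and orth: "!!g. g \<in> V ==> L2inner h g = 0"
  have "AE y in lborel. \<forall>l. bracket (fourier h) (\<gamma> l) y = 0"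
   unfolding \<gamma>_def using shift_invariant_bracket[OF V G h orth] by (subst AE_all_countable) blast
  hence "AE y in lborel. bracket (fourier h) (w m) y = 0"
   using fiber_l2[OF fourier_Lsq[OF h]] good_AE
  proof eventually_elim
   fix y :: "real^'n" assume b: "\<forall>l. bracket (fourier h) (\<gamma> l) y = 0" and hl: "fiber (fourier h) y \<in> l2" and g: "good y"
   have "Lsq_inner (counting) (v y m) (fiber (fourier h) y) = 0" for m
    using b g bracket_commute[of "\<gamma> (from_nat m)" "fourier h" y] by (simp add: v_def bracket_def)
   from gram_schmidt_orthogonal[of "v y", OF v hl this, of m]
   have "bracket (w m) (fourier h) y = 0" by (simp add: bracket_def fw)
   thus "bracket (fourier h) (w m) y = 0" using bracket_commute[of "fourier h" "w m" y] by simp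
  qed
  moreover have "AE y in lborel. bracket (fourier h) (fourier (\<phi> m)) y = bracket (fourier h) (w m) y"
   by (rule bracket_cong_AE[OF _ \<phi>(2)]) simp
  ultimately have "AE y in lborel. bracket (fourier h) (fourier (\<phi> m)) y = 0" by eventually_elim simp
  hence "L2inner h (translate 0 (\<phi> m)) = 0"
   using bracket_zero_iff_orthogonal_translates[OF \<phi>(1) h] by blast
  thus "L2inner (\<phi> m) h = 0" using Lsq_inner_commute[of lborel "\<phi> m" h] by simp
 qed
 define H where "H = {f \<in> L2. shift_energy UNIV \<phi> f = ennreal ((L2norm f)\<^sup>2)}"
 have H: "closed_subspace lborel H"
  unfolding H_def shift_energy_def
  by (rule energy_equality_closed_subspace)
    (use \<phi>(1) translate_Lsq shift_energy_field_Bessel[OF w \<phi>] in \<open>auto simp: shift_energy_def\<close>)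
 have GH: "translate k (G l) \<in> H" for k l
 proof -
  have tL: "translate k (G l) \<in> L2" by (intro translate_Lsq VL G)
  have "AE y in lborel. fiber (fourier (translate k (G l))) y \<in> range_space w y"
   using good_AE AE_lborel_all_shifts[OF fourier_translate[OF VL[OF G], of k l]]
  proof eventually_elim
   fix y :: "real^'n" assume g: "good y"
    and t: "\<forall>s. fourier (translate k (G l)) (shift2pi s y) = torus_char (- k) (shift2pi s y) * fourier (G l) (shift2pi s y)"
   have "v y (to_nat l) = fiber (\<gamma> l) y" using g by (simp add: v_def)
   hence "fiber (\<gamma> l) y \<in> range_space w y"
    using gram_schmidt_energy[of "v y", OF v, of "to_nat l"] g by (simp add: range_space_def range_energy_def fw good_def)
   from closed_subspace_scale[OF range_space_closed_subspace[OF w] this, of "torus_char (- k) y"]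
   show "fiber (fourier (translate k (G l))) y \<in> range_space w y"
    using t by (simp add: fiber_def \<gamma>_def periodic2piD[OF torus_char_periodic])
  qed
  thus ?thesis using shift_energy_field_eq_iff[OF w \<phi> tL] tL by (simp add: H_def)
 qed
 have "V \<subseteq> V \<inter> H"
 proof (rule closed_subspace_eqI[OF Vc closed_subspace_Int[OF Vc H]])
  fix f assume fV: "f \<in> V" and orth: "!!g. g \<in> V \<inter> H ==> L2inner f g = 0"
  have f: "f \<in> L2" by (rule VL[OF fV])
  have "AE y in lborel. bracket (fourier f) (one l) y = 0" for l
  proof -
   define d where "d = (\<lambda>x. e l x - G l x)"
   have dL: "d \<in> L2" unfolding d_def by (intro Lsq_diff e VL G)
   have "L2inner d g = 0" if "g \<in> V" for g
    unfolding d_def G_def by (rule Lsq_proj_orthogonal[OF Vc e(1) that])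
   hence "AE y in lborel. bracket (fourier d) (fourier f) y = 0" by (rule shift_invariant_bracket[OF V fV dL])
   hence "AE y in lborel. bracket (fourier f) (fourier d) y = 0"
    by eventually_elim (subst bracket_commute, simp)
   hence fd: "L2inner f (translate k d) = 0" for k
    using bracket_zero_iff_orthogonal_translates[OF dL f] by blast
   have "L2inner f (translate k (e l)) = 0" for k
   proof -
    have "translate k (e l) = (\<lambda>x. translate k (G l) x + translate k d x)" by (simp add: translate_def d_def)
    hence "L2inner f (translate k (e l)) = L2inner f (translate k (G l)) + L2inner f (translate k d)"
     by (simp only:) (intro Lsq_inner_add_right translate_Lsq VL G dL f)
    thus ?thesis using fd orth[of "translate k (G l)"] GH VT[OF G] by simp
   qed
   hence "AE y in lborel. bracket (fourier f) (fourier (e l)) y = 0"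
    using bracket_zero_iff_orthogonal_translates[OF e(1) f] by blast
   moreover have "AE y in lborel. bracket (fourier f) (fourier (e l)) y = bracket (fourier f) (one l) y"
    by (rule bracket_cong_AE[OF _ e(2)]) simp
   ultimately show ?thesis by eventually_elim simp
  qed
  hence "AE y in lborel. \<forall>l. bracket (fourier f) (one l) y = 0" by (subst AE_all_countable) blast
  from AE_lborel_imp_cell[OF this]
  have "AE y in cellM. y \<in> cell \<and> (\<forall>l. bracket (fourier f) (one l) y = 0)"
   by (simp add: AE_cell_measure_iff)
  hence "AE y in cellM. \<forall>l. fourier f (shift2pi l y) = 0"
  proof (rule eventually_mono, intro allI)
   fix y :: "real^'n" and l assume x: "y \<in> cell \<and> (\<forall>l. bracket (fourier f) (one l) y = 0)"
   have "one l (shift2pi k y) = (if k = l then 1 else 0)" for k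
   proof -
    have "shift2pi (- l) (shift2pi k y) \<in> cell \<longleftrightarrow> k = l"
    proof
     assume a: "shift2pi (- l) (shift2pi k y) \<in> cell"
     have "shift2pi 0 y \<in> cell" "shift2pi 0 (shift2pi (k - l) y) \<in> cell"
      using x a unfolding shift2pi_shift2pi by simp_all
     from cell_translates_disjoint[OF this] show "k = l" by simp
    qed (use x in \<open>simp only: shift2pi_shift2pi, simp\<close>)
    thus ?thesis by (simp add: one_def indicator_def)
   qed
   hence "bracket (fourier f) (one l) y = (\<integral>k. (if k = l then fourier f (shift2pi l y) else 0) \<partial>counting)"
    unfolding bracket_def Lsq_inner_def fiber_def by (intro Bochner_Integration.integral_cong) auto
   also have "... = fourier f (shift2pi l y)"
    by (subst lebesgue_integral_count_space_finite_support) (auto simp: if_distrib sum.delta cong: if_cong intro: finite_subset[of _ "{l}"])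
   finally show "fourier f (shift2pi l y) = 0" using x by simp
  qed
  hence "AE y in lborel. \<forall>l. fourier f (shift2pi l y) = 0"
   by (rule AE_cell_periodic) (simp only: shift2pi_shift2pi, blast)
  hence "AE y in lborel. fourier f y = 0"
   by eventually_elim (metis add_0_right lattice_vec_simps(1) scaleR_zero_right)
  thus "AE x in lborel. f x = 0" by (rule fourier_zero_imp_zero[OF f])
 qed auto
 hence "\<forall>f\<in>V. shift_energy UNIV \<phi> f = ennreal ((L2norm f)\<^sup>2)" by (auto simp: H_def)
 thus ?thesis using w \<phi>V \<phi>(2) by blast
qed

(* As a rewrite rule it would replace products with the transpose by left products with A. *)
declare transpose_matrix_vector [simp del]

section \<open>Powers of a contracting matrix\<close>

text \<open>Once the perturbation is small, the recursion contracts towards a small multiple of its bound.\<close>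

lemma perturbed_contraction_tendsto_0:
 fixes u :: "nat => complex"
 assumes rec: "!!j. u (Suc j) = l * u j + b j" and l: "cmod l < 1" and b: "b \<longlonglongrightarrow> 0"
 shows "u \<longlonglongrightarrow> 0"
proof (rule LIMSEQ_I)
 fix e :: real assume e: "e > 0"
 define r where "r = cmod l"
 have r: "0 \<le> r" "r < 1" using l by (auto simp: r_def)
 have "e * (1 - r) / 2 > 0" using e r by simp
 from LIMSEQ_D[OF b this] obtain N where N: "!!j. j \<ge> N ==> cmod (b j) < e * (1 - r) / 2" by auto
 have bound: "cmod (u (N + k)) \<le> r ^ k * cmod (u N) + e / 2" for k
 proof (induction k)
  case (Suc k)
  have "cmod (u (N + Suc k)) \<le> r * cmod (u (N + k)) + cmod (b (N + k))"
   using norm_triangle_ineq[of "l * u (N + k)" "b (N + k)"] by (simp add: rec norm_mult r_def)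
  also have "... \<le> r * (r ^ k * cmod (u N) + e / 2) + e * (1 - r) / 2"
   using Suc N[of "N + k"] r by (intro add_mono mult_left_mono) auto
  also have "... = r ^ Suc k * cmod (u N) + e / 2" by (simp add: field_simps)
  finally show ?case .
 qed (use e in simp)
 have "(\<lambda>k. r ^ k * cmod (u N)) \<longlonglongrightarrow> 0 * cmod (u N)"
  using r by (intro tendsto_intros LIMSEQ_realpow_zero)
 hence "(\<lambda>k. r ^ k * cmod (u N)) \<longlonglongrightarrow> 0" by simp
 from LIMSEQ_D[OF this, of "e / 2"] e obtain K where K: "!!k. k \<ge> K ==> \<bar>r ^ k * cmod (u N)\<bar> < e / 2" by auto
 have "norm (u n - 0) < e" if "n \<ge> N + K" for n
 proof -
  define k where "k = n - N"
  have "cmod (u (N + k)) \<le> r ^ k * cmod (u N) + e / 2" by (rule bound)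
  moreover have "\<bar>r ^ k * cmod (u N)\<bar> < e / 2" by (rule K) (use that in \<open>simp add: k_def\<close>)
  moreover have "N + k = n" using that by (simp add: k_def)
  ultimately show ?thesis by simp
 qed
 thus "\<exists>no. \<forall>n\<ge>no. norm (u n - 0) < e" by blast
qed

text \<open>The value at \<open>x\<close> of the polynomial \<open>p\<close> in the matrix \<open>M\<close>.\<close>

definition poly_act :: "complex^'n^'n => complex poly => complex^'n => complex^'n" where
 "poly_act M p x = (\<Sum>j\<le>degree p. coeff p j *s (((*v) M) ^^ j) x)"

lemma poly_act_bound:
 assumes "degree p \<le> n"
 shows "poly_act M p x = (\<Sum>j\<le>n. coeff p j *s (((*v) M) ^^ j) x)"
 unfolding poly_act_def using assms by (intro sum.mono_neutral_left) (auto simp: coeff_eq_0)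

lemma matrix_vector_scale:
 fixes M :: "'a::comm_semiring_1^'n^'m"
 shows "M *v (c *s x) = c *s (M *v x)"
 by (simp add: matrix_vector_mult_def vec_eq_iff sum_distrib_left mult_ac)

lemma matrix_vector_sum:
 fixes M :: "'a::comm_semiring_1^'n^'m"
 assumes "finite F"
 shows "M *v (\<Sum>j\<in>F. g j) = (\<Sum>j\<in>F. M *v g j)"
 using assms by (induction F rule: finite_induct) (simp_all add: matrix_vector_right_distrib)

lemma matrix_iterate_linear:
 fixes M :: "'a::comm_semiring_1^'n^'n"
 shows "(((*v) M) ^^ j) (x + y) = (((*v) M) ^^ j) x + (((*v) M) ^^ j) y"
  and "(((*v) M) ^^ j) (c *s x) = c *s (((*v) M) ^^ j) x"
 by (induction j) (simp_all add: matrix_vector_right_distrib matrix_vector_scale)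

lemma poly_act_linear:
 "poly_act M p (x + y) = poly_act M p x + poly_act M p y"
 "poly_act M p (c *s x) = c *s poly_act M p x"
 by (simp_all add: poly_act_def matrix_iterate_linear vector_add_ldistrib sum.distrib vec.scale_sum_right mult.commute)

lemma poly_act_mult_linear_factor:
 "poly_act M ([:- l, 1:] * q) x = poly_act M q (M *v x + (- l) *s x)"
proof -
 define n where "n = Suc (degree q)"
 have d: "degree ([:- l, 1:] * q) \<le> n"
  using degree_mult_le[of "[:- l, 1:]" q] by (simp add: n_def)
 have c: "coeff ([:- l, 1:] * q) j = (if j = 0 then 0 else coeff q (j - 1)) - l * coeff q j" for j
  by (cases j) (simp_all add: coeff_pCons)
 have "poly_act M ([:- l, 1:] * q) x = (\<Sum>j\<le>n. (if j = 0 then 0 else coeff q (j - 1)) *s (((*v) M) ^^ j) x + (- l * coeff q j) *s (((*v) M) ^^ j) x)"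
  unfolding poly_act_bound[OF d] c by (intro sum.cong refl) (simp add: vector_sadd_rdistrib[symmetric])
 also have "... = (\<Sum>j\<le>n. (if j = 0 then 0 else coeff q (j - 1)) *s (((*v) M) ^^ j) x) + (\<Sum>j\<le>n. (- l * coeff q j) *s (((*v) M) ^^ j) x)"
  by (rule sum.distrib)
 also have "(\<Sum>j\<le>n. (if j = 0 then 0 else coeff q (j - 1)) *s (((*v) M) ^^ j) x) = poly_act M q (M *v x)"
  unfolding n_def sum.atMost_Suc_shift by (simp add: poly_act_def funpow_swap1)
 also have "(\<Sum>j\<le>n. (- l * coeff q j) *s (((*v) M) ^^ j) x) = (- l) *s poly_act M q x"
  using poly_act_bound[of q n M x] by (simp add: n_def vec.scale_sum_right)
 finally show ?thesis by (simp only: poly_act_linear)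
qed

lemma poly_act_commute: "poly_act M q (M *v x) = M *v poly_act M q x"
 by (simp add: poly_act_def funpow_swap1 matrix_vector_sum matrix_vector_scale)

text \<open>Eigenvalues off the open unit disc can be removed from an annihilating polynomial because the corresponding
 linear factor is injective; each remaining factor is a contraction.\<close>

lemma iterates_tendsto_0_annihilated:
 fixes M :: "complex^'n^'n"
 assumes eig: "!!l v. M *v v = l *s v ==> 1 \<le> cmod l ==> v = 0"
 shows "p ~= 0 ==> poly_act M p x = 0 ==> (\<lambda>j. (((*v) M) ^^ j) x $ i) \<longlonglongrightarrow> 0"
proof (induction "degree p" arbitrary: p x)
 case 0
 then obtain c where c: "p = [:c:]" "c ~= 0" by (metis degree_eq_zeroE pCons_0_0)
 with 0 have "c *s x = 0" by (simp add: poly_act_def)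
 hence "x = 0" using c by (simp add: vec_eq_iff)
 moreover have "(((*v) M) ^^ j) 0 = 0" for j by (induction j) simp_all
 ultimately show ?case by simp
next
 case (Suc n)
 hence "\<not> constant (poly p)" by (simp add: constant_degree)
 then obtain l where "poly p l = 0" using fundamental_theorem_of_algebra by blast
 then obtain q where q: "p = [:- l, 1:] * q" by (auto simp: poly_eq_0_iff_dvd elim: dvdE)
 have q0: "q ~= 0" using Suc.prems(1) q by auto
 have "degree p = 1 + degree q" unfolding q using q0 by (subst degree_mult_eq) auto
 hence dq: "n = degree q" using Suc.hyps(2) by simp
 define y where "y = M *v x + (- l) *s x"
 have qy: "poly_act M q y = 0" using Suc.prems(2) unfolding q poly_act_mult_linear_factor y_def .
 show ?case
 proof (cases "cmod l < 1")
  case True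
  note lim = Suc.hyps(1)[OF dq q0 qy]
  show ?thesis
  proof (rule perturbed_contraction_tendsto_0[OF _ True lim])
   fix j
   have "M *v x = l *s x + y" by (simp add: y_def vec_eq_iff)
   hence "(((*v) M) ^^ Suc j) x = (((*v) M) ^^ j) (l *s x + y)" by (simp only: funpow_Suc_right o_apply)
   thus "(((*v) M) ^^ Suc j) x $ i = l * (((*v) M) ^^ j) x $ i + (((*v) M) ^^ j) y $ i"
    by (simp only: matrix_iterate_linear) (simp add: vector_smult_component)
  qed
 next
  case False
  have "M *v poly_act M q x + (- l) *s poly_act M q x = 0"
   using qy unfolding y_def poly_act_linear poly_act_commute .
  hence "M *v poly_act M q x = l *s poly_act M q x" by (simp add: vec_eq_iff)
  hence "poly_act M q x = 0" using False by (intro eig) auto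
  thus ?thesis by (rule Suc.hyps(1)[OF dq q0])
 qed
qed

text \<open>More iterates than the dimension are linearly dependent; real coefficients suffice.\<close>

lemma annihilating_polynomial_exists:
 fixes M :: "complex^'n^'n"
 shows "\<exists>p. p ~= 0 \<and> poly_act M p x = 0"
proof -
 define a where "a j = (((*v) M) ^^ j) x" for j
 define N where "N = DIM(complex^'n)"
 have "\<exists>u :: nat => real. (\<exists>j\<le>N. u j ~= 0) \<and> (\<Sum>j\<le>N. u j *\<^sub>R a j) = 0"
 proof (cases "inj_on a {..N}")
  case False
  then obtain i j where ij: "i \<le> N" "j \<le> N" "i ~= j" "a i = a j" by (auto simp: inj_on_def)
  define u :: "nat => real" where "u k = (if k = i then 1 else if k = j then -1 else 0)" for k
  have "(\<Sum>k\<le>N. u k *\<^sub>R a k) = (\<Sum>k\<in>{i, j}. u k *\<^sub>R a k)"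
   using ij by (intro sum.mono_neutral_right) (auto simp: u_def)
  also have "... = 0" using ij by (simp add: u_def)
  finally show ?thesis using ij by (intro exI[of _ u]) (auto simp: u_def)
 next
  case True
  have "dependent (a ` {..N})"
  proof (rule ccontr)
   assume "\<not> dependent (a ` {..N})"
   hence "card (a ` {..N}) \<le> N" unfolding N_def by (rule independent_bound[THEN conjunct2])
   thus False using True by (simp add: card_image)
  qed
  then obtain u where u: "\<exists>v\<in>a ` {..N}. u v ~= 0" "(\<Sum>v\<in>a ` {..N}. u v *\<^sub>R v) = 0"
   by (auto simp: dependent_finite)
  thus ?thesis using True by (intro exI[of _ "\<lambda>j. u (a j)"]) (auto simp: sum.reindex)
 qed
 then obtain u where u: "\<exists>j\<le>N. u j ~= (0::real)" "(\<Sum>j\<le>N. u j *\<^sub>R a j) = 0" by blast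
 define p where "p = (\<Sum>j\<le>N. monom (cplx (u j)) j)"
 have cp: "coeff p k = (if k \<le> N then cplx (u k) else 0)" for k
  by (simp add: p_def coeff_sum)
 have "p ~= 0" using u(1) cp by (metis coeff_0 of_real_eq_0_iff)
 moreover have "degree p \<le> N" by (rule degree_le) (simp add: cp)
 hence "poly_act M p x = (\<Sum>j\<le>N. u j *\<^sub>R a j)"
  unfolding poly_act_bound[OF \<open>degree p \<le> N\<close>] by (intro sum.cong) (auto simp: cp a_def vec_eq_iff scaleR_conv_of_real[where 'a=complex])
 ultimately show ?thesis using u(2) by auto
qed

definition complexify :: "real^'n => complex^'n" where
 "complexify x = (\<chi> i. cplx (x $ i))"

lemma complexify_mult: "map_matrix cplx M *v complexify x = complexify (M *v x)"
 by (simp add: complexify_def matrix_vector_mult_def map_matrix_def vec_eq_iff)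

theorem matrix_iterates_tendsto_0:
 fixes M :: "real^'n^'n"
 assumes eig: "!!l v. map_matrix cplx M *v v = l *s v ==> 1 \<le> cmod l ==> v = 0"
 shows "(\<lambda>j. (((*v) M) ^^ j) x) \<longlonglongrightarrow> 0"
proof (rule vec_tendstoI)
 fix i
 let ?C = "map_matrix cplx M"
 obtain p where p: "p ~= 0" "poly_act ?C p (complexify x) = 0" using annihilating_polynomial_exists by blast
 have it: "(((*v) ?C) ^^ j) (complexify x) = complexify ((((*v) M) ^^ j) x)" for j
  by (induction j) (simp_all add: complexify_mult)
 have "(\<lambda>j. (((*v) ?C) ^^ j) (complexify x) $ i) \<longlonglongrightarrow> 0"
  by (rule iterates_tendsto_0_annihilated[OF eig p])
 hence "(\<lambda>j. cplx ((((*v) M) ^^ j) x $ i)) \<longlonglongrightarrow> cplx 0" unfolding it by (simp add: complexify_def)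
 thus "(\<lambda>j. (((*v) M) ^^ j) x $ i) \<longlonglongrightarrow> 0 $ i" by (simp only: tendsto_of_real_iff zero_index)
qed

section \<open>Dilation matrices\<close>

lemma map_matrix_mult: "map_matrix cplx (M ** N) = map_matrix cplx M ** map_matrix cplx N"
 by (simp add: map_matrix_def matrix_matrix_mult_def vec_eq_iff)

lemma map_matrix_mat_1: "map_matrix cplx (mat 1) = mat 1"
 by (simp add: map_matrix_def mat_def vec_eq_iff)

lemma singular_iff_kernel:
 fixes M :: "'a::field^'n^'n"
 shows "det M = 0 \<longleftrightarrow> (\<exists>v. v ~= 0 \<and> M *v v = 0)"
 using invertible_det_nz[of M] invertible_left_inverse[of M] matrix_left_invertible_ker[of M] by blast

lemma matrix_iterate_zero:
 fixes M :: "real^'n^'n"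
 shows "(((*v) M) ^^ j) 0 = 0"
 by (induction j) (simp_all add: matrix_vector_mult_0_right)

locale dilation =
 fixes A :: "real^'n^'n"
 assumes dil: "dilation_matrix A"
begin

abbreviation At :: "real^'n^'n" where "At \<equiv> transpose A"
abbreviation B :: "real^'n^'n" where "B \<equiv> matrix_inv At"

lemma eigen: "map_matrix cplx A *v v = \<mu> *s v ==> cmod \<mu> \<le> 1 ==> v = 0"
 using dil unfolding dilation_matrix_def by (meson not_less)

lemma det_nz: "det A ~= 0"
proof
 assume "det A = 0"
 then obtain x where x: "x ~= 0" "A *v x = 0" using singular_iff_kernel by blast
 have "map_matrix cplx A *v complexify x = 0 *s complexify x"
  unfolding complexify_mult x(2) by (simp add: complexify_def vec_eq_iff)
 hence "complexify x = 0" by (rule eigen) simp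
 thus False using x(1) by (simp add: complexify_def vec_eq_iff)
qed

text \<open>An eigenvalue \<open>\<mu>\<close> of the transpose makes \<open>A - \<mu>\<close> singular, since a determinant is invariant under transposition.\<close>

lemma eigen_transpose:
 assumes "map_matrix cplx At *v v = \<mu> *s v" "cmod \<mu> \<le> 1"
 shows "v = 0"
proof (rule ccontr)
 assume "v ~= 0"
 let ?C = "map_matrix cplx A"
 have t: "map_matrix cplx At = transpose ?C" by (simp add: map_matrix_def transpose_def)
 define D where "D M = M - (\<chi> i j. if i = j then \<mu> else 0)" for M :: "complex^'n^'n"
 have D: "D M *v u = M *v u - \<mu> *s u" for M u
  by (simp add: D_def matrix_vector_mult_def vec_eq_iff left_diff_distrib sum_subtractf if_distrib[of "\<lambda>z. z * _"] cong: if_cong)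
 have "transpose (D ?C) = D (transpose ?C)" by (auto simp: D_def transpose_def vec_eq_iff)
 moreover have "det (D (transpose ?C)) = 0"
  using assms(1) \<open>v ~= 0\<close> unfolding t singular_iff_kernel D by (intro exI[of _ v]) simp
 ultimately have "det (D ?C) = 0" by (metis det_transpose)
 then obtain u where u: "u ~= 0" "?C *v u = \<mu> *s u" unfolding singular_iff_kernel D by auto
 from eigen[OF u(2) assms(2)] u(1) show False by simp
qed

lemma inverse_iterates_tendsto_0:
 fixes M :: "real^'n^'n"
 assumes det: "det M ~= 0" and e: "!!v \<mu>. map_matrix cplx M *v v = \<mu> *s v ==> cmod \<mu> \<le> 1 ==> v = 0"
 shows "(\<lambda>j. (((*v) (matrix_inv M)) ^^ j) x) \<longlonglongrightarrow> 0"
proof (rule matrix_iterates_tendsto_0)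
 fix l v assume lv: "map_matrix cplx (matrix_inv M) *v v = l *s v" and l: "1 \<le> cmod l"
 have "M ** matrix_inv M = mat 1" using det by (intro matrix_inv_right) (simp add: invertible_det_nz)
 hence "map_matrix cplx M *v (map_matrix cplx (matrix_inv M) *v v) = v"
  by (simp add: matrix_vector_mul_assoc map_matrix_mult[symmetric] map_matrix_mat_1)
 hence "l *s (map_matrix cplx M *v v) = v" by (simp add: lv matrix_vector_scale)
 moreover have "l ~= 0" using l by auto
 ultimately have "map_matrix cplx M *v v = (1 / l) *s v" by (auto simp: vec_eq_iff field_simps)
 thus "v = 0" by (rule e) (use l in \<open>simp add: norm_divide divide_le_eq_1\<close>)
qed

lemma det_At: "det At ~= 0"
 using det_nz by (simp add: det_transpose)

lemma B_iterates: "(\<lambda>j. (((*v) B) ^^ j) x) \<longlonglongrightarrow> 0"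
 by (rule inverse_iterates_tendsto_0[OF det_At eigen_transpose])

lemma inv_A_iterates: "(\<lambda>j. (((*v) (matrix_inv A)) ^^ j) x) \<longlonglongrightarrow> 0"
 by (rule inverse_iterates_tendsto_0[OF det_nz eigen])

lemma At_B [simp]: "At *v (B *v x) = x" and B_At [simp]: "B *v (At *v x) = x"
 using matrix_inv_right[of At] matrix_inv_left[of At] det_At
 by (simp_all add: matrix_vector_mul_assoc invertible_det_nz)

lemma A_inv [simp]: "A *v (matrix_inv A *v x) = x" and inv_A [simp]: "matrix_inv A *v (A *v x) = x"
 using matrix_inv_right[of A] matrix_inv_left[of A] det_nz
 by (simp_all add: matrix_vector_mul_assoc invertible_det_nz)

lemma At_inner: "u \<bullet> (At *v v) = (A *v u) \<bullet> v"
 by (metis dot_lmul_matrix inner_commute transpose_matrix_vector transpose_transpose)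

lemma integer_entries: "A $ i $ j \<in> \<int>"
proof -
 have "lattice_vec (axis j 1) = (axis j 1 :: real^'n)" by (simp add: vec_eq_iff axis_def)
 moreover have "A *v lattice_vec (axis j 1) \<in> range lattice_vec" using dil by (auto simp: dilation_matrix_def)
 ultimately obtain k where "A *v axis j 1 = lattice_vec k" by auto
 moreover have "(A *v axis j 1) $ i = A $ i $ j" by (simp add: matrix_vector_mult_def axis_def if_distrib cong: if_cong)
 ultimately show ?thesis by (metis Ints_of_int lattice_vec_simps(5))
qed

lemma lattice_map_exists:
 assumes "!!i j. M $ i $ j \<in> \<int>"
 shows "\<exists>f. \<forall>k :: int^'n. lattice_vec (f k) = (M :: real^'n^'n) *v lattice_vec k"
proof (intro exI allI)
 fix k :: "int^'n"
 have fl: "real_of_int \<lfloor>M $ i $ j\<rfloor> = M $ i $ j" for i j using assms[of i j] by (auto elim: Ints_cases)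
 show "lattice_vec ((\<lambda>k. \<chi> i. \<Sum>j\<in>UNIV. \<lfloor>M $ i $ j\<rfloor> * k $ j) k) = M *v lattice_vec k"
  by (simp add: vec_eq_iff matrix_vector_mult_def fl)
qed

text \<open>The action of the transpose on the integer lattice, which it preserves because \<open>A\<close> has integer entries.\<close>

definition latT :: "int^'n => int^'n" where
 "latT = (SOME f. \<forall>k. lattice_vec (f k) = At *v lattice_vec k)"

definition latA :: "int^'n => int^'n" where
 "latA = (SOME f. \<forall>k. lattice_vec (f k) = A *v lattice_vec k)"

lemma latT: "lattice_vec (latT k) = At *v lattice_vec k"
 using someI_ex[OF lattice_map_exists[of At]] integer_entries by (simp add: latT_def transpose_def)

lemma latA: "lattice_vec (latA k) = A *v lattice_vec k"
 using someI_ex[OF lattice_map_exists[of A]] integer_entries by (simp add: latA_def)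

lemma latT_inj: "inj latT"
 by (rule injI) (metis B_At latT lattice_vec_inj)

lemma At_shift2pi: "At *v shift2pi k y = shift2pi (latT k) (At *v y)"
 by (simp add: matrix_vector_right_distrib latT matrix_vector_mult_scaleR)

lemma lattice_vec_small:
 assumes "norm (lattice_vec k :: real^'n) < 1"
 shows "k = 0"
proof -
 have "\<bar>real_of_int (k $ i)\<bar> < 1" for i
  using component_le_norm_cart[of "lattice_vec k :: real^'n" i] assms by simp
 hence "k $ i = 0" for i by (metis of_int_abs of_int_less_1_iff zabs_less_one_iff)
 thus ?thesis by (simp add: vec_eq_iff)
qed

text \<open>Dividing by the transpose contracts a vector to the origin, but nonzero lattice points have norm at least \<open>1\<close>.\<close>

lemma latT_descent:
 assumes "!!m. \<exists>t. (latT ^^ m) t = s"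
 shows "s = 0"
proof -
 obtain m where m: "norm ((((*v) B) ^^ m) (lattice_vec s)) < 1"
  using LIMSEQ_D[OF B_iterates[of "lattice_vec s"], of 1] by auto
 obtain t where t: "(latT ^^ m) t = s" using assms by blast
 have "(((*v) B) ^^ m) (lattice_vec ((latT ^^ m) t)) = lattice_vec t" for m
 proof (induction m)
  case (Suc m)
  thus ?case
   by (simp only: funpow_Suc_right[of m "(*v) B"] funpow.simps(2)[of m latT] o_apply latT B_At)
 qed simp
 hence "norm (lattice_vec t :: real^'n) < 1" using m t by auto
 hence "t = 0" by (rule lattice_vec_small)
 moreover have "latT 0 = 0" using latT[of 0] lattice_vec_inj[of "latT 0" 0] by simp
 hence "(latT ^^ m) 0 = 0" for m by (induction m) simp_all
 ultimately show ?thesis using t by simp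
qed

text \<open>A periodic point would be fixed by a power of the inverse of \<open>A\<close>, whose powers tend to zero.\<close>

lemma latA_orbit_inj:
 assumes "k ~= 0"
 shows "inj (\<lambda>j. (latA ^^ j) k)"
proof -
 have inv: "(((*v) (matrix_inv A)) ^^ m) (lattice_vec ((latA ^^ m) t)) = lattice_vec t" for m t
 proof (induction m)
  case (Suc m)
  thus ?case
   by (simp only: funpow_Suc_right[of m "(*v) (matrix_inv A)"] funpow.simps(2)[of m latA] o_apply latA inv_A)
 qed simp
 have ne: "(latA ^^ i) k ~= (latA ^^ (i + Suc d)) k" for i d
 proof
  assume eq: "(latA ^^ i) k = (latA ^^ (i + Suc d)) k"
  define y where "y = (latA ^^ i) k"
  have "(latA ^^ Suc d) y = (latA ^^ (Suc d + i)) k" by (simp only: y_def funpow_add o_apply)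
  hence y: "(latA ^^ Suc d) y = y" using eq by (simp only: y_def add.commute)
  have yr: "(latA ^^ (Suc d * r)) y = y" for r
   by (induction r) (simp_all only: mult_0_right mult_Suc_right funpow_add o_apply y funpow_0 id_apply)
  have "lattice_vec y = (((*v) (matrix_inv A)) ^^ (Suc d * r)) (lattice_vec y)" for r
   using inv[of "Suc d * r" y] yr by simp
  moreover have "(\<lambda>r. (((*v) (matrix_inv A)) ^^ (Suc d * r)) (lattice_vec y)) \<longlonglongrightarrow> 0"
   by (rule LIMSEQ_subseq_LIMSEQ[OF inv_A_iterates, unfolded o_def]) (rule strict_monoI, simp only: mult_less_cancel1 zero_less_Suc)
  ultimately have "lattice_vec y = (0 :: real^'n)" by (simp add: LIMSEQ_const_iff)
  hence "(((*v) (matrix_inv A)) ^^ i) (lattice_vec y) = (0 :: real^'n)"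
   by (simp add: matrix_iterate_zero)
  hence "lattice_vec k = (0 :: real^'n)" using inv[of i k] by (simp add: y_def)
  thus False using assms by (simp add: vec_eq_iff)
 qed
 show ?thesis
 proof (rule injI)
  fix i j assume "(latA ^^ i) k = (latA ^^ j) k"
  thus "i = j" using ne[of i "j - i - 1"] ne[of j "i - j - 1"] by (cases i j rule: linorder_cases) auto
 qed
qed

text \<open>The powers of the inverse tend to zero entrywise, and the determinant is continuous.\<close>

lemma det_B_lt_1: "\<bar>det B\<bar> < 1"
proof (rule ccontr)
 assume "\<not> \<bar>det B\<bar> < 1"
 hence ge: "1 \<le> \<bar>det B\<bar> ^ j" for j by simp
 define P where "P j = ((\<lambda>X. B ** X) ^^ j) (mat 1)" for j
 have Px: "P j *v x = (((*v) B) ^^ j) x" for j x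
  by (induction j) (simp_all add: P_def matrix_vector_mul_assoc[symmetric])
 have detP: "det (P j) = det B ^ j" for j by (induction j) (simp_all add: P_def det_mul)
 have "(\<lambda>j. P j $ i $ k) \<longlonglongrightarrow> 0" for i k
 proof -
  have "P j $ i $ k = (P j *v axis k 1) $ i" for j
   by (simp add: matrix_vector_mult_def axis_def if_distrib cong: if_cong)
  thus ?thesis using tendsto_vec_nth[OF B_iterates[of "axis k 1"], of i] by (simp add: Px)
 qed
 hence "P \<longlonglongrightarrow> 0" by (intro vec_tendstoI) simp
 hence "(\<lambda>j. det (P j)) \<longlonglongrightarrow> det (0 :: real^'n^'n)"
  unfolding det_def by (intro tendsto_intros) auto
 moreover have "det (0 :: real^'n^'n) = 0"
  using singular_iff_kernel[of "0 :: real^'n^'n"] by (auto intro: exI[of _ "axis undefined 1"] simp: axis_eq_0_iff)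
 ultimately have "(\<lambda>j. \<bar>det B\<bar> ^ j) \<longlonglongrightarrow> 0" using tendsto_rabs_zero[of "\<lambda>j. det (P j)"] by (simp add: detP power_abs)
 thus False using ge LIMSEQ_le_const[of "\<lambda>j. \<bar>det B\<bar> ^ j" 0 1] by auto
qed

end

section \<open>The toral endomorphism induced by the transpose\<close>

context dilation
begin

lemma At_measurable [measurable]: "(\<lambda>y. At *v y) \<in> borelfun"
 by (intro borel_measurable_continuous_onI linear_continuous_on matrix_vector_mul_bounded_linear)

lemma At_iterate_measurable [measurable]: "(\<lambda>y. (((*v) At) ^^ j) y) \<in> borelfun"
proof (induction j)
 case (Suc j)
 from measurable_compose[OF this At_measurable] show ?case by simp
qed simp

text \<open>The endomorphism preserves the measure of the torus: average over all translates of the cell and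
 interchange the integrals.\<close>

lemma integral_cell_transpose:
 fixes p :: "real^'n => complex"
 assumes pm [measurable]: "p \<in> borelfun" and bdd: "!!y. cmod (p y) \<le> C" and per: "periodic2pi p"
 shows "(\<integral>y. p (At *v y) \<partial>cellM) = (\<integral>y. p y \<partial>cellM)"
proof -
 let ?M = "cellM :: (real^'n) measure"
 interpret fm: finite_measure ?M by (rule finite_measure_cell)
 interpret pair_sigma_finite ?M ?M ..
 interpret pm: finite_measure "?M \<Otimes>\<^sub>M ?M" by (rule finite_measure_pair_measure) unfold_locales
 define q where "q y = p (At *v y)" for y
 have qm [measurable]: "q \<in> borelfun" unfolding q_def by measurable
 have qi: "integrable ?M q" by (rule integrable_cell_bounded[OF qm, of C]) (simp add: q_def bdd)
 have qper: "periodic2pi q" using per by (simp add: q_def periodic2pi_def At_shift2pi)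
 have id [measurable]: "(\<lambda>y. y) \<in> measurable ?M borel" by (rule measurable_cell_measure) simp
 have m: "(\<lambda>(y, t). p (t + At *v y)) \<in> borel_measurable (?M \<Otimes>\<^sub>M ?M)"
 proof -
  have "fst \<in> measurable (?M \<Otimes>\<^sub>M ?M) borel" "snd \<in> measurable (?M \<Otimes>\<^sub>M ?M) borel"
   using measurable_compose[OF measurable_fst id] measurable_compose[OF measurable_snd id] by simp_all
  hence "(\<lambda>z. snd z + At *v fst z) \<in> measurable (?M \<Otimes>\<^sub>M ?M) borel"
   by (intro borel_measurable_add measurable_compose[OF _ At_measurable])
  from measurable_compose[OF this pm] show ?thesis by (simp add: case_prod_unfold)
 qed
 have int: "integrable (?M \<Otimes>\<^sub>M ?M) (\<lambda>(y, t). p (t + At *v y))"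
  using m by (intro pm.integrable_const_bound[of _ C]) (auto simp: bdd)
 define v where "v = measure ?M (space ?M)"
 have v: "v ~= 0" by (simp add: v_def measure_def space_restrict_space emeasure_restrict_space emeasure_cell)
 have "v *\<^sub>R (\<integral>y. p y \<partial>?M) = (\<integral>y. (\<integral>t. p (t + At *v y) \<partial>?M) \<partial>?M)"
  by (simp add: integral_cell_translate[OF integrable_cell_bounded[OF pm bdd] pm per] v_def)
 also have "... = (\<integral>t. (\<integral>y. p (t + At *v y) \<partial>?M) \<partial>?M)" by (rule Fubini_integral[OF int, symmetric])
 also have "... = (\<integral>t. (\<integral>y. q (y + B *v t) \<partial>?M) \<partial>?M)"
  by (simp add: q_def matrix_vector_right_distrib add.commute)
 also have "... = v *\<^sub>R (\<integral>y. q y \<partial>?M)"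
  using integral_cell_translate[OF qi qm qper] by (simp add: v_def)
 finally show ?thesis using v by (simp add: q_def)
qed

lemma torus_char_transpose: "torus_char k (At *v y) = torus_char (latA k) y"
 by (simp add: torus_char_def At_inner latA)

text \<open>The Fourier coefficients of an invariant function are constant along the infinite orbits
 of the nonzero frequencies, hence vanish there.\<close>

theorem transpose_ergodic:
 assumes Fm [measurable]: "F \<in> sets borel" and per: "!!y k. shift2pi k y \<in> F \<longleftrightarrow> y \<in> F"
  and sub: "!!y. At *v y \<in> F ==> y \<in> F"
 shows "(AE y in lborel. y \<in> F) \<or> (AE y in lborel. y \<notin> F)"
proof -
 let ?M = "cellM :: (real^'n) measure"
 define u :: "real^'n => complex" where "u = indicator F"
 have um [measurable]: "u \<in> borelfun" by (simp add: u_def)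
 have ub: "cmod (u y) \<le> 1" for y by (simp add: u_def indicator_def)
 have uper: "periodic2pi u" using per by (simp add: u_def periodic2pi_def indicator_def)
 have ui: "integrable ?M u" by (rule integrable_cell_bounded[OF um ub])
 have uAi: "integrable ?M (\<lambda>y. u (At *v y))" by (rule integrable_cell_bounded[of _ 1]) (auto simp: ub)
 have inv: "AE y in ?M. u (At *v y) = u y"
 proof -
  have nn: "0 \<le> Re (u y - u (At *v y))" for y using sub[of y] by (auto simp: u_def indicator_def)
  have "(\<integral>y. Re (u y - u (At *v y)) \<partial>?M) = Re (\<integral>y. u y - u (At *v y) \<partial>?M)"
   using ui uAi by (intro integral_Re Bochner_Integration.integrable_diff)
  also have "... = 0" using ui uAi integral_cell_transpose[OF um ub uper] by simp
  finally have "AE y in ?M. Re (u y - u (At *v y)) = 0"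
   using nn ui uAi by (subst (asm) integral_nonneg_eq_0_iff_AE) auto
  thus ?thesis
  proof eventually_elim
   fix y assume "Re (u y - u (At *v y)) = 0"
   thus "u (At *v y) = u y"
    by (cases "At *v y \<in> F"; cases "y \<in> F") (simp_all add: u_def)
  qed
 qed
 define c where "c k = (\<integral>y. u y * torus_char k y \<partial>?M)" for k
 have c_inv: "c (latA k) = c k" for k
 proof -
  have "periodic2pi (\<lambda>y. u y * torus_char k y)"
   using uper torus_char_periodic[of k] by (simp add: periodic2pi_def)
  hence "c k = (\<integral>y. u (At *v y) * torus_char k (At *v y) \<partial>?M)"
   unfolding c_def by (intro integral_cell_transpose[symmetric, of _ 1]) (auto simp: norm_mult ub)
  also have "... = c (latA k)" unfolding c_def torus_char_transpose
   by (intro integral_cong_AE measurable_cell_measure) (use inv in auto)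
  finally show ?thesis by simp
 qed
 have c_orbit: "c ((latA ^^ j) k) = c k" for j k by (induction j) (simp_all add: c_inv)
 have uL: "u \<in> Lsq ?M"
  using integrable_cell_bounded[of "\<lambda>y. cplx ((cmod (u y))\<^sup>2)" 1]
  by (auto simp: Lsq_def intro!: measurable_cell_measure finite_measure.integrable_const_bound[OF finite_measure_cell, of _ 1])
    (simp add: ub power_le_one)
 have c_fin: "(\<integral>\<^sup>+k. esq (c k) \<partial>counting) < \<infinity>"
  unfolding c_def Parseval_torus[OF uL] nn_integral_Lsq_norm[OF uL] by (simp add: ennreal_mult[symmetric])
 have c0: "c k = 0" if "k ~= 0" for k
 proof (rule ccontr)
  assume "c k ~= 0"
  let ?o = "\<lambda>j. (latA ^^ j) k"
  have "(\<integral>\<^sup>+j. esq (c (?o j)) \<partial>counting) = (\<integral>\<^sup>+k. esq (c k) \<partial>count_space (range ?o))"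
   using latA_orbit_inj[OF that] by (intro nn_integral_bij_count_space) (simp add: bij_betw_def)
  also have "... \<le> (\<integral>\<^sup>+k. esq (c k) \<partial>counting)"
   by (subst nn_integral_count_space_indicator) (auto intro!: nn_integral_mono simp: indicator_def)
  finally show False using c_fin \<open>c k ~= 0\<close> by (simp add: c_orbit top_unique ennreal_mult_top)
 qed
 define a where "a = c 0 / cplx ((2 * pi) ^ CARD('n))"
 have "AE y in ?M. u y - a = 0"
 proof (rule torus_uniqueness)
  have ai: "integrable ?M (\<lambda>y. a)" by (rule integrable_cell_bounded[of _ "cmod a"]) auto
  thus "integrable ?M (\<lambda>y. u y - a)" using ui by simp
  fix k :: "int^'n"
  have i1: "integrable ?M (\<lambda>y. u y * torus_char k y)" by (rule integrable_cell_bounded[of _ 1]) (auto simp: norm_mult ub)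
  have i2: "integrable ?M (\<lambda>y. torus_char k y)" by (rule integrable_cell_bounded[of _ 1]) auto
  have "(\<integral>y. (u y - a) * torus_char k y \<partial>?M) = c k - a * (\<integral>y. torus_char k y \<partial>?M)"
   using i1 i2 by (simp add: left_diff_distrib c_def)
  thus "(\<integral>y. (u y - a) * torus_char k y \<partial>?M) = 0"
   using c0[of k] by (simp add: integral_torus_char a_def)
 qed
 hence "AE y in ?M. u y = a" by simp
 hence const: "AE y in lborel. u y = a"
  by (rule AE_cell_periodic) (simp add: periodic2piD[OF uper])
 show ?thesis
 proof (cases "a = 1")
  case True
  from const have "AE y in lborel. y \<in> F" by eventually_elim (auto simp: u_def True indicator_def split: if_splits)
  thus ?thesis ..
 next
  case False
  from const have "AE y in lborel. y \<notin> F" by eventually_elim (use False in \<open>auto simp: u_def indicator_def split: if_splits\<close>)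
  thus ?thesis ..
 qed
qed

text \<open>The limit \<open>g\<close> of \<open>\<sigma>\<close> along the orbits is invariant under the dilation, and ergodicity turns finiteness of the
 lattice sum of \<open>\<sigma>\<close> on a set of positive measure into integrability of \<open>g\<close>.  A dilation multiplies
 integrals by a factor different from \<open>1\<close>, so an invariant integrable function is null.\<close>

theorem decreasing_along_orbits_tendsto_0:
 fixes \<sigma> :: "real^'n => ennreal"
 assumes sm [measurable]: "\<sigma> \<in> borelfun" and dec: "AE y in lborel. \<sigma> (At *v y) \<le> \<sigma> y"
  and S: "S \<in> sets lborel" "emeasure lborel S > 0"
  and fin: "AE y in lborel. y \<in> S --> (\<integral>\<^sup>+k. \<sigma> (shift2pi k y) \<partial>counting) < \<infinity>"
 shows "AE y in lborel. (\<lambda>j. \<sigma> ((((*v) At) ^^ j) y)) \<longlonglongrightarrow> 0"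
proof -
 define s where "s j y = \<sigma> ((((*v) At) ^^ j) y)" for j y
 have s_meas [measurable]: "s j \<in> borelfun" for j
  unfolding s_def by (rule measurable_compose[OF At_iterate_measurable sm])
 define g where "g y = liminf (\<lambda>j. s j y)" for y
 have gm [measurable]: "g \<in> borelfun" unfolding g_def by measurable
 have s_At: "s j (At *v y) = s (Suc j) y" for j y by (simp add: s_def funpow_swap1)
 have g_inv: "g (At *v y) = g y" for y
  using liminf_shift[of "\<lambda>j. s j y"] by (simp add: g_def s_At)
 have step: "AE y in lborel. s (Suc j) y \<le> s j y" for j
 proof (induction j)
  case 0 thus ?case using dec by (simp add: s_def)
 next
  case (Suc j)
  from AE_matrix_vector[OF det_At this] show ?case by (simp add: s_At)
 qed
 hence "AE y in lborel. \<forall>j. s (Suc j) y \<le> s j y" by (subst AE_all_countable) blast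
 hence lim: "AE y in lborel. (\<lambda>j. s j y) \<longlonglongrightarrow> g y \<and> g y \<le> \<sigma> y"
 proof eventually_elim
  fix y assume "\<forall>j. s (Suc j) y \<le> s j y"
  hence d: "decseq (\<lambda>j. s j y)" by (simp add: decseq_Suc_iff)
  have L: "(\<lambda>j. s j y) \<longlonglongrightarrow> (INF j. s j y)" by (rule LIMSEQ_INF[OF d])
  have "g y = (INF j. s j y)" unfolding g_def by (rule lim_imp_Liminf[OF _ L]) simp
  moreover have "(INF j. s j y) \<le> \<sigma> y" by (rule INF_lower2[of 0]) (simp_all add: s_def)
  ultimately show "(\<lambda>j. s j y) \<longlonglongrightarrow> g y \<and> g y \<le> \<sigma> y" using L by simp
 qed
 define G where "G y = (\<integral>\<^sup>+k. g (shift2pi k y) \<partial>counting)" for y :: "real^'n"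
 have Gm [measurable]: "G \<in> borelfun" unfolding G_def by (rule measurable_lattice_nn_sum) measurable
 have Gper: "G (shift2pi l y) = G y" for l y
 proof -
  have "G y = (\<integral>\<^sup>+k. g (shift2pi (k + l) y) \<partial>counting)"
   unfolding G_def by (rule nn_integral_bij_count_space[OF bij_add_lattice, symmetric])
  thus ?thesis unfolding G_def shift2pi_shift2pi by (simp only: add.commute)
 qed
 have GAt: "G y \<le> G (At *v y)" for y
 proof -
  have "G y = (\<integral>\<^sup>+k. g (shift2pi (latT k) (At *v y)) \<partial>counting)"
   unfolding G_def At_shift2pi[symmetric] g_inv ..
  also have "... = (\<integral>\<^sup>+k. g (shift2pi k (At *v y)) \<partial>count_space (range latT))"
   using latT_inj by (intro nn_integral_bij_count_space) (simp add: bij_betw_def)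
  also have "... \<le> G (At *v y)" unfolding G_def
   by (subst nn_integral_count_space_indicator) (auto intro!: nn_integral_mono simp: indicator_def)
  finally show ?thesis .
 qed
 define F where "F N = {y. G y \<le> of_nat N}" for N :: nat
 have erg: "(AE y in lborel. y \<in> F N) \<or> (AE y in lborel. y \<notin> F N)" for N
 proof (rule transpose_ergodic)
  show "F N \<in> sets borel" unfolding F_def by measurable
  show "shift2pi k y \<in> F N \<longleftrightarrow> y \<in> F N" for y k by (simp only: F_def mem_Collect_eq Gper)
  show "At *v y \<in> F N ==> y \<in> F N" for y using GAt[of y] by (auto simp: F_def)
 qed
 have "\<exists>N. AE y in lborel. y \<in> F N"
 proof (rule ccontr)
  assume "\<not> ?thesis"
  hence "AE y in lborel. \<forall>N. y \<notin> F N" using erg by (subst AE_all_countable) blast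
  moreover have "AE y in lborel. \<forall>k. g (shift2pi k y) \<le> \<sigma> (shift2pi k y)"
   by (rule AE_lborel_all_shifts) (use lim in \<open>auto elim: eventually_mono\<close>)
  ultimately have "AE y in lborel. y \<notin> S" using fin
  proof eventually_elim
   fix y assume *: "\<forall>N. y \<notin> F N" "\<forall>k. g (shift2pi k y) \<le> \<sigma> (shift2pi k y)"
    "y \<in> S --> (\<integral>\<^sup>+k. \<sigma> (shift2pi k y) \<partial>counting) < \<infinity>"
   show "y \<notin> S"
   proof
    assume "y \<in> S"
    have "G y \<le> (\<integral>\<^sup>+k. \<sigma> (shift2pi k y) \<partial>counting)"
     unfolding G_def using *(2) by (intro nn_integral_mono) auto
    hence "G y < \<infinity>" using *(3) \<open>y \<in> S\<close> by (auto intro: le_less_trans)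
    then obtain N :: nat where "G y \<le> of_nat N" using ennreal_Ex_less_of_nat[of "G y"] by (auto intro: less_imp_le)
    thus False using *(1) by (auto simp: F_def)
   qed
  qed
  hence "emeasure lborel S = 0" using S(1) by (subst (asm) AE_iff_null_sets[symmetric]) auto
  thus False using S(2) by simp
 qed
 then obtain N where N: "AE y in lborel. y \<in> F N" by blast
 define I where "I = (\<integral>\<^sup>+y. g y \<partial>lborel)"
 have "I = (\<integral>\<^sup>+y. G y \<partial>cellM)" unfolding I_def G_def by (rule nn_integral_unfold_cell) simp
 also have "... \<le> (\<integral>\<^sup>+y. of_nat N \<partial>(cellM :: (real^'n) measure))"
  using AE_lborel_imp_cell[OF N] by (intro nn_integral_mono_AE) (simp add: F_def)
 also have "... < \<infinity>"
  by (simp add: space_restrict_space emeasure_restrict_space emeasure_cell ennreal_mult_less_top of_nat_less_top)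
 finally have I_fin: "I < \<infinity>" .
 have detB: "det B ~= 0"
  using matrix_inv_right[of At] det_At by (metis det_I det_mul invertible_det_nz mult_zero_right zero_neq_one)
 have gB: "g (B *v y) = g y" for y using g_inv[of "B *v y"] by simp
 have eq: "I = ennreal (1 / \<bar>det B\<bar>) * I"
  using nn_integral_matrix_vector[OF detB gm] by (simp add: gB I_def)
 obtain r where r: "I = ennreal r" "0 \<le> r" using I_fin by (cases I) auto
 have "r = 1 / \<bar>det B\<bar> * r" using eq r by (simp add: ennreal_mult[symmetric])
 hence "r = 0" using det_B_lt_1 detB by (simp add: field_simps)
 hence "AE y in lborel. g y = 0" using r by (simp add: I_def nn_integral_0_iff_AE)
 with lim show ?thesis by eventually_elim (simp add: s_def)
qed

end

section \<open>Frames and projections\<close>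

lemma frame_energy_coefficients:
 assumes "frame_energy M I e f < \<infinity>"
 shows "(\<lambda>i. Lsq_inner M f (e i)) \<in> Lsq (count_space I)"
  and "frame_energy M I e f = ennreal ((Lsq_norm (count_space I) (\<lambda>i. Lsq_inner M f (e i)))\<^sup>2)"
proof -
 show L: "(\<lambda>i. Lsq_inner M f (e i)) \<in> Lsq (count_space I)"
  using assms by (subst Lsq_iff_nn_integral) (auto simp: frame_energy_def)
 show "frame_energy M I e f = ennreal ((Lsq_norm (count_space I) (\<lambda>i. Lsq_inner M f (e i)))\<^sup>2)"
  by (simp add: frame_energy_def nn_integral_Lsq_norm[OF L])
qed

text \<open>The coefficient map is a contraction into a sequence space by the Bessel inequality.\<close>

lemma frame_energy_tendsto:
 assumes e: "!!i. i \<in> I ==> e i \<in> Lsq M"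
  and bessel: "!!f. f \<in> Lsq M ==> frame_energy M I e f \<le> ennreal ((Lsq_norm M f)\<^sup>2)"
  and F: "!!m. F m \<in> Lsq M" and f: "f \<in> Lsq M" and lim: "(\<lambda>m. Lsq_norm M (\<lambda>x. F m x - f x)) \<longlonglongrightarrow> 0"
 shows "(\<lambda>m. frame_energy M I e (F m)) \<longlonglongrightarrow> frame_energy M I e f"
proof -
 define c where "c g = (\<lambda>i. Lsq_inner M g (e i))" for g
 have fin: "frame_energy M I e g < \<infinity>" if "g \<in> Lsq M" for g using bessel[OF that] by (auto intro: le_less_trans)
 have cL: "c g \<in> Lsq (count_space I)" and cE: "frame_energy M I e g = ennreal ((Lsq_norm (count_space I) (c g))\<^sup>2)"
  if "g \<in> Lsq M" for g
  unfolding c_def using frame_energy_coefficients[OF fin[OF that]] by auto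
 have cn: "Lsq_norm (count_space I) (c g) \<le> Lsq_norm M g" if "g \<in> Lsq M" for g
  by (rule power2_le_imp_le) (use bessel[OF that] cE[OF that] in simp_all)
 have le: "\<bar>Lsq_norm (count_space I) (c (F m)) - Lsq_norm (count_space I) (c f)\<bar> \<le> Lsq_norm M (\<lambda>x. F m x - f x)" for m
 proof -
  have "\<bar>Lsq_norm (count_space I) (c (F m)) - Lsq_norm (count_space I) (c f)\<bar>
    \<le> Lsq_norm (count_space I) (\<lambda>i. c (F m) i - c f i)" by (intro Lsq_norm_diff_le cL F f)
  also have "... = Lsq_norm (count_space I) (c (\<lambda>x. F m x - f x))"
   by (rule Lsq_norm_cong_AE) (auto simp: AE_count_space c_def Lsq_inner_diff_left[OF F f e])
  also have "... \<le> Lsq_norm M (\<lambda>x. F m x - f x)" by (intro cn Lsq_diff F f)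
  finally show ?thesis .
 qed
 have "(\<lambda>m. Lsq_norm (count_space I) (c (F m)) - Lsq_norm (count_space I) (c f)) \<longlonglongrightarrow> 0"
  by (rule Lim_null_comparison[OF _ lim]) (simp add: le)
 hence "(\<lambda>m. Lsq_norm (count_space I) (c (F m))) \<longlonglongrightarrow> Lsq_norm (count_space I) (c f)" by (rule LIM_zero_cancel)
 thus ?thesis unfolding cE[OF F] cE[OF f] by (intro tendsto_ennrealI tendsto_power)
qed

lemma frame_energy_Bessel_limit:
 assumes I: "countable I" and e: "!!i. i \<in> I ==> e i \<in> Lsq M"
  and bessel: "!!m. frame_energy M I e (F m) \<le> ennreal ((Lsq_norm M (F m))\<^sup>2)"
  and F: "!!m. F m \<in> Lsq M" and f: "f \<in> Lsq M" and lim: "(\<lambda>m. Lsq_norm M (\<lambda>x. F m x - f x)) \<longlonglongrightarrow> 0"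
 shows "frame_energy M I e f \<le> ennreal ((Lsq_norm M f)\<^sup>2)"
 unfolding frame_energy_def
proof (rule nn_integral_count_space_le[OF I])
 fix J assume J: "finite J" "J \<subseteq> I"
 have l1: "(\<lambda>m. \<Sum>i\<in>J. (cmod (Lsq_inner M (F m) (e i)))\<^sup>2) \<longlonglongrightarrow> (\<Sum>i\<in>J. (cmod (Lsq_inner M f (e i)))\<^sup>2)"
  using J e by (intro tendsto_sum tendsto_power tendsto_norm Lsq_inner_tendsto F f lim) auto
 have l2: "(\<lambda>m. (Lsq_norm M (F m))\<^sup>2) \<longlonglongrightarrow> (Lsq_norm M f)\<^sup>2"
  by (intro tendsto_power Lsq_norm_tendsto F f lim)
 have le: "(\<Sum>i\<in>J. (cmod (Lsq_inner M (F m) (e i)))\<^sup>2) \<le> (Lsq_norm M (F m))\<^sup>2" for m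
 proof -
  have "ennreal (\<Sum>i\<in>J. (cmod (Lsq_inner M (F m) (e i)))\<^sup>2) = (\<integral>\<^sup>+i. esq (Lsq_inner M (F m) (e i)) \<partial>count_space J)"
   using J by (simp add: nn_integral_count_space_finite sum_ennreal)
  also have "... \<le> frame_energy M I e (F m)" unfolding frame_energy_def
   using J by (auto simp: nn_integral_count_space_indicator indicator_def intro!: nn_integral_mono)
  also note bessel[of m]
  finally show ?thesis by simp
 qed
 have "(\<Sum>i\<in>J. (cmod (Lsq_inner M f (e i)))\<^sup>2) \<le> (Lsq_norm M f)\<^sup>2"
  by (rule LIMSEQ_le[OF l1 l2]) (simp add: le)
 thus "(\<Sum>i\<in>J. esq (Lsq_inner M f (e i))) \<le> ennreal ((Lsq_norm M f)\<^sup>2)"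
  by (simp add: sum_ennreal)
qed

text \<open>The Bessel inequality passes to limits by finite partial sums; then both energies are continuous.\<close>

lemma frame_energy_eq_dense:
 assumes I: "countable I" and e: "!!i. i \<in> I ==> e i \<in> Lsq M" and e': "!!i. i \<in> I' ==> e' i \<in> Lsq M"
  and bessel: "!!f. f \<in> Lsq M ==> frame_energy M I' e' f \<le> ennreal ((Lsq_norm M f)\<^sup>2)"
  and dense: "!!f. f \<in> Lsq M ==> \<exists>F. (\<forall>m. F m \<in> D) \<and> (\<lambda>m. Lsq_norm M (\<lambda>x. F m x - f x)) \<longlonglongrightarrow> 0"
  and D: "D \<subseteq> Lsq M" and eq: "!!f. f \<in> D ==> frame_energy M I e f = frame_energy M I' e' f"
  and f: "f \<in> Lsq M"
 shows "frame_energy M I e f = frame_energy M I' e' f"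
proof -
 have b: "frame_energy M I e f \<le> ennreal ((Lsq_norm M f)\<^sup>2)" if f: "f \<in> Lsq M" for f
 proof -
  obtain F where F: "!!m. F m \<in> D" "(\<lambda>m. Lsq_norm M (\<lambda>x. F m x - f x)) \<longlonglongrightarrow> 0" using dense[OF f] by blast
  have FL: "F m \<in> Lsq M" for m using F(1) D by blast
  have "frame_energy M I e (F m) \<le> ennreal ((Lsq_norm M (F m))\<^sup>2)" for m
   unfolding eq[OF F(1)] by (rule bessel[OF FL])
  from frame_energy_Bessel_limit[OF I e this FL f F(2)] show ?thesis by simp
 qed
 obtain F where F: "!!m. F m \<in> D" "(\<lambda>m. Lsq_norm M (\<lambda>x. F m x - f x)) \<longlonglongrightarrow> 0" using dense[OF f] by blast
 have FL: "F m \<in> Lsq M" for m using F(1) D by blast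
 have "(\<lambda>m. frame_energy M I e (F m)) \<longlonglongrightarrow> frame_energy M I e f" by (rule frame_energy_tendsto[OF e b FL f F(2)])
 moreover have "(\<lambda>m. frame_energy M I e (F m)) \<longlonglongrightarrow> frame_energy M I' e' f"
  unfolding eq[OF F(1)] by (rule frame_energy_tendsto[OF e' bessel FL f F(2)])
 ultimately show ?thesis by (rule LIMSEQ_unique)
qed

lemma Lsq_proj_norm_unique:
 assumes V: "closed_subspace M V" and f: "f \<in> Lsq M" and q: "q \<in> V" and orth: "!!g. g \<in> V ==> Lsq_inner M (\<lambda>x. f x - q x) g = 0"
 shows "Lsq_norm M (Lsq_proj M V f) = Lsq_norm M q"
proof -
 let ?p = "Lsq_proj M V f"
 have p: "?p \<in> V" by (rule Lsq_proj_in[OF V f])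
 have qL: "q \<in> Lsq M" and pL: "?p \<in> Lsq M" using q p closed_subspace_Lsq[OF V] by auto
 have qi: "Lsq_inner M q g = Lsq_inner M f g" if "g \<in> V" for g
  using orth[OF that] Lsq_inner_diff_left[OF f qL closed_subspace_Lsq[OF V that]] by simp
 have "Lsq_inner M ?p ?p = Lsq_inner M q ?p" by (simp add: qi[OF p] Lsq_proj_inner[OF V f p])
 also have "... = cnj (Lsq_inner M ?p q)" by (rule Lsq_inner_commute)
 also have "... = cnj (Lsq_inner M q q)" by (simp add: qi[OF q] Lsq_proj_inner[OF V f q])
 finally have "(Lsq_norm M ?p)\<^sup>2 = (Lsq_norm M q)\<^sup>2" by (simp only: Lsq_inner_self of_real_eq_iff complex_cnj_complex_of_real)
 thus ?thesis by simp
qed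

lemma frame_energy_proj:
 assumes V: "closed_subspace M V" and f: "f \<in> Lsq M" and e: "!!i. i \<in> I ==> e i \<in> V"
 shows "frame_energy M I e f = frame_energy M I e (Lsq_proj M V f)"
 unfolding frame_energy_def by (rule nn_integral_cong) (simp add: Lsq_proj_inner[OF V f e])

text \<open>Membership of the generators in \<open>V\<close> is encoded in the energy: it vanishes on the orthogonal complement of \<open>V\<close>,
 so the translates are orthogonal to this complement.\<close>

theorem ntf_generator_iff_energy:
 assumes V: "closed_subspace lborel V" and \<Phi>: "\<Phi> \<subseteq> L2"
 shows "ntf_generator \<Phi> V \<longleftrightarrow>
  (\<forall>f\<in>L2. shift_energy \<Phi> (\<lambda>\<phi>. \<phi>) f = ennreal ((L2norm (Lsq_proj lborel V f))\<^sup>2))"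
  (is "_ \<longleftrightarrow> (\<forall>f\<in>_. ?E f = ?Q f)")
proof
 assume "ntf_generator \<Phi> V"
 hence mem: "!!i. i \<in> UNIV \<times> \<Phi> ==> (\<lambda>(k, \<phi>). translate k \<phi>) i \<in> V" and "!!f. f \<in> V ==> ?E f = ennreal ((L2norm f)\<^sup>2)"
  by (auto simp: ntf_generator_def normalized_tight_frame_iff_energy shift_energy_def)
 moreover have "?E f = ?E (Lsq_proj lborel V f)" if "f \<in> L2" for f
  unfolding shift_energy_def by (rule frame_energy_proj[OF V that mem])
 ultimately show "\<forall>f\<in>L2. ?E f = ?Q f" using Lsq_proj_in[OF V] by simp
next
 assume E: "\<forall>f\<in>L2. ?E f = ?Q f"
 have mem: "translate k \<phi> \<in> V" if "\<phi> \<in> \<Phi>" for k \<phi>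
 proof (rule double_orthogonal_complement[OF V])
  show t: "translate k \<phi> \<in> L2" using that \<Phi> by (intro translate_Lsq) auto
  fix h assume h: "h \<in> L2" "!!g. g \<in> V ==> L2inner h g = 0"
  have "L2norm (Lsq_proj lborel V h) = L2norm (\<lambda>x::real^'a. 0)"
   by (rule Lsq_proj_norm_unique[OF V h(1)]) (use closed_subspace_zero[OF V] h(2) in auto)
  hence "?E h = 0" using E h(1) by simp
  hence "\<forall>i\<in>UNIV \<times> \<Phi>. L2inner h ((\<lambda>(k, \<phi>). translate k \<phi>) i) = 0"
   by (simp add: shift_energy_def frame_energy_def nn_integral_0_iff_AE AE_count_space)
  hence "L2inner h (translate k \<phi>) = 0" using that by auto
  thus "L2inner (translate k \<phi>) h = 0" using Lsq_inner_commute[of lborel "translate k \<phi>" h] by simp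
 qed
 have "?E f = ennreal ((L2norm f)\<^sup>2)" if "f \<in> V" for f
 proof -
  have "L2norm (Lsq_proj lborel V f) = L2norm f"
   by (rule Lsq_proj_norm_unique[OF V closed_subspace_Lsq[OF V that] that]) simp
  thus ?thesis using E closed_subspace_Lsq[OF V that] by simp
 qed
 moreover have "\<Phi> \<subseteq> V" using mem[of _ 0] by auto
 ultimately show "ntf_generator \<Phi> V" using mem
  by (auto simp: ntf_generator_def normalized_tight_frame_iff_energy shift_energy_def)
qed

section \<open>The kernel determines the energy\<close>

text \<open>Truncate the transform in space and in height.\<close>

lemma test_functions_dense:
 fixes f :: "real^'n => complex"
 assumes f: "f \<in> L2"
 shows "\<exists>F. (\<forall>m. F m \<in> {f \<in> L2. \<exists>h. test_function h \<and> (AE y in lborel. fourier f y = h y)})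
  \<and> (\<lambda>m::nat. L2norm (\<lambda>x. F m x - f x)) \<longlonglongrightarrow> 0"
proof -
 define g where "g = fourier f"
 have g: "g \<in> L2" using fourier_Lsq[OF f] by (simp add: g_def)
 have gm [measurable]: "g \<in> borelfun" unfolding g_def by (rule fourier_measurable[OF f])
 define A where "A m = scaled_cell (Suc m) \<inter> {y. cmod (g y) \<le> real m}" for m
 have Am [measurable]: "A m \<in> sets borel" for m unfolding A_def by measurable
 define h where "h m y = (if y \<in> A m then g y else 0)" for m y
 have h: "test_function (h m)" for m
  unfolding test_function_def
 proof (intro conjI)
  show "h m \<in> borelfun" unfolding h_def by measurable
  show "\<exists>C. \<forall>y. cmod (h m y) \<le> C" by (intro exI[of _ "real m"]) (auto simp: h_def A_def)
  show "cell_supported (h m)" unfolding cell_supported_def by (intro exI[of _ "real (Suc m)"]) (auto simp: h_def A_def)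
 qed
 have "\<exists>f. f \<in> L2 \<and> (AE y in lborel. fourier f y = h m y)" for m using fourier_preimage[OF h[of m]] by blast
 then obtain F where F: "!!m. F m \<in> L2" "!!m. AE y in lborel. fourier (F m) y = h m y" by metis
 have ev: "\<forall>\<^sub>F m in sequentially. y \<in> A m" for y
 proof -
  obtain n :: nat where n: "norm y + cmod (g y) \<le> n" using real_arch_simple by blast
  have "y \<in> A m" if "m \<ge> n" for m
  proof -
   have "norm y \<le> m" "cmod (g y) \<le> m" using n that norm_ge_zero[of y] norm_ge_zero[of "g y"] by linarith+
   moreover have "- (pi * real (Suc m)) < y $ i \<and> y $ i \<le> pi * real (Suc m)" for i
   proof -
    have "\<bar>y $ i\<bar> \<le> m" using component_le_norm_cart[of y i] \<open>norm y \<le> m\<close> by linarith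
    moreover have "1 * real (Suc m) \<le> pi * real (Suc m)" using pi_ge_two by (intro mult_right_mono) auto
    moreover have "- q < x \<and> x \<le> q" if "\<bar>x\<bar> \<le> real m" "1 * real (Suc m) \<le> q" for x q using that by auto
    ultimately show ?thesis by blast
   qed
   ultimately show ?thesis by (simp add: A_def scaled_cell_iff)
  qed
  thus ?thesis by (auto simp: eventually_sequentially)
 qed
 have "(\<lambda>m. L2norm (\<lambda>y. h m y - g y)) \<longlonglongrightarrow> 0"
  unfolding h_def by (rule Lsq_truncation_tendsto[OF g]) (use ev in auto)
 moreover have "L2norm (\<lambda>y. h m y - g y) = sqrt (plancherel_const TYPE('n)) * L2norm (\<lambda>x. F m x - f x)" for m
 proof -
  have "L2norm (fourier (\<lambda>x. F m x - f x)) = L2norm (\<lambda>y. h m y - g y)"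
  proof (rule Lsq_norm_cong_AE)
   show "AE y in lborel. fourier (\<lambda>x. F m x - f x) y = h m y - g y"
    using fourier_diff[OF F(1)[of m] f] F(2)[of m] by eventually_elim (simp add: g_def)
   show "(\<lambda>y. h m y - g y) \<in> borel_measurable lborel" unfolding h_def by measurable
  qed (use fourier_measurable[OF Lsq_diff[OF F(1) f]] in simp)
  thus ?thesis by (simp add: fourier_norm[OF Lsq_diff[OF F(1) f]])
 qed
 ultimately have "(\<lambda>m. sqrt (plancherel_const TYPE('n)) * L2norm (\<lambda>x. F m x - f x)) \<longlonglongrightarrow> 0" by simp
 from tendsto_mult_left[OF this, of "1 / sqrt (plancherel_const TYPE('n))"]
 have "(\<lambda>m. L2norm (\<lambda>x. F m x - f x)) \<longlonglongrightarrow> 0" by simp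
 thus ?thesis using F h by blast
qed

lemma shift_energy_eq_dense:
 fixes \<phi> :: "'i => real^'n => complex" and \<psi> :: "'j => real^'n => complex"
 assumes I: "countable I" and \<phi>: "!!i. i \<in> I ==> \<phi> i \<in> L2" and \<psi>: "!!j. j \<in> J ==> \<psi> j \<in> L2"
  and bessel: "!!f. f \<in> L2 ==> shift_energy J \<psi> f \<le> ennreal ((L2norm f)\<^sup>2)"
  and eq: "!!f h. f \<in> L2 ==> test_function h ==> (AE y in lborel. fourier f y = h y) ==> shift_energy I \<phi> f = shift_energy J \<psi> f"
  and f: "f \<in> L2"
 shows "shift_energy I \<phi> f = shift_energy J \<psi> f"
 unfolding shift_energy_def
proof (rule frame_energy_eq_dense[OF _ _ _ _ test_functions_dense _ _ f])
 show "countable ((UNIV :: (int^'n) set) \<times> I)" using I by simp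
 show "(case i of (k, i) => translate k (\<phi> i)) \<in> L2" if "i \<in> UNIV \<times> I" for i
  using that \<phi> by (auto intro: translate_Lsq)
 show "(case i of (k, i) => translate k (\<psi> i)) \<in> L2" if "i \<in> UNIV \<times> J" for i
  using that \<psi> by (auto intro: translate_Lsq)
qed (use bessel eq in \<open>auto simp: shift_energy_def\<close>)

definition bounded_kernel :: "(real^'n => int^'n => complex) => bool" where
 "bounded_kernel K \<longleftrightarrow> (\<forall>s. (\<lambda>y. K y s) \<in> borelfun) \<and> (\<exists>C. \<forall>s. AE y in lborel. cmod (K y s) \<le> C)"

lemma bounded_kernel_kernel:
 assumes I: "countable I" and \<phi>: "!!i. i \<in> I ==> \<phi> i \<in> Lsq (lborel :: (real^'n) measure)"
  and bdd: "AE y in lborel. spectral I \<phi> y \<le> 1"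
 shows "bounded_kernel (kernel I \<phi>)"
 unfolding bounded_kernel_def
proof (intro conjI allI exI)
 show "(\<lambda>y. kernel I \<phi> y s) \<in> borelfun" for s by (rule kernel_measurable[OF I \<phi>])
 show "AE y in lborel. cmod (kernel I \<phi> y s) \<le> 1" for s
  using bdd AE_lborel_all_shifts[OF bdd] by eventually_elim (auto intro: kernel_bound)
qed

lemma bounded_kernel_diff:
 assumes "bounded_kernel K" "bounded_kernel L"
 shows "bounded_kernel (\<lambda>y s. K y s - L y s)"
proof -
 obtain C D where C: "!!s. AE y in lborel. cmod (K y s) \<le> C" and D: "!!s. AE y in lborel. cmod (L y s) \<le> D"
  using assms by (auto simp: bounded_kernel_def)
 have "AE y in lborel. cmod (K y s - L y s) \<le> C + D" for s
  using C[of s] D[of s]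
 proof eventually_elim
  fix y assume "cmod (K y s) \<le> C" "cmod (L y s) \<le> D"
  thus "cmod (K y s - L y s) \<le> C + D" using norm_triangle_ineq4[of "K y s" "L y s"] by linarith
 qed
 thus ?thesis using assms by (auto simp: bounded_kernel_def intro!: borel_measurable_diff)
qed

lemma kernel_form_diff:
 assumes K: "bounded_kernel K" and L: "bounded_kernel L" and h: "test_function h"
 shows "kernel_form (\<lambda>y s. K y s - L y s) S h = kernel_form K S h - kernel_form L S h"
proof -
 have i: "integrable lborel (\<lambda>y. \<Sum>s\<in>S. h y * cnj (h (shift2pi s y)) * cnj (K y s))" if bk: "bounded_kernel K" for K
 proof (rule Bochner_Integration.integrable_sum)
  fix s
  obtain C where "(\<lambda>y. K y s) \<in> borelfun" "AE y in lborel. cmod (K y s) \<le> C"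
   using bk unfolding bounded_kernel_def by blast
  thus "integrable lborel (\<lambda>y. h y * cnj (h (shift2pi s y)) * cnj (K y s))"
   by (rule test_function_bounded_integrable[OF h])
 qed
 have "(\<Sum>s\<in>S. h y * cnj (h (shift2pi s y)) * cnj (K y s - L y s))
  = (\<Sum>s\<in>S. h y * cnj (h (shift2pi s y)) * cnj (K y s)) - (\<Sum>s\<in>S. h y * cnj (h (shift2pi s y)) * cnj (L y s))" for y
  by (simp only: complex_cnj_diff right_diff_distrib sum_subtractf)
 thus ?thesis unfolding kernel_form_def
  by (simp only: Bochner_Integration.integral_diff[OF i[OF K] i[OF L]])
qed

lemma bounded_kernel_unique:
 assumes K: "bounded_kernel K" and L: "bounded_kernel L"
  and eq: "!!h S. test_function h ==> lattice_cover S h ==> kernel_form K S h = kernel_form L S h"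
 shows "AE y in lborel. \<forall>s. K y s = L y s"
proof -
 from bounded_kernel_diff[OF K L] obtain C where C: "!!s. (\<lambda>y. K y s - L y s) \<in> borelfun"
  "!!s. AE y in lborel. cmod (K y s - L y s) \<le> C" by (auto simp: bounded_kernel_def)
 have "AE y in lborel. \<forall>s. K y s - L y s = 0"
  by (rule kernel_form_determines[OF C]) (simp_all add: kernel_form_diff[OF K L] eq)
 thus ?thesis by simp
qed

theorem kernel_eq_iff_shift_energy_eq:
 fixes \<phi> :: "'i => real^'n => complex" and \<psi> :: "'j => real^'n => complex"
 assumes I: "countable I" and \<phi>: "!!i. i \<in> I ==> \<phi> i \<in> L2" and b: "AE y in lborel. spectral I \<phi> y \<le> 1"
  and J: "countable J" and \<psi>: "!!j. j \<in> J ==> \<psi> j \<in> L2"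
  and bessel: "!!f. f \<in> L2 ==> shift_energy J \<psi> f \<le> ennreal ((L2norm f)\<^sup>2)"
 shows "(AE y in lborel. \<forall>s. kernel I \<phi> y s = kernel J \<psi> y s) \<longleftrightarrow>
  (\<forall>f\<in>L2. shift_energy I \<phi> f = shift_energy J \<psi> f)"
proof
 have b': "AE y in lborel. spectral J \<psi> y \<le> 1" by (rule spectral_le_1[OF J \<psi> bessel])
 note ef = shift_energy_kernel_form[of I \<phi>, OF I \<phi> b] shift_energy_kernel_form[of J \<psi>, OF J \<psi> b']
 {
  assume eq: "\<forall>f\<in>L2. shift_energy I \<phi> f = shift_energy J \<psi> f"
  show "AE y in lborel. \<forall>s. kernel I \<phi> y s = kernel J \<psi> y s"
  proof (rule bounded_kernel_unique)
   show "bounded_kernel (kernel I \<phi>)" "bounded_kernel (kernel J \<psi>)"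
    by (rule bounded_kernel_kernel[of I \<phi>, OF I \<phi> b], assumption, rule bounded_kernel_kernel[of J \<psi>, OF J \<psi> b'], assumption)
   fix h :: "real^'n => complex" and S assume h: "test_function h" "lattice_cover S h"
   obtain f where f: "f \<in> L2" "AE y in lborel. fourier f y = h y" using fourier_preimage[OF h(1)] .
   show "kernel_form (kernel I \<phi>) S h = kernel_form (kernel J \<psi>) S h"
    using ef(2,4)[OF _ f h] eq f(1) by simp
  qed
 }
 assume AE: "AE y in lborel. \<forall>s. kernel I \<phi> y s = kernel J \<psi> y s"
 show "\<forall>f\<in>L2. shift_energy I \<phi> f = shift_energy J \<psi> f"
 proof
  fix f :: "real^'n => complex" assume "f \<in> L2"
  thus "shift_energy I \<phi> f = shift_energy J \<psi> f"
  proof (rule shift_energy_eq_dense[of I \<phi> J \<psi>, OF I \<phi> \<psi> bessel, rotated -1])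
   fix f h :: "real^'n => complex" assume f: "f \<in> L2" "test_function h" "AE y in lborel. fourier f y = h y"
   obtain S where S: "lattice_cover S h" using lattice_cover_exists[OF f(2)] ..
   have bk: "bounded_kernel (kernel I \<phi>)" "bounded_kernel (kernel J \<psi>)"
    by (rule bounded_kernel_kernel[of I \<phi>, OF I \<phi> b], assumption, rule bounded_kernel_kernel[of J \<psi>, OF J \<psi> b'], assumption)
   have "kernel_form (kernel I \<phi>) S h = kernel_form (kernel J \<psi>) S h"
    unfolding kernel_form_def
   proof (rule integral_cong_AE)
    have [measurable]: "(\<lambda>y. kernel I \<phi> y s) \<in> borelfun" "(\<lambda>y. kernel J \<psi> y s) \<in> borelfun"
     "h \<in> borelfun" for s
     using bk f(2) by (auto simp: bounded_kernel_def test_function_def)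
    show "(\<lambda>y. \<Sum>s\<in>S. h y * cnj (h (shift2pi s y)) * cnj (kernel I \<phi> y s)) \<in> borel_measurable lborel"
     "(\<lambda>y. \<Sum>s\<in>S. h y * cnj (h (shift2pi s y)) * cnj (kernel J \<psi> y s)) \<in> borel_measurable lborel"
     by measurable
    show "AE y in lborel. (\<Sum>s\<in>S. h y * cnj (h (shift2pi s y)) * cnj (kernel I \<phi> y s)) = (\<Sum>s\<in>S. h y * cnj (h (shift2pi s y)) * cnj (kernel J \<psi> y s))"
     using AE by eventually_elim simp
   qed
   hence "enn2real (shift_energy I \<phi> f) = enn2real (shift_energy J \<psi> f)"
    using ef(2,4)[OF _ f(1,3,2) S] by (simp add: of_real_eq_iff[where 'a=complex] del: of_real_mult)
   thus "shift_energy I \<phi> f = shift_energy J \<psi> f"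
    using ef(1,3)[OF _ f(1,3,2) S] by (metis ennreal_enn2real_if infinity_ennreal_def less_irrefl)
  qed auto
 qed
qed

section \<open>Dilating correlation kernels\<close>

context dilation
begin

lemma det_inv_A: "det (matrix_inv A) ~= 0" and det_A_inv: "\<bar>det A\<bar> * \<bar>det (matrix_inv A)\<bar> = 1"
proof -
 have "A ** matrix_inv A = mat 1" using det_nz by (intro matrix_inv_right) (simp add: invertible_det_nz)
 hence "det A * det (matrix_inv A) = 1" by (metis det_I det_mul)
 thus "det (matrix_inv A) ~= 0" "\<bar>det A\<bar> * \<bar>det (matrix_inv A)\<bar> = 1" by (auto simp: abs_mult[symmetric])
qed

abbreviation undilate :: "(real^'n => complex) => real^'n => complex" where
 "undilate \<equiv> dilate (matrix_inv A)"

lemma undilate_Lsq: "f \<in> L2 ==> undilate f \<in> L2"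
 by (rule dilate_Lsq_norm(1)[OF det_inv_A])

lemma dilate_undilate: "dilate A (undilate f) = f"
proof -
 have "sqrt \<bar>det A\<bar> * sqrt \<bar>det (matrix_inv A)\<bar> = 1" by (simp add: real_sqrt_mult[symmetric] det_A_inv)
 hence "cplx (sqrt \<bar>det A\<bar>) * cplx (sqrt \<bar>det (matrix_inv A)\<bar>) = 1"
  by (metis of_real_1 of_real_mult)
 thus ?thesis by (simp add: dilate_def fun_eq_iff mult.assoc[symmetric])
qed

lemma dilate_inner:
 assumes f: "f \<in> L2" and g: "g \<in> L2"
 shows "L2inner (dilate A f) (dilate A g) = L2inner f g"
proof -
 have [measurable]: "f \<in> borelfun" "g \<in> borelfun" using f g by (auto dest: LsqD)
 have "cplx (sqrt \<bar>det A\<bar>) * cplx (sqrt \<bar>det A\<bar>) = cplx \<bar>det A\<bar>"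
  by (simp add: of_real_mult[symmetric] del: of_real_mult)
 hence "dilate A f x * cnj (dilate A g x) = cplx \<bar>det A\<bar> * (f (A *v x) * cnj (g (A *v x)))" for x
  by (simp add: dilate_def algebra_simps)
 hence "L2inner (dilate A f) (dilate A g) = cplx \<bar>det A\<bar> * (\<integral>x. f (A *v x) * cnj (g (A *v x)) \<partial>lborel)"
  by (simp add: Lsq_inner_def)
 also have "... = cplx \<bar>det A\<bar> * (cplx (1 / \<bar>det A\<bar>) * L2inner f g)"
  using integral_matrix_vector(1)[OF det_nz, of "\<lambda>x. f x * cnj (g x)"] by (simp add: Lsq_inner_def)
 also have "... = L2inner f g" using det_nz by (simp add: mult.assoc[symmetric] of_real_mult[symmetric] del: of_real_mult)
 finally show ?thesis .
qed

lemma fourier_undilate: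
 assumes f: "f \<in> L2" and h: "AE y in lborel. fourier f y = h y"
 shows "AE y in lborel. fourier (undilate f) y = cplx (sqrt \<bar>det A\<bar>) * h (At *v y)"
proof -
 have "AE y in lborel. h y = cplx (1 / sqrt \<bar>det A\<bar>) * fourier (undilate f) (B *v y)"
  using fourier_dilate[OF det_nz undilate_Lsq[OF f]] h by eventually_elim (simp add: dilate_undilate)
 from AE_matrix_vector[OF det_At this] show ?thesis
  by eventually_elim (use det_nz in simp)
qed

text \<open>The kernel of the dilated family: its translates run over \<open>A\<^sup>-\<^sup>1 \<int>\<^sup>n\<close>, whose dual lattice is coarser, so that
 only displacements in the image of the transpose remain.\<close>

definition dilated_kernel :: "(real^'n => int^'n => complex) => real^'n => int^'n => complex" where
 "dilated_kernel K y t = (if t \<in> range latT then K (B *v y) (inv latT t) else 0)"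

lemma dilated_kernel_latT [simp]: "dilated_kernel K y (latT s) = K (B *v y) s"
 by (simp add: dilated_kernel_def inv_f_f[OF latT_inj])

lemma det_B: "det B ~= 0"
 using matrix_inv_right[of At] det_At by (metis det_I det_mul invertible_det_nz mult_zero_right zero_neq_one)

lemma bounded_dilated_kernel:
 assumes "bounded_kernel K"
 shows "bounded_kernel (dilated_kernel K)"
proof -
 obtain C where K: "!!s. (\<lambda>y. K y s) \<in> borelfun" and C: "!!s. AE y in lborel. cmod (K y s) \<le> C"
  using assms unfolding bounded_kernel_def by blast
 have Bm: "(\<lambda>y. B *v y) \<in> borelfun" by measurable
 show ?thesis unfolding bounded_kernel_def
 proof (intro conjI exI allI)
  show "(\<lambda>y. dilated_kernel K y s) \<in> borelfun" for s
   using measurable_compose[OF Bm K] by (cases "s \<in> range latT") (simp_all add: dilated_kernel_def)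
  show "AE y in lborel. cmod (dilated_kernel K y s) \<le> max C 0" for s
   using AE_matrix_vector[OF det_B C[of "inv latT s"]] by eventually_elim (auto simp: dilated_kernel_def)
 qed
qed

text \<open>The change of variables \<open>y = A\<^sup>T \<eta>\<close> in the quadratic form of a kernel.\<close>

lemma test_function_undilate:
 assumes h: "test_function h" and S: "lattice_cover S h"
 defines "h' \<equiv> \<lambda>y. cplx (sqrt \<bar>det A\<bar>) * h (At *v y)" and "S' \<equiv> {s. latT s \<in> S}"
 shows "test_function h'" "lattice_cover S' h'" "bounded_kernel K ==> kernel_form K S' h' = kernel_form (dilated_kernel K) S h"
proof -
 obtain C R where C: "!!y. cmod (h y) \<le> C" and hm [measurable]: "h \<in> borelfun"
  and R: "R > 0" "!!y. y \<notin> scaled_cell R ==> h y = 0"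
  using h by (auto simp: test_function_def cell_supported_def)
 have "scaled_cell R \<subseteq> cbox (\<chi> i. - (pi * R)) (\<chi> i. pi * R :: real^'n)"
  using R(1) by (auto simp: scaled_cell_iff mem_box_cart less_imp_le)
 hence "bounded (scaled_cell R :: (real^'n) set)" by (rule bounded_subset[OF bounded_cbox])
 hence "bounded ((\<lambda>y. B *v y) ` scaled_cell R)"
  by (rule bounded_linear_image) (rule matrix_vector_mul_bounded_linear)
 thus "test_function h'"
 proof (rule bounded_test_function[rotated 2])
  show "h' \<in> borelfun" unfolding h'_def by measurable
  show "cmod (h' y) \<le> sqrt \<bar>det A\<bar> * C" for y using C by (auto simp: h'_def norm_mult intro!: mult_left_mono)
  show "h' y = 0" if "y \<notin> (\<lambda>y. B *v y) ` scaled_cell R" for y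
  proof -
   have "At *v y \<notin> scaled_cell R"
   proof
    assume "At *v y \<in> scaled_cell R"
    hence "B *v (At *v y) \<in> (\<lambda>y. B *v y) ` scaled_cell R" by (rule imageI)
    thus False using that by simp
   qed
   thus ?thesis by (simp add: h'_def R(2))
  qed
 qed
 have fS: "finite S" using S by (simp add: lattice_cover_def)
 have "S' = latT -` S" by (auto simp: S'_def)
 hence fS': "finite S'" using finite_vimageI[OF fS latT_inj] by simp
 show "lattice_cover S' h'"
  using S fS' by (auto simp: lattice_cover_def h'_def S'_def At_shift2pi)
 assume K: "bounded_kernel K"
 have [measurable]: "(\<lambda>y. K y s) \<in> borelfun" for s using K by (simp add: bounded_kernel_def)
 have KB [measurable]: "(\<lambda>y. K (B *v y) s) \<in> borelfun" for s
  by (rule measurable_compose[of "\<lambda>y. B *v y" _ borel "\<lambda>y. K y s"]) measurable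
 define F where "F \<eta> = (\<Sum>s\<in>S'. cplx \<bar>det A\<bar> * (h \<eta> * cnj (h (shift2pi (latT s) \<eta>)) * cnj (K (B *v \<eta>) s)))" for \<eta>
 have Fm: "F \<in> borelfun" unfolding F_def by measurable
 have sq: "cplx (sqrt \<bar>det A\<bar>) * cplx (sqrt \<bar>det A\<bar>) = cplx \<bar>det A\<bar>"
  by (simp add: of_real_mult[symmetric] del: of_real_mult)
 have "h' y * cnj (h' (shift2pi s y)) * cnj (K y s)
   = (cplx (sqrt \<bar>det A\<bar>) * cplx (sqrt \<bar>det A\<bar>)) * (h (At *v y) * cnj (h (shift2pi (latT s) (At *v y))) * cnj (K y s))" for y s
  unfolding h'_def At_shift2pi complex_cnj_mult complex_cnj_complex_of_real by (simp only: mult_ac)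
 hence "kernel_form K S' h' = (\<integral>y. F (At *v y) \<partial>lborel)"
  unfolding kernel_form_def F_def sq by (simp only: B_At)
 also have "... = cplx (1 / \<bar>det At\<bar>) * (\<integral>y. F y \<partial>lborel)"
  by (rule integral_matrix_vector(1)[OF det_At Fm])
 also have "(\<integral>y. F y \<partial>lborel) = cplx \<bar>det A\<bar> * kernel_form (dilated_kernel K) S h"
 proof -
  have "F \<eta> = cplx \<bar>det A\<bar> * (\<Sum>t\<in>S. h \<eta> * cnj (h (shift2pi t \<eta>)) * cnj (dilated_kernel K \<eta> t))" for \<eta>
  proof -
   have "(\<Sum>t\<in>S. h \<eta> * cnj (h (shift2pi t \<eta>)) * cnj (dilated_kernel K \<eta> t))
     = (\<Sum>t\<in>latT ` S'. h \<eta> * cnj (h (shift2pi t \<eta>)) * cnj (dilated_kernel K \<eta> t))"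
    using fS by (intro sum.mono_neutral_right) (auto simp: S'_def dilated_kernel_def)
   also have "... = (\<Sum>s\<in>S'. h \<eta> * cnj (h (shift2pi (latT s) \<eta>)) * cnj (K (B *v \<eta>) s))"
    using latT_inj by (subst sum.reindex) (auto intro: inj_on_subset)
   finally show ?thesis by (simp add: F_def sum_distrib_left)
  qed
  thus ?thesis by (simp add: kernel_form_def)
 qed
 finally show "kernel_form K S' h' = kernel_form (dilated_kernel K) S h"
  using det_nz by (simp add: det_transpose mult.assoc[symmetric] of_real_mult[symmetric] del: of_real_mult)
qed

theorem dilated_kernel_decomposition:
 fixes \<phi> :: "'i => real^'n => complex" and \<psi> :: "'j => real^'n => complex"
 assumes I: "countable I" and \<phi>: "!!i. i \<in> I ==> \<phi> i \<in> L2" and b: "AE y in lborel. spectral I \<phi> y \<le> 1"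
  and J: "countable J" and \<psi>: "!!j. j \<in> J ==> \<psi> j \<in> L2" and b': "AE y in lborel. spectral J \<psi> y \<le> 1"
  and E: "!!f. f \<in> L2 ==> shift_energy I \<phi> (undilate f) = shift_energy I \<phi> f + shift_energy J \<psi> f"
 shows "AE y in lborel. \<forall>t. dilated_kernel (kernel I \<phi>) y t = kernel I \<phi> y t + kernel J \<psi> y t"
proof -
 note e\<phi> = shift_energy_kernel_form[of I \<phi>, OF I \<phi> b] and e\<psi> = shift_energy_kernel_form[of J \<psi>, OF J \<psi> b']
 have k\<phi>: "bounded_kernel (kernel I \<phi>)" by (rule bounded_kernel_kernel[of I \<phi>, OF I \<phi> b])
 have k\<psi>: "bounded_kernel (kernel J \<psi>)" by (rule bounded_kernel_kernel[of J \<psi>, OF J \<psi> b'])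
 note kd = bounded_dilated_kernel[OF k\<phi>]
 have "AE y in lborel. \<forall>t. dilated_kernel (kernel I \<phi>) y t - kernel I \<phi> y t = kernel J \<psi> y t"
 proof (rule bounded_kernel_unique[OF bounded_kernel_diff[OF kd k\<phi>] k\<psi>])
  fix h :: "real^'n => complex" and S assume h: "test_function h" and S: "lattice_cover S h"
  obtain f where f: "f \<in> L2" "AE y in lborel. fourier f y = h y" using fourier_preimage[OF h] .
  note t = test_function_undilate[OF h S]
  have k1: "kernel_form (kernel I \<phi>) S h = cplx (plancherel_const TYPE('n) * enn2real (shift_energy I \<phi> f))"
   by (rule e\<phi>(2)[OF _ f h S])
  have k2: "kernel_form (kernel J \<psi>) S h = cplx (plancherel_const TYPE('n) * enn2real (shift_energy J \<psi> f))"
   by (rule e\<psi>(2)[OF _ f h S])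
  have "kernel_form (dilated_kernel (kernel I \<phi>)) S h
    = cplx (plancherel_const TYPE('n) * enn2real (shift_energy I \<phi> (undilate f)))"
   unfolding t(3)[OF k\<phi>, symmetric]
   by (rule e\<phi>(2)[OF _ undilate_Lsq[OF f(1)] fourier_undilate[OF f] t(1,2)])
  also have "enn2real (shift_energy I \<phi> (undilate f)) = enn2real (shift_energy I \<phi> f) + enn2real (shift_energy J \<psi> f)"
   unfolding E[OF f(1)] by (rule enn2real_plus) (use e\<phi>(1)[OF _ f h S] e\<psi>(1)[OF _ f h S] in simp_all)
  finally show "kernel_form (\<lambda>y s. dilated_kernel (kernel I \<phi>) y s - kernel I \<phi> y s) S h = kernel_form (kernel J \<psi>) S h"
   unfolding kernel_form_diff[OF kd k\<phi> h] k1 k2 by (simp add: distrib_left)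
 qed
 thus ?thesis by eventually_elim (simp add: algebra_simps)
qed

text \<open>The dilation is unitary and maps \<open>V 0\<close> onto \<open>V 1\<close>.\<close>

lemma proj_norm_undilate:
 assumes V: "gmra A V" and f: "f \<in> L2"
 shows "L2norm (Lsq_proj lborel (V 1) f) = L2norm (Lsq_proj lborel (V 0) (undilate f))"
proof -
 have c: "closed_subspace lborel (V j)" for j using V by (simp add: gmra_def)
 have dil: "g \<in> V 0 \<longleftrightarrow> dilate A g \<in> V 1" if "g \<in> L2" for g
  using V that unfolding gmra_def by (metis add_0)
 let ?p = "Lsq_proj lborel (V 0) (undilate f)"
 note uL = undilate_Lsq[OF f]
 have p: "?p \<in> V 0" by (rule Lsq_proj_in[OF c uL])
 have pL: "?p \<in> L2" by (rule closed_subspace_Lsq[OF c p])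
 have "L2norm (Lsq_proj lborel (V 1) f) = L2norm (dilate A ?p)"
 proof (rule Lsq_proj_norm_unique[OF c f])
  show "dilate A ?p \<in> V 1" using dil[OF pL] p by simp
  fix g assume g: "g \<in> V 1"
  have gL: "g \<in> L2" by (rule closed_subspace_Lsq[OF c g])
  have ug: "undilate g \<in> V 0" using dil[OF undilate_Lsq[OF gL]] g by (simp add: dilate_undilate)
  have "(\<lambda>x. f x - dilate A ?p x) = dilate A (\<lambda>x. undilate f x - ?p x)"
   using dilate_undilate[of f] by (simp add: dilate_def fun_eq_iff right_diff_distrib)
  hence "L2inner (\<lambda>x. f x - dilate A ?p x) g = L2inner (dilate A (\<lambda>x. undilate f x - ?p x)) (dilate A (undilate g))"
   by (simp only: dilate_undilate)
  also have "... = L2inner (\<lambda>x. undilate f x - ?p x) (undilate g)"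
   by (intro dilate_inner Lsq_diff uL pL undilate_Lsq gL)
  also have "... = 0" by (rule Lsq_proj_orthogonal[OF c uL ug])
  finally show "L2inner (\<lambda>x. f x - dilate A ?p x) g = 0" .
 qed
 also have "... = L2norm ?p" by (rule dilate_Lsq_norm(2)[OF det_nz pL])
 finally show ?thesis .
qed

end

section \<open>Countability of the nonzero generators\<close>

lemma countable_support_nn_integral:
 assumes "(\<integral>\<^sup>+i. esq (g i) \<partial>count_space I) < \<infinity>"
 shows "countable {i\<in>I. g i ~= 0}"
proof -
 have "(\<lambda>i. (cmod (g i))\<^sup>2) summable_on I"
  using assms by (intro integrable_count_space_summable_on integrableI_nonneg) auto
 from summable_countable_real[OF this] show ?thesis by simp
qed

text \<open>Every nonzero function has a nonzero coefficient in a fixed countable Parseval family, and each member of that family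
 has only countably many nonzero coefficients with respect to the generators.\<close>

lemma countable_nonzero_generators:
 fixes \<Psi> :: "(real^'n => complex) set"
 assumes \<Psi>: "\<Psi> \<subseteq> L2" and fin: "!!f. f \<in> L2 ==> shift_energy \<Psi> (\<lambda>\<psi>. \<psi>) f < \<infinity>"
 shows "countable {\<psi>\<in>\<Psi>. \<not> (AE x in lborel. \<psi> x = 0)}"
proof -
 have "closed_subspace lborel (Lsq (lborel :: (real^'n) measure))"
  by (auto simp: closed_subspace_def Lsq_closure_def intro: Lsq_add Lsq_scale)
 hence "shift_invariant (Lsq (lborel :: (real^'n) measure))" by (auto simp: shift_invariant_def translate_Lsq)
 from orthonormal_field_exists[OF this] obtain \<phi> :: "nat => real^'n => complex" where \<phi>: "!!m. \<phi> m \<in> L2"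
  and E: "!!f. f \<in> L2 ==> shift_energy UNIV \<phi> f = ennreal ((L2norm f)\<^sup>2)" by blast
 define C where "C k m = {\<psi>\<in>\<Psi>. L2inner (translate k (\<phi> m)) \<psi> ~= 0}" for k m
 have "countable (C k m)" for k m
 proof -
  have e: "translate k (\<phi> m) \<in> L2" by (rule translate_Lsq[OF \<phi>])
  have "countable {i \<in> (UNIV :: (int^'n) set) \<times> \<Psi>. L2inner (translate k (\<phi> m)) ((\<lambda>(l, \<psi>). translate l \<psi>) i) ~= 0}"
   using fin[OF e] unfolding shift_energy_def frame_energy_def by (rule countable_support_nn_integral)
  hence "countable (snd ` {i \<in> (UNIV :: (int^'n) set) \<times> \<Psi>. L2inner (translate k (\<phi> m)) ((\<lambda>(l, \<psi>). translate l \<psi>) i) ~= 0})"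
   by (rule countable_image)
  thus ?thesis by (rule countable_subset[rotated]) (force simp: C_def intro!: image_eqI[of _ _ "(0, _)"])
 qed
 hence "countable (\<Union>k m. C k m)" by (intro countable_UN) auto
 moreover have "{\<psi>\<in>\<Psi>. \<not> (AE x in lborel. \<psi> x = 0)} \<subseteq> (\<Union>k m. C k m)"
 proof
  fix \<psi> assume "\<psi> \<in> {\<psi>\<in>\<Psi>. \<not> (AE x in lborel. \<psi> x = 0)}"
  hence \<psi>: "\<psi> \<in> \<Psi>" "\<psi> \<in> L2" "\<not> (AE x in lborel. \<psi> x = 0)" using \<Psi> by auto
  hence "L2norm \<psi> ~= 0" using Lsq_norm_eq_0_iff[OF \<psi>(2)] by simp
  hence "shift_energy UNIV \<phi> \<psi> ~= 0" unfolding E[OF \<psi>(2)] by (simp add: zero_less_power2 ennreal_eq_0_iff not_le)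
  then obtain k m where "L2inner \<psi> (translate k (\<phi> m)) ~= 0"
   unfolding shift_energy_def frame_energy_def by (auto simp: nn_integral_0_iff_AE AE_count_space)
  hence "\<psi> \<in> C k m" using Lsq_inner_commute[of lborel "translate k (\<phi> m)" \<psi>] \<psi>(1) by (simp add: C_def)
  thus "\<psi> \<in> (\<Union>k m. C k m)" by blast
 qed
 ultimately show ?thesis by (rule countable_subset[rotated])
qed

lemma shift_energy_nonzero_members:
 fixes \<Psi> :: "(real^'n => complex) set"
 assumes \<Psi>: "\<Psi> \<subseteq> L2" and f: "f \<in> L2"
 shows "shift_energy {\<psi>\<in>\<Psi>. \<not> (AE x in lborel. \<psi> x = 0)} (\<lambda>\<psi>. \<psi>) f = shift_energy \<Psi> (\<lambda>\<psi>. \<psi>) f"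
 unfolding shift_energy_def frame_energy_def
proof (rule nn_integral_count_space_eq)
 fix i :: "(int^'n) \<times> (real^'n => complex)"
 assume i: "i \<in> UNIV \<times> \<Psi> - UNIV \<times> {\<psi>\<in>\<Psi>. \<not> (AE x in lborel. \<psi> x = 0)}"
 obtain k \<psi> where k: "i = (k, \<psi>)" by fastforce
 have \<psi>: "\<psi> \<in> L2" "AE x in lborel. \<psi> x = 0" using i k \<Psi> by auto
 have "L2norm (translate k \<psi>) = 0" using translate_norm[OF \<psi>(1)] Lsq_norm_eq_0_iff[OF \<psi>(1)] \<psi>(2) by simp
 hence "L2inner f (translate k \<psi>) = 0"
  using Lsq_Cauchy_Schwarz[OF f translate_Lsq[OF \<psi>(1), of k]] by simp
 thus "esq (L2inner f (case i of (k, i) => translate k i)) = 0" by (simp add: k)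
qed auto

text \<open>All null functions have one and the same transform as representative, so uncountably many of them contribute
 zero outside a single null set.\<close>

lemma correlation_nonzero_members:
 fixes \<Psi> :: "(real^'n => complex) set"
 assumes \<Psi>: "\<Psi> \<subseteq> L2"
 shows "AE y in lborel. \<forall>s. corr \<Psi> y (shift2pi s y) = kernel {\<psi>\<in>\<Psi>. \<not> (AE x in lborel. \<psi> x = 0)} (\<lambda>\<psi>. \<psi>) y s \<and>
  (corr_converges \<Psi> y (shift2pi s y) \<longleftrightarrow> corr_converges {\<psi>\<in>\<Psi>. \<not> (AE x in lborel. \<psi> x = 0)} y (shift2pi s y))"
proof -
 let ?z = "fourier (\<lambda>x::real^'n. 0)"
 have "L2norm ?z = 0" by (simp add: fourier_norm)
 hence "AE y in lborel. ?z y = 0" using Lsq_norm_eq_0_iff[OF fourier_Lsq[OF Lsq_zero]] by blast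
 thus ?thesis
 proof eventually_elim
  fix y assume z: "?z y = 0"
  have "fourier \<psi> y = 0" if "\<psi> \<in> \<Psi>" "AE x in lborel. \<psi> x = 0" for \<psi>
   using fourier_cong_AE[of \<psi> "\<lambda>x. 0"] that \<Psi> z by auto
  thus "\<forall>s. corr \<Psi> y (shift2pi s y) = kernel {\<psi>\<in>\<Psi>. \<not> (AE x in lborel. \<psi> x = 0)} (\<lambda>\<psi>. \<psi>) y s \<and>
   (corr_converges \<Psi> y (shift2pi s y) \<longleftrightarrow> corr_converges {\<psi>\<in>\<Psi>. \<not> (AE x in lborel. \<psi> x = 0)} y (shift2pi s y))"
   unfolding corr_def kernel_def corr_converges_def
   by (intro allI conjI infsum_cong_neutral summable_on_cong_neutral) auto
 qed
qed

section \<open>The dimension function dominates the periodized spectral function\<close>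

lemma infsum_ennreal_nn_integral:
 fixes f :: "'i => ennreal"
 assumes I: "countable I"
 shows "infsum f I = (\<integral>\<^sup>+i. f i \<partial>count_space I)"
proof -
 have eq: "infsum f I = (SUP F\<in>{F. finite F \<and> F \<subseteq> I}. sum f F)" by (rule nonneg_infsum_complete) simp
 show ?thesis
 proof (rule antisym)
  have "sum f F \<le> (\<integral>\<^sup>+i. f i \<partial>count_space I)" if "finite F" "F \<subseteq> I" for F
  proof -
   have "sum f F = (\<integral>\<^sup>+i. f i \<partial>count_space F)" using that by (simp add: nn_integral_count_space_finite)
   also have "... \<le> (\<integral>\<^sup>+i. f i \<partial>count_space I)"
    using that by (auto simp: nn_integral_count_space_indicator indicator_def intro!: nn_integral_mono)
   finally show ?thesis .
  qed
  thus "infsum f I \<le> (\<integral>\<^sup>+i. f i \<partial>count_space I)" unfolding eq by (intro SUP_least) auto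
  show "(\<integral>\<^sup>+i. f i \<partial>count_space I) \<le> infsum f I"
   unfolding eq by (rule nn_integral_count_space_le[OF I]) (auto intro: SUP_upper)
 qed
qed

text \<open>The diagonal entries of the projection are the squared norms of the projected unit vectors; apply the Bessel inequality to each.\<close>

lemma projection_trace_ge:
 fixes u :: "nat => 'a::countable => complex"
 assumes U: "closed_subspace (counting) U" and u: "orthonormal_or_zero (counting) UNIV u" and mem: "!!m. u m \<in> U"
 shows "(\<integral>\<^sup>+l. (\<integral>\<^sup>+m. esq (u m l) \<partial>counting) \<partial>counting) \<le> projection_trace U"
 unfolding projection_trace_def infsum_ennreal_nn_integral[OF countableI_type]
proof (rule nn_integral_mono)
 fix l :: 'a
 let ?M = "counting :: 'a measure"
 define d :: "'a => complex" where "d = indicator {l}"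
 let ?p = "Lsq_proj ?M U d"
 have "esq (d x) = indicator {l} x" for x by (simp add: d_def indicator_def)
 hence dL: "d \<in> Lsq ?M" by (subst Lsq_iff_nn_integral) simp_all
 have inner: "Lsq_inner ?M d g = cnj (g l)" for g
  unfolding Lsq_inner_def d_def
  by (cases "g l = 0"; subst lebesgue_integral_count_space_finite_support; auto simp: indicator_def intro: finite_subset[of _ "{l}"])
 have p: "?p \<in> U" by (rule Lsq_proj_in[OF U dL])
 have pL: "?p \<in> Lsq ?M" by (rule closed_subspace_Lsq[OF U p])
 have "Lsq_inner ?M ?p d = cnj (Lsq_inner ?M d ?p)" by (rule Lsq_inner_commute)
 also have "... = cnj (Lsq_inner ?M ?p ?p)" by (simp add: Lsq_proj_inner[OF U dL p])
 finally have tr: "Re (Lsq_inner ?M ?p d) = (Lsq_norm ?M ?p)\<^sup>2" by (simp add: Lsq_inner_self del: of_real_power)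
 have "(\<integral>\<^sup>+m. esq (u m l) \<partial>counting) = frame_energy ?M UNIV u ?p"
  unfolding frame_energy_def by (simp add: Lsq_proj_inner[OF U dL mem] inner)
 also have "... \<le> ennreal ((Lsq_norm ?M ?p)\<^sup>2)" by (rule Bessel_inequality[OF u _ pL]) simp
 finally show "(\<integral>\<^sup>+m. esq (u m l) \<partial>counting)
  \<le> ennreal (Re (Lsq_inner ?M (Lsq_proj ?M U (indicator {l})) (indicator {l})))"
  by (simp only: d_def[symmetric] tr)
qed

text \<open>The fibers of the generators lie in the range function, whatever choice of it is made.  The range
 space of the field satisfies the defining condition of this choice, which is therefore not void.\<close>

theorem dim_fun_ge:
 fixes V :: "(real^'n => complex) set"
 assumes V: "shift_invariant V" and w: "orthonormal_field w" and \<phi>: "!!m. \<phi> m \<in> V" "!!m. AE y in lborel. fourier (\<phi> m) y = w m y"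
  and E: "!!f. f \<in> V ==> shift_energy UNIV \<phi> f = ennreal ((L2norm f)\<^sup>2)"
 shows "AE y in lborel. (\<integral>\<^sup>+k. spectral UNIV \<phi> (shift2pi k y) \<partial>counting) \<le> dim_fun V y"
proof -
 have cV: "closed_subspace lborel V" using V by (simp add: shift_invariant_def)
 have \<phi>L: "\<phi> m \<in> L2" for m by (rule closed_subspace_Lsq[OF cV \<phi>(1)])
 have V_eq: "V = {f \<in> L2. AE y in lborel. periodize f y \<in> range_space w y}"
 proof (intro set_eqI iffI)
  fix f assume f: "f \<in> V"
  hence fL: "f \<in> L2" by (rule closed_subspace_Lsq[OF cV])
  have "AE y in lborel. fiber (fourier f) y \<in> range_space w y"
   using shift_energy_field_eq_iff[of w \<phi>, OF w \<phi>L \<phi>(2) fL] E[OF f] by simp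
  thus "f \<in> {f \<in> L2. AE y in lborel. periodize f y \<in> range_space w y}" using fL by (simp add: periodize_fiber)
 next
  fix f assume "f \<in> {f \<in> L2. AE y in lborel. periodize f y \<in> range_space w y}"
  hence fL: "f \<in> L2" and f: "AE y in lborel. fiber (fourier f) y \<in> range_space w y" by (simp_all add: periodize_fiber)
  let ?p = "Lsq_proj lborel V f"
  have p: "?p \<in> V" by (rule Lsq_proj_in[OF cV fL])
  have pL: "?p \<in> L2" by (rule closed_subspace_Lsq[OF cV p])
  have mem: "(\<lambda>(k, m). translate k (\<phi> m)) i \<in> V" for i
   using V \<phi>(1) by (auto simp: shift_invariant_def split: prod.split)
  have "ennreal ((L2norm f)\<^sup>2) = shift_energy UNIV \<phi> f"
   using shift_energy_field_eq_iff[of w \<phi>, OF w \<phi>L \<phi>(2) fL] f by simp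
  also have "... = shift_energy UNIV \<phi> ?p"
   unfolding shift_energy_def by (rule frame_energy_proj[OF cV fL mem])
  also have "... = ennreal ((L2norm ?p)\<^sup>2)" by (rule E[OF p])
  finally have "(L2norm (\<lambda>x. f x - ?p x))\<^sup>2 = 0"
   using Lsq_proj_norm_power2[OF cV fL] by simp
  hence "AE x in lborel. f x - ?p x = 0" using Lsq_norm_eq_0_iff[OF Lsq_diff[OF fL pL]] by simp
  thus "f \<in> V" by (intro closed_subspace_cong_AE[OF cV p fL]) (auto elim: eventually_mono)
 qed
 have "periodic_range_function (J_per V) \<and> V = {f \<in> L2. AE y in lborel. periodize f y \<in> J_per V y}"
  unfolding J_per_def by (rule someI[of _ "range_space w"]) (use range_space_periodic_range_function[OF w] V_eq in blast)
 hence J: "!!y. closed_subspace (counting) (J_per V y)" and VJ: "V \<subseteq> {f. AE y in lborel. periodize f y \<in> J_per V y}"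
  by (auto simp: periodic_range_function_def)
 have "AE y in lborel. \<forall>m. fourier (\<phi> m) y = w m y" using \<phi>(2) by (subst AE_all_countable) blast
 hence w_eq: "AE y in lborel. \<forall>k m. fourier (\<phi> m) (shift2pi k y) = w m (shift2pi k y)" by (rule AE_lborel_all_shifts)
 have "AE y in lborel. \<forall>m. periodize (\<phi> m) y \<in> J_per V y" using VJ \<phi>(1) by (subst AE_all_countable) blast
 with w_eq show ?thesis
 proof eventually_elim
  fix y assume eq: "\<forall>k m. fourier (\<phi> m) (shift2pi k y) = w m (shift2pi k y)" and mem: "\<forall>m. periodize (\<phi> m) y \<in> J_per V y"
  have fw: "fiber (w m) y = periodize (\<phi> m) y" for m using eq by (simp add: periodize_fiber fiber_def)
  have "(\<integral>\<^sup>+k. spectral UNIV \<phi> (shift2pi k y) \<partial>counting)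
    = (\<integral>\<^sup>+k. (\<integral>\<^sup>+m. esq (fiber (w m) y k) \<partial>counting) \<partial>counting)"
   using eq by (simp add: spectral_def fiber_def)
  also have "... \<le> dim_fun V y" unfolding dim_fun_def
   by (rule projection_trace_ge[OF J orthonormal_fieldD(2)[OF w]]) (use mem fw in simp)
  finally show "(\<integral>\<^sup>+k. spectral UNIV \<phi> (shift2pi k y) \<partial>counting) \<le> dim_fun V y" .
 qed
qed

section \<open>Uniqueness of the solution of the dilation equations\<close>

context dilation
begin

lemma AE_At_iterates:
 assumes "AE y in lborel. P y"
 shows "AE y in lborel. \<forall>j. P ((((*v) At) ^^ j) y)"
proof -
 have "AE y in lborel. P ((((*v) At) ^^ j) y)" for j
 proof (induction j)
  case (Suc j)
  from AE_matrix_vector[OF det_At this] show ?case by (simp add: funpow_swap1)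
 qed (use assms in simp)
 thus ?thesis by (subst AE_all_countable) blast
qed

lemma AE_B_iterates:
 assumes "AE y in lborel. P y"
 shows "AE y in lborel. \<forall>j. P ((((*v) B) ^^ j) y)"
proof -
 have "AE y in lborel. P ((((*v) B) ^^ j) y)" for j
 proof (induction j)
  case (Suc j)
  from AE_matrix_vector[OF det_B this] show ?case by (simp add: funpow_swap1)
 qed (use assms in simp)
 thus ?thesis by (subst AE_all_countable) blast
qed

text \<open>Off the diagonal, divide the displacement by the transpose until it leaves the sublattice, where the
 dilated kernel vanishes.  On the diagonal the kernel is constant along orbits.\<close>

theorem dilation_invariant_kernel_zero:
 assumes inv: "AE y in lborel. \<forall>s. dilated_kernel D y s = D y s"
  and lim: "AE y in lborel. (\<lambda>j. D ((((*v) At) ^^ j) y) 0) \<longlonglongrightarrow> 0"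
 shows "AE y in lborel. \<forall>s. D y s = 0"
 using AE_At_iterates[OF inv] AE_B_iterates[OF inv] lim
proof eventually_elim
 fix y assume A: "\<forall>j s. dilated_kernel D ((((*v) At) ^^ j) y) s = D ((((*v) At) ^^ j) y) s"
  and Bi: "\<forall>j s. dilated_kernel D ((((*v) B) ^^ j) y) s = D ((((*v) B) ^^ j) y) s"
  and lim: "(\<lambda>j. D ((((*v) At) ^^ j) y) 0) \<longlonglongrightarrow> 0"
 have T0: "latT 0 = 0" using latT[of 0] lattice_vec_inj[of "latT 0" 0] by simp
 show "\<forall>s. D y s = 0"
 proof
  fix s
  show "D y s = 0"
  proof (cases "s = 0")
   case True
   have "D ((((*v) At) ^^ j) y) 0 = D y 0" for j
   proof (induction j)
    case (Suc j)
    have "D ((((*v) At) ^^ Suc j) y) 0 = D (B *v ((((*v) At) ^^ Suc j) y)) 0"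
     using A[rule_format, of "Suc j" "latT 0"] dilated_kernel_latT[of D _ 0] by (simp only: T0)
    also have "... = D ((((*v) At) ^^ j) y) 0" by simp
    finally show ?case using Suc by simp
   qed simp
   thus ?thesis using lim True by (simp add: LIMSEQ_const_iff)
  next
   case False
   then obtain m where m: "!!t. (latT ^^ m) t ~= s" using latT_descent[of s] by blast
   have "\<forall>j s. (\<forall>t. (latT ^^ m) t ~= s) --> D ((((*v) B) ^^ j) y) s = 0" for m
   proof (induction m)
    case (Suc m)
    show ?case
    proof (intro allI impI)
     fix j s assume s: "\<forall>t. (latT ^^ Suc m) t ~= s"
     have eq: "D ((((*v) B) ^^ j) y) s = dilated_kernel D ((((*v) B) ^^ j) y) s" using Bi by simp
     show "D ((((*v) B) ^^ j) y) s = 0"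
     proof (cases "s \<in> range latT")
      case True
      then obtain r where r: "s = latT r" by blast
      have "\<forall>t. (latT ^^ m) t ~= r" using s r by auto
      hence "D ((((*v) B) ^^ Suc j) y) r = 0" using Suc by blast
      thus ?thesis unfolding eq unfolding r dilated_kernel_latT by simp
     qed (simp add: eq dilated_kernel_def)
    qed
   qed simp
   from this[of m, rule_format, of s 0] show ?thesis using m by simp
  qed
 qed
qed

lemma range_latT_iff:
 fixes s :: "int^'n"
 shows "lattice_vec s \<in> (\<lambda>x. At *v x) ` range lattice_vec \<longleftrightarrow> s \<in> range latT"
proof -
 have "lattice_vec s = At *v lattice_vec t \<longleftrightarrow> s = latT t" for t
  unfolding latT[symmetric] by (rule lattice_vec_inj)
 thus ?thesis by auto
qed

lemma B_shift2pi_latT: "B *v shift2pi (latT t) y = shift2pi t (B *v y)"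
 using B_At[of "shift2pi t (B *v y)"] by (simp only: At_shift2pi At_B)

end

section \<open>The characterization\<close>

lemma limit_kernel_diagonal:
 fixes \<sigma> :: "nat => ennreal"
 assumes "\<sigma> \<longlonglongrightarrow> 0"
 shows "(\<lambda>j. cplx (enn2real (\<sigma> j))) \<longlonglongrightarrow> 0"
proof -
 have "(\<lambda>j. enn2real (\<sigma> j)) \<longlonglongrightarrow> enn2real 0" by (rule tendsto_enn2real) (use assms in simp_all)
 from tendsto_of_real[OF this, where 'a = complex] show ?thesis by simp
qed

theorem theorem3p2:
  fixes A :: "real^'n^'n"
    and V :: "int \<Rightarrow> (real^'n \<Rightarrow> complex) set"
    and \<Phi> \<Psi> :: "(real^'n \<Rightarrow> complex) set"
  assumes "dilation_matrix A"
    and "gmra A V"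
    and "\<exists>S \<in> sets lborel. emeasure lborel S > 0 \<and> (\<forall>\<xi>\<in>S. dim_fun (V 0) \<xi> < \<infinity>)"
    and "ntf_generator \<Psi> (orth_diff lborel (V 1) (V 0))"
    and "countable \<Phi>"
    and "\<Phi> \<subseteq> Lsq lborel"
  shows "ntf_generator \<Phi> (V 0) \<longleftrightarrow>
    (AE \<xi> in lborel.
       (\<forall>s :: int^'n. lattice_vec s \<notin> (\<lambda>x. transpose A *v x) ` range lattice_vec \<longrightarrow>
          (let \<eta> = \<xi> + (2 * pi) *\<^sub>R lattice_vec s in
             corr_converges \<Phi> \<xi> \<eta> \<and> corr_converges \<Psi> \<xi> \<eta> \<and>
             - corr \<Phi> \<xi> \<eta> = corr \<Psi> \<xi> \<eta>)) \<and>
       (\<forall>s :: int^'n. lattice_vec s \<in> (\<lambda>x. transpose A *v x) ` range lattice_vec \<longrightarrow>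
          (let \<eta> = \<xi> + (2 * pi) *\<^sub>R lattice_vec s; B = matrix_inv (transpose A) in
             corr_converges \<Phi> (B *v \<xi>) (B *v \<eta>) \<and>
             corr_converges \<Phi> \<xi> \<eta> \<and> corr_converges \<Psi> \<xi> \<eta> \<and>
             corr \<Phi> (B *v \<xi>) (B *v \<eta>) - corr \<Phi> \<xi> \<eta> = corr \<Psi> \<xi> \<eta>))) \<and>
    (AE \<xi> in lborel.
       (\<lambda>j::nat. \<Sum>\<^sub>\<infinity>\<phi>\<in>\<Phi>. ennreal ((cmod (fourier \<phi> (((\<lambda>x. transpose A *v x) ^^ j) \<xi>)))\<^sup>2))
         \<longlonglongrightarrow> 0)"
  (is "_ \<longleftrightarrow> (AE y in lborel. ?off y \<and> ?on y) \<and> (AE y in lborel. ?lim y)")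
proof -
 interpret dilation A by unfold_locales (rule assms(1))
 have cV: "closed_subspace lborel (V j)" for j using assms(2) by (simp add: gmra_def)
 have V01: "V 0 \<subseteq> V 1" using assms(2) unfolding gmra_def by (metis add_0)
 have siV: "shift_invariant (V 0)"
  using assms(2) cV[of 0] unfolding gmra_def shift_invariant_def by blast
 define W where "W = orth_diff lborel (V 1) (V 0)"
 have cW: "closed_subspace lborel W" unfolding W_def by (rule orth_diff_closed_subspace[OF cV cV])

 (* The reference generator; every other one is compared with it through its kernel. *)
 obtain w \<phi> where w: "orthonormal_field w" and \<phi>V: "!!m. \<phi> m \<in> V 0" and \<phi>w: "!!m. AE y in lborel. fourier (\<phi> m) y = w m y"
  and \<phi>E: "!!f. f \<in> V 0 ==> shift_energy UNIV \<phi> f = ennreal ((L2norm f)\<^sup>2)"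
  using orthonormal_field_exists[OF siV] by blast
 have \<phi>L: "\<phi> m \<in> L2" for m by (rule closed_subspace_Lsq[OF cV \<phi>V])
 have \<phi>_proj: "shift_energy UNIV \<phi> f = ennreal ((L2norm (Lsq_proj lborel (V 0) f))\<^sup>2)" if "f \<in> L2" for f
 proof -
  have mem: "(\<lambda>(k, m). translate k (\<phi> m)) i \<in> V 0" for i
   using siV \<phi>V by (auto simp: shift_invariant_def split: prod.split)
  have "shift_energy UNIV \<phi> f = shift_energy UNIV \<phi> (Lsq_proj lborel (V 0) f)"
   unfolding shift_energy_def by (rule frame_energy_proj[OF cV that mem])
  thus ?thesis using \<phi>E[OF Lsq_proj_in[OF cV that]] by simp
 qed
 have \<phi>bessel: "shift_energy UNIV \<phi> f \<le> ennreal ((L2norm f)\<^sup>2)" if "f \<in> L2" for f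
  unfolding \<phi>_proj[OF that] using Lsq_proj_norm_le[OF cV that] by (intro ennreal_leI power_mono) auto
 have \<phi>1: "AE y in lborel. spectral UNIV \<phi> y \<le> 1" by (rule spectral_le_1[of UNIV \<phi>]) (use \<phi>L \<phi>bessel in auto)

 have \<Psi>L: "\<Psi> \<subseteq> L2"
  using assms(4) closed_subspace_Lsq[OF cW] by (auto simp: ntf_generator_def W_def)
 (* Uncountable families enter only through null functions, which do not change sums. *)
 define \<Psi>' where "\<Psi>' = {\<psi>\<in>\<Psi>. \<not> (AE x in lborel. \<psi> x = 0)}"
 have \<Psi>E: "shift_energy \<Psi> (\<lambda>\<psi>. \<psi>) f = ennreal ((L2norm (Lsq_proj lborel W f))\<^sup>2)" if "f \<in> L2" for f
  using assms(4) that ntf_generator_iff_energy[OF cW \<Psi>L] by (simp add: W_def)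
 have \<Psi>c: "countable \<Psi>'"
  unfolding \<Psi>'_def by (rule countable_nonzero_generators[OF \<Psi>L]) (simp add: \<Psi>E)
 have \<Psi>'L: "\<psi> \<in> L2" if "\<psi> \<in> \<Psi>'" for \<psi> using that \<Psi>L by (auto simp: \<Psi>'_def)
 have \<Psi>'E: "shift_energy \<Psi>' (\<lambda>\<psi>. \<psi>) f = ennreal ((L2norm (Lsq_proj lborel W f))\<^sup>2)" if "f \<in> L2" for f
  using shift_energy_nonzero_members[OF \<Psi>L that] \<Psi>E[OF that] by (simp add: \<Psi>'_def)
 have \<Psi>1: "AE y in lborel. spectral \<Psi>' (\<lambda>\<psi>. \<psi>) y \<le> 1"
 proof (rule spectral_le_1[of \<Psi>' "\<lambda>\<psi>. \<psi>", OF \<Psi>c \<Psi>'L])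
  show "shift_energy \<Psi>' (\<lambda>\<psi>. \<psi>) f \<le> ennreal ((L2norm f)\<^sup>2)" if "f \<in> L2" for f
   unfolding \<Psi>'E[OF that] using Lsq_proj_norm_le[OF cW that] by (intro ennreal_leI power_mono) auto
 qed

 let ?K = "kernel UNIV \<phi>" and ?K\<Phi> = "kernel \<Phi> (\<lambda>\<phi>. \<phi>)" and ?K\<Psi> = "kernel \<Psi>' (\<lambda>\<psi>. \<psi>)"
 let ?\<sigma> = "spectral UNIV \<phi>" and ?\<sigma>\<Phi> = "spectral \<Phi> (\<lambda>\<phi>. \<phi>)"
 have K_eq: "AE y in lborel. \<forall>t. dilated_kernel ?K y t = ?K y t + ?K\<Psi> y t"
 proof (rule dilated_kernel_decomposition[of UNIV \<phi> \<Psi>' "\<lambda>\<psi>. \<psi>", OF _ \<phi>L \<phi>1 \<Psi>c \<Psi>'L \<Psi>1])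
  fix f :: "real^'n => complex" assume f: "f \<in> L2"
  have "shift_energy UNIV \<phi> (undilate f) = ennreal ((L2norm (Lsq_proj lborel (V 1) f))\<^sup>2)"
   by (simp add: \<phi>_proj[OF undilate_Lsq[OF f]] proj_norm_undilate[OF assms(2) f])
  also have "... = shift_energy UNIV \<phi> f + shift_energy \<Psi>' (\<lambda>\<psi>. \<psi>) f"
   unfolding orth_diff_proj_norm_power2[OF cV cV V01 f] \<phi>_proj[OF f] \<Psi>'E[OF f] W_def by (simp add: ennreal_plus)
  finally show "shift_energy UNIV \<phi> (undilate f) = shift_energy UNIV \<phi> f + shift_energy \<Psi>' (\<lambda>\<psi>. \<psi>) f" .
 qed simp_all
 have T0: "latT 0 = 0" using latT[of 0] lattice_vec_inj[of "latT 0" 0] by simp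

 have \<sigma>_lim: "AE y in lborel. (\<lambda>j. ?\<sigma> ((((*v) At) ^^ j) y)) \<longlonglongrightarrow> 0"
 proof -
  obtain S where S: "S \<in> sets lborel" "emeasure lborel S > 0" "!!y. y \<in> S ==> dim_fun (V 0) y < \<infinity>" using assms(3) by blast
  show ?thesis
  proof (rule decreasing_along_orbits_tendsto_0[OF _ _ S(1,2)])
   show "?\<sigma> \<in> borelfun" by (rule spectral_measurable[of UNIV \<phi>]) (use \<phi>L in auto)
   have "AE y in lborel. ?\<sigma> y \<le> ?\<sigma> (B *v y)"
    using K_eq \<phi>1 AE_matrix_vector[OF det_B \<phi>1] \<Psi>1
   proof eventually_elim
    fix y assume eq: "\<forall>t. dilated_kernel ?K y t = ?K y t + ?K\<Psi> y t" and le: "?\<sigma> y \<le> 1" "?\<sigma> (B *v y) \<le> 1" "spectral \<Psi>' (\<lambda>\<psi>. \<psi>) y \<le> 1"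
    have fin: "?\<sigma> y < \<infinity>" "?\<sigma> (B *v y) < \<infinity>" "spectral \<Psi>' (\<lambda>\<psi>. \<psi>) y < \<infinity>" using le by (auto intro: le_less_trans)
    have "?K (B *v y) 0 = ?K y 0 + ?K\<Psi> y 0" using eq[rule_format, of "latT 0"] unfolding dilated_kernel_latT by (simp add: T0)
    hence "cplx (enn2real (?\<sigma> (B *v y))) = cplx (enn2real (?\<sigma> y) + enn2real (spectral \<Psi>' (\<lambda>\<psi>. \<psi>) y))"
     unfolding spectral_kernel_0[OF fin(1)] spectral_kernel_0[OF fin(2)] spectral_kernel_0[OF fin(3)] by simp
    hence "enn2real (?\<sigma> y) \<le> enn2real (?\<sigma> (B *v y))" unfolding of_real_eq_iff by simp
    thus "?\<sigma> y \<le> ?\<sigma> (B *v y)" using fin by (metis ennreal_enn2real ennreal_leI infinity_ennreal_def)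
   qed
   from AE_matrix_vector[OF det_At this] show "AE y in lborel. ?\<sigma> (At *v y) \<le> ?\<sigma> y" by simp
   have "AE y in lborel. (\<integral>\<^sup>+k. ?\<sigma> (shift2pi k y) \<partial>counting) \<le> dim_fun (V 0) y"
    by (rule dim_fun_ge[of "V 0" w \<phi>, OF siV w \<phi>V \<phi>w \<phi>E])
   thus "AE y in lborel. y \<in> S --> (\<integral>\<^sup>+k. ?\<sigma> (shift2pi k y) \<partial>counting) < \<infinity>"
    by eventually_elim (use S(3) in \<open>auto intro: le_less_trans\<close>)
  qed
 qed

 have \<Psi>_corr: "AE y in lborel. \<forall>s. corr \<Psi> y (shift2pi s y) = ?K\<Psi> y s \<and> corr_converges \<Psi> y (shift2pi s y)"
  using correlation_nonzero_members[OF \<Psi>L] \<Psi>1 AE_lborel_all_shifts[OF \<Psi>1]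
 proof eventually_elim
  fix y assume 1: "\<forall>s. corr \<Psi> y (shift2pi s y) = kernel {\<psi>\<in>\<Psi>. \<not> (AE x in lborel. \<psi> x = 0)} (\<lambda>\<psi>. \<psi>) y s \<and>
    (corr_converges \<Psi> y (shift2pi s y) \<longleftrightarrow> corr_converges {\<psi>\<in>\<Psi>. \<not> (AE x in lborel. \<psi> x = 0)} y (shift2pi s y))"
   and le: "spectral \<Psi>' (\<lambda>\<psi>. \<psi>) y \<le> 1" "\<forall>s. spectral \<Psi>' (\<lambda>\<psi>. \<psi>) (shift2pi s y) \<le> 1"
  have "corr_converges \<Psi>' y (shift2pi s y)" for s
   unfolding corr_converges_def using le by (intro kernel_summable(1)) (auto intro: le_less_trans)
  thus "\<forall>s. corr \<Psi> y (shift2pi s y) = ?K\<Psi> y s \<and> corr_converges \<Psi> y (shift2pi s y)" using 1 by (simp add: \<Psi>'_def)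
 qed

 have equations: "?off y \<and> ?on y \<longleftrightarrow> (\<forall>s. corr_converges \<Phi> y (shift2pi s y)) \<and> (\<forall>t. corr_converges \<Phi> (B *v y) (shift2pi t (B *v y)))
   \<and> (\<forall>s. dilated_kernel ?K\<Phi> y s = ?K\<Phi> y s + ?K\<Psi> y s)"
  if 1: "\<forall>s. corr \<Psi> y (shift2pi s y) = ?K\<Psi> y s \<and> corr_converges \<Psi> y (shift2pi s y)" for y
 proof -
  have c: "corr \<Phi> \<eta> (shift2pi s \<eta>) = ?K\<Phi> \<eta> s" for \<eta> s by (simp add: corr_def kernel_def)
  have off: "?off y \<longleftrightarrow> (\<forall>s. s \<notin> range latT --> corr_converges \<Phi> y (shift2pi s y) \<and> dilated_kernel ?K\<Phi> y s = ?K\<Phi> y s + ?K\<Psi> y s)"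
   unfolding range_latT_iff Let_def using 1 by (simp add: c dilated_kernel_def neg_eq_iff_add_eq_0)
  have on: "?on y \<longleftrightarrow> (\<forall>t. corr_converges \<Phi> (B *v y) (shift2pi t (B *v y)) \<and> corr_converges \<Phi> y (shift2pi (latT t) y)
    \<and> dilated_kernel ?K\<Phi> y (latT t) = ?K\<Phi> y (latT t) + ?K\<Psi> y (latT t))"
  proof -
   have "?on y \<longleftrightarrow> (\<forall>t. corr_converges \<Phi> (B *v y) (B *v shift2pi (latT t) y) \<and> corr_converges \<Phi> y (shift2pi (latT t) y)
    \<and> corr \<Phi> (B *v y) (B *v shift2pi (latT t) y) - ?K\<Phi> y (latT t) = ?K\<Psi> y (latT t))"
    unfolding range_latT_iff Let_def using 1 c by auto
   thus ?thesis unfolding B_shift2pi_latT c dilated_kernel_latT by (simp add: diff_eq_eq add.commute)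
  qed
  have split: "(\<forall>s. s \<notin> range latT --> P s \<and> Q s) \<and> (\<forall>t. R t \<and> P (latT t) \<and> Q (latT t)) \<longleftrightarrow> (\<forall>s. P s) \<and> (\<forall>t. R t) \<and> (\<forall>s. Q s)"
   (is "?L \<longleftrightarrow> ?R") for P Q R
  proof
   assume L: ?L
   have "P s \<and> Q s" for s
   proof (cases "s \<in> range latT")
    case True
    then obtain t where "s = latT t" by blast
    thus ?thesis using L by simp
   qed (use L in blast)
   thus ?R using L by simp
  qed simp
  show ?thesis unfolding off on by (rule split)
 qed

 have \<Phi>L: "\<phi> \<in> L2" if "\<phi> \<in> \<Phi>" for \<phi> using that assms(6) by blast
 have lim_iff: "?lim y \<longleftrightarrow> (\<lambda>j. ?\<sigma>\<Phi> ((((*v) At) ^^ j) y)) \<longlonglongrightarrow> 0" for y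
  by (simp add: infsum_ennreal_nn_integral[OF assms(5)] spectral_def)
 have ntf: "ntf_generator \<Phi> (V 0) \<longleftrightarrow> (\<forall>f\<in>L2. shift_energy \<Phi> (\<lambda>\<phi>. \<phi>) f = shift_energy UNIV \<phi> f)"
  unfolding ntf_generator_iff_energy[OF cV assms(6)] using \<phi>_proj by simp
 have kernels: "(AE y in lborel. \<forall>s. ?K\<Phi> y s = ?K y s) \<longleftrightarrow> ntf_generator \<Phi> (V 0)" if "AE y in lborel. ?\<sigma>\<Phi> y \<le> 1"
  unfolding ntf by (rule kernel_eq_iff_shift_energy_eq[of \<Phi> "\<lambda>\<phi>. \<phi>" UNIV \<phi>, OF assms(5) \<Phi>L that _ \<phi>L \<phi>bessel]) auto

 show ?thesis
 proof
  assume n: "ntf_generator \<Phi> (V 0)"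
  have \<Phi>1: "AE y in lborel. ?\<sigma>\<Phi> y \<le> 1"
   by (rule spectral_le_1[of \<Phi> "\<lambda>\<phi>. \<phi>", OF assms(5) \<Phi>L]) (use n ntf \<phi>bessel in auto)
  have K\<Phi>: "AE y in lborel. \<forall>s. ?K\<Phi> y s = ?K y s" using kernels[OF \<Phi>1] n by simp
  have "AE y in lborel. ?off y \<and> ?on y"
   using \<Psi>_corr K_eq K\<Phi> AE_matrix_vector[OF det_B K\<Phi>] \<Phi>1 AE_lborel_all_shifts[OF \<Phi>1] AE_matrix_vector[OF det_B \<Phi>1]
    AE_matrix_vector[OF det_B AE_lborel_all_shifts[OF \<Phi>1]]
  proof eventually_elim
   fix y assume 1: "\<forall>s. corr \<Psi> y (shift2pi s y) = ?K\<Psi> y s \<and> corr_converges \<Psi> y (shift2pi s y)"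
    and 2: "\<forall>t. dilated_kernel ?K y t = ?K y t + ?K\<Psi> y t" "\<forall>s. ?K\<Phi> y s = ?K y s" "\<forall>s. ?K\<Phi> (B *v y) s = ?K (B *v y) s"
    and le: "?\<sigma>\<Phi> y \<le> 1" "\<forall>k. ?\<sigma>\<Phi> (shift2pi k y) \<le> 1" "?\<sigma>\<Phi> (B *v y) \<le> 1" "\<forall>k. ?\<sigma>\<Phi> (shift2pi k (B *v y)) \<le> 1"
   have c: "corr_converges \<Phi> \<eta> \<zeta>" if "?\<sigma>\<Phi> \<eta> \<le> 1" "?\<sigma>\<Phi> \<zeta> \<le> 1" for \<eta> \<zeta>
    unfolding corr_converges_def using that by (intro kernel_summable(1)) (auto intro: le_less_trans)
   have "dilated_kernel ?K\<Phi> y s = ?K\<Phi> y s + ?K\<Psi> y s" for s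
    using 2(1)[rule_format, of s] 2(2,3) by (simp add: dilated_kernel_def split: if_splits)
   thus "?off y \<and> ?on y" unfolding equations[OF 1] using c le by blast
  qed
  moreover have "AE y in lborel. ?\<sigma>\<Phi> y = ?\<sigma> y"
   using K\<Phi> \<Phi>1 \<phi>1
  proof eventually_elim
   fix y assume eq: "\<forall>s. ?K\<Phi> y s = ?K y s" and le: "?\<sigma>\<Phi> y \<le> 1" "?\<sigma> y \<le> 1"
   have fin: "?\<sigma>\<Phi> y < \<infinity>" "?\<sigma> y < \<infinity>" using le by (auto intro: le_less_trans)
   have "enn2real (?\<sigma>\<Phi> y) = enn2real (?\<sigma> y)"
    using eq[rule_format, of 0] unfolding spectral_kernel_0[OF fin(1)] spectral_kernel_0[OF fin(2)] of_real_eq_iff .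
   thus "?\<sigma>\<Phi> y = ?\<sigma> y" using fin by (metis ennreal_enn2real infinity_ennreal_def)
  qed
  from AE_At_iterates[OF this] \<sigma>_lim have "AE y in lborel. ?lim y"
   by eventually_elim (simp only: lim_iff)
  ultimately show "(AE y in lborel. ?off y \<and> ?on y) \<and> (AE y in lborel. ?lim y)" by blast
 next
  assume ii: "(AE y in lborel. ?off y \<and> ?on y) \<and> (AE y in lborel. ?lim y)"
  from ii have "AE y in lborel. ?off y \<and> ?on y" by blast
  with \<Psi>_corr have eqs: "AE y in lborel. (\<forall>s. corr_converges \<Phi> y (shift2pi s y)) \<and> (\<forall>s. dilated_kernel ?K\<Phi> y s = ?K\<Phi> y s + ?K\<Psi> y s)"
   by eventually_elim (use equations in blast)
  have fin: "AE y in lborel. ?\<sigma>\<Phi> y < \<infinity>"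
   using eqs
  proof eventually_elim
   fix y assume "(\<forall>s. corr_converges \<Phi> y (shift2pi s y)) \<and> (\<forall>s. dilated_kernel ?K\<Phi> y s = ?K\<Phi> y s + ?K\<Psi> y s)"
   hence "corr_converges \<Phi> y (shift2pi 0 y)" by blast
   hence "(\<lambda>\<phi>. cplx ((cmod (fourier \<phi> y))\<^sup>2)) summable_on \<Phi>"
    by (simp only: corr_converges_def lattice_vec_simps scaleR_zero_right add_0_right complex_norm_square)
   hence "(\<lambda>\<phi>. (cmod (fourier \<phi> y))\<^sup>2) summable_on \<Phi>" using summable_on_Re by fastforce
   then obtain a where a: "((\<lambda>\<phi>. (cmod (fourier \<phi> y))\<^sup>2) has_sum a) \<Phi>" by (auto simp: summable_on_def)
   hence "0 \<le> a" by (rule has_sum_nonneg) simp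
   thus "?\<sigma>\<Phi> y < \<infinity>"
    using a has_sum_iff_nn_integral_count_space[of \<Phi> "\<lambda>\<phi>. (cmod (fourier \<phi> y))\<^sup>2" a] by (simp add: spectral_def)
  qed
   (* The inhomogeneous terms of the two kernels cancel in the difference. *)
  define D where "D y s = ?K\<Phi> y s - ?K y s" for y s
  have D0: "AE y in lborel. D y 0 = cplx (enn2real (?\<sigma>\<Phi> y)) - cplx (enn2real (?\<sigma> y))"
   using fin \<phi>1
  proof eventually_elim
   fix y assume f: "?\<sigma>\<Phi> y < \<infinity>" and "?\<sigma> y \<le> 1"
   hence f': "?\<sigma> y < \<infinity>" by (auto intro: le_less_trans)
   show "D y 0 = cplx (enn2real (?\<sigma>\<Phi> y)) - cplx (enn2real (?\<sigma> y))"
    unfolding D_def spectral_kernel_0[OF f] spectral_kernel_0[OF f'] ..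
  qed
  have "AE y in lborel. \<forall>s. D y s = 0"
  proof (rule dilation_invariant_kernel_zero)
   show "AE y in lborel. \<forall>s. dilated_kernel D y s = D y s"
    using eqs K_eq
   proof eventually_elim
    fix y assume a: "(\<forall>s. corr_converges \<Phi> y (shift2pi s y)) \<and> (\<forall>s. dilated_kernel ?K\<Phi> y s = ?K\<Phi> y s + ?K\<Psi> y s)"
     and b: "\<forall>s. dilated_kernel ?K y s = ?K y s + ?K\<Psi> y s"
    have "dilated_kernel D y s = dilated_kernel ?K\<Phi> y s - dilated_kernel ?K y s" for s by (simp add: dilated_kernel_def D_def)
    thus "\<forall>s. dilated_kernel D y s = D y s" using a b by (simp add: D_def)
   qed
   have "AE y in lborel. (\<lambda>j. ?\<sigma>\<Phi> ((((*v) At) ^^ j) y)) \<longlonglongrightarrow> 0" using ii lim_iff by simp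
   from this \<sigma>_lim AE_At_iterates[OF D0] show "AE y in lborel. (\<lambda>j. D ((((*v) At) ^^ j) y) 0) \<longlonglongrightarrow> 0"
   proof eventually_elim
    fix y assume "(\<lambda>j. ?\<sigma>\<Phi> ((((*v) At) ^^ j) y)) \<longlonglongrightarrow> 0" "(\<lambda>j. ?\<sigma> ((((*v) At) ^^ j) y)) \<longlonglongrightarrow> 0"
     and d: "\<forall>j. D ((((*v) At) ^^ j) y) 0 = cplx (enn2real (?\<sigma>\<Phi> ((((*v) At) ^^ j) y))) - cplx (enn2real (?\<sigma> ((((*v) At) ^^ j) y)))"
    from tendsto_diff[OF this(1,2)[THEN limit_kernel_diagonal]]
    show "(\<lambda>j. D ((((*v) At) ^^ j) y) 0) \<longlonglongrightarrow> 0" using d by simp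
   qed
  qed
  hence K\<Phi>: "AE y in lborel. \<forall>s. ?K\<Phi> y s = ?K y s" by (simp add: D_def)
  have "AE y in lborel. ?\<sigma>\<Phi> y \<le> 1"
   using K\<Phi> fin \<phi>1
  proof eventually_elim
   fix y assume eq: "\<forall>s. ?K\<Phi> y s = ?K y s" and f: "?\<sigma>\<Phi> y < \<infinity>" and le: "?\<sigma> y \<le> 1"
   have f': "?\<sigma> y < \<infinity>" using le by (auto intro: le_less_trans)
   have "enn2real (?\<sigma>\<Phi> y) = enn2real (?\<sigma> y)"
    using eq[rule_format, of 0] unfolding spectral_kernel_0[OF f] spectral_kernel_0[OF f'] of_real_eq_iff .
   hence "?\<sigma>\<Phi> y = ?\<sigma> y" using f f' by (metis ennreal_enn2real infinity_ennreal_def)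
   thus "?\<sigma>\<Phi> y \<le> 1" using le by simp
  qed
  from kernels[OF this] K\<Phi> show "ntf_generator \<Phi> (V 0)" by simp
 qed
qed

end
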